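(* Let $\mathcal{E}$ be a locally presentable and locally cartesian closed category equipped with a functorial cylinder $I\otimes(-)$ with contractions and connections such that $I\otimes(-)$ has a right adjoint. Let $(\mathsf{C},\mathsf{F_t})$ be a suitable algebraic weak factorization system on $\mathcal{E}$, cofibrantly generated by a small category of maps $u\colon\mathcal{I}\to\mathcal{E}^\to$. Let $\mathcal{I}_\otimes=\mathcal{I}+\mathcal{I}$ with functor $u_\otimes\colon\mathcal{I}_\otimes\to\mathcal{E}^\to$ given by $i\mapsto\delta^0\hat\otimes u_i$ on the first summand and $i\mapsto\delta^1\hat\otimes u_i$ on the second, and let $\mathsf{Fib}=(\mathcal{I}_\otimes)^{\pitchfork}$ (the category of uniform fibrations) and $\mathsf{TrivCof}={}^{\pitchfork}\mathsf{Fib}$. Then $\mathcal{E}$ admits a cofibrantly generated algebraic weak factorization system $(\mathsf{C_t},\mathsf{F})$ such that, as categories over $\mathcal{E}^\to$, $$\mathsf{TrivCof}=\mathsf{C_t}\text{-}\mathsf{map},\qquad \mathsf{Fib}=\mathsf{F}\text{-}\mathsf{Map}.$$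
   Context: A functorial cylinder on $\mathcal{E}$ is an endofunctor $I\otimes(-)$ with natural transformations $\delta^0\otimes(-),\delta^1\otimes(-)\colon \mathrm{Id}\to I\otimes(-)$. It has contractions if there is a natural transformation $\varepsilon\otimes(-)\colon I\otimes(-)\to\mathrm{Id}$ with $(\varepsilon\otimes X)\circ(\delta^k\otimes X)=\mathrm{id}_X$ for $k=0,1$. It then has connections if for $k\in\{0,1\}$ there is a natural $c^k\otimes(-)\colon I\otimes I\otimes(-)\to I\otimes(-)$ such that $(c^k\otimes X)\circ(\delta^k\otimes I\otimes X)=(\delta^k\otimes X)\circ(\varepsilon\otimes X)=(c^k\otimes X)\circ(I\otimes\delta^k\otimes X)$ and $(c^k\otimes X)\circ(\delta^{1-k}\otimes I\otimes X)=\mathrm{id}_{I\otimes X}=(c^k\otimes X)\circ(I\otimes\delta^{1-k}\otimes X)$; here $\delta^k\otimes I\otimes X$ is the component at $I\otimes X$, and $I\otimes\delta^k\otimes X$ is $I\otimes(-)$ applied to the component at $X$. For $i\colon A\to B$ the Leibniz product $\delta^k\hat\otimes i\colon (I\otimes A)+_A B\to I\otimes B$ is the map out of the pushout of $\delta^k\otimes A$ and $i$ induced by $I\otimes i$ and $\delta^k\otimes B$; this is a functor $\mathcal{E}^\to\to\mathcal{E}^\to$. For $u\colon\mathcal{I}\to\mathcal{E}^\to$ with values $u_i\colon A_i\to B_i$, a right $\mathcal{I}$-map is a map $f\colon X\to Y$ with a function $\phi$ assigning to each $i$ and square $(s,t)\colon u_i\to f$ a diagonal filler $\phi(i,s,t)\colon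 B_i\to X$, such that for $\sigma\colon i\to j$ with $u_\sigma=(a,b)$ and $(s,t)\colon u_j\to f$ one has $\phi(j,s,t)\circ b=\phi(i,s\circ a,t\circ b)$; morphisms are squares commuting with fillers. $\mathcal{I}^{\pitchfork}$ is the category of right $\mathcal{I}$-maps over $\mathcal{E}^\to$, and ${}^{\pitchfork}\mathcal{I}$ the dually defined category of left $\mathcal{I}$-maps. An algebraic weak factorization system (awfs) $(\mathsf{L},\mathsf{R})$ is a functorial factorization $f=\mathsf{R}f\circ\mathsf{L}f$ together with a comultiplication $\mathsf{L}\to\mathsf{L}\mathsf{L}$ and a multiplication $\mathsf{R}\mathsf{R}\to\mathsf{R}$ making the copointed endofunctor $\mathsf{L}$ of $\mathcal{E}^\to$ a comonad and the pointed endofunctor $\mathsf{R}$ of $\mathcal{E}^\to$ a monad, such that the canonical $\mathsf{L}\mathsf{R}\to\mathsf{R}\mathsf{L}$ is a distributive law. $\mathsf{L}\text{-}\mathsf{map}$ is the category of coalgebras for the copointed endofunctor $\mathsf{L}$ and $\mathsf{R}\text{-}\mathsf{Map}$ the category of algebras for the monad $\mathsf{R}$; one has $\mathsf{L}\text{-}\mathsf{map}={}^{\pitchfork}(\mathsf{R}\text{-}\mathsf{Map})$. The awfs is algebraically-free on $u\colon\mathcal{I}\to\mathcal{E}^\to$ if $\mathsf{R}\text{-}\mathsf{Map}\cong\mathcal{I}^{\pitchfork}$ over $\mathcal{E}^\to$, and cofibrantly generated (by $u$) if it is algebraically-free on some $u$ with $\mathcal{I}$ small. For an awfs $(\mathsf{C},\mathsf{F_t})$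 put $\mathsf{Cof}=\mathsf{C}\text{-}\mathsf{map}$ and $\mathsf{TrivFib}=\mathsf{F_t}\text{-}\mathsf{Map}$. It is suitable if: (S1) it is cofibrantly generated; (S2) the functor $\mathcal{E}\to\mathcal{E}^\to$, $X\mapsto(0\to X)$, factors through $\mathsf{Cof}\to\mathcal{E}^\to$; (S3) the pullback functor $P\colon\mathcal{E}^\to\times_{\mathcal{E}}\mathcal{E}^\to\to\mathcal{E}^\to$, $(g,h)\mapsto h^*(g)$, on pairs with common codomain lifts to a functor $\mathsf{Cof}\times_{\mathcal{E}}\mathcal{E}^\to\to\mathsf{Cof}$; (S4) for $k\in\{0,1\}$ the functor $\delta^k\hat\otimes(-)$ lifts to a functor $\mathsf{Cof}\to\mathsf{Cof}$. *)

theory Defs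
  imports "HOL-Library.FuncSet"
begin

unbundle cardinal_syntax

section \<open>Categories, functors, natural transformations\<close>

record ('o, 'm) cat =
  Obj :: "'o set"
  Arr :: "'m set"
  Dom :: "'m \<Rightarrow> 'o"
  Cod :: "'m \<Rightarrow> 'o"
  Ide :: "'o \<Rightarrow> 'm"
  Comp :: "'m \<Rightarrow> 'm \<Rightarrow> 'm" (infixl "\<cdot>\<index>" 70)

definition Hom :: "('o, 'm) cat \<Rightarrow> 'o \<Rightarrow> 'o \<Rightarrow> 'm set" where
  "Hom C a b = {f \<in> Arr C. Dom C f = a \<and> Cod C f = b}"

locale category =
  fixes C :: "('o, 'm) cat" (structure)
  assumes Dom_Obj: "f \<in> Arr C \<Longrightarrow> Dom C f \<in> Obj C"
    and Cod_Obj: "f \<in> Arr C \<Longrightarrow> Cod C f \<in> Obj C"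
    and Id_Hom: "a \<in> Obj C \<Longrightarrow> Ide C a \<in> Hom C a a"
    and Comp_Hom: "\<lbrakk>f \<in> Hom C a b; g \<in> Hom C b c\<rbrakk> \<Longrightarrow> g \<cdot> f \<in> Hom C a c"
    and Comp_Id: "f \<in> Hom C a b \<Longrightarrow> f \<cdot> Ide C a = f"
    and Id_Comp: "f \<in> Hom C a b \<Longrightarrow> Ide C b \<cdot> f = f"
    and Comp_assoc: "\<lbrakk>f \<in> Hom C a b; g \<in> Hom C b c; h \<in> Hom C c d\<rbrakk>
                      \<Longrightarrow> (h \<cdot> g) \<cdot> f = h \<cdot> (g \<cdot> f)"

record ('o, 'm, 'p, 'n) ftor =
  fob :: "'o \<Rightarrow> 'p"
  far :: "'m \<Rightarrow> 'n"

definition is_functor ::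
  "('o, 'm) cat \<Rightarrow> ('p, 'n) cat \<Rightarrow> ('o, 'm, 'p, 'n) ftor \<Rightarrow> bool" where
  "is_functor C D F \<longleftrightarrow>
     (\<forall>a \<in> Obj C. fob F a \<in> Obj D) \<and>
     (\<forall>a b. \<forall>f \<in> Hom C a b. far F f \<in> Hom D (fob F a) (fob F b)) \<and>
     (\<forall>a \<in> Obj C. far F (Ide C a) = Ide D (fob F a)) \<and>
     (\<forall>a b c. \<forall>f \<in> Hom C a b. \<forall>g \<in> Hom C b c. far F (g \<cdot>\<^bsub>C\<^esub> f) = far F g \<cdot>\<^bsub>D\<^esub> far F f)"

definition id_ftor :: "('o, 'm, 'o, 'm) ftor" where
  "id_ftor = \<lparr>fob = \<lambda>x. x, far = \<lambda>f. f\<rparr>"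

definition comp_ftor ::
  "('p, 'n, 'q, 'l) ftor \<Rightarrow> ('o, 'm, 'p, 'n) ftor \<Rightarrow> ('o, 'm, 'q, 'l) ftor"
  (infixl "\<circ>\<^sub>F" 65) where
  "G \<circ>\<^sub>F F = \<lparr>fob = \<lambda>x. fob G (fob F x), far = \<lambda>f. far G (far F f)\<rparr>"

text \<open>Equality of functors with domain \<open>C\<close>; values outside \<open>C\<close> are irrelevant.\<close>

definition ftor_eq ::
  "('o, 'm) cat \<Rightarrow> ('o, 'm, 'p, 'n) ftor \<Rightarrow> ('o, 'm, 'p, 'n) ftor \<Rightarrow> bool" where
  "ftor_eq C F G \<longleftrightarrow> (\<forall>a \<in> Obj C. fob F a = fob G a) \<and> (\<forall>f \<in> Arr C. far F f = far G f)"

definition nat_trans ::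
  "('o, 'm) cat \<Rightarrow> ('p, 'n) cat \<Rightarrow> ('o, 'm, 'p, 'n) ftor \<Rightarrow> ('o, 'm, 'p, 'n) ftor
    \<Rightarrow> ('o \<Rightarrow> 'n) \<Rightarrow> bool" where
  "nat_trans C D F G t \<longleftrightarrow>
     (\<forall>a \<in> Obj C. t a \<in> Hom D (fob F a) (fob G a)) \<and>
     (\<forall>a b. \<forall>f \<in> Hom C a b. t b \<cdot>\<^bsub>D\<^esub> far F f = far G f \<cdot>\<^bsub>D\<^esub> t a)"

definition has_right_adjoint ::
  "('o, 'm) cat \<Rightarrow> ('p, 'n) cat \<Rightarrow> ('o, 'm, 'p, 'n) ftor \<Rightarrow> bool" where
  "has_right_adjoint C D F \<longleftrightarrow>
     (\<exists>G \<eta> \<epsilon>. is_functor D C G \<and>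
        nat_trans C C id_ftor (G \<circ>\<^sub>F F) \<eta> \<and> nat_trans D D (F \<circ>\<^sub>F G) id_ftor \<epsilon> \<and>
        (\<forall>a \<in> Obj C. \<epsilon> (fob F a) \<cdot>\<^bsub>D\<^esub> far F (\<eta> a) = Ide D (fob F a)) \<and>
        (\<forall>b \<in> Obj D. far G (\<epsilon> b) \<cdot>\<^bsub>C\<^esub> \<eta> (fob G b) = Ide C (fob G b)))"

definition factors_through ::
  "('o, 'm) cat \<Rightarrow> ('o, 'm, 'p, 'n) ftor \<Rightarrow> ('q, 'l) cat \<Rightarrow> ('q, 'l, 'p, 'n) ftor \<Rightarrow> bool" where
  "factors_through C F D U \<longleftrightarrow> (\<exists>K. is_functor C D K \<and> ftor_eq C (U \<circ>\<^sub>F K) F)"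

text \<open>Isomorphism of the categories \<open>(C, U)\<close> and \<open>(D, V)\<close> over a common base.\<close>

definition iso_over ::
  "('o, 'm) cat \<Rightarrow> ('o, 'm, 'q, 'l) ftor \<Rightarrow> ('p, 'n) cat \<Rightarrow> ('p, 'n, 'q, 'l) ftor \<Rightarrow> bool" where
  "iso_over C U D V \<longleftrightarrow>
     (\<exists>F G. is_functor C D F \<and> is_functor D C G \<and>
        ftor_eq C (G \<circ>\<^sub>F F) id_ftor \<and> ftor_eq D (F \<circ>\<^sub>F G) id_ftor \<and>
        ftor_eq C (V \<circ>\<^sub>F F) U)"

subsection \<open>Constructions on categories\<close>

text \<open>The category of objects of \<open>C\<close> equipped with a structure: its objects are the pairs
  \<open>(x, s) \<in> S\<close>, and its arrows \<open>X \<rightarrow> Y\<close> are the arrows \<open>m\<close> between the underlying objects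
  that satisfy \<open>P X Y m\<close>. An arrow carries its source and target.\<close>

definition str_cat ::
  "('o, 'm) cat \<Rightarrow> ('o \<times> 's) set \<Rightarrow> ('o \<times> 's \<Rightarrow> 'o \<times> 's \<Rightarrow> 'm \<Rightarrow> bool)
    \<Rightarrow> ('o \<times> 's, ('o \<times> 's) \<times> ('o \<times> 's) \<times> 'm) cat" where
  "str_cat C S P =
     \<lparr>Obj = S,
      Arr = {(X, Y, m). X \<in> S \<and> Y \<in> S \<and> m \<in> Hom C (fst X) (fst Y) \<and> P X Y m},
      Dom = (\<lambda>(X, Y, m). X),
      Cod = (\<lambda>(X, Y, m). Y),
      Ide = (\<lambda>X. (X, X, Ide C (fst X))),
      Comp = (\<lambda>(Y', Z, n) (X, Y, m). (X, Z, n \<cdot>\<^bsub>C\<^esub> m))\<rparr>"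

definition forget :: "('o \<times> 's, ('o \<times> 's) \<times> ('o \<times> 's) \<times> 'm, 'o, 'm) ftor" where
  "forget = \<lparr>fob = fst, far = (\<lambda>(X, Y, m). m)\<rparr>"

definition slice :: "('o, 'm) cat \<Rightarrow> 'o \<Rightarrow> ('o \<times> 'm, ('o \<times> 'm) \<times> ('o \<times> 'm) \<times> 'm) cat" where
  "slice C x = str_cat C {(a, f). f \<in> Hom C a x} (\<lambda>(a, f) (b, g) m. g \<cdot>\<^bsub>C\<^esub> m = f)"

text \<open>The strict pullback of categories \<open>C \<times>\<^sub>B D\<close> along \<open>U : C \<rightarrow> B\<close> and \<open>V : D \<rightarrow> B\<close>.\<close>

definition fibprod ::
  "('o, 'm) cat \<Rightarrow> ('o, 'm, 'q, 'l) ftor \<Rightarrow> ('p, 'n) cat \<Rightarrow> ('p, 'n, 'q, 'l) ftor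
    \<Rightarrow> ('o \<times> 'p, 'm \<times> 'n) cat" where
  "fibprod C U D V =
     \<lparr>Obj = {(x, y). x \<in> Obj C \<and> y \<in> Obj D \<and> fob U x = fob V y},
      Arr = {(f, g). f \<in> Arr C \<and> g \<in> Arr D \<and> far U f = far V g},
      Dom = map_prod (Dom C) (Dom D),
      Cod = map_prod (Cod C) (Cod D),
      Ide = map_prod (Ide C) (Ide D),
      Comp = (\<lambda>(f', g') (f, g). (f' \<cdot>\<^bsub>C\<^esub> f, g' \<cdot>\<^bsub>D\<^esub> g))\<rparr>"

definition prod_ftor ::
  "('o, 'm, 'p, 'n) ftor \<Rightarrow> ('o', 'm', 'p', 'n') ftor
    \<Rightarrow> ('o \<times> 'o', 'm \<times> 'm', 'p \<times> 'p', 'n \<times> 'n') ftor" where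
  "prod_ftor F G = \<lparr>fob = map_prod (fob F) (fob G), far = map_prod (far F) (far G)\<rparr>"

definition coprod_cat :: "('o, 'm) cat \<Rightarrow> ('p, 'n) cat \<Rightarrow> ('o + 'p, 'm + 'n) cat" where
  "coprod_cat C D =
     \<lparr>Obj = Obj C <+> Obj D,
      Arr = Arr C <+> Arr D,
      Dom = map_sum (Dom C) (Dom D),
      Cod = map_sum (Cod C) (Cod D),
      Ide = map_sum (Ide C) (Ide D),
      Comp = (\<lambda>g f. case (g, f) of
                 (Inl g', Inl f') \<Rightarrow> Inl (g' \<cdot>\<^bsub>C\<^esub> f')
               | (Inr g', Inr f') \<Rightarrow> Inr (g' \<cdot>\<^bsub>D\<^esub> f')
               | _ \<Rightarrow> undefined)\<rparr>"

definition copair_ftor ::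
  "('o, 'm, 'q, 'l) ftor \<Rightarrow> ('p, 'n, 'q, 'l) ftor \<Rightarrow> ('o + 'p, 'm + 'n, 'q, 'l) ftor" where
  "copair_ftor F G = \<lparr>fob = case_sum (fob F) (fob G), far = case_sum (far F) (far G)\<rparr>"

text \<open>The arrow category: \<open>Sq f g s t\<close> is the commutative square \<open>g s = t f\<close> regarded as
  an arrow from \<open>f\<close> to \<open>g\<close>.\<close>

datatype 'm sq = Sq (sq_dom: 'm) (sq_cod: 'm) (sq_top: 'm) (sq_bot: 'm)

definition arrow_cat :: "('o, 'm) cat \<Rightarrow> ('m, 'm sq) cat" where
  "arrow_cat E =
     \<lparr>Obj = Arr E,
      Arr = {Sq f g s t | f g s t. f \<in> Arr E \<and> g \<in> Arr E \<and>
               s \<in> Hom E (Dom E f) (Dom E g) \<and> t \<in> Hom E (Cod E f) (Cod E g) \<and>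
               g \<cdot>\<^bsub>E\<^esub> s = t \<cdot>\<^bsub>E\<^esub> f},
      Dom = sq_dom,
      Cod = sq_cod,
      Ide = (\<lambda>f. Sq f f (Ide E (Dom E f)) (Ide E (Cod E f))),
      Comp = (\<lambda>q p. Sq (sq_dom p) (sq_cod q) (sq_top q \<cdot>\<^bsub>E\<^esub> sq_top p) (sq_bot q \<cdot>\<^bsub>E\<^esub> sq_bot p))\<rparr>"

definition dom_ftor :: "('o, 'm) cat \<Rightarrow> ('m, 'm sq, 'o, 'm) ftor" where
  "dom_ftor E = \<lparr>fob = Dom E, far = sq_top\<rparr>"

definition cod_ftor :: "('o, 'm) cat \<Rightarrow> ('m, 'm sq, 'o, 'm) ftor" where
  "cod_ftor E = \<lparr>fob = Cod E, far = sq_bot\<rparr>"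

section \<open>Limits and colimits\<close>

definition is_initial :: "('o, 'm) cat \<Rightarrow> 'o \<Rightarrow> bool" where
  "is_initial C z \<longleftrightarrow> z \<in> Obj C \<and> (\<forall>x \<in> Obj C. \<exists>!f. f \<in> Hom C z x)"

definition is_terminal :: "('o, 'm) cat \<Rightarrow> 'o \<Rightarrow> bool" where
  "is_terminal C z \<longleftrightarrow> z \<in> Obj C \<and> (\<forall>x \<in> Obj C. \<exists>!f. f \<in> Hom C x z)"

definition is_product :: "('o, 'm) cat \<Rightarrow> 'o \<Rightarrow> 'o \<Rightarrow> 'o \<Rightarrow> 'm \<Rightarrow> 'm \<Rightarrow> bool" where
  "is_product C a b p \<pi>\<^sub>1 \<pi>\<^sub>2 \<longleftrightarrow> p \<in> Obj C \<and> \<pi>\<^sub>1 \<in> Hom C p a \<and> \<pi>\<^sub>2 \<in> Hom C p b \<and>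
     (\<forall>x \<in> Obj C. \<forall>f \<in> Hom C x a. \<forall>g \<in> Hom C x b.
        \<exists>!h. h \<in> Hom C x p \<and> \<pi>\<^sub>1 \<cdot>\<^bsub>C\<^esub> h = f \<and> \<pi>\<^sub>2 \<cdot>\<^bsub>C\<^esub> h = g)"

text \<open>\<open>e\<close> with evaluation \<open>ev\<close>, defined on a product \<open>p\<close> of \<open>e\<close> and \<open>a\<close>, is an exponential
  \<open>b\<^sup>a\<close>: every \<open>h : x \<times> a \<rightarrow> b\<close> is \<open>ev (g \<times> a)\<close> for a unique \<open>g : x \<rightarrow> e\<close>.\<close>

definition is_exponential ::
  "('o, 'm) cat \<Rightarrow> 'o \<Rightarrow> 'o \<Rightarrow> 'o \<Rightarrow> 'o \<Rightarrow> 'm \<Rightarrow> 'm \<Rightarrow> 'm \<Rightarrow> bool" where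
  "is_exponential C a b e p \<pi>\<^sub>1 \<pi>\<^sub>2 ev \<longleftrightarrow> is_product C e a p \<pi>\<^sub>1 \<pi>\<^sub>2 \<and> ev \<in> Hom C p b \<and>
     (\<forall>x q \<rho>\<^sub>1 \<rho>\<^sub>2. x \<in> Obj C \<and> is_product C x a q \<rho>\<^sub>1 \<rho>\<^sub>2 \<longrightarrow>
        (\<forall>h \<in> Hom C q b. \<exists>!g. g \<in> Hom C x e \<and>
           (\<exists>k \<in> Hom C q p. \<pi>\<^sub>1 \<cdot>\<^bsub>C\<^esub> k = g \<cdot>\<^bsub>C\<^esub> \<rho>\<^sub>1 \<and> \<pi>\<^sub>2 \<cdot>\<^bsub>C\<^esub> k = \<rho>\<^sub>2 \<and> ev \<cdot>\<^bsub>C\<^esub> k = h)))"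

definition cartesian_closed :: "('o, 'm) cat \<Rightarrow> bool" where
  "cartesian_closed C \<longleftrightarrow>
     (\<exists>z. is_terminal C z) \<and>
     (\<forall>a \<in> Obj C. \<forall>b \<in> Obj C. \<exists>p \<pi>\<^sub>1 \<pi>\<^sub>2. is_product C a b p \<pi>\<^sub>1 \<pi>\<^sub>2) \<and>
     (\<forall>a \<in> Obj C. \<forall>b \<in> Obj C. \<exists>e p \<pi>\<^sub>1 \<pi>\<^sub>2 ev. is_exponential C a b e p \<pi>\<^sub>1 \<pi>\<^sub>2 ev)"

definition locally_cartesian_closed :: "('o, 'm) cat \<Rightarrow> bool" where
  "locally_cartesian_closed C \<longleftrightarrow> (\<forall>x \<in> Obj C. cartesian_closed (slice C x))"

definition is_pullback :: "('o, 'm) cat \<Rightarrow> 'm \<Rightarrow> 'm \<Rightarrow> 'm \<Rightarrow> 'm \<Rightarrow> bool" where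
  "is_pullback C g h p\<^sub>1 p\<^sub>2 \<longleftrightarrow>
     (\<exists>p \<in> Obj C. p\<^sub>1 \<in> Hom C p (Dom C g) \<and> p\<^sub>2 \<in> Hom C p (Dom C h) \<and>
        g \<cdot>\<^bsub>C\<^esub> p\<^sub>1 = h \<cdot>\<^bsub>C\<^esub> p\<^sub>2 \<and>
        (\<forall>x \<in> Obj C. \<forall>a \<in> Hom C x (Dom C g). \<forall>b \<in> Hom C x (Dom C h).
           g \<cdot>\<^bsub>C\<^esub> a = h \<cdot>\<^bsub>C\<^esub> b \<longrightarrow> (\<exists>!k. k \<in> Hom C x p \<and> p\<^sub>1 \<cdot>\<^bsub>C\<^esub> k = a \<and> p\<^sub>2 \<cdot>\<^bsub>C\<^esub> k = b)))"

definition is_pushout :: "('o, 'm) cat \<Rightarrow> 'm \<Rightarrow> 'm \<Rightarrow> 'm \<Rightarrow> 'm \<Rightarrow> bool" where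
  "is_pushout C f g j\<^sub>1 j\<^sub>2 \<longleftrightarrow>
     (\<exists>p \<in> Obj C. j\<^sub>1 \<in> Hom C (Cod C f) p \<and> j\<^sub>2 \<in> Hom C (Cod C g) p \<and>
        j\<^sub>1 \<cdot>\<^bsub>C\<^esub> f = j\<^sub>2 \<cdot>\<^bsub>C\<^esub> g \<and>
        (\<forall>x \<in> Obj C. \<forall>a \<in> Hom C (Cod C f) x. \<forall>b \<in> Hom C (Cod C g) x.
           a \<cdot>\<^bsub>C\<^esub> f = b \<cdot>\<^bsub>C\<^esub> g \<longrightarrow> (\<exists>!k. k \<in> Hom C p x \<and> k \<cdot>\<^bsub>C\<^esub> j\<^sub>1 = a \<and> k \<cdot>\<^bsub>C\<^esub> j\<^sub>2 = b)))"

text \<open>Initial object, pullbacks and pushouts are chosen once and for all by \<open>SOME\<close>.\<close>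

definition initial_obj :: "('o, 'm) cat \<Rightarrow> 'o" where
  "initial_obj C = (SOME z. is_initial C z)"

definition pb :: "('o, 'm) cat \<Rightarrow> 'm \<Rightarrow> 'm \<Rightarrow> 'm \<times> 'm" where
  "pb C g h = (SOME (p\<^sub>1, p\<^sub>2). is_pullback C g h p\<^sub>1 p\<^sub>2)"

definition pb_pair :: "('o, 'm) cat \<Rightarrow> 'm \<Rightarrow> 'm \<Rightarrow> 'm \<Rightarrow> 'm \<Rightarrow> 'm" where
  "pb_pair C g h a b = (case pb C g h of (p\<^sub>1, p\<^sub>2) \<Rightarrow>
     (THE k. k \<in> Hom C (Dom C a) (Dom C p\<^sub>1) \<and> p\<^sub>1 \<cdot>\<^bsub>C\<^esub> k = a \<and> p\<^sub>2 \<cdot>\<^bsub>C\<^esub> k = b))"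

definition po :: "('o, 'm) cat \<Rightarrow> 'm \<Rightarrow> 'm \<Rightarrow> 'm \<times> 'm" where
  "po C f g = (SOME (j\<^sub>1, j\<^sub>2). is_pushout C f g j\<^sub>1 j\<^sub>2)"

definition po_copair :: "('o, 'm) cat \<Rightarrow> 'm \<Rightarrow> 'm \<Rightarrow> 'm \<Rightarrow> 'm \<Rightarrow> 'm" where
  "po_copair C f g a b = (case po C f g of (j\<^sub>1, j\<^sub>2) \<Rightarrow>
     (THE k. k \<in> Hom C (Cod C j\<^sub>1) (Cod C a) \<and> k \<cdot>\<^bsub>C\<^esub> j\<^sub>1 = a \<and> k \<cdot>\<^bsub>C\<^esub> j\<^sub>2 = b))"

definition is_cocone ::
  "('i, 'j) cat \<Rightarrow> ('o, 'm) cat \<Rightarrow> ('i, 'j, 'o, 'm) ftor \<Rightarrow> 'o \<Rightarrow> ('i \<Rightarrow> 'm) \<Rightarrow> bool" where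
  "is_cocone J C D c \<iota> \<longleftrightarrow> c \<in> Obj C \<and> (\<forall>j \<in> Obj J. \<iota> j \<in> Hom C (fob D j) c) \<and>
     (\<forall>j k. \<forall>f \<in> Hom J j k. \<iota> k \<cdot>\<^bsub>C\<^esub> far D f = \<iota> j)"

definition is_colimit ::
  "('i, 'j) cat \<Rightarrow> ('o, 'm) cat \<Rightarrow> ('i, 'j, 'o, 'm) ftor \<Rightarrow> 'o \<Rightarrow> ('i \<Rightarrow> 'm) \<Rightarrow> bool" where
  "is_colimit J C D c \<iota> \<longleftrightarrow> is_cocone J C D c \<iota> \<and>
     (\<forall>x \<xi>. is_cocone J C D x \<xi> \<longrightarrow>
        (\<exists>!h. h \<in> Hom C c x \<and> (\<forall>j \<in> Obj J. h \<cdot>\<^bsub>C\<^esub> \<iota> j = \<xi> j)))"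

section \<open>Smallness and locally presentable categories\<close>

text \<open>The universe of small sets is given by a strongly inaccessible cardinal \<open>\<kappa>\<close>: a set,
  of any type, is small if its cardinality is below \<open>\<kappa>\<close>. As \<open>Field \<kappa>\<close> has type \<open>'u set\<close>,
  every small set is equipollent to a set of type \<open>'u set\<close>, so quantifying over small sets or
  small categories in \<open>'u\<close> accounts for all of them up to isomorphism.\<close>

definition universe :: "'u rel \<Rightarrow> bool" where
  "universe \<kappa> \<longleftrightarrow> Card_order \<kappa> \<and> natLeq <o \<kappa> \<and> regularCard \<kappa> \<and>
     (\<forall>A :: 'u set. |A| <o \<kappa> \<longrightarrow> |Pow A| <o \<kappa>)"

definition small :: "'u rel \<Rightarrow> 'a set \<Rightarrow> bool" where
  "small \<kappa> A \<longleftrightarrow> |A| <o \<kappa>"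

definition small_category :: "'u rel \<Rightarrow> ('o, 'm) cat \<Rightarrow> bool" where
  "small_category \<kappa> J \<longleftrightarrow> category J \<and> small \<kappa> (Obj J) \<and> small \<kappa> (Arr J)"

definition locally_small :: "'u rel \<Rightarrow> ('o, 'm) cat \<Rightarrow> bool" where
  "locally_small \<kappa> C \<longleftrightarrow> (\<forall>a \<in> Obj C. \<forall>b \<in> Obj C. small \<kappa> (Hom C a b))"

definition cocomplete :: "'u rel \<Rightarrow> ('o, 'm) cat \<Rightarrow> bool" where
  "cocomplete \<kappa> C \<longleftrightarrow>
     (\<forall>(J :: ('u, 'u) cat) D. small_category \<kappa> J \<and> is_functor J C D \<longrightarrow>
        (\<exists>c \<iota>. is_colimit J C D c \<iota>))"

text \<open>A small \<open>\<mu>\<close>-directed poset, viewed as a category.\<close>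

definition directed_poset :: "'u rel \<Rightarrow> 'u rel \<Rightarrow> ('i, 'j) cat \<Rightarrow> bool" where
  "directed_poset \<kappa> \<mu> J \<longleftrightarrow> small_category \<kappa> J \<and>
     (\<forall>j k. \<forall>f \<in> Hom J j k. \<forall>g \<in> Hom J j k. f = g) \<and>
     (\<forall>j k. Hom J j k \<noteq> {} \<and> Hom J k j \<noteq> {} \<longrightarrow> j = k) \<and>
     (\<forall>S \<subseteq> Obj J. |S| <o \<mu> \<longrightarrow> (\<exists>k \<in> Obj J. \<forall>j \<in> S. Hom J j k \<noteq> {}))"

text \<open>The functor \<open>Hom(a, -)\<close> sends the cocone \<open>(c, \<iota>)\<close> under \<open>D\<close> to a colimit cocone in the
  category of small sets.\<close>

definition hom_sends_to_colimit ::
  "'u rel \<Rightarrow> ('i, 'j) cat \<Rightarrow> ('o, 'm) cat \<Rightarrow> 'o \<Rightarrow> ('i, 'j, 'o, 'm) ftor \<Rightarrow> 'o \<Rightarrow> ('i \<Rightarrow> 'm) \<Rightarrow> bool"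
  where
  "hom_sends_to_colimit \<kappa> J C a D c \<iota> \<longleftrightarrow>
     (\<forall>(S :: 'u set) h. small \<kappa> S \<and>
        (\<forall>j \<in> Obj J. h j \<in> Hom C a (fob D j) \<rightarrow> S) \<and>
        (\<forall>j k. \<forall>f \<in> Hom J j k. \<forall>x \<in> Hom C a (fob D j). h k (far D f \<cdot>\<^bsub>C\<^esub> x) = h j x) \<longrightarrow>
        (\<exists>!g. g \<in> Hom C a c \<rightarrow>\<^sub>E S \<and>
           (\<forall>j \<in> Obj J. \<forall>x \<in> Hom C a (fob D j). g (\<iota> j \<cdot>\<^bsub>C\<^esub> x) = h j x)))"

definition presentable :: "'u rel \<Rightarrow> 'u rel \<Rightarrow> ('o, 'm) cat \<Rightarrow> 'o \<Rightarrow> bool" where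
  "presentable \<kappa> \<mu> C a \<longleftrightarrow> a \<in> Obj C \<and>
     (\<forall>(J :: ('u, 'u) cat) D c \<iota>.
        directed_poset \<kappa> \<mu> J \<and> is_functor J C D \<and> is_colimit J C D c \<iota> \<longrightarrow>
        hom_sends_to_colimit \<kappa> J C a D c \<iota>)"

definition locally_presentable :: "'u rel \<Rightarrow> ('o, 'm) cat \<Rightarrow> bool" where
  "locally_presentable \<kappa> C \<longleftrightarrow> locally_small \<kappa> C \<and> cocomplete \<kappa> C \<and>
     (\<exists>\<mu> :: 'u rel. Card_order \<mu> \<and> natLeq \<le>o \<mu> \<and> regularCard \<mu> \<and> \<mu> <o \<kappa> \<and>
        (\<exists>G. small \<kappa> G \<and> (\<forall>a \<in> G. presentable \<kappa> \<mu> C a) \<and>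
           (\<forall>x \<in> Obj C. \<exists>(J :: ('u, 'u) cat) D \<iota>. directed_poset \<kappa> \<mu> J \<and> is_functor J C D \<and>
              (\<forall>j \<in> Obj J. fob D j \<in> G) \<and> is_colimit J C D x \<iota>)))"

section \<open>Functorial cylinders\<close>

text \<open>\<open>T\<close> is the endofunctor \<open>I \<otimes> (-)\<close> and \<open>\<delta> k x\<close> is \<open>\<delta>\<^sup>k \<otimes> x\<close> for \<open>k \<in> {0, 1}\<close>; similarly
  for the contraction \<open>\<epsilon>\<close> and the connections \<open>c k\<close>.\<close>

definition functorial_cylinder ::
  "('o, 'm) cat \<Rightarrow> ('o, 'm, 'o, 'm) ftor \<Rightarrow> (nat \<Rightarrow> 'o \<Rightarrow> 'm) \<Rightarrow> bool" where
  "functorial_cylinder E T \<delta> \<longleftrightarrow> is_functor E E T \<and> (\<forall>k \<in> {0, 1}. nat_trans E E id_ftor T (\<delta> k))"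

definition contraction ::
  "('o, 'm) cat \<Rightarrow> ('o, 'm, 'o, 'm) ftor \<Rightarrow> (nat \<Rightarrow> 'o \<Rightarrow> 'm) \<Rightarrow> ('o \<Rightarrow> 'm) \<Rightarrow> bool" where
  "contraction E T \<delta> \<epsilon> \<longleftrightarrow> nat_trans E E T id_ftor \<epsilon> \<and>
     (\<forall>k \<in> {0, 1}. \<forall>x \<in> Obj E. \<epsilon> x \<cdot>\<^bsub>E\<^esub> \<delta> k x = Ide E x)"

definition connections ::
  "('o, 'm) cat \<Rightarrow> ('o, 'm, 'o, 'm) ftor \<Rightarrow> (nat \<Rightarrow> 'o \<Rightarrow> 'm) \<Rightarrow> ('o \<Rightarrow> 'm)
    \<Rightarrow> (nat \<Rightarrow> 'o \<Rightarrow> 'm) \<Rightarrow> bool" where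
  "connections E T \<delta> \<epsilon> c \<longleftrightarrow>
     (\<forall>k \<in> {0, 1}. nat_trans E E (T \<circ>\<^sub>F T) T (c k) \<and>
        (\<forall>x \<in> Obj E.
           c k x \<cdot>\<^bsub>E\<^esub> \<delta> k (fob T x) = \<delta> k x \<cdot>\<^bsub>E\<^esub> \<epsilon> x \<and>
           c k x \<cdot>\<^bsub>E\<^esub> far T (\<delta> k x) = \<delta> k x \<cdot>\<^bsub>E\<^esub> \<epsilon> x \<and>
           c k x \<cdot>\<^bsub>E\<^esub> \<delta> (1 - k) (fob T x) = Ide E (fob T x) \<and>
           c k x \<cdot>\<^bsub>E\<^esub> far T (\<delta> (1 - k) x) = Ide E (fob T x)))"

text \<open>The Leibniz product \<open>(I \<otimes> A) +\<^sub>A B \<rightarrow> I \<otimes> B\<close> of \<open>d = \<delta>\<^sup>k\<close> with \<open>i : A \<rightarrow> B\<close>, and its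
  functorial action on squares.\<close>

definition leibniz_obj ::
  "('o, 'm) cat \<Rightarrow> ('o, 'm, 'o, 'm) ftor \<Rightarrow> ('o \<Rightarrow> 'm) \<Rightarrow> 'm \<Rightarrow> 'm" where
  "leibniz_obj E T d i = po_copair E (d (Dom E i)) i (far T i) (d (Cod E i))"

definition leibniz ::
  "('o, 'm) cat \<Rightarrow> ('o, 'm, 'o, 'm) ftor \<Rightarrow> ('o \<Rightarrow> 'm) \<Rightarrow> ('m, 'm sq, 'm, 'm sq) ftor" where
  "leibniz E T d =
     \<lparr>fob = leibniz_obj E T d,
      far = (\<lambda>q. case q of Sq i i' s t \<Rightarrow>
         case po E (d (Dom E i')) i' of (j\<^sub>1', j\<^sub>2') \<Rightarrow>
           Sq (leibniz_obj E T d i) (leibniz_obj E T d i')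
              (po_copair E (d (Dom E i)) i (j\<^sub>1' \<cdot>\<^bsub>E\<^esub> far T s) (j\<^sub>2' \<cdot>\<^bsub>E\<^esub> t))
              (far T t))\<rparr>"

section \<open>Categories of right and left maps\<close>

definition is_filler :: "('o, 'm) cat \<Rightarrow> 'm sq \<Rightarrow> 'm \<Rightarrow> bool" where
  "is_filler E q h \<longleftrightarrow> h \<in> Hom E (Cod E (sq_dom q)) (Dom E (sq_cod q)) \<and>
     h \<cdot>\<^bsub>E\<^esub> sq_dom q = sq_top q \<and> sq_cod q \<cdot>\<^bsub>E\<^esub> h = sq_bot q"

text \<open>A lifting function takes an index \<open>i\<close> and a square; it is made \<open>undefined\<close> on arguments
  that do not matter, so that a right (left) map has exactly one representation.\<close>

definition right_map ::
  "('o, 'm) cat \<Rightarrow> ('i, 'j) cat \<Rightarrow> ('i, 'j, 'm, 'm sq) ftor \<Rightarrow> 'm \<times> ('i \<Rightarrow> 'm sq \<Rightarrow> 'm) \<Rightarrow> bool" where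
  "right_map E I u = (\<lambda>(f, \<phi>). f \<in> Arr E \<and>
     (\<forall>i \<in> Obj I. \<forall>q \<in> Hom (arrow_cat E) (fob u i) f. is_filler E q (\<phi> i q)) \<and>
     (\<forall>i j. \<forall>\<sigma> \<in> Hom I i j. \<forall>q \<in> Hom (arrow_cat E) (fob u j) f.
        \<phi> j q \<cdot>\<^bsub>E\<^esub> sq_bot (far u \<sigma>) = \<phi> i (q \<cdot>\<^bsub>arrow_cat E\<^esub> far u \<sigma>)) \<and>
     (\<forall>i q. \<not> (i \<in> Obj I \<and> q \<in> Hom (arrow_cat E) (fob u i) f) \<longrightarrow> \<phi> i q = undefined))"

definition right_maps ::
  "('o, 'm) cat \<Rightarrow> ('i, 'j) cat \<Rightarrow> ('i, 'j, 'm, 'm sq) ftor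
    \<Rightarrow> ('m \<times> ('i \<Rightarrow> 'm sq \<Rightarrow> 'm),
        ('m \<times> ('i \<Rightarrow> 'm sq \<Rightarrow> 'm)) \<times> ('m \<times> ('i \<Rightarrow> 'm sq \<Rightarrow> 'm)) \<times> 'm sq) cat" where
  "right_maps E I u = str_cat (arrow_cat E) {X. right_map E I u X}
     (\<lambda>(f, \<phi>) (g, \<psi>) m. \<forall>i \<in> Obj I. \<forall>q \<in> Hom (arrow_cat E) (fob u i) f.
        sq_top m \<cdot>\<^bsub>E\<^esub> \<phi> i q = \<psi> i (m \<cdot>\<^bsub>arrow_cat E\<^esub> q))"

definition left_map ::
  "('o, 'm) cat \<Rightarrow> ('i, 'j) cat \<Rightarrow> ('i, 'j, 'm, 'm sq) ftor \<Rightarrow> 'm \<times> ('i \<Rightarrow> 'm sq \<Rightarrow> 'm) \<Rightarrow> bool" where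
  "left_map E I u = (\<lambda>(f, \<phi>). f \<in> Arr E \<and>
     (\<forall>i \<in> Obj I. \<forall>q \<in> Hom (arrow_cat E) f (fob u i). is_filler E q (\<phi> i q)) \<and>
     (\<forall>i j. \<forall>\<sigma> \<in> Hom I i j. \<forall>q \<in> Hom (arrow_cat E) f (fob u i).
        sq_top (far u \<sigma>) \<cdot>\<^bsub>E\<^esub> \<phi> i q = \<phi> j (far u \<sigma> \<cdot>\<^bsub>arrow_cat E\<^esub> q)) \<and>
     (\<forall>i q. \<not> (i \<in> Obj I \<and> q \<in> Hom (arrow_cat E) f (fob u i)) \<longrightarrow> \<phi> i q = undefined))"

definition left_maps ::
  "('o, 'm) cat \<Rightarrow> ('i, 'j) cat \<Rightarrow> ('i, 'j, 'm, 'm sq) ftor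
    \<Rightarrow> ('m \<times> ('i \<Rightarrow> 'm sq \<Rightarrow> 'm),
        ('m \<times> ('i \<Rightarrow> 'm sq \<Rightarrow> 'm)) \<times> ('m \<times> ('i \<Rightarrow> 'm sq \<Rightarrow> 'm)) \<times> 'm sq) cat" where
  "left_maps E I u = str_cat (arrow_cat E) {X. left_map E I u X}
     (\<lambda>(f, \<phi>) (g, \<psi>) m. \<forall>i \<in> Obj I. \<forall>q \<in> Hom (arrow_cat E) g (fob u i).
        \<phi> i (q \<cdot>\<^bsub>arrow_cat E\<^esub> m) = \<psi> i q \<cdot>\<^bsub>E\<^esub> sq_bot m)"

section \<open>Algebraic weak factorization systems\<close>

definition comonad ::
  "('o, 'm) cat \<Rightarrow> ('o, 'm, 'o, 'm) ftor \<Rightarrow> ('o \<Rightarrow> 'm) \<Rightarrow> ('o \<Rightarrow> 'm) \<Rightarrow> bool" where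
  "comonad C L \<epsilon> \<Delta> \<longleftrightarrow> is_functor C C L \<and>
     nat_trans C C L id_ftor \<epsilon> \<and> nat_trans C C L (L \<circ>\<^sub>F L) \<Delta> \<and>
     (\<forall>a \<in> Obj C.
        \<epsilon> (fob L a) \<cdot>\<^bsub>C\<^esub> \<Delta> a = Ide C (fob L a) \<and>
        far L (\<epsilon> a) \<cdot>\<^bsub>C\<^esub> \<Delta> a = Ide C (fob L a) \<and>
        \<Delta> (fob L a) \<cdot>\<^bsub>C\<^esub> \<Delta> a = far L (\<Delta> a) \<cdot>\<^bsub>C\<^esub> \<Delta> a)"

definition monad ::
  "('o, 'm) cat \<Rightarrow> ('o, 'm, 'o, 'm) ftor \<Rightarrow> ('o \<Rightarrow> 'm) \<Rightarrow> ('o \<Rightarrow> 'm) \<Rightarrow> bool" where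
  "monad C R \<eta> \<mu> \<longleftrightarrow> is_functor C C R \<and>
     nat_trans C C id_ftor R \<eta> \<and> nat_trans C C (R \<circ>\<^sub>F R) R \<mu> \<and>
     (\<forall>a \<in> Obj C.
        \<mu> a \<cdot>\<^bsub>C\<^esub> \<eta> (fob R a) = Ide C (fob R a) \<and>
        \<mu> a \<cdot>\<^bsub>C\<^esub> far R (\<eta> a) = Ide C (fob R a) \<and>
        \<mu> a \<cdot>\<^bsub>C\<^esub> \<mu> (fob R a) = \<mu> a \<cdot>\<^bsub>C\<^esub> far R (\<mu> a))"

text \<open>A distributive law \<open>\<Lambda> : L R \<rightarrow> R L\<close> of the comonad \<open>L\<close> over the monad \<open>R\<close>.\<close>

definition distributive_law ::
  "('o, 'm) cat \<Rightarrow> ('o, 'm, 'o, 'm) ftor \<Rightarrow> ('o \<Rightarrow> 'm) \<Rightarrow> ('o \<Rightarrow> 'm)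
    \<Rightarrow> ('o, 'm, 'o, 'm) ftor \<Rightarrow> ('o \<Rightarrow> 'm) \<Rightarrow> ('o \<Rightarrow> 'm) \<Rightarrow> ('o \<Rightarrow> 'm) \<Rightarrow> bool" where
  "distributive_law C L \<epsilon> \<Delta> R \<eta> \<mu> \<Lambda> \<longleftrightarrow>
     nat_trans C C (L \<circ>\<^sub>F R) (R \<circ>\<^sub>F L) \<Lambda> \<and>
     (\<forall>a \<in> Obj C.
        \<Lambda> a \<cdot>\<^bsub>C\<^esub> far L (\<eta> a) = \<eta> (fob L a) \<and>
        far R (\<epsilon> a) \<cdot>\<^bsub>C\<^esub> \<Lambda> a = \<epsilon> (fob R a) \<and>
        \<Lambda> a \<cdot>\<^bsub>C\<^esub> far L (\<mu> a) = \<mu> (fob L a) \<cdot>\<^bsub>C\<^esub> far R (\<Lambda> a) \<cdot>\<^bsub>C\<^esub> \<Lambda> (fob R a) \<and>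
        far R (\<Delta> a) \<cdot>\<^bsub>C\<^esub> \<Lambda> a = \<Lambda> (fob L a) \<cdot>\<^bsub>C\<^esub> far L (\<Lambda> a) \<cdot>\<^bsub>C\<^esub> \<Delta> (fob R a))"

text \<open>The functorial factorization sends \<open>f\<close> to \<open>lft f : dom f \<rightarrow> K f\<close> and \<open>rgt f : K f \<rightarrow> cod f\<close>,
  where \<open>K = mid\<close> acts on objects and arrows of the arrow category.\<close>

record ('o, 'm) awfs_data =
  mid :: "('m, 'm sq, 'o, 'm) ftor"
  lft :: "'m \<Rightarrow> 'm"
  rgt :: "'m \<Rightarrow> 'm"
  comul :: "'m \<Rightarrow> 'm sq"
  mul :: "'m \<Rightarrow> 'm sq"

definition functorial_factorization :: "('o, 'm) cat \<Rightarrow> ('o, 'm) awfs_data \<Rightarrow> bool" where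
  "functorial_factorization E W \<longleftrightarrow>
     is_functor (arrow_cat E) E (mid W) \<and>
     nat_trans (arrow_cat E) E (dom_ftor E) (mid W) (lft W) \<and>
     nat_trans (arrow_cat E) E (mid W) (cod_ftor E) (rgt W) \<and>
     (\<forall>f \<in> Arr E. rgt W f \<cdot>\<^bsub>E\<^esub> lft W f = f)"

definition L_ftor :: "('o, 'm) awfs_data \<Rightarrow> ('m, 'm sq, 'm, 'm sq) ftor" where
  "L_ftor W = \<lparr>fob = lft W,
     far = (\<lambda>q. Sq (lft W (sq_dom q)) (lft W (sq_cod q)) (sq_top q) (far (mid W) q))\<rparr>"

definition R_ftor :: "('o, 'm) awfs_data \<Rightarrow> ('m, 'm sq, 'm, 'm sq) ftor" where
  "R_ftor W = \<lparr>fob = rgt W,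
     far = (\<lambda>q. Sq (rgt W (sq_dom q)) (rgt W (sq_cod q)) (far (mid W) q) (sq_bot q))\<rparr>"

definition L_counit :: "('o, 'm) cat \<Rightarrow> ('o, 'm) awfs_data \<Rightarrow> 'm \<Rightarrow> 'm sq" where
  "L_counit E W f = Sq (lft W f) f (Ide E (Dom E f)) (rgt W f)"

definition R_unit :: "('o, 'm) cat \<Rightarrow> ('o, 'm) awfs_data \<Rightarrow> 'm \<Rightarrow> 'm sq" where
  "R_unit E W f = Sq f (rgt W f) (lft W f) (Ide E (Cod E f))"

text \<open>The canonical \<open>L R f \<rightarrow> R L f\<close> is the square from \<open>lft (rgt f) : K f \<rightarrow> K (rgt f)\<close> to
  \<open>rgt (lft f) : K (lft f) \<rightarrow> K f\<close> whose top is the component \<open>K f \<rightarrow> K (lft f)\<close> of the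
  comultiplication and whose bottom is the component \<open>K (rgt f) \<rightarrow> K f\<close> of the
  multiplication; its diagonal is the identity of \<open>K f\<close>.\<close>

definition canonical_dist :: "('o, 'm) awfs_data \<Rightarrow> 'm \<Rightarrow> 'm sq" where
  "canonical_dist W f =
     Sq (lft W (rgt W f)) (rgt W (lft W f)) (sq_bot (comul W f)) (sq_top (mul W f))"

definition is_awfs :: "('o, 'm) cat \<Rightarrow> ('o, 'm) awfs_data \<Rightarrow> bool" where
  "is_awfs E W \<longleftrightarrow> functorial_factorization E W \<and>
     comonad (arrow_cat E) (L_ftor W) (L_counit E W) (comul W) \<and>
     monad (arrow_cat E) (R_ftor W) (R_unit E W) (mul W) \<and>
     distributive_law (arrow_cat E)
       (L_ftor W) (L_counit E W) (comul W) (R_ftor W) (R_unit E W) (mul W) (canonical_dist W)"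

text \<open>Coalgebras for a copointed endofunctor, and algebras for a monad.\<close>

definition copointed_coalg ::
  "('o, 'm) cat \<Rightarrow> ('o, 'm, 'o, 'm) ftor \<Rightarrow> ('o \<Rightarrow> 'm)
    \<Rightarrow> ('o \<times> 'm, ('o \<times> 'm) \<times> ('o \<times> 'm) \<times> 'm) cat" where
  "copointed_coalg C L \<epsilon> = str_cat C
     {(a, \<alpha>). a \<in> Obj C \<and> \<alpha> \<in> Hom C a (fob L a) \<and> \<epsilon> a \<cdot>\<^bsub>C\<^esub> \<alpha> = Ide C a}
     (\<lambda>(a, \<alpha>) (b, \<beta>) m. \<beta> \<cdot>\<^bsub>C\<^esub> m = far L m \<cdot>\<^bsub>C\<^esub> \<alpha>)"

definition monad_alg ::
  "('o, 'm) cat \<Rightarrow> ('o, 'm, 'o, 'm) ftor \<Rightarrow> ('o \<Rightarrow> 'm) \<Rightarrow> ('o \<Rightarrow> 'm)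
    \<Rightarrow> ('o \<times> 'm, ('o \<times> 'm) \<times> ('o \<times> 'm) \<times> 'm) cat" where
  "monad_alg C R \<eta> \<mu> = str_cat C
     {(a, \<alpha>). a \<in> Obj C \<and> \<alpha> \<in> Hom C (fob R a) a \<and> \<alpha> \<cdot>\<^bsub>C\<^esub> \<eta> a = Ide C a \<and>
        \<alpha> \<cdot>\<^bsub>C\<^esub> \<mu> a = \<alpha> \<cdot>\<^bsub>C\<^esub> far R \<alpha>}
     (\<lambda>(a, \<alpha>) (b, \<beta>) m. m \<cdot>\<^bsub>C\<^esub> \<alpha> = \<beta> \<cdot>\<^bsub>C\<^esub> far R m)"

definition L_map ::
  "('o, 'm) cat \<Rightarrow> ('o, 'm) awfs_data
    \<Rightarrow> ('m \<times> 'm sq, ('m \<times> 'm sq) \<times> ('m \<times> 'm sq) \<times> 'm sq) cat" where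
  "L_map E W = copointed_coalg (arrow_cat E) (L_ftor W) (L_counit E W)"

definition R_Map ::
  "('o, 'm) cat \<Rightarrow> ('o, 'm) awfs_data
    \<Rightarrow> ('m \<times> 'm sq, ('m \<times> 'm sq) \<times> ('m \<times> 'm sq) \<times> 'm sq) cat" where
  "R_Map E W = monad_alg (arrow_cat E) (R_ftor W) (R_unit E W) (mul W)"

definition algebraically_free ::
  "('o, 'm) cat \<Rightarrow> ('o, 'm) awfs_data \<Rightarrow> ('i, 'j) cat \<Rightarrow> ('i, 'j, 'm, 'm sq) ftor \<Rightarrow> bool" where
  "algebraically_free E W I u \<longleftrightarrow> iso_over (R_Map E W) forget (right_maps E I u) forget"

definition cofibrantly_generated_by ::
  "'u rel \<Rightarrow> ('o, 'm) cat \<Rightarrow> ('o, 'm) awfs_data \<Rightarrow> ('i, 'j) cat \<Rightarrow> ('i, 'j, 'm, 'm sq) ftor \<Rightarrow> bool"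
  where
  "cofibrantly_generated_by \<kappa> E W I u \<longleftrightarrow> small_category \<kappa> I \<and> is_functor I (arrow_cat E) u \<and>
     algebraically_free E W I u"

definition cofibrantly_generated :: "'u rel \<Rightarrow> ('o, 'm) cat \<Rightarrow> ('o, 'm) awfs_data \<Rightarrow> bool" where
  "cofibrantly_generated \<kappa> E W \<longleftrightarrow>
     (\<exists>(I :: ('u, 'u) cat) u. cofibrantly_generated_by \<kappa> E W I u)"

section \<open>Suitable algebraic weak factorization systems\<close>

definition initial_ftor :: "('o, 'm) cat \<Rightarrow> ('o, 'm, 'm, 'm sq) ftor" where
  "initial_ftor E = (let z = initial_obj E; init = (\<lambda>x. THE f. f \<in> Hom E z x) in
     \<lparr>fob = init, far = (\<lambda>f. Sq (init (Dom E f)) (init (Cod E f)) (Ide E z) f)\<rparr>)"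

text \<open>The pullback functor \<open>(g, h) \<mapsto> h\<^sup>* g\<close> on pairs of arrows with a common codomain.\<close>

definition pullback_ftor :: "('o, 'm) cat \<Rightarrow> ('m \<times> 'm, 'm sq \<times> 'm sq, 'm, 'm sq) ftor" where
  "pullback_ftor E =
     \<lparr>fob = (\<lambda>(g, h). snd (pb E g h)),
      far = (\<lambda>(q, r). case (q, r) of (Sq g g' a b, Sq h h' c d) \<Rightarrow>
         case pb E g h of (p\<^sub>1, p\<^sub>2) \<Rightarrow>
           Sq p\<^sub>2 (snd (pb E g' h')) (pb_pair E g' h' (a \<cdot>\<^bsub>E\<^esub> p\<^sub>1) (c \<cdot>\<^bsub>E\<^esub> p\<^sub>2)) c)\<rparr>"

definition suitable ::
  "'u rel \<Rightarrow> ('o, 'm) cat \<Rightarrow> ('o, 'm, 'o, 'm) ftor \<Rightarrow> (nat \<Rightarrow> 'o \<Rightarrow> 'm) \<Rightarrow> ('o, 'm) awfs_data \<Rightarrow> bool"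
  where
  "suitable \<kappa> E T \<delta> W \<longleftrightarrow>
     cofibrantly_generated \<kappa> E W \<and>
     factors_through E (initial_ftor E) (L_map E W) forget \<and>
     factors_through
       (fibprod (L_map E W) (cod_ftor E \<circ>\<^sub>F forget) (arrow_cat E) (cod_ftor E))
       (pullback_ftor E \<circ>\<^sub>F prod_ftor forget id_ftor) (L_map E W) forget \<and>
     (\<forall>k \<in> {0, 1}.
        factors_through (L_map E W) (leibniz E T (\<delta> k) \<circ>\<^sub>F forget) (L_map E W) forget)"

section \<open>Uniform fibrations and trivial cofibrations\<close>

definition u_tensor ::
  "('o, 'm) cat \<Rightarrow> ('o, 'm, 'o, 'm) ftor \<Rightarrow> (nat \<Rightarrow> 'o \<Rightarrow> 'm) \<Rightarrow> ('i, 'j, 'm, 'm sq) ftor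
    \<Rightarrow> ('i + 'i, 'j + 'j, 'm, 'm sq) ftor" where
  "u_tensor E T \<delta> u = copair_ftor (leibniz E T (\<delta> 0) \<circ>\<^sub>F u) (leibniz E T (\<delta> 1) \<circ>\<^sub>F u)"

definition Fib where
  "Fib E T \<delta> I u = right_maps E (coprod_cat I I) (u_tensor E T \<delta> u)"

definition TrivCof where
  "TrivCof E T \<delta> I u = left_maps E (Fib E T \<delta> I u) forget"

end

theory Submission
  imports Defs
begin

text \<open>The theorem is Garner's algebraic small object argument
  (\<open>algebraic_small_object_argument\<close>), applied to the functor \<open>u_tensor\<close>: for every functor \<open>v\<close> from a
  small category \<open>J\<close> to the arrows of a locally presentable category \<open>E\<close> there is an awfs whose
  algebras are the right \<open>J\<close>-maps and whose coalgebras are the maps that lift, coherently, against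
  all right \<open>J\<close>-maps. Two things make \<open>u_tensor\<close> such a functor: Leibniz products are functorial
  (\<open>leibniz_functor\<close>), and the coproduct of two small categories is small.

  The awfs is read off from free right maps. A free right map on \<open>f : X \<rightarrow> Y\<close> is a factorization
  \<open>f = r l\<close> with a right map structure on \<open>r : W \<rightarrow> Y\<close> such that every square from \<open>f\<close> to a right map
  extends along \<open>l\<close> to a unique morphism of right maps out of \<open>r\<close>. This makes \<open>f \<mapsto> r\<close> a monad. Since a
  composite of right maps is a right map, the factorization of \<open>f\<close> can be compared with that of
  \<open>l\<close>, and this gives the comultiplication on \<open>f \<mapsto> l\<close>. Every axiom of an awfs equates two maps
  out of a free right map; both sides turn out to be morphisms of right maps with the same
  restriction along \<open>l\<close>, so they agree (\<open>rmor_eqI\<close>, \<open>W_awfs\<close>). A right map structure on \<open>f\<close> amounts to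
  the extension of the identity of \<open>f\<close> to the free right map, which is an algebra structure
  (\<open>right_maps_iso_R_Map\<close>). To lift \<open>f\<close> naturally against all right maps it suffices to lift it
  against its own free right map, which is a coalgebra structure (\<open>left_maps_iso_L_map\<close>).

  Free right maps exist (\<open>free_right_map_exists\<close>) by a transfinite construction. At each stage
  \<open>W\<^sub>b \<rightarrow> Y\<close> fillers for all squares from the generators are adjoined, naturally in the generator, and a
  square that factors through an earlier stage keeps its earlier filler. The stages are indexed
  by a regular cardinal that is so long that the domains of the generators are compact with
  respect to chains of its length (\<open>long_chain_exists\<close>). Hence every square into the colimit \<open>W\<close> comes
  from a stage, and any two stages that it comes from give it the same filler. Maps out of the
  stages are determined one after the other, which yields the universal property.\<close>

section \<open>Small sets\<close>

locale small_universe =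
  fixes \<kappa> :: "'u rel"
  assumes univ: "universe \<kappa>"
begin

lemma card_order: "Card_order \<kappa>"
  and regular: "regularCard \<kappa>"
  and natLeq_less: "natLeq <o \<kappa>"
  using univ unfolding universe_def by auto

lemma Field_ordIso: "|Field \<kappa>| =o \<kappa>"
  using card_order by (rule card_of_Field_ordIso)

lemma infinite_Field: "\<not> finite (Field \<kappa>)"
proof -
  have "natLeq \<le>o |Field \<kappa>|"
    by (rule ordLess_imp_ordLeq[OF ordLess_ordIso_trans[OF natLeq_less ordIso_symmetric[OF Field_ordIso]]])
  thus ?thesis using infinite_iff_natLeq_ordLeq[of "Field \<kappa>"] by blast
qed

lemma small_mono: "A \<subseteq> B \<Longrightarrow> small \<kappa> B \<Longrightarrow> small \<kappa> A"
  unfolding small_def by (rule ordLeq_ordLess_trans[OF card_of_mono1])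

lemma small_image: "small \<kappa> A \<Longrightarrow> small \<kappa> (f ` A)"
  unfolding small_def by (rule ordLeq_ordLess_trans[OF card_of_image])

lemma small_inj: "inj_on f A \<Longrightarrow> f ` A \<subseteq> B \<Longrightarrow> small \<kappa> B \<Longrightarrow> small \<kappa> A"
  unfolding small_def by (meson card_of_ordLeq ordLeq_ordLess_trans)

lemma small_Sigma:
  assumes "small \<kappa> A" "\<And>a. a \<in> A \<Longrightarrow> small \<kappa> (F a)"
  shows "small \<kappa> (SIGMA a:A. F a)"
  using stable_elim[OF regularCard_stable[OF card_order infinite_Field regular]] assms
  unfolding small_def by blast

lemma small_UNION:
  assumes "small \<kappa> A" "\<And>a. a \<in> A \<Longrightarrow> small \<kappa> (F a)"
  shows "small \<kappa> (\<Union>a\<in>A. F a)"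
proof -
  have eq: "(\<Union>a\<in>A. F a) = snd ` (SIGMA a:A. F a)" by force
  show ?thesis unfolding eq by (intro small_image small_Sigma assms)
qed

lemma small_finite: "finite A \<Longrightarrow> small \<kappa> A"
  unfolding small_def finite_iff_ordLess_natLeq by (rule ordLess_transitive[OF _ natLeq_less])

lemma small_Un:
  assumes "small \<kappa> A" "small \<kappa> B"
  shows "small \<kappa> (A \<union> B)"
proof -
  have "small \<kappa> (\<Union>b\<in>{True, False}. if b then A else B)"
    by (rule small_UNION) (simp_all add: small_finite assms)
  thus ?thesis by (simp add: Un_commute)
qed

lemma small_Plus: "small \<kappa> A \<Longrightarrow> small \<kappa> B \<Longrightarrow> small \<kappa> (A <+> B)"
  unfolding Plus_def by (intro small_Un small_image)

text \<open>Every small set has a copy in the type \<open>'u\<close>. This is what allows indices of other types where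
  the definitions quantify over categories on \<open>'u\<close>.\<close>

lemma small_copy:
  assumes "small \<kappa> A"
  obtains f :: "'a \<Rightarrow> 'u" where "inj_on f A"
proof -
  have "|A| \<le>o |Field \<kappa>|"
    using assms unfolding small_def
    by (rule ordLess_imp_ordLeq[OF ordLess_ordIso_trans[OF _ ordIso_symmetric[OF Field_ordIso]]])
  thus ?thesis using that by (metis card_of_ordLeq)
qed

lemma small_Pow:
  assumes "small \<kappa> A"
  shows "small \<kappa> (Pow A)"
proof -
  obtain f :: "'a \<Rightarrow> 'u" where f: "inj_on f A" using small_copy[OF assms] .
  have "small \<kappa> (Pow (f ` A))"
    using univ small_image[OF assms, of f] unfolding universe_def small_def by blast
  moreover have "inj_on (image f) (Pow A)" using f by (rule inj_on_image_Pow)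
  moreover have "image f ` Pow A \<subseteq> Pow (f ` A)" by auto
  ultimately show ?thesis by (meson small_inj)
qed

text \<open>A small infinite set \<open>Q\<close> gives the small regular cardinal \<open>|Q|\<^sup>+\<close>: every family in it
  that is indexed by a subset of \<open>Q\<close> is bounded. Its strict order is the index of the transfinite
  construction below.\<close>

lemma small_regular_order:
  fixes Q :: "'q set"
  assumes Q: "small \<kappa> Q" "infinite Q"
  obtains \<Lambda> :: "'q set set" and R :: "'q set rel"
  where "small \<kappa> \<Lambda>" "\<Lambda> \<noteq> {}" "R \<subseteq> \<Lambda> \<times> \<Lambda>" "wf R" "trans R" "total_on \<Lambda> R"
    "\<And>S. S \<subseteq> \<Lambda> \<Longrightarrow> |S| \<le>o |Q| \<Longrightarrow> \<exists>b\<in>\<Lambda>. \<forall>a\<in>S. (a, b) \<in> R"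
proof (rule that[of "Field (cardSuc |Q| )" "cardSuc |Q| - Id"])
  let ?r = "cardSuc |Q|"
  let ?L = "Field ?r"
  have co: "Card_order ?r" by (rule cardSuc_Card_order[OF card_of_Card_order])
  hence wo: "Well_order ?r" by (rule card_order_on_well_order_on)
  have inf: "infinite ?L" using Q(2) card_of_cardSuc_finite[of Q] by blast
  have reg: "regularCard ?r"
    by (rule infinite_cardSuc_regularCard[OF _ card_of_Card_order]) (simp add: Q Field_card_of)
  have lin: "Linear_order ?r" and wfr: "wf (?r - Id)"
    using wo unfolding well_order_on_def by blast+
  have tr: "trans ?r" and an: "antisym ?r"
    and tot: "total_on ?L ?r" and refl: "refl_on ?L ?r"
    using lin unfolding linear_order_on_def partial_order_on_def preorder_on_def by blast+
  have "?r \<le>o |Pow Q|"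
    by (rule cardSuc_least[OF card_of_Card_order card_of_Card_order card_of_Pow])
  moreover have "|?L| =o ?r" using co by (rule card_of_Field_ordIso)
  ultimately have "|?L| \<le>o |Pow Q|" using ordIso_ordLeq_trans by blast
  thus "small \<kappa> ?L" using small_Pow[OF Q(1)] unfolding small_def
    by (rule ordLeq_ordLess_trans)
  show "?L \<noteq> {}" using inf by auto
  show "?r - Id \<subseteq> ?L \<times> ?L" by (auto simp: Field_def)
  show "wf (?r - Id)" by (fact wfr)
  show "trans (?r - Id)" using tr an by (simp add: trans_diff_Id)
  show "total_on ?L (?r - Id)" using tot by (auto simp: total_on_def)
  fix S assume S: "S \<subseteq> ?L" "|S| \<le>o |Q|"
  have less: "|S| <o ?r" 
    using S(2) cardSuc_ordLeq_ordLess[OF card_of_Card_order card_of_Card_order] by blast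
  hence "\<not> cofinal S ?r"
    using reg S(1) unfolding regularCard_def by (meson not_ordLess_ordIso)
  then obtain a where a: "a \<in> ?L" "\<forall>b\<in>S. \<not> (a \<noteq> b \<and> (a, b) \<in> ?r)"
    unfolding cofinal_def by blast
  have "\<exists>d\<in>?L. a \<noteq> d \<and> (a, d) \<in> ?r"
    by (rule infinite_Card_order_limit[OF co inf a(1)])
  then obtain d where d: "d \<in> ?L" "(a, d) \<in> ?r" "a \<noteq> d" by auto
  show "\<exists>b\<in>?L. \<forall>a\<in>S. (a, b) \<in> ?r - Id"
  proof (intro bexI[of _ d] ballI d(1))
    fix b assume b: "b \<in> S"
    have "(b, a) \<in> ?r"
    proof (cases "a = b")
      case True
      thus ?thesis using refl_onD[OF refl a(1)] by simp
    next
      case False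
      thus ?thesis using tot a b S(1) unfolding total_on_def by blast
    qed
    hence "(b, d) \<in> ?r" "b \<noteq> d" using d transD[OF tr] antisymD[OF an] by blast+
    thus "(b, d) \<in> ?r - Id" by simp
  qed
qed

end

section \<open>Categories and arrow categories\<close>

context category
begin

lemma HomI: "f \<in> Arr C \<Longrightarrow> Dom C f = a \<Longrightarrow> Cod C f = b \<Longrightarrow> f \<in> Hom C a b"
  by (simp add: Hom_def)

lemma HomD:
  assumes "f \<in> Hom C a b"
  shows "f \<in> Arr C" "Dom C f = a" "Cod C f = b" "a \<in> Obj C" "b \<in> Obj C"
  using assms Dom_Obj Cod_Obj by (auto simp: Hom_def)

lemma Arr_Hom: "f \<in> Arr C \<Longrightarrow> f \<in> Hom C (Dom C f) (Cod C f)"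
  by (simp add: Hom_def)

lemma comp_arr [simp]:
  assumes "f \<in> Arr C" "g \<in> Arr C" "Cod C f = Dom C g"
  shows "g \<cdot> f \<in> Arr C" "Dom C (g \<cdot> f) = Dom C f" "Cod C (g \<cdot> f) = Cod C g"
  using Comp_Hom[of f "Dom C f" "Cod C f" g "Cod C g"] assms by (auto simp: Hom_def)

lemma ide_arr [simp]:
  assumes "a \<in> Obj C"
  shows "Ide C a \<in> Arr C" "Dom C (Ide C a) = a" "Cod C (Ide C a) = a"
  using Id_Hom[OF assms] by (auto simp: Hom_def)

lemma comp_ide [simp]: "f \<in> Arr C \<Longrightarrow> Dom C f = a \<Longrightarrow> f \<cdot> Ide C a = f"
  and ide_comp [simp]: "f \<in> Arr C \<Longrightarrow> Cod C f = a \<Longrightarrow> Ide C a \<cdot> f = f"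
  using Comp_Id Id_Comp Arr_Hom by blast+

lemma comp_assoc:
  assumes "f \<in> Arr C" "g \<in> Arr C" "h \<in> Arr C" "Cod C f = Dom C g" "Cod C g = Dom C h"
  shows "(h \<cdot> g) \<cdot> f = h \<cdot> (g \<cdot> f)"
  using Comp_assoc[of f "Dom C f" "Cod C f" g "Cod C g" h "Cod C h"] assms by (auto simp: Hom_def)

lemma Dom_Obj' [simp]: "f \<in> Arr C \<Longrightarrow> Dom C f \<in> Obj C"
  and Cod_Obj' [simp]: "f \<in> Arr C \<Longrightarrow> Cod C f \<in> Obj C"
  by (fact Dom_Obj, fact Cod_Obj)

lemma arrow_cat_simps [simp]:
  "Obj (arrow_cat C) = Arr C" "Dom (arrow_cat C) = sq_dom" "Cod (arrow_cat C) = sq_cod"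
  "Ide (arrow_cat C) f = Sq f f (Ide C (Dom C f)) (Ide C (Cod C f))"
  "q \<cdot>\<^bsub>arrow_cat C\<^esub> p = Sq (sq_dom p) (sq_cod q) (sq_top q \<cdot> sq_top p) (sq_bot q \<cdot> sq_bot p)"
  by (simp_all add: arrow_cat_def)

lemma Sq_Hom_iff:
  "Sq f' g' s t \<in> Hom (arrow_cat C) f g \<longleftrightarrow> f' = f \<and> g' = g \<and> f \<in> Arr C \<and> g \<in> Arr C \<and>
     s \<in> Hom C (Dom C f) (Dom C g) \<and> t \<in> Hom C (Cod C f) (Cod C g) \<and> g \<cdot> s = t \<cdot> f"
  by (auto simp: arrow_cat_def Hom_def)

lemma Sq_HomE:
  assumes "q \<in> Hom (arrow_cat C) f g"
  obtains s t where "q = Sq f g s t" "f \<in> Arr C" "g \<in> Arr C" "s \<in> Hom C (Dom C f) (Dom C g)"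
    "t \<in> Hom C (Cod C f) (Cod C g)" "g \<cdot> s = t \<cdot> f"
  using assms by (cases q) (auto simp: Sq_Hom_iff)

lemma HomA_D:
  assumes "q \<in> Hom (arrow_cat C) f g"
  shows "sq_dom q = f" "sq_cod q = g" "f \<in> Arr C" "g \<in> Arr C"
    "sq_top q \<in> Arr C" "Dom C (sq_top q) = Dom C f" "Cod C (sq_top q) = Dom C g"
    "sq_bot q \<in> Arr C" "Dom C (sq_bot q) = Cod C f" "Cod C (sq_bot q) = Cod C g"
    "g \<cdot> sq_top q = sq_bot q \<cdot> f"
proof -
  obtain s t where "q = Sq f g s t" "f \<in> Arr C" "g \<in> Arr C" "s \<in> Hom C (Dom C f) (Dom C g)"
    "t \<in> Hom C (Cod C f) (Cod C g)" "g \<cdot> s = t \<cdot> f"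
    using Sq_HomE[OF assms] .
  thus "sq_dom q = f" "sq_cod q = g" "f \<in> Arr C" "g \<in> Arr C"
    "sq_top q \<in> Arr C" "Dom C (sq_top q) = Dom C f" "Cod C (sq_top q) = Dom C g"
    "sq_bot q \<in> Arr C" "Dom C (sq_bot q) = Cod C f" "Cod C (sq_bot q) = Cod C g"
    "g \<cdot> sq_top q = sq_bot q \<cdot> f"
    by (simp_all add: Hom_def)
qed

lemma pasting:
  assumes "q \<in> Hom (arrow_cat C) f g" "r \<in> Hom (arrow_cat C) g h"
  shows "h \<cdot> (sq_top r \<cdot> sq_top q) = (sq_bot r \<cdot> sq_bot q) \<cdot> f"
proof -
  note q = HomA_D[OF assms(1)] and r = HomA_D[OF assms(2)]
  have "h \<cdot> (sq_top r \<cdot> sq_top q) = (h \<cdot> sq_top r) \<cdot> sq_top q"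
    using q(1-10) r(1-10) by (simp add: comp_assoc)
  also have "\<dots> = sq_bot r \<cdot> (g \<cdot> sq_top q)" unfolding r(11) using q(1-10) r(1-10) by (simp add: comp_assoc)
  also have "\<dots> = (sq_bot r \<cdot> sq_bot q) \<cdot> f" unfolding q(11) using q(1-10) r(1-10) by (simp add: comp_assoc)
  finally show ?thesis .
qed

lemma arrow_category: "category (arrow_cat C)"
proof
  fix q assume "q \<in> Arr (arrow_cat C)"
  thus "Dom (arrow_cat C) q \<in> Obj (arrow_cat C)" "Cod (arrow_cat C) q \<in> Obj (arrow_cat C)"
    by (auto simp: arrow_cat_def)
next
  fix f assume "f \<in> Obj (arrow_cat C)"
  thus "Ide (arrow_cat C) f \<in> Hom (arrow_cat C) f f" by (simp add: Sq_Hom_iff Id_Hom)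
next
  fix f g h q r
  assume a: "q \<in> Hom (arrow_cat C) f g" "r \<in> Hom (arrow_cat C) g h"
  show "r \<cdot>\<^bsub>arrow_cat C\<^esub> q \<in> Hom (arrow_cat C) f h"
    using HomA_D[OF a(1)] HomA_D[OF a(2)] pasting[OF a] by (simp add: Sq_Hom_iff HomI)
next
  fix f g q
  assume a: "q \<in> Hom (arrow_cat C) f g"
  show "q \<cdot>\<^bsub>arrow_cat C\<^esub> Ide (arrow_cat C) f = q" "Ide (arrow_cat C) g \<cdot>\<^bsub>arrow_cat C\<^esub> q = q"
    using HomA_D[OF a] by (cases q; simp)+
next
  fix f g h k q r p
  assume a: "q \<in> Hom (arrow_cat C) f g" "r \<in> Hom (arrow_cat C) g h" "p \<in> Hom (arrow_cat C) h k"
  show "p \<cdot>\<^bsub>arrow_cat C\<^esub> r \<cdot>\<^bsub>arrow_cat C\<^esub> q = p \<cdot>\<^bsub>arrow_cat C\<^esub> (r \<cdot>\<^bsub>arrow_cat C\<^esub> q)"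
    using HomA_D[OF a(1)] HomA_D[OF a(2)] HomA_D[OF a(3)] by (simp add: comp_assoc)
qed

end

lemma functorD:
  assumes "is_functor C D F"
  shows "a \<in> Obj C \<Longrightarrow> fob F a \<in> Obj D"
    "f \<in> Hom C a b \<Longrightarrow> far F f \<in> Hom D (fob F a) (fob F b)"
    "a \<in> Obj C \<Longrightarrow> far F (Ide C a) = Ide D (fob F a)"
    "f \<in> Hom C a b \<Longrightarrow> g \<in> Hom C b c \<Longrightarrow> far F (g \<cdot>\<^bsub>C\<^esub> f) = far F g \<cdot>\<^bsub>D\<^esub> far F f"
  using assms unfolding is_functor_def by blast+

lemma comp_ftor_simps [simp]:
  "fob (G \<circ>\<^sub>F F) x = fob G (fob F x)" "far (G \<circ>\<^sub>F F) f = far G (far F f)"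
  "fob id_ftor y = y" "far id_ftor g = g"
  by (simp_all add: comp_ftor_def id_ftor_def)

lemma is_functor_comp:
  "is_functor C D F \<Longrightarrow> is_functor D B G \<Longrightarrow> is_functor C B (G \<circ>\<^sub>F F)"
  unfolding is_functor_def comp_ftor_simps by (metis (no_types, lifting))

section \<open>Colimits indexed by small categories of any type\<close>

text \<open>Cocompleteness and presentability are stated for index categories on the type \<open>'u\<close>. They are
  moved to index categories of other types along isomorphisms.\<close>

definition cat_iso ::
  "('a, 'b) cat \<Rightarrow> ('c, 'd) cat \<Rightarrow> ('a, 'b, 'c, 'd) ftor \<Rightarrow> ('c, 'd, 'a, 'b) ftor \<Rightarrow> bool" where
  "cat_iso J K P Q \<longleftrightarrow> category J \<and> category K \<and> is_functor J K P \<and> is_functor K J Q \<and>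
     ftor_eq J (Q \<circ>\<^sub>F P) id_ftor \<and> ftor_eq K (P \<circ>\<^sub>F Q) id_ftor"

lemma cat_iso_sym: "cat_iso J K P Q \<Longrightarrow> cat_iso K J Q P"
  by (simp add: cat_iso_def)

lemma cat_isoD:
  assumes "cat_iso J K P Q"
  shows "category J" "category K" "is_functor J K P" "is_functor K J Q"
    "x \<in> Obj J \<Longrightarrow> fob Q (fob P x) = x" "f \<in> Arr J \<Longrightarrow> far Q (far P f) = f"
    "y \<in> Obj K \<Longrightarrow> fob P (fob Q y) = y" "g \<in> Arr K \<Longrightarrow> far P (far Q g) = g"
  using assms by (auto simp: cat_iso_def ftor_eq_def)

lemma (in small_universe) small_category_copy:
  fixes J :: "('a, 'b) cat"
  assumes "small_category \<kappa> J"
  obtains K :: "('u, 'u) cat" and P Q where "small_category \<kappa> K" "cat_iso J K P Q"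
proof -
  interpret J: category J using assms by (simp add: small_category_def)
  have sm: "small \<kappa> (Obj J)" "small \<kappa> (Arr J)" using assms by (auto simp: small_category_def)
  obtain a :: "'a \<Rightarrow> 'u" where a: "inj_on a (Obj J)" using small_copy[OF sm(1)] .
  obtain b :: "'b \<Rightarrow> 'u" where b: "inj_on b (Arr J)" using small_copy[OF sm(2)] .
  define a' b' where "a' = the_inv_into (Obj J) a" and "b' = the_inv_into (Arr J) b"
  have a': "\<And>x. x \<in> Obj J \<Longrightarrow> a' (a x) = x" and b': "\<And>f. f \<in> Arr J \<Longrightarrow> b' (b f) = f"
    using a b by (simp_all add: a'_def b'_def the_inv_into_f_f)
  have aeq: "\<And>x y. x \<in> Obj J \<Longrightarrow> y \<in> Obj J \<Longrightarrow> a x = a y \<longleftrightarrow> x = y"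
    using a by (auto dest: inj_onD)
  define K :: "('u, 'u) cat" where "K =
    \<lparr>Obj = a ` Obj J, Arr = b ` Arr J, Dom = \<lambda>g. a (Dom J (b' g)), Cod = \<lambda>g. a (Cod J (b' g)),
     Ide = \<lambda>x. b (Ide J (a' x)), Comp = \<lambda>g f. b (b' g \<cdot>\<^bsub>J\<^esub> b' f)\<rparr>"
  have K: "Obj K = a ` Obj J" "Arr K = b ` Arr J" "\<And>g. Dom K g = a (Dom J (b' g))"
    "\<And>g. Cod K g = a (Cod J (b' g))" "\<And>x. Ide K x = b (Ide J (a' x))"
    "\<And>g f. g \<cdot>\<^bsub>K\<^esub> f = b (b' g \<cdot>\<^bsub>J\<^esub> b' f)"
    by (simp_all add: K_def)
  have cat: "category K"
    by unfold_locales (auto simp: K Hom_def a' b' aeq J.comp_assoc)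
  define P where "P = \<lparr>fob = a, far = b\<rparr>"
  define Q where "Q = \<lparr>fob = a', far = b'\<rparr>"
  have "is_functor J K P" "is_functor K J Q"
    by (auto simp: is_functor_def P_def Q_def K Hom_def a' b' aeq)
  moreover have "ftor_eq J (Q \<circ>\<^sub>F P) id_ftor" "ftor_eq K (P \<circ>\<^sub>F Q) id_ftor"
    by (auto simp: ftor_eq_def P_def Q_def K a' b')
  moreover have "small_category \<kappa> K"
    using cat sm by (simp add: small_category_def K small_image)
  ultimately show ?thesis using that cat J.category_axioms by (auto simp: cat_iso_def)
qed

lemma is_cocone_transport:
  assumes "cat_iso J K P Q" "is_cocone J C D c \<iota>"
  shows "is_cocone K C (D \<circ>\<^sub>F Q) c (\<lambda>k. \<iota> (fob Q k))"
  using assms(2) functorD[OF cat_isoD(4)[OF assms(1)]]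
  unfolding is_cocone_def by simp

lemma is_colimit_transport:
  assumes iso: "cat_iso J K P Q" and col: "is_colimit J C D c \<iota>"
  shows "is_colimit K C (D \<circ>\<^sub>F Q) c (\<lambda>k. \<iota> (fob Q k))"
  unfolding is_colimit_def
proof (intro conjI allI impI)
  note i = cat_isoD[OF iso]
  interpret J: category J by (fact i)
  show "is_cocone K C (D \<circ>\<^sub>F Q) c (\<lambda>k. \<iota> (fob Q k))"
    by (rule is_cocone_transport[OF iso]) (use col in \<open>simp add: is_colimit_def\<close>)
  fix x \<xi> assume x: "is_cocone K C (D \<circ>\<^sub>F Q) x \<xi>"
  have "is_cocone J C (D \<circ>\<^sub>F Q \<circ>\<^sub>F P) x (\<lambda>j. \<xi> (fob P j))"
    by (rule is_cocone_transport[OF cat_iso_sym[OF iso] x])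
  hence "is_cocone J C D x (\<lambda>j. \<xi> (fob P j))"
    using i(5,6) by (auto simp: is_cocone_def J.HomD)
  hence "\<exists>!h. h \<in> Hom C c x \<and> (\<forall>j\<in>Obj J. h \<cdot>\<^bsub>C\<^esub> \<iota> j = \<xi> (fob P j))"
    using col unfolding is_colimit_def by blast
  moreover have "(\<forall>j\<in>Obj J. h \<cdot>\<^bsub>C\<^esub> \<iota> j = \<xi> (fob P j)) \<longleftrightarrow>
      (\<forall>k\<in>Obj K. h \<cdot>\<^bsub>C\<^esub> \<iota> (fob Q k) = \<xi> k)" for h
    using i(5,7) functorD(1)[OF i(3)] functorD(1)[OF i(4)] by metis
  ultimately show "\<exists>!h. h \<in> Hom C c x \<and> (\<forall>k\<in>Obj K. h \<cdot>\<^bsub>C\<^esub> \<iota> (fob Q k) = \<xi> k)"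
    by simp
qed

lemma (in small_universe) cocomplete_any_index:
  assumes "cocomplete \<kappa> C" "small_category \<kappa> J" "is_functor J C D"
  shows "\<exists>c \<iota>. is_colimit J C D c \<iota>"
proof -
  obtain K :: "('u, 'u) cat" and P Q where K: "small_category \<kappa> K" "cat_iso J K P Q"
    using small_category_copy[OF assms(2)] .
  note i = cat_isoD[OF K(2)]
  interpret J: category J by (fact i)
  have "is_functor K C (D \<circ>\<^sub>F Q)" by (rule is_functor_comp[OF i(4) assms(3)])
  then obtain c \<iota> where "is_colimit K C (D \<circ>\<^sub>F Q) c \<iota>"
    using assms(1) K(1) unfolding cocomplete_def by blast
  hence "is_colimit J C (D \<circ>\<^sub>F Q \<circ>\<^sub>F P) c (\<lambda>j. \<iota> (fob P j))"
    by (rule is_colimit_transport[OF cat_iso_sym[OF K(2)]])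
  hence "is_colimit J C D c (\<lambda>j. \<iota> (fob P j))"
    using i(5,6) by (simp add: is_colimit_def is_cocone_def J.HomD cong: conj_cong ball_cong)
  thus ?thesis by blast
qed

text \<open>The constructions below ask for a universal object with maps from a family of objects, subject to
  equations \<open>z\<^sub>x a = z\<^sub>y b\<close> between composites out of test objects; pushouts are an example. Such
  a presentation is a diagram with one node for each object, one for each equation, and two
  arrows out of each equation.\<close>

definition glue_cocone ::
  "('o, 'm) cat \<Rightarrow> 'n set \<Rightarrow> ('n \<Rightarrow> 'o) \<Rightarrow> ('n \<times> 'm \<times> 'n \<times> 'm) set \<Rightarrow> 'o \<Rightarrow> ('n \<Rightarrow> 'm) \<Rightarrow> bool" where
  "glue_cocone C N ob R Z z \<longleftrightarrow> Z \<in> Obj C \<and> (\<forall>n\<in>N. z n \<in> Hom C (ob n) Z) \<and>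
     (\<forall>x a y b. (x, a, y, b) \<in> R \<longrightarrow> z x \<cdot>\<^bsub>C\<^esub> a = z y \<cdot>\<^bsub>C\<^esub> b)"

datatype ('n, 'r) glue_arr = GId "'n + 'r" | GLeft 'r | GRight 'r

definition glue_cat ::
  "'n set \<Rightarrow> ('n \<times> 'm \<times> 'n \<times> 'm) set
    \<Rightarrow> ('n + 'n \<times> 'm \<times> 'n \<times> 'm, ('n, 'n \<times> 'm \<times> 'n \<times> 'm) glue_arr) cat" where
  "glue_cat N R =
     \<lparr>Obj = N <+> R, Arr = GId ` (N <+> R) \<union> GLeft ` R \<union> GRight ` R,
      Dom = (\<lambda>f. case f of GId v \<Rightarrow> v | GLeft r \<Rightarrow> Inr r | GRight r \<Rightarrow> Inr r),
      Cod = (\<lambda>f. case f of GId v \<Rightarrow> v | GLeft (x, a, y, b) \<Rightarrow> Inl x | GRight (x, a, y, b) \<Rightarrow> Inl y),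
      Ide = GId,
      Comp = (\<lambda>g f. case f of GId v \<Rightarrow> g | _ \<Rightarrow> f)\<rparr>"

lemma glue_category:
  assumes "\<And>x a y b. (x, a, y, b) \<in> R \<Longrightarrow> x \<in> N \<and> y \<in> N"
  shows "category (glue_cat N R)"
  by unfold_locales
    (use assms in \<open>auto simp: glue_cat_def Hom_def split: glue_arr.splits\<close>)

theorem (in small_universe) glue_colimit:
  fixes C :: "('b, 'c) cat" (structure) and ob :: "'a \<Rightarrow> 'b"
  assumes C: "category C" "cocomplete \<kappa> C" "locally_small \<kappa> C"
    and N: "small \<kappa> N" "\<And>n. n \<in> N \<Longrightarrow> ob n \<in> Obj C"
    and T: "small \<kappa> T" "T \<subseteq> Obj C"
    and R: "\<And>x a y b. (x, a, y, b) \<in> R \<Longrightarrow>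
              x \<in> N \<and> y \<in> N \<and> (\<exists>d\<in>T. a \<in> Hom C d (ob x) \<and> b \<in> Hom C d (ob y))"
  shows "\<exists>Z z. glue_cocone C N ob R Z z \<and> (\<forall>Z' z'. glue_cocone C N ob R Z' z' \<longrightarrow>
           (\<exists>!k. k \<in> Hom C Z Z' \<and> (\<forall>n\<in>N. k \<cdot>\<^bsub>C\<^esub> z n = z' n)))"
proof -
  interpret category C by fact
  let ?J = "glue_cat N R"
  define D :: "('a + 'a \<times> 'c \<times> 'a \<times> 'c, ('a, 'a \<times> 'c \<times> 'a \<times> 'c) glue_arr, 'b, 'c) ftor"
    where "D = \<lparr>fob = case_sum ob (\<lambda>(x, a, y, b). Dom C a),
    far = (\<lambda>f. case f of GId v \<Rightarrow> Ide C (case_sum ob (\<lambda>(x, a, y, b). Dom C a) v)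
                | GLeft (x, a, y, b) \<Rightarrow> a | GRight (x, a, y, b) \<Rightarrow> b)\<rparr>"
  have J: "category ?J" by (rule glue_category) (use R in blast)
  have "small \<kappa> (SIGMA x:N. SIGMA y:N. SIGMA d:T. Hom C d (ob x) \<times> Hom C d (ob y))" (is "small \<kappa> ?S")
    using C(3) N T by (intro small_Sigma) (auto simp: locally_small_def)
  hence "small \<kappa> ((\<lambda>(x, y, d, a, b). (x, a, y, b)) ` ?S)" by (rule small_image)
  moreover have "R \<subseteq> (\<lambda>(x, y, d, a, b). (x, a, y, b)) ` ?S" using R by (force simp: image_iff)
  ultimately have smR: "small \<kappa> R" by (rule small_mono[rotated])
  have smJ: "small_category \<kappa> ?J"
    unfolding small_category_def using J
    by (simp add: glue_cat_def small_Plus small_Un small_image N smR)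
  have D: "is_functor ?J C D"
    unfolding is_functor_def
    using R N(2) by (fastforce simp: D_def glue_cat_def Hom_def split: glue_arr.splits)
  obtain Z \<zeta> where Z: "is_colimit ?J C D Z \<zeta>"
    using cocomplete_any_index[OF C(2) smJ D] by blast
  have legs: "glue_cocone C N ob R Z' (\<lambda>n. \<xi> (Inl n))
      \<and> (\<forall>x a y b. (x, a, y, b) \<in> R \<longrightarrow> \<xi> (Inr (x, a, y, b)) = \<xi> (Inl x) \<cdot>\<^bsub>C\<^esub> a)"
    if c: "is_cocone ?J C D Z' \<xi>" for Z' \<xi>
  proof -
    have l: "\<xi> (Inl x) \<cdot>\<^bsub>C\<^esub> a = \<xi> (Inr (x, a, y, b))" "\<xi> (Inl y) \<cdot>\<^bsub>C\<^esub> b = \<xi> (Inr (x, a, y, b))"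
      if r: "(x, a, y, b) \<in> R" for x a y b
    proof -
      have "GLeft (x, a, y, b) \<in> Hom ?J (Inr (x, a, y, b)) (Inl x)"
        "GRight (x, a, y, b) \<in> Hom ?J (Inr (x, a, y, b)) (Inl y)"
        using r by (auto simp: glue_cat_def Hom_def)
      thus "\<xi> (Inl x) \<cdot>\<^bsub>C\<^esub> a = \<xi> (Inr (x, a, y, b))" "\<xi> (Inl y) \<cdot>\<^bsub>C\<^esub> b = \<xi> (Inr (x, a, y, b))"
        using c unfolding is_cocone_def by (fastforce simp: D_def)+
    qed
    moreover have "\<xi> (Inl n) \<in> Hom C (ob n) Z'" if "n \<in> N" for n
    proof -
      have "Inl n \<in> Obj ?J" using that by (auto simp: glue_cat_def)
      hence "\<xi> (Inl n) \<in> Hom C (fob D (Inl n)) Z'" using c unfolding is_cocone_def by blast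
      thus ?thesis by (simp add: D_def)
    qed
    ultimately show ?thesis using c by (auto simp: glue_cocone_def is_cocone_def)
  qed
  have ofglue: "is_cocone ?J C D Z' (case_sum z (\<lambda>(x, a, y, b). z x \<cdot>\<^bsub>C\<^esub> a))"
    if c: "glue_cocone C N ob R Z' z" for Z' z
  proof -
    let ?\<xi> = "case_sum z (\<lambda>(x, a, y, b). z x \<cdot>\<^bsub>C\<^esub> a)"
    have zn: "z n \<in> Hom C (ob n) Z'" if "n \<in> N" for n
      using c that unfolding glue_cocone_def by blast
    have eq: "z x \<cdot>\<^bsub>C\<^esub> a = z y \<cdot>\<^bsub>C\<^esub> b" if "(x, a, y, b) \<in> R" for x a y b
      using c that unfolding glue_cocone_def by blast
    have \<xi>: "?\<xi> j \<in> Hom C (fob D j) Z'" if j: "j \<in> Obj ?J" for j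
    proof (cases j)
      case (Inl n)
      thus ?thesis using j zn by (auto simp: glue_cat_def D_def)
    next
      case (Inr r)
      obtain x a y b where r: "r = (x, a, y, b)" by (cases r)
      have r': "(x, a, y, b) \<in> R" using j Inr r by (auto simp: glue_cat_def)
      have "a \<in> Hom C (Dom C a) (ob x)" using R[OF r'] by (auto simp: Hom_def)
      thus ?thesis using Comp_Hom[OF _ zn] R[OF r'] by (simp add: D_def Inr r)
    qed
    show ?thesis unfolding is_cocone_def
    proof (intro conjI ballI allI)
      show "Z' \<in> Obj C" using c by (simp add: glue_cocone_def)
      show "?\<xi> j \<in> Hom C (fob D j) Z'" if "j \<in> Obj ?J" for j by (rule \<xi>[OF that])
      fix j k f assume f: "f \<in> Hom ?J j k"
      show "?\<xi> k \<cdot>\<^bsub>C\<^esub> far D f = ?\<xi> j"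
      proof (cases f)
        case (GId v)
        hence v: "j = v" "k = v" "v \<in> Obj ?J" using f by (auto simp: glue_cat_def Hom_def)
        have "far D f = Ide C (fob D v)" by (simp add: D_def GId)
        thus ?thesis using Comp_Id[OF \<xi>[OF v(3)]] v by simp
      next
        case (GLeft r)
        obtain x a y b where "r = (x, a, y, b)" by (cases r)
        thus ?thesis using f GLeft by (auto simp: glue_cat_def Hom_def D_def)
      next
        case (GRight r)
        obtain x a y b where r: "r = (x, a, y, b)" by (cases r)
        hence "(x, a, y, b) \<in> R" using f GRight by (auto simp: glue_cat_def Hom_def)
        thus ?thesis using f GRight r eq by (auto simp: glue_cat_def Hom_def D_def)
      qed
    qed
  qed
  show ?thesis
  proof (intro exI conjI allI impI)
    have cZ: "is_cocone ?J C D Z \<zeta>" using Z by (simp add: is_colimit_def)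
    show gZ: "glue_cocone C N ob R Z (\<lambda>n. \<zeta> (Inl n))" using legs[OF cZ] by blast
    fix Z' z' assume g: "glue_cocone C N ob R Z' z'"
    have "\<exists>!h. h \<in> Hom C Z Z' \<and>
        (\<forall>j\<in>Obj ?J. h \<cdot>\<^bsub>C\<^esub> \<zeta> j = (case_sum z' (\<lambda>(x, a, y, b). z' x \<cdot>\<^bsub>C\<^esub> a)) j)"
      using Z ofglue[OF g] unfolding is_colimit_def by blast
    moreover have "(\<forall>j\<in>Obj ?J. h \<cdot>\<^bsub>C\<^esub> \<zeta> j = (case_sum z' (\<lambda>(x, a, y, b). z' x \<cdot>\<^bsub>C\<^esub> a)) j)
        \<longleftrightarrow> (\<forall>n\<in>N. h \<cdot>\<^bsub>C\<^esub> \<zeta> (Inl n) = z' n)" if h: "h \<in> Hom C Z Z'" for h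
    proof (intro iffI ballI)
      fix j assume n: "\<forall>n\<in>N. h \<cdot>\<^bsub>C\<^esub> \<zeta> (Inl n) = z' n" and j: "j \<in> Obj ?J"
      show "h \<cdot>\<^bsub>C\<^esub> \<zeta> j = (case_sum z' (\<lambda>(x, a, y, b). z' x \<cdot>\<^bsub>C\<^esub> a)) j"
      proof (cases j)
        case (Inl x)
        thus ?thesis using n j by (auto simp: glue_cat_def)
      next
        case (Inr r)
        obtain x a y b where r: "r = (x, a, y, b)" by (cases r)
        have r': "(x, a, y, b) \<in> R" using j Inr r by (auto simp: glue_cat_def)
        have zx: "\<zeta> (Inl x) \<in> Hom C (ob x) Z" using gZ R[OF r'] unfolding glue_cocone_def by blast
        have ax: "a \<in> Hom C (Dom C a) (ob x)" using R[OF r'] by (auto simp: Hom_def)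
        have "h \<cdot> \<zeta> j = h \<cdot> (\<zeta> (Inl x) \<cdot> a)" using legs[OF cZ] r' Inr r by simp
        also have "\<dots> = (h \<cdot> \<zeta> (Inl x)) \<cdot> a" using Comp_assoc[OF ax zx h] by simp
        also have "\<dots> = z' x \<cdot> a" using n R[OF r'] by simp
        finally show ?thesis using Inr r by simp
      qed
    next
      fix n assume j: "\<forall>j\<in>Obj ?J. h \<cdot>\<^bsub>C\<^esub> \<zeta> j = (case_sum z' (\<lambda>(x, a, y, b). z' x \<cdot>\<^bsub>C\<^esub> a)) j"
        and n: "n \<in> N"
      have "Inl n \<in> Obj ?J" using n by (auto simp: glue_cat_def)
      thus "h \<cdot> \<zeta> (Inl n) = z' n" using bspec[OF j] by fastforce
    qed
    ultimately show "\<exists>!k. k \<in> Hom C Z Z' \<and> (\<forall>n\<in>N. k \<cdot>\<^bsub>C\<^esub> \<zeta> (Inl n) = z' n)"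
      by (smt (verit, best))
  qed
qed

section \<open>Objects that are small with respect to long chains\<close>

text \<open>The elementary form of the statement that \<open>Hom(a, -)\<close> preserves colimits of shape \<open>J\<close>, for
  \<open>J\<close> directed.\<close>

definition compact_for :: "('i, 'j) cat \<Rightarrow> ('o, 'm) cat \<Rightarrow> 'o \<Rightarrow> bool" where
  "compact_for J C a \<longleftrightarrow> (\<forall>D c \<iota>. is_functor J C D \<and> is_colimit J C D c \<iota> \<longrightarrow>
     (\<forall>x \<in> Hom C a c. \<exists>j \<in> Obj J. \<exists>y \<in> Hom C a (fob D j). x = \<iota> j \<cdot>\<^bsub>C\<^esub> y) \<and>
     (\<forall>j \<in> Obj J. \<forall>y \<in> Hom C a (fob D j). \<forall>y' \<in> Hom C a (fob D j).
        \<iota> j \<cdot>\<^bsub>C\<^esub> y = \<iota> j \<cdot>\<^bsub>C\<^esub> y' \<longrightarrow> (\<exists>k. \<exists>f \<in> Hom J j k. far D f \<cdot>\<^bsub>C\<^esub> y = far D f \<cdot>\<^bsub>C\<^esub> y')))"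

text \<open>Both halves are tested against cocones of functions into a two-element set. Uniqueness of the
  induced function shows that the maps induced by the legs are jointly onto. Its existence for the
  characteristic functions of the elements that eventually agree with \<open>y\<close> shows that elements
  identified in the colimit are identified at some stage.\<close>

lemma (in small_universe) presentable_compact_for:
  fixes J :: "('u, 'u) cat" and C :: "('o, 'm) cat" (structure)
  assumes C: "category C" and \<mu>: "Card_order \<mu>" "natLeq \<le>o \<mu>"
    and a: "presentable \<kappa> \<mu> C a" and J: "directed_poset \<kappa> \<mu> J"
  shows "compact_for J C a"
  unfolding compact_for_def
proof (intro allI impI)
  fix D c \<iota> assume D: "is_functor J C D \<and> is_colimit J C D c \<iota>"
  interpret category C by fact
  interpret J: category J using J by (simp add: directed_poset_def small_category_def)
  have DJ: "is_functor J C D" and col: "is_colimit J C D c \<iota>" using D by auto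
  hence coc: "is_cocone J C D c \<iota>" by (simp add: is_colimit_def)
  have \<iota>: "\<iota> j \<in> Hom C (fob D j) c" if "j \<in> Obj J" for j
    using coc that by (simp add: is_cocone_def)
  have \<iota>_comp: "\<iota> k \<cdot> (far D f \<cdot> x) = \<iota> j \<cdot> x"
    if f: "f \<in> Hom J j k" and x: "x \<in> Hom C a (fob D j)" for f j k x
  proof -
    have "\<iota> k \<cdot> (far D f \<cdot> x) = (\<iota> k \<cdot> far D f) \<cdot> x"
      using Comp_assoc[OF x functorD(2)[OF DJ f] \<iota>] J.HomD[OF f] by simp
    thus ?thesis using coc f by (simp add: is_cocone_def)
  qed
  have par: "f = g" if "f \<in> Hom J j k" "g \<in> Hom J j k" for f g j k
    using J that by (auto simp: directed_poset_def)
  have ub: "\<exists>l\<in>Obj J. \<exists>f\<in>Hom J j l. \<exists>g\<in>Hom J k l. True" if "j \<in> Obj J" "k \<in> Obj J" for j k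
  proof -
    have "finite {j, k}" by simp
    hence "|{j, k}| <o \<mu>" using \<mu>(2) finite_iff_ordLess_natLeq ordLess_ordLeq_trans by blast
    hence "\<exists>l\<in>Obj J. \<forall>i\<in>{j, k}. Hom J i l \<noteq> {}"
      using J that unfolding directed_poset_def by (elim conjE allE[where x = "{j, k}"]) simp
    thus ?thesis by auto
  qed
  have "\<exists>e0 e1 :: 'u. e0 \<noteq> e1"
  proof (rule ccontr)
    assume "\<not> ?thesis"
    hence "Field \<kappa> \<subseteq> {undefined}" by blast
    thus False using infinite_Field finite_subset by blast
  qed
  then obtain e0 e1 :: 'u where e: "e0 \<noteq> e1" by blast
  let ?S = "{e0, e1}"
  have S: "small \<kappa> ?S" by (simp add: small_finite)
  have H: "\<exists>!g. g \<in> Hom C a c \<rightarrow>\<^sub>E ?S \<and> (\<forall>j\<in>Obj J. \<forall>x\<in>Hom C a (fob D j). g (\<iota> j \<cdot> x) = h j x)"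
    if "\<And>j x. j \<in> Obj J \<Longrightarrow> x \<in> Hom C a (fob D j) \<Longrightarrow> h j x \<in> ?S"
      "\<And>j k f x. f \<in> Hom J j k \<Longrightarrow> x \<in> Hom C a (fob D j) \<Longrightarrow> h k (far D f \<cdot> x) = h j x" for h
  proof -
    have "hom_sends_to_colimit \<kappa> J C a D c \<iota>"
      using a J DJ col unfolding presentable_def by blast
    moreover have "\<forall>j\<in>Obj J. h j \<in> Hom C a (fob D j) \<rightarrow> ?S" using that(1) by blast
    moreover have "\<forall>j k. \<forall>f\<in>Hom J j k. \<forall>x\<in>Hom C a (fob D j). h k (far D f \<cdot> x) = h j x"
      using that(2) by blast
    ultimately show ?thesis unfolding hom_sends_to_colimit_def using S
      by (elim allE[where x = ?S] allE[where x = h]) blast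
  qed
  have cx: "\<iota> j \<cdot> x \<in> Hom C a c" if "j \<in> Obj J" "x \<in> Hom C a (fob D j)" for j x
    using Comp_Hom[OF that(2) \<iota>[OF that(1)]] .
  show "(\<forall>x \<in> Hom C a c. \<exists>j \<in> Obj J. \<exists>y \<in> Hom C a (fob D j). x = \<iota> j \<cdot> y) \<and>
     (\<forall>j \<in> Obj J. \<forall>y \<in> Hom C a (fob D j). \<forall>y' \<in> Hom C a (fob D j).
        \<iota> j \<cdot> y = \<iota> j \<cdot> y' \<longrightarrow> (\<exists>k. \<exists>f \<in> Hom J j k. far D f \<cdot> y = far D f \<cdot> y'))"
  proof (intro conjI ballI impI)
    fix x assume x: "x \<in> Hom C a c"
    let ?P = "\<lambda>x. \<exists>j \<in> Obj J. \<exists>y \<in> Hom C a (fob D j). x = \<iota> j \<cdot> y"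
    \<comment> \<open>Both functions are constant on the image of the legs, so they coincide.\<close>
    define g1 where "g1 = restrict (\<lambda>x. e0) (Hom C a c)"
    define g2 where "g2 = restrict (\<lambda>x. if ?P x then e0 else e1) (Hom C a c)"
    have "g1 \<in> Hom C a c \<rightarrow>\<^sub>E ?S \<and> (\<forall>j\<in>Obj J. \<forall>x\<in>Hom C a (fob D j). g1 (\<iota> j \<cdot> x) = e0)"
      "g2 \<in> Hom C a c \<rightarrow>\<^sub>E ?S \<and> (\<forall>j\<in>Obj J. \<forall>x\<in>Hom C a (fob D j). g2 (\<iota> j \<cdot> x) = e0)"
      using cx by (auto simp: g1_def g2_def)
    hence "g1 = g2" using H[of "\<lambda>_ _. e0"] by blast
    hence "g1 x = g2 x" by simp
    thus "?P x" using x e by (auto simp: g1_def g2_def split: if_splits)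
  next
    fix j y y' assume j: "j \<in> Obj J" and y: "y \<in> Hom C a (fob D j)" "y' \<in> Hom C a (fob D j)"
      and eq: "\<iota> j \<cdot> y = \<iota> j \<cdot> y'"
    let ?P = "\<lambda>k x. \<exists>l. \<exists>f\<in>Hom J j l. \<exists>g\<in>Hom J k l. far D f \<cdot> y = far D g \<cdot> x"
    define h where "h = (\<lambda>k x. if ?P k x then e0 else e1)"
    have "h k (far D f \<cdot> x) = h i x" if f: "f \<in> Hom J i k" and x: "x \<in> Hom C a (fob D i)" for i k f x
    proof -
      have Df: "far D f \<in> Hom C (fob D i) (fob D k)" by (rule functorD(2)[OF DJ f])
      have "?P k (far D f \<cdot> x) \<longleftrightarrow> ?P i x"
      proof
        assume "?P k (far D f \<cdot> x)"
        then obtain l p q where l: "p \<in> Hom J j l" "q \<in> Hom J k l"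
          "far D p \<cdot> y = far D q \<cdot> (far D f \<cdot> x)" by blast
        have "far D q \<cdot> (far D f \<cdot> x) = far D (q \<cdot>\<^bsub>J\<^esub> f) \<cdot> x"
          using functorD(4)[OF DJ f l(2)] Comp_assoc[OF x Df functorD(2)[OF DJ l(2)]] by simp
        thus "?P i x" using l J.Comp_Hom[OF f l(2)] by metis
      next
        assume "?P i x"
        then obtain l p q where l: "p \<in> Hom J j l" "q \<in> Hom J i l" "far D p \<cdot> y = far D q \<cdot> x"
          by blast
        obtain m r s where m: "r \<in> Hom J l m" "s \<in> Hom J k m"
          using ub[of l k] J.HomD[OF l(1)] J.HomD[OF f] by blast
        have rs: "r \<cdot>\<^bsub>J\<^esub> q = s \<cdot>\<^bsub>J\<^esub> f"
          by (rule par[OF J.Comp_Hom[OF l(2) m(1)] J.Comp_Hom[OF f m(2)]])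
        have "far D (r \<cdot>\<^bsub>J\<^esub> p) \<cdot> y = far D r \<cdot> (far D p \<cdot> y)"
          using functorD(4)[OF DJ l(1) m(1)]
            Comp_assoc[OF y(1) functorD(2)[OF DJ l(1)] functorD(2)[OF DJ m(1)]] by simp
        also have "\<dots> = far D (r \<cdot>\<^bsub>J\<^esub> q) \<cdot> x"
          using functorD(4)[OF DJ l(2) m(1)] l(3)
            Comp_assoc[OF x functorD(2)[OF DJ l(2)] functorD(2)[OF DJ m(1)]] by simp
        also have "\<dots> = far D s \<cdot> (far D f \<cdot> x)"
          unfolding rs using functorD(4)[OF DJ f m(2)]
            Comp_assoc[OF x Df functorD(2)[OF DJ m(2)]] by simp
        finally show "?P k (far D f \<cdot> x)" using J.Comp_Hom[OF l(1) m(1)] m(2) by blast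
      qed
      thus ?thesis by (simp add: h_def)
    qed
    moreover have "h k x \<in> ?S" for k x by (simp add: h_def)
    ultimately obtain g where g: "\<forall>j\<in>Obj J. \<forall>x\<in>Hom C a (fob D j). g (\<iota> j \<cdot> x) = h j x"
      using H[of h] by blast
    have "h j y = e0" using J.Id_Hom[OF j] by (auto simp: h_def)
    moreover have "h j y = h j y'" using g j y eq by metis
    ultimately have "?P j y'" using e by (auto simp: h_def split: if_splits)
    then obtain l f g where "f \<in> Hom J j l" "g \<in> Hom J j l" "far D f \<cdot> y = far D g \<cdot> y'" by blast
    thus "\<exists>k. \<exists>f \<in> Hom J j k. far D f \<cdot> y = far D f \<cdot> y'" using par by blast
  qed
qed

lemma compact_for_transport:
  assumes iso: "cat_iso J K P Q" and K: "compact_for K C a"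
  shows "compact_for J C a"
  unfolding compact_for_def
proof (intro allI impI)
  note i = cat_isoD[OF iso]
  interpret J: category J by (fact i)
  fix D c \<iota> assume D: "is_functor J C D \<and> is_colimit J C D c \<iota>"
  let ?D = "D \<circ>\<^sub>F Q" and ?\<iota> = "\<lambda>k. \<iota> (fob Q k)"
  have "is_functor K C ?D" "is_colimit K C ?D c ?\<iota>"
    using is_functor_comp[OF i(4) conjunct1[OF D]] is_colimit_transport[OF iso conjunct2[OF D]] .
  hence k: "(\<forall>x \<in> Hom C a c. \<exists>j \<in> Obj K. \<exists>y \<in> Hom C a (fob ?D j). x = ?\<iota> j \<cdot>\<^bsub>C\<^esub> y)"
     "(\<forall>j \<in> Obj K. \<forall>y \<in> Hom C a (fob ?D j). \<forall>y' \<in> Hom C a (fob ?D j).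
        ?\<iota> j \<cdot>\<^bsub>C\<^esub> y = ?\<iota> j \<cdot>\<^bsub>C\<^esub> y' \<longrightarrow> (\<exists>k. \<exists>f \<in> Hom K j k. far ?D f \<cdot>\<^bsub>C\<^esub> y = far ?D f \<cdot>\<^bsub>C\<^esub> y'))"
    using K unfolding compact_for_def by blast+
  show "(\<forall>x \<in> Hom C a c. \<exists>j \<in> Obj J. \<exists>y \<in> Hom C a (fob D j). x = \<iota> j \<cdot>\<^bsub>C\<^esub> y) \<and>
     (\<forall>j \<in> Obj J. \<forall>y \<in> Hom C a (fob D j). \<forall>y' \<in> Hom C a (fob D j).
        \<iota> j \<cdot>\<^bsub>C\<^esub> y = \<iota> j \<cdot>\<^bsub>C\<^esub> y' \<longrightarrow> (\<exists>k. \<exists>f \<in> Hom J j k. far D f \<cdot>\<^bsub>C\<^esub> y = far D f \<cdot>\<^bsub>C\<^esub> y'))"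
  proof (intro conjI ballI impI)
    fix x assume "x \<in> Hom C a c"
    then obtain j y where "j \<in> Obj K" "y \<in> Hom C a (fob ?D j)" "x = ?\<iota> j \<cdot>\<^bsub>C\<^esub> y" using k(1) by blast
    thus "\<exists>j \<in> Obj J. \<exists>y \<in> Hom C a (fob D j). x = \<iota> j \<cdot>\<^bsub>C\<^esub> y"
      using functorD(1)[OF i(4)] by auto
  next
    fix j y y' assume j: "j \<in> Obj J" and y: "y \<in> Hom C a (fob D j)" "y' \<in> Hom C a (fob D j)"
      and eq: "\<iota> j \<cdot>\<^bsub>C\<^esub> y = \<iota> j \<cdot>\<^bsub>C\<^esub> y'"
    have "fob P j \<in> Obj K" by (rule functorD(1)[OF i(3) j])
    then obtain k f where "f \<in> Hom K (fob P j) k" "far ?D f \<cdot>\<^bsub>C\<^esub> y = far ?D f \<cdot>\<^bsub>C\<^esub> y'"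
      using k(2) y eq i(5)[OF j] by (metis comp_ftor_simps(1))
    thus "\<exists>k. \<exists>f \<in> Hom J j k. far D f \<cdot>\<^bsub>C\<^esub> y = far D f \<cdot>\<^bsub>C\<^esub> y'"
      using functorD(2)[OF i(4)] i(5)[OF j] by (metis comp_ftor_simps(2))
  qed
qed

lemma directed_poset_transport:
  assumes iso: "cat_iso J K P Q" and K: "small_category \<kappa> K" and J: "directed_poset \<kappa> \<mu> J"
  shows "directed_poset \<kappa> \<mu> K"
  unfolding directed_poset_def
proof (intro conjI allI impI ballI)
  note i = cat_isoD[OF iso]
  interpret J: category J by (fact i)
  interpret K: category K by (fact i)
  note Q = functorD[OF i(4)] and P = functorD[OF i(3)]
  show "small_category \<kappa> K" by fact
  fix j k
  { fix f g assume fg: "f \<in> Hom K j k" "g \<in> Hom K j k"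
    have "far Q f = far Q g" using J Q(2)[OF fg(1)] Q(2)[OF fg(2)] by (simp add: directed_poset_def)
    hence "far P (far Q f) = far P (far Q g)" by simp
    thus "f = g" using i(8) K.HomD(1)[OF fg(1)] K.HomD(1)[OF fg(2)] by simp }
  assume "Hom K j k \<noteq> {} \<and> Hom K k j \<noteq> {}"
  then obtain f g where fg: "f \<in> Hom K j k" "g \<in> Hom K k j" by blast
  have "Hom J (fob Q j) (fob Q k) \<noteq> {} \<and> Hom J (fob Q k) (fob Q j) \<noteq> {}"
    using Q(2)[OF fg(1)] Q(2)[OF fg(2)] by blast
  hence "fob Q j = fob Q k" using J by (simp add: directed_poset_def)
  hence "fob P (fob Q j) = fob P (fob Q k)" by simp
  thus "j = k" using i(7) K.HomD(4,5)[OF fg(1)] by simp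
next
  note i = cat_isoD[OF iso]
  interpret J: category J by (fact i)
  interpret K: category K by (fact i)
  fix S assume S: "S \<subseteq> Obj K" "|S| <o \<mu>"
  have "fob Q ` S \<subseteq> Obj J" using S functorD(1)[OF i(4)] by auto
  moreover have "|fob Q ` S| <o \<mu>" using S(2) by (rule ordLeq_ordLess_trans[OF card_of_image])
  ultimately obtain k where k: "k \<in> Obj J" "\<forall>j\<in>fob Q ` S. Hom J j k \<noteq> {}"
    using J unfolding directed_poset_def by (elim conjE allE[where x = "fob Q ` S"]) auto
  have "Hom K j (fob P k) \<noteq> {}" if j: "j \<in> S" for j
  proof -
    obtain f where "f \<in> Hom J (fob Q j) k" using k j by auto
    hence "far P f \<in> Hom K (fob P (fob Q j)) (fob P k)" by (rule functorD(2)[OF i(3)])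
    thus ?thesis using i(7) S j by auto
  qed
  thus "\<exists>k\<in>Obj K. \<forall>j\<in>S. Hom K j k \<noteq> {}" using functorD(1)[OF i(3) k(1)] by blast
qed

definition chain_cat :: "'l set \<Rightarrow> 'l rel \<Rightarrow> ('l, 'l \<times> 'l) cat" where
  "chain_cat \<Lambda> R =
     \<lparr>Obj = \<Lambda>, Arr = {(a, b). a \<in> \<Lambda> \<and> b \<in> \<Lambda> \<and> (a = b \<or> (a, b) \<in> R)},
      Dom = fst, Cod = snd, Ide = (\<lambda>a. (a, a)), Comp = (\<lambda>g f. (fst f, snd g))\<rparr>"

lemma chain_cat_simps [simp]:
  "Obj (chain_cat \<Lambda> R) = \<Lambda>"
  "f \<in> Hom (chain_cat \<Lambda> R) a b \<longleftrightarrow> f = (a, b) \<and> a \<in> \<Lambda> \<and> b \<in> \<Lambda> \<and> (a = b \<or> (a, b) \<in> R)"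
  "Ide (chain_cat \<Lambda> R) a = (a, a)" "g \<cdot>\<^bsub>chain_cat \<Lambda> R\<^esub> f = (fst f, snd g)"
  by (auto simp: chain_cat_def Hom_def)

lemma chain_category: "trans R \<Longrightarrow> category (chain_cat \<Lambda> R)"
  by unfold_locales (auto simp: chain_cat_def Hom_def dest: transD)

text \<open>A well-ordered index in which every family of at most \<open>|Q|\<close> elements has a strict upper bound.
  That \<open>Q\<close> is nonempty makes the chain unbounded.\<close>

locale long_chain = small_universe \<kappa> for \<kappa> :: "'u rel" +
  fixes \<Lambda> :: "'l set" and R :: "'l rel" and Q :: "'q set"
  assumes small_index: "small \<kappa> \<Lambda>" and width: "Q \<noteq> {}"
    and index: "R \<subseteq> \<Lambda> \<times> \<Lambda>" "wf R" "trans R" "total_on \<Lambda> R"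
    and bound: "\<And>S. S \<subseteq> \<Lambda> \<Longrightarrow> |S| \<le>o |Q| \<Longrightarrow> \<exists>b\<in>\<Lambda>. \<forall>a\<in>S. (a, b) \<in> R"
begin

abbreviation "chain \<equiv> chain_cat \<Lambda> R"

lemma bound_image:
  assumes "\<And>x. x \<in> X \<Longrightarrow> f x \<in> \<Lambda>" "|X| \<le>o |Q|"
  obtains b where "b \<in> \<Lambda>" "\<And>x. x \<in> X \<Longrightarrow> (f x, b) \<in> R"
proof -
  have "|f ` X| \<le>o |Q|" by (rule ordLeq_transitive[OF card_of_image assms(2)])
  moreover have "f ` X \<subseteq> \<Lambda>" using assms(1) by auto
  ultimately show ?thesis using bound[of "f ` X"] that by blast
qed

lemma common_bound:
  assumes "a \<in> \<Lambda>" "b \<in> \<Lambda>"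
  obtains d where "d \<in> \<Lambda>" "a = d \<or> (a, d) \<in> R" "b = d \<or> (b, d) \<in> R"
  using assms index(4) that unfolding total_on_def by blast

lemma nonempty: "\<Lambda> \<noteq> {}"
  using bound_image[of "{}" "\<lambda>x. x"] by (auto simp: card_of_empty)

lemma later:
  assumes "b \<in> \<Lambda>"
  obtains d where "d \<in> \<Lambda>" "(b, d) \<in> R"
proof -
  have "|{b}| \<le>o |Q|" using width by (rule card_of_singl_ordLeq)
  thus ?thesis using bound[of "{b}"] assms that by auto
qed

lemma chain_directed:
  assumes "Card_order \<mu>" "|Field \<mu>| \<le>o |Q|"
  shows "directed_poset \<kappa> \<mu> chain"
  unfolding directed_poset_def
proof (intro conjI allI impI ballI)
  have "Arr chain \<subseteq> \<Lambda> \<times> \<Lambda>" by (auto simp: chain_cat_def)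
  moreover have "small \<kappa> (\<Lambda> \<times> \<Lambda>)" by (intro small_Sigma small_index)
  ultimately have "small \<kappa> (Arr chain)" by (rule small_mono)
  thus "small_category \<kappa> chain"
    using chain_category[OF index(3)] small_index by (simp add: small_category_def)
  fix j k
  show "f = g" if "f \<in> Hom chain j k" "g \<in> Hom chain j k" for f g using that by auto
  show "j = k" if "Hom chain j k \<noteq> {} \<and> Hom chain k j \<noteq> {}"
  proof -
    have "j = k \<or> (j, k) \<in> R" "j = k \<or> (k, j) \<in> R" using that by auto
    moreover have "\<not> ((j, k) \<in> R \<and> (k, j) \<in> R)" using wf_asym[OF index(2)] by blast
    ultimately show ?thesis by blast
  qed
next
  fix S assume S: "S \<subseteq> Obj chain" "|S| <o \<mu>"
  have "\<mu> =o |Field \<mu>|" using card_of_Field_ordIso[OF assms(1)] by (rule ordIso_symmetric)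
  hence "|S| \<le>o |Q|"
    using ordLess_imp_ordLeq[OF S(2)] assms(2) ordIso_ordLeq_trans ordLeq_transitive by blast
  then obtain b where "b \<in> \<Lambda>" "\<forall>a\<in>S. (a, b) \<in> R" using bound[of S] S(1) by auto
  hence "\<forall>j\<in>S. (j, b) \<in> Hom chain j b" "b \<in> Obj chain" using S(1) by auto
  thus "\<exists>k\<in>Obj chain. \<forall>j\<in>S. Hom chain j k \<noteq> {}" by blast
qed

lemma presentable_compact_for_chain:
  assumes "category C" "Card_order \<mu>" "natLeq \<le>o \<mu>" "|Field \<mu>| \<le>o |Q|" "presentable \<kappa> \<mu> C a"
  shows "compact_for chain C a"
proof -
  have d: "directed_poset \<kappa> \<mu> chain" using assms by (simp add: chain_directed)
  hence "small_category \<kappa> chain" by (simp add: directed_poset_def)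
  then obtain K :: "('u, 'u) cat" and P P' where K: "small_category \<kappa> K" "cat_iso chain K P P'"
    by (rule small_category_copy)
  have "directed_poset \<kappa> \<mu> K" by (rule directed_poset_transport[OF K(2) K(1) d])
  hence "compact_for K C a"
    by (rule presentable_compact_for[OF assms(1,2,3,5)])
  thus ?thesis by (rule compact_for_transport[OF K(2)])
qed

text \<open>Compactness for the chain passes to colimits over at most \<open>|Q|\<close> arrows: the choices of
  stages that it makes for the vertices and for the arrows of the diagram are bounded in the
  chain.\<close>

lemma compact_for_chain_colimit:
  fixes C :: "('o, 'm) cat" (structure)
  assumes C: "category C" and K: "category K" and F: "is_functor K C F"
    and a: "is_colimit K C F a l" and comp: "\<And>k. k \<in> Obj K \<Longrightarrow> compact_for chain C (fob F k)"
    and card: "|Arr K| \<le>o |Q|"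
  shows "compact_for chain C a"
  unfolding compact_for_def
proof (intro allI impI)
  interpret category C by fact
  interpret K: category K by fact
  fix D c \<iota> assume D': "is_functor chain C D \<and> is_colimit chain C D c \<iota>"
  hence D: "is_functor chain C D" and coc: "is_cocone chain C D c \<iota>" by (auto simp: is_colimit_def)
  have \<iota>: "\<iota> j \<in> Hom C (fob D j) c" if "j \<in> \<Lambda>" for j
    using coc that by (simp add: is_cocone_def)
  let ?le = "\<lambda>i j. i \<in> \<Lambda> \<and> j \<in> \<Lambda> \<and> (i = j \<or> (i, j) \<in> R)"
  have Dm: "far D (i, j) \<in> Hom C (fob D i) (fob D j)" if "?le i j" for i j
    using functorD(2)[OF D, of "(i, j)" i j] that by simp
  have \<iota>_comp: "\<iota> j \<cdot> (far D (i, j) \<cdot> x) = \<iota> i \<cdot> x"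
    if le: "?le i j" and x: "x \<in> Hom C b (fob D i)" for i j x b
  proof -
    have "\<iota> j \<cdot> far D (i, j) = \<iota> i" using coc le by (simp add: is_cocone_def)
    thus ?thesis using Comp_assoc[OF x Dm[OF le] \<iota>] le by simp
  qed
  have D_comp: "far D (j, k) \<cdot> (far D (i, j) \<cdot> x) = far D (i, k) \<cdot> x"
    if le: "?le i j" "?le j k" and x: "x \<in> Hom C b (fob D i)" for i j k x b
  proof -
    have "far D (i, k) = far D (j, k) \<cdot> far D (i, j)"
      using functorD(4)[OF D, of "(i, j)" i j "(j, k)" k] le by simp
    thus ?thesis using Comp_assoc[OF x Dm[OF le(1)] Dm[OF le(2)]] by simp
  qed
  have le_trans: "?le i k" if "?le i j" "?le j k" for i j k
    using that index(3) by (auto dest: transD)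
  have coa: "is_cocone K C F a l" using a by (simp add: is_colimit_def)
  have l: "l k \<in> Hom C (fob F k) a" if "k \<in> Obj K" for k
    using coa that by (simp add: is_cocone_def)
  have lF: "l k' \<cdot> far F f = l k" if "f \<in> Hom K k k'" for f k k'
    using coa that by (simp add: is_cocone_def)
  have uniq: "x = x'" if "x \<in> Hom C a b" "x' \<in> Hom C a b" "\<And>k. k \<in> Obj K \<Longrightarrow> x \<cdot> l k = x' \<cdot> l k" for x x' b
  proof -
    have "is_cocone K C F b (\<lambda>k. x \<cdot> l k)"
      unfolding is_cocone_def
    proof (intro conjI ballI allI)
      show "b \<in> Obj C" using HomD that by blast
      show "x \<cdot> l k \<in> Hom C (fob F k) b" if "k \<in> Obj K" for k
        using Comp_Hom l that \<open>x \<in> Hom C a b\<close> by blast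
      show "x \<cdot> l k' \<cdot> far F f = x \<cdot> l k" if f: "f \<in> Hom K k k'" for k k' f
        using Comp_assoc[OF functorD(2)[OF F f] l \<open>x \<in> Hom C a b\<close>] K.HomD[OF f] lF[OF f] by simp
    qed
    hence "\<exists>!h. h \<in> Hom C a b \<and> (\<forall>k\<in>Obj K. h \<cdot> l k = x \<cdot> l k)"
      using a unfolding is_colimit_def by blast
    thus ?thesis using that by (metis (no_types))
  qed
  have stage: "\<exists>j\<in>\<Lambda>. \<exists>y\<in>Hom C (fob F k) (fob D j). x = \<iota> j \<cdot> y"
    if "k \<in> Obj K" "x \<in> Hom C (fob F k) c" for k x
    using comp[OF that(1), unfolded compact_for_def, rule_format, OF D', THEN conjunct1] that(2)
    by simp
  have eventually: "\<exists>j'. ?le j j' \<and> far D (j, j') \<cdot> y = far D (j, j') \<cdot> y'"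
    if k: "k \<in> Obj K" and j: "j \<in> \<Lambda>" and y: "y \<in> Hom C (fob F k) (fob D j)"
      "y' \<in> Hom C (fob F k) (fob D j)" and eq: "\<iota> j \<cdot> y = \<iota> j \<cdot> y'" for k j y y'
  proof -
    have "\<exists>j'. \<exists>f\<in>Hom chain j j'. far D f \<cdot> y = far D f \<cdot> y'"
      using comp[OF k, unfolded compact_for_def, rule_format, OF D', THEN conjunct2] j y eq by simp
    thus ?thesis by auto
  qed
  show "(\<forall>x \<in> Hom C a c. \<exists>j \<in> Obj chain. \<exists>y \<in> Hom C a (fob D j). x = \<iota> j \<cdot> y) \<and>
     (\<forall>j \<in> Obj chain. \<forall>y \<in> Hom C a (fob D j). \<forall>y' \<in> Hom C a (fob D j).
        \<iota> j \<cdot> y = \<iota> j \<cdot> y' \<longrightarrow> (\<exists>k. \<exists>f \<in> Hom chain j k. far D f \<cdot> y = far D f \<cdot> y'))"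
  proof (intro conjI ballI impI)
    fix x assume x: "x \<in> Hom C a c"
    have xl: "x \<cdot> l k \<in> Hom C (fob F k) c" if "k \<in> Obj K" for k
      by (rule Comp_Hom[OF l[OF that] x])
    obtain s y where sy: "\<And>k. k \<in> Obj K \<Longrightarrow> s k \<in> \<Lambda>"
      "\<And>k. k \<in> Obj K \<Longrightarrow> y k \<in> Hom C (fob F k) (fob D (s k))"
      "\<And>k. k \<in> Obj K \<Longrightarrow> x \<cdot> l k = \<iota> (s k) \<cdot> y k"
      using stage[OF _ xl] by metis
    \<comment> \<open>The restrictions of \<open>x\<close> to the vertices factor through one stage \<open>p\<close>, but the factors form a
      cocone only after moving on to a stage \<open>b\<close> that settles every arrow of the diagram.\<close>
    obtain p where p: "p \<in> \<Lambda>" "\<And>f. f \<in> Arr K \<Longrightarrow> (s (Dom K f), p) \<in> R"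
      using bound_image[of "Arr K" "\<lambda>f. s (Dom K f)"] sy(1) card by (metis K.Dom_Obj)
    have le_p: "?le (s k) p" if "k \<in> Obj K" for k
      using p sy(1)[OF that] that K.ide_arr[OF that] by metis
    define z where "z k = far D (s k, p) \<cdot> y k" for k
    have z: "z k \<in> Hom C (fob F k) (fob D p)" if "k \<in> Obj K" for k
      unfolding z_def by (rule Comp_Hom[OF sy(2)[OF that] Dm[OF le_p[OF that]]])
    have \<iota>z: "\<iota> p \<cdot> z k = x \<cdot> l k" if "k \<in> Obj K" for k
      unfolding z_def using \<iota>_comp[OF le_p[OF that] sy(2)[OF that]] sy(3)[OF that] by simp
    have ev: "\<exists>j'. ?le p j' \<and> far D (p, j') \<cdot> (z (Cod K f) \<cdot> far F f) = far D (p, j') \<cdot> z (Dom K f)"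
      if f: "f \<in> Arr K" for f
    proof (rule eventually)
      have fH: "f \<in> Hom K (Dom K f) (Cod K f)" by (rule K.Arr_Hom[OF f])
      have k: "Dom K f \<in> Obj K" "Cod K f \<in> Obj K" using f by auto
      show "Dom K f \<in> Obj K" "p \<in> \<Lambda>" by fact+
      show "z (Cod K f) \<cdot> far F f \<in> Hom C (fob F (Dom K f)) (fob D p)"
        by (rule Comp_Hom[OF functorD(2)[OF F fH] z[OF k(2)]])
      show "z (Dom K f) \<in> Hom C (fob F (Dom K f)) (fob D p)" by (rule z[OF k(1)])
      have "\<iota> p \<cdot> (z (Cod K f) \<cdot> far F f) = (\<iota> p \<cdot> z (Cod K f)) \<cdot> far F f"
        using Comp_assoc[OF functorD(2)[OF F fH] z[OF k(2)] \<iota>[OF p(1)]] by simp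
      also have "\<dots> = x \<cdot> (l (Cod K f) \<cdot> far F f)"
        using \<iota>z[OF k(2)] Comp_assoc[OF functorD(2)[OF F fH] l[OF k(2)] x] by simp
      finally show "\<iota> p \<cdot> (z (Cod K f) \<cdot> far F f) = \<iota> p \<cdot> z (Dom K f)"
        using lF[OF fH] \<iota>z[OF k(1)] by simp
    qed
    then obtain r where r: "\<And>f. f \<in> Arr K \<Longrightarrow> ?le p (r f)"
      "\<And>f. f \<in> Arr K \<Longrightarrow> far D (p, r f) \<cdot> (z (Cod K f) \<cdot> far F f) = far D (p, r f) \<cdot> z (Dom K f)"
      by metis
    obtain b0 where b0: "b0 \<in> \<Lambda>" "\<And>f. f \<in> Arr K \<Longrightarrow> (r f, b0) \<in> R"
      using bound_image[of "Arr K" r] r(1) card by metis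
    obtain b where b: "b \<in> \<Lambda>" "p = b \<or> (p, b) \<in> R" "b0 = b \<or> (b0, b) \<in> R"
      using common_bound[OF p(1) b0(1)] .
    have pb: "?le p b" using p(1) b by simp
    have rb: "?le (r f) b" if "f \<in> Arr K" for f
      by (rule le_trans[of _ b0]) (use r(1)[OF that] b0 b that in auto)
    define t where "t k = far D (p, b) \<cdot> z k" for k
    have t: "t k \<in> Hom C (fob F k) (fob D b)" if "k \<in> Obj K" for k
      unfolding t_def by (rule Comp_Hom[OF z[OF that] Dm[OF pb]])
    have "is_cocone K C F (fob D b) t"
      unfolding is_cocone_def
    proof (intro conjI ballI allI)
      show "fob D b \<in> Obj C" using functorD(1)[OF D] b by simp
      show "t k \<in> Hom C (fob F k) (fob D b)" if "k \<in> Obj K" for k by (rule t[OF that])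
      fix k k' f assume f: "f \<in> Hom K k k'"
      note f' = K.HomD[OF f]
      have zf: "z k' \<cdot> far F f \<in> Hom C (fob F k) (fob D p)"
        by (rule Comp_Hom[OF functorD(2)[OF F f] z[OF f'(5)]])
      have "t k' \<cdot> far F f = far D (p, b) \<cdot> (z k' \<cdot> far F f)"
        unfolding t_def by (rule Comp_assoc[OF functorD(2)[OF F f] z[OF f'(5)] Dm[OF pb]])
      also have "\<dots> = far D (r f, b) \<cdot> (far D (p, r f) \<cdot> (z k' \<cdot> far F f))"
        by (rule D_comp[OF r(1)[OF f'(1)] rb[OF f'(1)] zf, symmetric])
      also have "\<dots> = far D (r f, b) \<cdot> (far D (p, r f) \<cdot> z k)"
        using r(2)[OF f'(1)] f' by simp
      also have "\<dots> = t k"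
        unfolding t_def by (rule D_comp[OF r(1)[OF f'(1)] rb[OF f'(1)] z[OF f'(4)]])
      finally show "t k' \<cdot> far F f = t k" .
    qed
    then obtain w where w: "w \<in> Hom C a (fob D b)" "\<And>k. k \<in> Obj K \<Longrightarrow> w \<cdot> l k = t k"
      using a unfolding is_colimit_def by metis
    have "x = \<iota> b \<cdot> w"
    proof (rule uniq[OF x Comp_Hom[OF w(1) \<iota>[OF b(1)]]])
      fix k assume k: "k \<in> Obj K"
      have "\<iota> b \<cdot> w \<cdot> l k = \<iota> b \<cdot> t k"
        using Comp_assoc[OF l[OF k] w(1) \<iota>[OF b(1)]] w(2)[OF k] by simp
      also have "\<dots> = x \<cdot> l k" unfolding t_def using \<iota>_comp[OF pb z[OF k]] \<iota>z[OF k] by simp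
      finally show "x \<cdot> l k = \<iota> b \<cdot> w \<cdot> l k" by simp
    qed
    thus "\<exists>j \<in> Obj chain. \<exists>y \<in> Hom C a (fob D j). x = \<iota> j \<cdot> y" using w(1) b(1) by auto
  next
    fix j y y' assume "j \<in> Obj chain" and y: "y \<in> Hom C a (fob D j)" "y' \<in> Hom C a (fob D j)"
      and eq: "\<iota> j \<cdot> y = \<iota> j \<cdot> y'"
    hence j: "j \<in> \<Lambda>" by simp
    have yl: "y \<cdot> l k \<in> Hom C (fob F k) (fob D j)" "y' \<cdot> l k \<in> Hom C (fob F k) (fob D j)"
      if "k \<in> Obj K" for k
      by (rule Comp_Hom[OF l[OF that]], fact)+
    have "\<exists>j'. ?le j j' \<and> far D (j, j') \<cdot> (y \<cdot> l k) = far D (j, j') \<cdot> (y' \<cdot> l k)" if k: "k \<in> Obj K" for k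
      using eventually[OF k j yl[OF k]] Comp_assoc[OF l[OF k] y(1) \<iota>[OF j]]
        Comp_assoc[OF l[OF k] y(2) \<iota>[OF j]] eq by simp
    then obtain r where r: "\<And>k. k \<in> Obj K \<Longrightarrow> ?le j (r k)"
      "\<And>k. k \<in> Obj K \<Longrightarrow> far D (j, r k) \<cdot> (y \<cdot> l k) = far D (j, r k) \<cdot> (y' \<cdot> l k)"
      by metis
    obtain b0 where b0: "b0 \<in> \<Lambda>" "\<And>f. f \<in> Arr K \<Longrightarrow> (r (Dom K f), b0) \<in> R"
      using bound_image[of "Arr K" "\<lambda>f. r (Dom K f)"] r(1) card by (metis K.Dom_Obj)
    obtain b where b: "b \<in> \<Lambda>" "j = b \<or> (j, b) \<in> R" "b0 = b \<or> (b0, b) \<in> R"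
      using common_bound[OF j b0(1)] .
    have jb: "?le j b" using j b by simp
    have rb: "?le (r k) b" if "k \<in> Obj K" for k
    proof (rule le_trans[of _ b0])
      have "(r k, b0) \<in> R" using b0(2)[of "Ide K k"] K.ide_arr[OF that] by simp
      thus "?le (r k) b0" using r(1)[OF that] b0(1) by simp
    qed (use b0 b in auto)
    have "far D (j, b) \<cdot> y = far D (j, b) \<cdot> y'"
    proof (rule uniq[OF Comp_Hom[OF y(1) Dm[OF jb]] Comp_Hom[OF y(2) Dm[OF jb]]])
      fix k assume k: "k \<in> Obj K"
      have "far D (j, b) \<cdot> y \<cdot> l k = far D (r k, b) \<cdot> (far D (j, r k) \<cdot> (y \<cdot> l k))"
        using D_comp[OF r(1)[OF k] rb[OF k] yl(1)[OF k]] Comp_assoc[OF l[OF k] y(1) Dm[OF jb]] by simp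
      also have "\<dots> = far D (j, b) \<cdot> y' \<cdot> l k"
        unfolding r(2)[OF k]
        using D_comp[OF r(1)[OF k] rb[OF k] yl(2)[OF k]] Comp_assoc[OF l[OF k] y(2) Dm[OF jb]] by simp
      finally show "far D (j, b) \<cdot> y \<cdot> l k = far D (j, b) \<cdot> y' \<cdot> l k" .
    qed
    moreover have "(j, b) \<in> Hom chain j b" using jb by simp
    ultimately show "\<exists>k. \<exists>f \<in> Hom chain j k. far D f \<cdot> y = far D f \<cdot> y'" by blast
  qed
qed

end

text \<open>The length of the chain: a regular cardinal above the rank of presentability and above the sizes
  of the diagrams that present the given objects.\<close>

lemma (in small_universe) long_chain_exists:
  fixes E :: "('o, 'm) cat"
  assumes E: "category E" "locally_presentable \<kappa> E" and A: "small \<kappa> A" "A \<subseteq> Obj E"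
  obtains \<Lambda> :: "('u + 'o \<times> 'u) set set" and R and Q :: "('u + 'o \<times> 'u) set"
  where "long_chain \<kappa> \<Lambda> R Q" "\<And>a. a \<in> A \<Longrightarrow> compact_for (chain_cat \<Lambda> R) E a"
proof -
  obtain \<mu> :: "'u rel" and G where \<mu>: "Card_order \<mu>" "natLeq \<le>o \<mu>" "\<mu> <o \<kappa>"
    and G: "\<forall>a \<in> G. presentable \<kappa> \<mu> E a"
      "\<forall>x \<in> Obj E. \<exists>(J :: ('u, 'u) cat) D \<iota>. directed_poset \<kappa> \<mu> J \<and> is_functor J E D \<and>
              (\<forall>j \<in> Obj J. fob D j \<in> G) \<and> is_colimit J E D x \<iota>"
    using E(2) unfolding locally_presentable_def by blast
  have "\<forall>a\<in>A. \<exists>(J :: ('u, 'u) cat) D \<iota>. directed_poset \<kappa> \<mu> J \<and> is_functor J E D \<and>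
              (\<forall>j \<in> Obj J. fob D j \<in> G) \<and> is_colimit J E D a \<iota>"
    using G(2) A(2) by (simp add: subset_iff)
  then obtain J :: "'o \<Rightarrow> ('u, 'u) cat" where "\<forall>a\<in>A. \<exists>D \<iota>. directed_poset \<kappa> \<mu> (J a) \<and>
      is_functor (J a) E D \<and> (\<forall>j \<in> Obj (J a). fob D j \<in> G) \<and> is_colimit (J a) E D a \<iota>"
    by (rule bchoice[THEN exE]) iprover
  then obtain D where "\<forall>a\<in>A. \<exists>\<iota>. directed_poset \<kappa> \<mu> (J a) \<and>
      is_functor (J a) E (D a) \<and> (\<forall>j \<in> Obj (J a). fob (D a) j \<in> G) \<and> is_colimit (J a) E (D a) a \<iota>"
    by (rule bchoice[THEN exE]) iprover
  then obtain \<iota> where "\<forall>a\<in>A. directed_poset \<kappa> \<mu> (J a) \<and>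
      is_functor (J a) E (D a) \<and> (\<forall>j \<in> Obj (J a). fob (D a) j \<in> G) \<and> is_colimit (J a) E (D a) a (\<iota> a)"
    by (rule bchoice[THEN exE]) iprover
  hence J: "\<And>a. a \<in> A \<Longrightarrow> directed_poset \<kappa> \<mu> (J a)" "\<And>a. a \<in> A \<Longrightarrow> is_functor (J a) E (D a)"
      "\<And>a j. a \<in> A \<Longrightarrow> j \<in> Obj (J a) \<Longrightarrow> fob (D a) j \<in> G"
      "\<And>a. a \<in> A \<Longrightarrow> is_colimit (J a) E (D a) a (\<iota> a)"
    by simp_all
  define Q where "Q = Field \<mu> <+> (SIGMA a:A. Arr (J a))"
  have \<mu>F: "|Field \<mu>| =o \<mu>" by (rule card_of_Field_ordIso[OF \<mu>(1)])
  have "small \<kappa> (Field \<mu>)" unfolding small_def using ordIso_ordLess_trans[OF \<mu>F \<mu>(3)] .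
  moreover have "small \<kappa> (Arr (J a))" if "a \<in> A" for a
    using J(1)[OF that] by (simp add: directed_poset_def small_category_def)
  ultimately have Q: "small \<kappa> Q" unfolding Q_def by (intro small_Plus small_Sigma A)
  have "natLeq \<le>o |Field \<mu>|" using ordLeq_ordIso_trans[OF \<mu>(2) ordIso_symmetric[OF \<mu>F]] .
  hence "infinite (Field \<mu>)" using infinite_iff_natLeq_ordLeq by blast
  hence "infinite Q" by (simp add: Q_def finite_Plus_iff)
  with Q obtain \<Lambda> :: "('u + 'o \<times> 'u) set set" and R where \<Lambda>: "small \<kappa> \<Lambda>" "R \<subseteq> \<Lambda> \<times> \<Lambda>"
    "wf R" "trans R" "total_on \<Lambda> R" "\<And>S. S \<subseteq> \<Lambda> \<Longrightarrow> |S| \<le>o |Q| \<Longrightarrow> \<exists>b\<in>\<Lambda>. \<forall>a\<in>S. (a, b) \<in> R"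
    using small_regular_order[of Q] by metis
  interpret long_chain \<kappa> \<Lambda> R Q by unfold_locales (use \<Lambda> \<open>infinite Q\<close> in auto)
  have "compact_for (chain_cat \<Lambda> R) E a" if a: "a \<in> A" for a
  proof (rule compact_for_chain_colimit[OF E(1) _ J(2)[OF a] J(4)[OF a]])
    show "category (J a)" using J(1)[OF a] by (simp add: directed_poset_def small_category_def)
    show "compact_for chain E (fob (D a) k)" if "k \<in> Obj (J a)" for k
    proof (rule presentable_compact_for_chain[OF E(1) \<mu>(1,2)])
      show "|Field \<mu>| \<le>o |Q|" unfolding Q_def by (rule card_of_Plus1)
      show "presentable \<kappa> \<mu> E (fob (D a) k)" using J(3)[OF a that] G(1) by blast
    qed
    have "inj_on (\<lambda>f. Inr (a, f)) (Arr (J a))" by (simp add: inj_on_def)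
    moreover have "(\<lambda>f. Inr (a, f)) ` Arr (J a) \<subseteq> Q" using a by (auto simp: Q_def)
    ultimately show "|Arr (J a)| \<le>o |Q|" using card_of_ordLeq by blast
  qed
  thus ?thesis using that long_chain_axioms by blast
qed

section \<open>Free right maps\<close>

text \<open>A stage \<open>W\<close> of the construction of the free right map on \<open>f : X \<rightarrow> Y\<close>: the map \<open>proj : W \<rightarrow> Y\<close>
  (the free right map will be the colimit of these), the map \<open>seed : X \<rightarrow> W\<close> over \<open>Y\<close>, the maps
  \<open>link b : W\<^sub>b \<rightarrow> W\<close> from the earlier stages, and for each square \<open>(s, t)\<close> from \<open>u\<^sub>i\<close> to an earlier
  stage \<open>W\<^sub>b \<rightarrow> Y\<close> the filler \<open>cell b i s t : B\<^sub>i \<rightarrow> W\<close> that has been adjoined for it.\<close>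

record ('l, 'i, 'm) stage =
  proj :: 'm
  seed :: 'm
  link :: "'l \<Rightarrow> 'm"
  cell :: "'l \<Rightarrow> 'i \<Rightarrow> 'm \<Rightarrow> 'm \<Rightarrow> 'm"

datatype ('l, 'i, 'm) node = Seed | Stage 'l | Cell 'l 'i 'm 'm

locale indexed_maps = E: category E + I: category I
  for E :: "('o, 'm) cat" (structure) and I :: "('i, 'j) cat" +
  fixes u :: "('i, 'j, 'm, 'm sq) ftor"
  assumes u: "is_functor I (arrow_cat E) u"
begin

abbreviation "src i \<equiv> Dom E (fob u i)"
abbreviation "tgt i \<equiv> Cod E (fob u i)"
abbreviation "utop \<sigma> \<equiv> sq_top (far u \<sigma>)"
abbreviation "ubot \<sigma> \<equiv> sq_bot (far u \<sigma>)"

lemma gen_arr: "i \<in> Obj I \<Longrightarrow> fob u i \<in> Arr E"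
  using functorD(1)[OF u] by simp

lemma gen_Hom: "i \<in> Obj I \<Longrightarrow> fob u i \<in> Hom E (src i) (tgt i)"
  using gen_arr by (rule E.Arr_Hom)

lemma gen_map:
  assumes "\<sigma> \<in> Hom I j i"
  shows "far u \<sigma> \<in> Hom (arrow_cat E) (fob u j) (fob u i)"
    "utop \<sigma> \<in> Hom E (src j) (src i)" "ubot \<sigma> \<in> Hom E (tgt j) (tgt i)"
    "fob u i \<cdot> utop \<sigma> = ubot \<sigma> \<cdot> fob u j"
    "i \<in> Obj I" "j \<in> Obj I"
proof -
  show q: "far u \<sigma> \<in> Hom (arrow_cat E) (fob u j) (fob u i)" by (rule functorD(2)[OF u assms])
  from E.HomA_D[OF q] show "utop \<sigma> \<in> Hom E (src j) (src i)" "ubot \<sigma> \<in> Hom E (tgt j) (tgt i)"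
    "fob u i \<cdot> utop \<sigma> = ubot \<sigma> \<cdot> fob u j" by (simp_all add: E.HomI)
  show "i \<in> Obj I" "j \<in> Obj I" using I.HomD[OF assms] by simp_all
qed

definition sqr :: "'i \<Rightarrow> 'm \<Rightarrow> 'm \<Rightarrow> 'm \<Rightarrow> bool" where
  "sqr i g s t \<longleftrightarrow> i \<in> Obj I \<and> Sq (fob u i) g s t \<in> Hom (arrow_cat E) (fob u i) g"

lemma sqr_iff:
  "sqr i g s t \<longleftrightarrow> i \<in> Obj I \<and> g \<in> Arr E \<and> s \<in> Hom E (src i) (Dom E g) \<and>
     t \<in> Hom E (tgt i) (Cod E g) \<and> g \<cdot> s = t \<cdot> fob u i"
  using gen_arr by (auto simp: sqr_def E.Sq_Hom_iff)

lemma sqrD: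
  assumes "sqr i g s t"
  shows "i \<in> Obj I" "g \<in> Arr E" "s \<in> Hom E (src i) (Dom E g)" "t \<in> Hom E (tgt i) (Cod E g)"
    "g \<cdot> s = t \<cdot> fob u i" "fob u i \<in> Hom E (src i) (tgt i)" "g \<in> Hom E (Dom E g) (Cod E g)"
  using assms gen_Hom E.Arr_Hom by (auto simp: sqr_iff)

lemma sqr_precomp:
  assumes s: "sqr i g s t" and \<sigma>: "\<sigma> \<in> Hom I j i"
  shows "sqr j g (s \<cdot> utop \<sigma>) (t \<cdot> ubot \<sigma>)"
  unfolding sqr_iff
proof (intro conjI)
  note q = sqrD[OF s] and g = gen_map[OF \<sigma>]
  show "j \<in> Obj I" "g \<in> Arr E" by fact+
  show "s \<cdot> utop \<sigma> \<in> Hom E (src j) (Dom E g)" "t \<cdot> ubot \<sigma> \<in> Hom E (tgt j) (Cod E g)"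
    using E.Comp_Hom q g by blast+
  have "g \<cdot> (s \<cdot> utop \<sigma>) = (g \<cdot> s) \<cdot> utop \<sigma>" using E.Comp_assoc[OF g(2) q(3,7)] by simp
  also have "\<dots> = t \<cdot> (fob u i \<cdot> utop \<sigma>)" unfolding q(5) by (rule E.Comp_assoc[OF g(2) q(6,4)])
  also have "\<dots> = (t \<cdot> ubot \<sigma>) \<cdot> fob u j"
    unfolding g(4) using E.Comp_assoc[OF gen_Hom[OF g(6)] g(3) q(4)] by simp
  finally show "g \<cdot> (s \<cdot> utop \<sigma>) = (t \<cdot> ubot \<sigma>) \<cdot> fob u j" .
qed

lemma sqr_postcomp:
  assumes s: "sqr i g s t" and w: "w \<in> Hom E (Dom E g) (Dom E h)" "h \<in> Arr E" "v \<in> Hom E (Cod E g) (Cod E h)"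
    "h \<cdot> w = v \<cdot> g"
  shows "sqr i h (w \<cdot> s) (v \<cdot> t)"
  unfolding sqr_iff
proof (intro conjI)
  note q = sqrD[OF s] and h = E.Arr_Hom[OF w(2)]
  show "i \<in> Obj I" "h \<in> Arr E" by fact+
  show "w \<cdot> s \<in> Hom E (src i) (Dom E h)" "v \<cdot> t \<in> Hom E (tgt i) (Cod E h)"
    using E.Comp_Hom q w by blast+
  have "h \<cdot> (w \<cdot> s) = (h \<cdot> w) \<cdot> s" using E.Comp_assoc[OF q(3) w(1) h] by simp
  also have "\<dots> = v \<cdot> (g \<cdot> s)" unfolding w(4) by (rule E.Comp_assoc[OF q(3,7) w(3)])
  also have "\<dots> = (v \<cdot> t) \<cdot> fob u i" unfolding q(5) using E.Comp_assoc[OF q(6,4) w(3)] by simp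
  finally show "h \<cdot> (w \<cdot> s) = (v \<cdot> t) \<cdot> fob u i" .
qed

lemma sqr_postcomp_over:
  assumes s: "sqr i g s t" and w: "w \<in> Hom E (Dom E g) (Dom E h)" "h \<in> Arr E" "Cod E h = Cod E g"
    "h \<cdot> w = g"
  shows "sqr i h (w \<cdot> s) t"
proof -
  have "sqr i h (w \<cdot> s) (Ide E (Cod E g) \<cdot> t)"
    by (rule sqr_postcomp[OF s w(1,2)]) (use w sqrD[OF s] in \<open>simp_all add: E.Id_Hom\<close>)
  thus ?thesis using E.Id_Comp[OF sqrD(4)[OF s]] by simp
qed

end

locale cell_chain = long_chain \<kappa> \<Lambda> R Q + indexed_maps E I u
  for \<kappa> :: "'u rel" and \<Lambda> :: "'l set" and R :: "'l rel" and Q :: "'q set"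
    and E :: "('o, 'm) cat" (structure) and I :: "('i, 'j) cat" and u :: "('i, 'j, 'm, 'm sq) ftor" +
  fixes f :: 'm
  assumes f: "f \<in> Arr E"
    and cocomplete: "cocomplete \<kappa> E" and locally_small: "locally_small \<kappa> E"
    and small_gen: "small_category \<kappa> I"
    and compact: "\<And>i. i \<in> Obj I \<Longrightarrow> compact_for (chain_cat \<Lambda> R) E (Dom E (fob u i))"
begin

abbreviation "X \<equiv> Dom E f"
abbreviation "Y \<equiv> Cod E f"

text \<open>The data that a map out of the stage after the stages in \<open>D\<close> amounts to. The last two
  conditions say that a filler is adjoined only once: a square that arises at an earlier stage
  keeps the filler that it has. Without them the fillers in the colimit would depend on the
  stage at which the square is considered, and they would not be natural.\<close>

definition stage_cocone ::
  "('l \<Rightarrow> ('l, 'i, 'm) stage) \<Rightarrow> 'l set \<Rightarrow> 'o \<Rightarrow> 'm \<Rightarrow> ('l \<Rightarrow> 'm) \<Rightarrow> ('l \<Rightarrow> 'i \<Rightarrow> 'm \<Rightarrow> 'm \<Rightarrow> 'm) \<Rightarrow> bool"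
  where
  "stage_cocone S D Z x w c \<longleftrightarrow> x \<in> Hom E X Z \<and>
     (\<forall>b\<in>D. w b \<in> Hom E (Dom E (proj (S b))) Z \<and> w b \<cdot> seed (S b) = x \<and>
       (\<forall>i s t. sqr i (proj (S b)) s t \<longrightarrow>
          c b i s t \<in> Hom E (tgt i) Z \<and> c b i s t \<cdot> fob u i = w b \<cdot> s \<and>
          (\<forall>j. \<forall>\<sigma>\<in>Hom I j i. c b i s t \<cdot> ubot \<sigma> = c b j (s \<cdot> utop \<sigma>) (t \<cdot> ubot \<sigma>))) \<and>
       (\<forall>a\<in>D. (a, b) \<in> R \<longrightarrow> w b \<cdot> link (S b) a = w a \<and>
          (\<forall>i s t. sqr i (proj (S a)) s t \<longrightarrow>
             w b \<cdot> cell (S b) a i s t = c a i s t \<and> c b i (link (S b) a \<cdot> s) t = c a i s t)))"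

lemma stage_coconeD:
  assumes "stage_cocone S D Z x w c"
  shows "x \<in> Hom E X Z"
    "\<And>b. b \<in> D \<Longrightarrow> w b \<in> Hom E (Dom E (proj (S b))) Z"
    "\<And>b. b \<in> D \<Longrightarrow> w b \<cdot> seed (S b) = x"
    "\<And>b i s t. b \<in> D \<Longrightarrow> sqr i (proj (S b)) s t \<Longrightarrow> c b i s t \<in> Hom E (tgt i) Z"
    "\<And>b i s t. b \<in> D \<Longrightarrow> sqr i (proj (S b)) s t \<Longrightarrow> c b i s t \<cdot> fob u i = w b \<cdot> s"
    "\<And>b i s t j \<sigma>. b \<in> D \<Longrightarrow> sqr i (proj (S b)) s t \<Longrightarrow> \<sigma> \<in> Hom I j i \<Longrightarrow>
       c b i s t \<cdot> ubot \<sigma> = c b j (s \<cdot> utop \<sigma>) (t \<cdot> ubot \<sigma>)"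
    "\<And>a b. b \<in> D \<Longrightarrow> a \<in> D \<Longrightarrow> (a, b) \<in> R \<Longrightarrow> w b \<cdot> link (S b) a = w a"
    "\<And>a b i s t. b \<in> D \<Longrightarrow> a \<in> D \<Longrightarrow> (a, b) \<in> R \<Longrightarrow> sqr i (proj (S a)) s t \<Longrightarrow>
       w b \<cdot> cell (S b) a i s t = c a i s t"
    "\<And>a b i s t. b \<in> D \<Longrightarrow> a \<in> D \<Longrightarrow> (a, b) \<in> R \<Longrightarrow> sqr i (proj (S a)) s t \<Longrightarrow>
       c b i (link (S b) a \<cdot> s) t = c a i s t"
  using assms unfolding stage_cocone_def by simp_all

lemma stage_coconeI:
  assumes "x \<in> Hom E X Z"
    "\<And>b. b \<in> D \<Longrightarrow> w b \<in> Hom E (Dom E (proj (S b))) Z"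
    "\<And>b. b \<in> D \<Longrightarrow> w b \<cdot> seed (S b) = x"
    "\<And>b i s t. b \<in> D \<Longrightarrow> sqr i (proj (S b)) s t \<Longrightarrow> c b i s t \<in> Hom E (tgt i) Z"
    "\<And>b i s t. b \<in> D \<Longrightarrow> sqr i (proj (S b)) s t \<Longrightarrow> c b i s t \<cdot> fob u i = w b \<cdot> s"
    "\<And>b i s t j \<sigma>. b \<in> D \<Longrightarrow> sqr i (proj (S b)) s t \<Longrightarrow> \<sigma> \<in> Hom I j i \<Longrightarrow>
       c b i s t \<cdot> ubot \<sigma> = c b j (s \<cdot> utop \<sigma>) (t \<cdot> ubot \<sigma>)"
    "\<And>a b. b \<in> D \<Longrightarrow> a \<in> D \<Longrightarrow> (a, b) \<in> R \<Longrightarrow> w b \<cdot> link (S b) a = w a"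
    "\<And>a b i s t. b \<in> D \<Longrightarrow> a \<in> D \<Longrightarrow> (a, b) \<in> R \<Longrightarrow> sqr i (proj (S a)) s t \<Longrightarrow>
       w b \<cdot> cell (S b) a i s t = c a i s t"
    "\<And>a b i s t. b \<in> D \<Longrightarrow> a \<in> D \<Longrightarrow> (a, b) \<in> R \<Longrightarrow> sqr i (proj (S a)) s t \<Longrightarrow>
       c b i (link (S b) a \<cdot> s) t = c a i s t"
  shows "stage_cocone S D Z x w c"
  unfolding stage_cocone_def using assms by simp

text \<open>The map \<open>k\<close> out of the stage \<open>st\<close> that the data \<open>(x, w, c)\<close> of a \<open>stage_cocone\<close> amount to.\<close>

definition mediates ::
  "('l \<Rightarrow> ('l, 'i, 'm) stage) \<Rightarrow> 'l set \<Rightarrow> ('l, 'i, 'm) stage \<Rightarrow> 'm \<Rightarrow> ('l \<Rightarrow> 'm)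
    \<Rightarrow> ('l \<Rightarrow> 'i \<Rightarrow> 'm \<Rightarrow> 'm \<Rightarrow> 'm) \<Rightarrow> 'm \<Rightarrow> bool" where
  "mediates S D st x w c k \<longleftrightarrow> k \<cdot> seed st = x \<and> (\<forall>b\<in>D. k \<cdot> link st b = w b \<and>
     (\<forall>i s t. sqr i (proj (S b)) s t \<longrightarrow> k \<cdot> cell st b i s t = c b i s t))"

text \<open>A stage is the universal object for the data of \<open>stage_cocone\<close>, and its projection to \<open>Y\<close> is
  the map that corresponds to the projections of the earlier stages.\<close>

definition is_stage ::
  "('l \<Rightarrow> ('l, 'i, 'm) stage) \<Rightarrow> 'l set \<Rightarrow> ('l, 'i, 'm) stage \<Rightarrow> bool" where
  "is_stage S D st \<longleftrightarrow> proj st \<in> Arr E \<and> Cod E (proj st) = Y \<and>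
     stage_cocone S D (Dom E (proj st)) (seed st) (link st) (cell st) \<and>
     mediates S D st f (\<lambda>b. proj (S b)) (\<lambda>b i s t. t) (proj st) \<and>
     (\<forall>Z x w c. stage_cocone S D Z x w c \<longrightarrow>
        (\<exists>!k. k \<in> Hom E (Dom E (proj st)) Z \<and> mediates S D st x w c k))"

abbreviation "below b \<equiv> {a. (a, b) \<in> R}"

lemma is_stage_cong:
  assumes "\<And>b. b \<in> D \<Longrightarrow> S b = S' b"
  shows "is_stage S D st = is_stage S' D st"
proof -
  have "stage_cocone S D = stage_cocone S' D"
    by (intro ext) (use assms in \<open>simp add: stage_cocone_def cong: ball_cong\<close>)
  moreover have "mediates S D st x w c k = mediates S' D st x w c k" for x w c k
    using assms by (simp add: mediates_def cong: ball_cong)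
  moreover have "mediates S D st f (\<lambda>b. proj (S b)) c k = mediates S D st f (\<lambda>b. proj (S' b)) c k" for c k
    using assms by (simp add: mediates_def cong: ball_cong)
  ultimately show ?thesis by (simp add: is_stage_def)
qed

lemma below_index: "below b \<subseteq> \<Lambda>"
  using index(1) by auto

lemma is_stageD:
  assumes "is_stage S D st"
  shows "proj st \<in> Arr E" "Cod E (proj st) = Y"
    "stage_cocone S D (Dom E (proj st)) (seed st) (link st) (cell st)"
    "proj st \<cdot> seed st = f"
    "b \<in> D \<Longrightarrow> proj st \<cdot> link st b = proj (S b)"
    "b \<in> D \<Longrightarrow> sqr i (proj (S b)) s t \<Longrightarrow> proj st \<cdot> cell st b i s t = t"
    "proj st \<in> Hom E (Dom E (proj st)) Y"
    "stage_cocone S D Z x w c \<Longrightarrow>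
        \<exists>!k. k \<in> Hom E (Dom E (proj st)) Z \<and> mediates S D st x w c k"
  using assms by (auto simp: is_stage_def mediates_def Hom_def)

lemma stage_map_eqI:
  assumes st: "is_stage S D st" and c: "stage_cocone S D Z x w c"
    and k: "k \<in> Hom E (Dom E (proj st)) Z" "mediates S D st x w c k"
    and k': "k' \<in> Hom E (Dom E (proj st)) Z" "mediates S D st x w c k'"
  shows "k = k'"
  using is_stageD(8)[OF st c] k k' by blast

text \<open>The equations that \<open>stage_cocone\<close> imposes, as a presentation to be glued.\<close>

inductive stage_rel ::
  "('l \<Rightarrow> ('l, 'i, 'm) stage) \<Rightarrow> 'l set
    \<Rightarrow> ('l, 'i, 'm) node \<Rightarrow> 'm \<Rightarrow> ('l, 'i, 'm) node \<Rightarrow> 'm \<Rightarrow> bool"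
  for S D where
    seed_rel: "b \<in> D \<Longrightarrow> stage_rel S D (Stage b) (seed (S b)) Seed (Ide E X)"
  | fill_rel: "b \<in> D \<Longrightarrow> sqr i (proj (S b)) s t \<Longrightarrow>
      stage_rel S D (Cell b i s t) (fob u i) (Stage b) s"
  | natural_rel: "b \<in> D \<Longrightarrow> sqr i (proj (S b)) s t \<Longrightarrow> \<sigma> \<in> Hom I j i \<Longrightarrow>
      stage_rel S D (Cell b i s t) (ubot \<sigma>) (Cell b j (s \<cdot> utop \<sigma>) (t \<cdot> ubot \<sigma>)) (Ide E (tgt j))"
  | link_rel: "a \<in> D \<Longrightarrow> b \<in> D \<Longrightarrow> (a, b) \<in> R \<Longrightarrow>
      stage_rel S D (Stage b) (link (S b) a) (Stage a) (Ide E (Dom E (proj (S a))))"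
  | cell_rel: "a \<in> D \<Longrightarrow> b \<in> D \<Longrightarrow> (a, b) \<in> R \<Longrightarrow> sqr i (proj (S a)) s t \<Longrightarrow>
      stage_rel S D (Stage b) (cell (S b) a i s t) (Cell a i s t) (Ide E (tgt i))"
  | refill_rel: "a \<in> D \<Longrightarrow> b \<in> D \<Longrightarrow> (a, b) \<in> R \<Longrightarrow> sqr i (proj (S a)) s t \<Longrightarrow>
      stage_rel S D (Cell b i (link (S b) a \<cdot> s) t) (Ide E (tgt i)) (Cell a i s t) (Ide E (tgt i))"

context
  fixes S :: "'l \<Rightarrow> ('l, 'i, 'm) stage" and D :: "'l set"
  assumes stages: "\<And>b. b \<in> D \<Longrightarrow> is_stage S (below b) (S b)"
begin

lemma stage_link:
  assumes "b \<in> D" "(a, b) \<in> R"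
  shows "link (S b) a \<in> Hom E (Dom E (proj (S a))) (Dom E (proj (S b)))"
    "proj (S b) \<cdot> link (S b) a = proj (S a)"
    "link (S b) a \<cdot> seed (S a) = seed (S b)"
  using stage_coconeD(2,3)[OF is_stageD(3)[OF stages[OF assms(1)]], of a]
    is_stageD(5)[OF stages[OF assms(1)], of a] assms by auto

lemma stage_cell:
  assumes "b \<in> D" "(a, b) \<in> R" "sqr i (proj (S a)) s t"
  shows "cell (S b) a i s t \<in> Hom E (tgt i) (Dom E (proj (S b)))"
    "proj (S b) \<cdot> cell (S b) a i s t = t"
  using stage_coconeD(4)[OF is_stageD(3)[OF stages[OF assms(1)]], of a]
    is_stageD(6)[OF stages[OF assms(1)], of a] assms by auto

lemma stage_sqr:
  assumes "b \<in> D" "a \<in> D" "(a, b) \<in> R" "sqr i (proj (S a)) s t"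
  shows "sqr i (proj (S b)) (link (S b) a \<cdot> s) t"
  by (rule sqr_postcomp_over[OF assms(4)])
    (use stage_link[OF assms(1,3)] is_stageD(1,2)[OF stages] assms(1,2) in auto)

text \<open>The universal object is a glued colimit. It is small because \<open>E\<close> is locally small: there are few
  squares into each of the earlier stages. The projection comes from universality, as \<open>Y\<close> itself,
  with the bottom maps of the squares as fillers, satisfies all the equations.\<close>

lemma stage_exists:
  assumes D: "D \<subseteq> \<Lambda>"
  shows "\<exists>st. is_stage S D st"
proof -
  let ?g = "\<lambda>b. proj (S b)"
  define ob where "ob n = (case n of Seed \<Rightarrow> X | Stage b \<Rightarrow> Dom E (?g b) | Cell b i s t \<Rightarrow> tgt i)"
    for n :: "('l, 'i, 'm) node"
  have ob [simp]: "ob Seed = X" "ob (Stage b) = Dom E (?g b)" "ob (Cell b i s t) = tgt i" for b i s t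
    by (simp_all add: ob_def)
  define N where "N = {Seed} \<union> Stage ` D \<union> {Cell b i s t | b i s t. b \<in> D \<and> sqr i (?g b) s t}"
  define T where "T = {X} \<union> (\<lambda>b. Dom E (?g b)) ` D \<union> src ` Obj I \<union> tgt ` Obj I"
  have g: "?g b \<in> Arr E" "Cod E (?g b) = Y" "?g b \<cdot> seed (S b) = f" "?g b \<in> Hom E (Dom E (?g b)) Y"
    "seed (S b) \<in> Hom E X (Dom E (?g b))" if "b \<in> D" for b
    using is_stageD[OF stages[OF that]] stage_coconeD(1)[OF is_stageD(3)[OF stages[OF that]]] by auto
  have X: "X \<in> Obj E" using f by simp
  have obE: "ob n \<in> Obj E" if "n \<in> N" for n
    using that f g(1) by (auto simp: N_def dest!: sqrD(1) gen_arr)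
  have smD: "small \<kappa> D" by (rule small_mono[OF D small_index])
  have smI: "small \<kappa> (Obj I)" using small_gen by (simp add: small_category_def)
  have "small \<kappa> ((\<lambda>(b, i, s, t). Cell b i s t) `
    (SIGMA b:D. SIGMA i:Obj I. Hom E (src i) (Dom E (?g b)) \<times> Hom E (tgt i) Y))" (is "small \<kappa> ?C")
    using locally_small g gen_arr f
    by (intro small_image small_Sigma smD smI) (auto simp: locally_small_def)
  moreover have "{Cell b i s t | b i s t. b \<in> D \<and> sqr i (?g b) s t} \<subseteq> ?C"
    using g(2) by (fastforce simp: sqr_iff image_iff)
  ultimately have smC: "small \<kappa> {Cell b i s t | b i s t. b \<in> D \<and> sqr i (?g b) s t}"
    by (rule small_mono[rotated])
  have smN: "small \<kappa> N" unfolding N_def by (intro small_Un small_finite small_image smD smC) simp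
  have smT: "small \<kappa> T" unfolding T_def by (intro small_Un small_finite small_image smD smI) simp
  have TE: "T \<subseteq> Obj E" using f g gen_arr by (auto simp: T_def)
  have wf: "x \<in> N \<and> y \<in> N \<and> (\<exists>d\<in>T. a \<in> Hom E d (ob x) \<and> b \<in> Hom E d (ob y))"
    if r: "stage_rel S D x a y b" for x a y b
  proof -
    have T: "X \<in> T" "\<And>b. b \<in> D \<Longrightarrow> Dom E (?g b) \<in> T" "\<And>i. i \<in> Obj I \<Longrightarrow> src i \<in> T"
      "\<And>i. i \<in> Obj I \<Longrightarrow> tgt i \<in> T" by (auto simp: T_def)
    have N: "Seed \<in> N" "\<And>b. b \<in> D \<Longrightarrow> Stage b \<in> N"
      "\<And>b i s t. b \<in> D \<Longrightarrow> sqr i (?g b) s t \<Longrightarrow> Cell b i s t \<in> N" by (auto simp: N_def)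
    from r show ?thesis
    proof (induction rule: stage_rel.induct)
      case 1: (seed_rel b)
      thus ?case using N T g(5)[OF 1(1)] E.Id_Hom[OF X] by auto
    next
      case 2: (fill_rel b i s t)
      thus ?case using N T sqrD[OF 2(2)] by auto
    next
      case 3: (natural_rel b i s t \<sigma> j)
      thus ?case using N T sqrD[OF 3(2)] sqr_precomp[OF 3(2,3)] gen_map[OF 3(3)] gen_arr
        by (auto intro!: bexI[of _ "tgt j"] E.Id_Hom)
    next
      case 4: (link_rel a b)
      thus ?case using N T stage_link[OF 4(2,3)] g(1)[OF 4(1)]
        by (auto intro!: bexI[of _ "Dom E (?g a)"] E.Id_Hom)
    next
      case 5: (cell_rel a b i s t)
      thus ?case using N T stage_cell[OF 5(2,3,4)] sqrD[OF 5(4)] gen_arr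
        by (auto intro!: bexI[of _ "tgt i"] E.Id_Hom)
    next
      case 6: (refill_rel a b i s t)
      thus ?case using N T stage_sqr[OF 6(2,1,3,4)] sqrD[OF 6(4)] gen_arr
        by (auto intro!: bexI[of _ "tgt i"] E.Id_Hom)
    qed
  qed
  have iff: "glue_cocone E N ob {(x, a, y, b). stage_rel S D x a y b} Z z \<longleftrightarrow>
      stage_cocone S D Z (z Seed) (\<lambda>b. z (Stage b)) (\<lambda>b i s t. z (Cell b i s t))" for Z z
  proof
    assume c: "glue_cocone E N ob {(x, a, y, b). stage_rel S D x a y b} Z z"
    have n: "z n \<in> Hom E (ob n) Z" if "n \<in> N" for n using c that by (simp add: glue_cocone_def)
    have r: "z x \<cdot> a = z y \<cdot> b" if "stage_rel S D x a y b" for x a y b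
      using c that by (auto simp: glue_cocone_def)
    show "stage_cocone S D Z (z Seed) (\<lambda>b. z (Stage b)) (\<lambda>b i s t. z (Cell b i s t))"
    proof (rule stage_coconeI)
      show s: "z Seed \<in> Hom E X Z" using n[of Seed] by (simp add: N_def)
      fix b assume b: "b \<in> D"
      show st: "z (Stage b) \<in> Hom E (Dom E (?g b)) Z" using n[of "Stage b"] b by (simp add: N_def)
      have "stage_rel S D (Stage b) (seed (S b)) Seed (Ide E X)" using b by (rule seed_rel)
      thus "z (Stage b) \<cdot> seed (S b) = z Seed" using E.Comp_Id[OF s] by (auto dest!: r)
      { fix i s t assume sq: "sqr i (?g b) s t"
        show ce: "z (Cell b i s t) \<in> Hom E (tgt i) Z"
          using n[of "Cell b i s t"] b sq by (auto simp: N_def)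
        have "stage_rel S D (Cell b i s t) (fob u i) (Stage b) s" using b sq by (rule fill_rel)
        thus "z (Cell b i s t) \<cdot> fob u i = z (Stage b) \<cdot> s" by (rule r)
        fix j \<sigma> assume \<sigma>: "\<sigma> \<in> Hom I j i"
        have "z (Cell b j (s \<cdot> utop \<sigma>) (t \<cdot> ubot \<sigma>)) \<in> Hom E (tgt j) Z"
          using n[of "Cell b j (s \<cdot> utop \<sigma>) (t \<cdot> ubot \<sigma>)"] b sqr_precomp[OF sq \<sigma>] by (auto simp: N_def)
        moreover have "stage_rel S D (Cell b i s t) (ubot \<sigma>) (Cell b j (s \<cdot> utop \<sigma>) (t \<cdot> ubot \<sigma>)) (Ide E (tgt j))"
          using b sq \<sigma> by (rule natural_rel)
        ultimately show "z (Cell b i s t) \<cdot> ubot \<sigma> = z (Cell b j (s \<cdot> utop \<sigma>) (t \<cdot> ubot \<sigma>))"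
          using E.Comp_Id by (auto dest!: r) }
      fix a assume a: "a \<in> D" "(a, b) \<in> R"
      have st': "z (Stage a) \<in> Hom E (Dom E (?g a)) Z" using n[of "Stage a"] a by (simp add: N_def)
      have "stage_rel S D (Stage b) (link (S b) a) (Stage a) (Ide E (Dom E (?g a)))"
        using a(1) b a(2) by (rule link_rel)
      thus "z (Stage b) \<cdot> link (S b) a = z (Stage a)" using E.Comp_Id[OF st'] by (auto dest!: r)
      fix i s t assume sq: "sqr i (?g a) s t"
      have ce: "z (Cell a i s t) \<in> Hom E (tgt i) Z"
        using n[of "Cell a i s t"] a sq by (auto simp: N_def)
      have ce': "z (Cell b i (link (S b) a \<cdot> s) t) \<in> Hom E (tgt i) Z"
        using n[of "Cell b i (link (S b) a \<cdot> s) t"] b stage_sqr[OF b a sq] by (auto simp: N_def)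
      have "stage_rel S D (Stage b) (cell (S b) a i s t) (Cell a i s t) (Ide E (tgt i))"
        using a(1) b a(2) sq by (rule cell_rel)
      thus "z (Stage b) \<cdot> cell (S b) a i s t = z (Cell a i s t)" using E.Comp_Id[OF ce] by (auto dest!: r)
      have "stage_rel S D (Cell b i (link (S b) a \<cdot> s) t) (Ide E (tgt i)) (Cell a i s t) (Ide E (tgt i))"
        using a(1) b a(2) sq by (rule refill_rel)
      thus "z (Cell b i (link (S b) a \<cdot> s) t) = z (Cell a i s t)"
        using E.Comp_Id[OF ce] E.Comp_Id[OF ce'] by (auto dest!: r)
    qed
  next
    assume c: "stage_cocone S D Z (z Seed) (\<lambda>b. z (Stage b)) (\<lambda>b i s t. z (Cell b i s t))"
    note c' = stage_coconeD[OF c]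
    have id: "h \<cdot> Ide E a = h" if "h \<in> Hom E a Z" for h a using E.Comp_Id[OF that] .
    show "glue_cocone E N ob {(x, a, y, b). stage_rel S D x a y b} Z z"
      unfolding glue_cocone_def
    proof (intro conjI ballI allI impI)
      show "Z \<in> Obj E" using E.HomD(5)[OF c'(1)] .
      show "z n \<in> Hom E (ob n) Z" if "n \<in> N" for n
        using that c'(1,2,4) unfolding N_def by auto
      fix x a y b assume "(x, a, y, b) \<in> {(x, a, y, b). stage_rel S D x a y b}"
      hence "stage_rel S D x a y b" by simp
      thus "z x \<cdot> a = z y \<cdot> b"
      proof (induction rule: stage_rel.induct)
        case (seed_rel b)
        thus ?case using c'(3) id[OF c'(1)] by simp
      next
        case (fill_rel b i s t)
        thus ?case using c'(5) by simp
      next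
        case 3: (natural_rel b i s t \<sigma> j)
        thus ?case using c'(6)[OF 3(1-3)] id[OF c'(4)[OF 3(1) sqr_precomp[OF 3(2,3)]]] by simp
      next
        case 4: (link_rel a b)
        thus ?case using c'(7)[OF 4(2,1,3)] id[OF c'(2)[OF 4(1)]] by simp
      next
        case 5: (cell_rel a b i s t)
        thus ?case using c'(8)[OF 5(2,1,3,4)] id[OF c'(4)[OF 5(1,4)]] by simp
      next
        case 6: (refill_rel a b i s t)
        thus ?case using c'(9)[OF 6(2,1,3,4)] by simp
      qed
    qed
  qed
  have "\<exists>Z z. glue_cocone E N ob {(x, a, y, b). stage_rel S D x a y b} Z z \<and>
      (\<forall>Z' z'. glue_cocone E N ob {(x, a, y, b). stage_rel S D x a y b} Z' z' \<longrightarrow>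
        (\<exists>!k. k \<in> Hom E Z Z' \<and> (\<forall>n\<in>N. k \<cdot> z n = z' n)))"
  proof (rule glue_colimit[OF E.category_axioms cocomplete locally_small smN _ smT TE])
    show "ob n \<in> Obj E" if "n \<in> N" for n using that by (rule obE)
    fix x a y b assume "(x, a, y, b) \<in> {(x, a, y, b). stage_rel S D x a y b}"
    hence "stage_rel S D x a y b" by simp
    thus "x \<in> N \<and> y \<in> N \<and> (\<exists>d\<in>T. a \<in> Hom E d (ob x) \<and> b \<in> Hom E d (ob y))" by (rule wf)
  qed
  then obtain Z z where Z: "glue_cocone E N ob {(x, a, y, b). stage_rel S D x a y b} Z z"
    and univ: "\<And>Z' z'. glue_cocone E N ob {(x, a, y, b). stage_rel S D x a y b} Z' z' \<Longrightarrow>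
      \<exists>!k. k \<in> Hom E Z Z' \<and> (\<forall>n\<in>N. k \<cdot> z n = z' n)" by blast
  define W where "W p = \<lparr>proj = p, seed = z Seed, link = \<lambda>b. z (Stage b), cell = \<lambda>b i s t. z (Cell b i s t)\<rparr>" for p
  have W [simp]: "proj (W p) = p" "seed (W p) = z Seed" "link (W p) b = z (Stage b)"
    "cell (W p) b i s t = z (Cell b i s t)" for p b i s t by (simp_all add: W_def)
  have cW: "stage_cocone S D Z (seed (W p)) (link (W p)) (cell (W p))" for p
    using Z unfolding iff by (simp add: W_def)
  have uW: "\<exists>!k. k \<in> Hom E Z Z' \<and> mediates S D (W p) x w c k" if c: "stage_cocone S D Z' x w c" for Z' x w c p
  proof -
    define z' where "z' n = (case n of Seed \<Rightarrow> x | Stage b \<Rightarrow> w b | Cell b i s t \<Rightarrow> c b i s t)" for n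
    have "glue_cocone E N ob {(x, a, y, b). stage_rel S D x a y b} Z' z'" unfolding iff using c by (simp add: z'_def)
    hence "\<exists>!k. k \<in> Hom E Z Z' \<and> (\<forall>n\<in>N. k \<cdot> z n = z' n)" by (rule univ)
    moreover have "(\<forall>n\<in>N. k \<cdot> z n = z' n) \<longleftrightarrow> mediates S D (W p) x w c k" for k
      unfolding N_def mediates_def z'_def by (auto 0 4)
    ultimately show ?thesis by simp
  qed
  have "stage_cocone S D Y f ?g (\<lambda>b i s t. t)"
    by (rule stage_coconeI)
      (use g f stage_link stage_cell in \<open>auto simp: E.Arr_Hom dest: sqrD\<close>)
  then obtain p where p: "p \<in> Hom E Z Y" "mediates S D (W undefined) f ?g (\<lambda>b i s t. t) p"
    using uW by metis
  have "mediates S D (W p) f ?g (\<lambda>b i s t. t) p"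
    using p(2) by (simp add: mediates_def)
  hence "is_stage S D (W p)"
    using p(1) cW[of p] uW[of _ _ _ _ p] E.HomD[OF p(1)] unfolding is_stage_def by simp
  thus ?thesis by blast
qed

end

end

lemma (in indexed_maps) right_mapD:
  assumes "right_map E I u (h, \<psi>)"
  shows "h \<in> Arr E"
    "\<And>i s t. sqr i h s t \<Longrightarrow> \<psi> i (Sq (fob u i) h s t) \<in> Hom E (tgt i) (Dom E h)"
    "\<And>i s t. sqr i h s t \<Longrightarrow> \<psi> i (Sq (fob u i) h s t) \<cdot> fob u i = s"
    "\<And>i s t. sqr i h s t \<Longrightarrow> h \<cdot> \<psi> i (Sq (fob u i) h s t) = t"
    "\<And>i j \<sigma> s t. sqr j h s t \<Longrightarrow> \<sigma> \<in> Hom I i j \<Longrightarrow>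
       \<psi> j (Sq (fob u j) h s t) \<cdot> ubot \<sigma> = \<psi> i (Sq (fob u i) h (s \<cdot> utop \<sigma>) (t \<cdot> ubot \<sigma>))"
    "\<And>i q. \<not> (i \<in> Obj I \<and> q \<in> Hom (arrow_cat E) (fob u i) h) \<Longrightarrow> \<psi> i q = undefined"
proof -
  show "h \<in> Arr E" using assms by (simp add: right_map_def)
  show "\<psi> i q = undefined" if "\<not> (i \<in> Obj I \<and> q \<in> Hom (arrow_cat E) (fob u i) h)" for i q
    using assms that unfolding right_map_def by blast
  fix i s t assume s: "sqr i h s t"
  hence "is_filler E (Sq (fob u i) h s t) (\<psi> i (Sq (fob u i) h s t))"
    using assms unfolding right_map_def sqr_def by blast
  thus "\<psi> i (Sq (fob u i) h s t) \<in> Hom E (tgt i) (Dom E h)"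
    "\<psi> i (Sq (fob u i) h s t) \<cdot> fob u i = s" "h \<cdot> \<psi> i (Sq (fob u i) h s t) = t"
    by (simp_all add: is_filler_def)
next
  fix i j \<sigma> s t assume s: "sqr j h s t" and \<sigma>: "\<sigma> \<in> Hom I i j"
  have "\<psi> j (Sq (fob u j) h s t) \<cdot> ubot \<sigma> = \<psi> i (Sq (fob u j) h s t \<cdot>\<^bsub>arrow_cat E\<^esub> far u \<sigma>)"
    using assms s \<sigma> unfolding right_map_def sqr_def by blast
  thus "\<psi> j (Sq (fob u j) h s t) \<cdot> ubot \<sigma> = \<psi> i (Sq (fob u i) h (s \<cdot> utop \<sigma>) (t \<cdot> ubot \<sigma>))"
    using E.HomA_D(1)[OF gen_map(1)[OF \<sigma>]] by simp
qed

context cell_chain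
begin

text \<open>The transfinite recursion, in the form of dependent choice: whether an object is a stage at \<open>b\<close>
  depends only on the stages below \<open>b\<close>.\<close>

lemma stage_family_exists:
  "\<exists>S. \<forall>b. is_stage S (below b) (S b)"
proof (rule dependent_wf_choice[OF index(2), where P = "\<lambda>S b st. is_stage S (below b) st"])
  fix S S' :: "'l \<Rightarrow> ('l, 'i, 'm) stage" and b st
  assume "\<And>z. (z, b) \<in> R \<Longrightarrow> S z = S' z"
  thus "is_stage S (below b) st = is_stage S' (below b) st" by (intro is_stage_cong) simp
next
  fix b and S :: "'l \<Rightarrow> ('l, 'i, 'm) stage"
  assume "\<And>a. (a, b) \<in> R \<Longrightarrow> is_stage S (below a) (S a)"
  thus "\<exists>st. is_stage S (below b) st" by (intro stage_exists below_index) simp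
qed

text \<open>The property that determines a map \<open>k\<close> out of a stage. A square from \<open>f\<close> to a right map \<open>h\<close> with
  fillers \<open>\<psi>\<close> extends to each stage in exactly one way that sends the adjoined fillers to those
  given by \<open>\<psi>\<close>.\<close>

definition extends ::
  "('l \<Rightarrow> ('l, 'i, 'm) stage) \<Rightarrow> 'm \<Rightarrow> ('i \<Rightarrow> 'm sq \<Rightarrow> 'm) \<Rightarrow> 'm \<Rightarrow> 'm \<Rightarrow> 'l set
    \<Rightarrow> ('l, 'i, 'm) stage \<Rightarrow> 'm \<Rightarrow> bool" where
  "extends S h \<psi> s\<^sub>0 t\<^sub>0 D st k \<longleftrightarrow> k \<in> Hom E (Dom E (proj st)) (Dom E h) \<and> h \<cdot> k = t\<^sub>0 \<cdot> proj st \<and>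
     k \<cdot> seed st = s\<^sub>0 \<and>
     (\<forall>b\<in>D. \<forall>i s t. sqr i (proj (S b)) s t \<longrightarrow>
        k \<cdot> cell st b i s t = \<psi> i (Sq (fob u i) h (k \<cdot> link st b \<cdot> s) (t\<^sub>0 \<cdot> t)))"

context
  fixes S :: "'l \<Rightarrow> ('l, 'i, 'm) stage"
  assumes stages: "\<And>b. is_stage S (below b) (S b)"
begin

context
  fixes h :: 'm and \<psi> :: "'i \<Rightarrow> 'm sq \<Rightarrow> 'm" and s\<^sub>0 t\<^sub>0 :: 'm
  assumes h: "right_map E I u (h, \<psi>)"
    and s\<^sub>0: "s\<^sub>0 \<in> Hom E X (Dom E h)" and t\<^sub>0: "t\<^sub>0 \<in> Hom E Y (Cod E h)" and sq: "h \<cdot> s\<^sub>0 = t\<^sub>0 \<cdot> f"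
begin

lemma extends_sqr:
  assumes "is_stage S D st" "k \<in> Hom E (Dom E (proj st)) (Dom E h)" "h \<cdot> k = t\<^sub>0 \<cdot> proj st"
    and "sqr i (proj st) s t"
  shows "sqr i h (k \<cdot> s) (t\<^sub>0 \<cdot> t)"
  by (rule sqr_postcomp[OF assms(4,2) right_mapD(1)[OF h] _ assms(3)])
    (use t\<^sub>0 is_stageD(2)[OF assms(1)] in simp)

lemma extends_restrict:
  assumes st: "is_stage S D st" and k: "extends S h \<psi> s\<^sub>0 t\<^sub>0 D st k" and b: "b \<in> D"
    and D: "below b \<subseteq> D"
  shows "extends S h \<psi> s\<^sub>0 t\<^sub>0 (below b) (S b) (k \<cdot> link st b)"
  unfolding extends_def
proof (intro conjI ballI allI impI)
  note c = stage_coconeD[OF is_stageD(3)[OF st]]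
  note cb = stage_coconeD[OF is_stageD(3)[OF stages[of b]]]
  have kH: "k \<in> Hom E (Dom E (proj st)) (Dom E h)" and hk: "h \<cdot> k = t\<^sub>0 \<cdot> proj st"
    and ks: "k \<cdot> seed st = s\<^sub>0" using k by (auto simp: extends_def)
  have hH: "h \<in> Hom E (Dom E h) (Cod E h)" by (rule E.Arr_Hom[OF right_mapD(1)[OF h]])
  show "k \<cdot> link st b \<in> Hom E (Dom E (proj (S b))) (Dom E h)" by (rule E.Comp_Hom[OF c(2)[OF b] kH])
  have "h \<cdot> (k \<cdot> link st b) = (t\<^sub>0 \<cdot> proj st) \<cdot> link st b"
    using E.Comp_assoc[OF c(2)[OF b] kH hH] hk by simp
  also have "\<dots> = t\<^sub>0 \<cdot> proj (S b)"
    using E.Comp_assoc[OF c(2)[OF b] is_stageD(7)[OF st] t\<^sub>0] is_stageD(5)[OF st b] by simp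
  finally show "h \<cdot> (k \<cdot> link st b) = t\<^sub>0 \<cdot> proj (S b)" .
  show "k \<cdot> link st b \<cdot> seed (S b) = s\<^sub>0"
    using E.Comp_assoc[OF cb(1) c(2)[OF b] kH] c(3)[OF b] ks by simp
  fix a i s t assume a: "a \<in> below b" and sq: "sqr i (proj (S a)) s t"
  have aD: "a \<in> D" and ab: "(a, b) \<in> R" using a D by auto
  have ce: "cell (S b) a i s t \<in> Hom E (tgt i) (Dom E (proj (S b)))" by (rule cb(4)[OF a sq])
  have li: "link (S b) a \<in> Hom E (Dom E (proj (S a))) (Dom E (proj (S b)))" by (rule cb(2)[OF a])
  have "k \<cdot> link st b \<cdot> cell (S b) a i s t = k \<cdot> cell st a i s t"
    using E.Comp_assoc[OF ce c(2)[OF b] kH] c(8)[OF b aD ab sq] by simp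
  also have "\<dots> = \<psi> i (Sq (fob u i) h (k \<cdot> link st a \<cdot> s) (t\<^sub>0 \<cdot> t))"
    using k aD sq unfolding extends_def by blast
  also have "k \<cdot> link st a = k \<cdot> link st b \<cdot> link (S b) a"
    using E.Comp_assoc[OF li c(2)[OF b] kH] c(7)[OF b aD ab] by simp
  finally show "k \<cdot> link st b \<cdot> cell (S b) a i s t =
    \<psi> i (Sq (fob u i) h (k \<cdot> link st b \<cdot> link (S b) a \<cdot> s) (t\<^sub>0 \<cdot> t))" .
qed

text \<open>Because the extensions to the earlier stages are unique, they are compatible with the links.
  Together with the fillers prescribed by \<open>\<psi>\<close> they therefore form a \<open>stage_cocone\<close>, and universality
  yields the extension to the next stage. The same argument applies to the colimit of all
  stages.\<close>

lemma extends_step: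
  assumes st: "is_stage S D st" and D: "\<And>b. b \<in> D \<Longrightarrow> below b \<subseteq> D"
    and IH: "\<And>b. b \<in> D \<Longrightarrow> \<exists>!k. extends S h \<psi> s\<^sub>0 t\<^sub>0 (below b) (S b) k"
  shows "\<exists>!k. extends S h \<psi> s\<^sub>0 t\<^sub>0 D st k"
proof -
  define k where "k b = (THE k. extends S h \<psi> s\<^sub>0 t\<^sub>0 (below b) (S b) k)" for b
  have k: "extends S h \<psi> s\<^sub>0 t\<^sub>0 (below b) (S b) (k b)" if "b \<in> D" for b
    unfolding k_def by (rule theI'[OF IH[OF that]])
  have uniq: "l = k b" if "b \<in> D" "extends S h \<psi> s\<^sub>0 t\<^sub>0 (below b) (S b) l" for b l
    using IH[OF that(1)] k[OF that(1)] that(2) by blast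
  have kD: "k b \<in> Hom E (Dom E (proj (S b))) (Dom E h)" "h \<cdot> k b = t\<^sub>0 \<cdot> proj (S b)"
    "k b \<cdot> seed (S b) = s\<^sub>0" if "b \<in> D" for b
    using k[OF that] by (auto simp: extends_def)
  have k_cell: "k b \<cdot> cell (S b) a i s t = \<psi> i (Sq (fob u i) h (k b \<cdot> link (S b) a \<cdot> s) (t\<^sub>0 \<cdot> t))"
    if "b \<in> D" "(a, b) \<in> R" "sqr i (proj (S a)) s t" for a b i s t
    using k[OF that(1)] that(2,3) unfolding extends_def by blast
  have k_link: "k b \<cdot> link (S b) a = k a" if "b \<in> D" "(a, b) \<in> R" for a b
  proof (rule uniq)
    show "a \<in> D" using D that by blast
    have "below a \<subseteq> below b" using that(2) index(3) by (auto dest: transD)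
    thus "extends S h \<psi> s\<^sub>0 t\<^sub>0 (below a) (S a) (k b \<cdot> link (S b) a)"
      using extends_restrict[OF stages k[OF that(1)]] that(2) by simp
  qed
  have k_sqr: "sqr i h (k b \<cdot> s) (t\<^sub>0 \<cdot> t)" if "b \<in> D" "sqr i (proj (S b)) s t" for b i s t
    by (rule extends_sqr[OF stages kD(1,2)[OF that(1)] that(2)])
  note r = right_mapD[OF h]
  note c = stage_coconeD[OF is_stageD(3)[OF st]]
  let ?c = "\<lambda>b i s t. \<psi> i (Sq (fob u i) h (k b \<cdot> s) (t\<^sub>0 \<cdot> t))"
  have hH: "h \<in> Hom E (Dom E h) (Cod E h)" by (rule E.Arr_Hom[OF r(1)])
  have cc: "stage_cocone S D (Dom E h) s\<^sub>0 k ?c"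
  proof (rule stage_coconeI)
    show "s\<^sub>0 \<in> Hom E X (Dom E h)" by (rule s\<^sub>0)
    fix b assume b: "b \<in> D"
    show "k b \<in> Hom E (Dom E (proj (S b))) (Dom E h)" "k b \<cdot> seed (S b) = s\<^sub>0" by (rule kD[OF b])+
    { fix i s t assume sq: "sqr i (proj (S b)) s t"
      show "?c b i s t \<in> Hom E (tgt i) (Dom E h)" "?c b i s t \<cdot> fob u i = k b \<cdot> s"
        by (rule r(2,3)[OF k_sqr[OF b sq]])+
      fix j \<sigma> assume \<sigma>: "\<sigma> \<in> Hom I j i"
      note q = sqrD[OF sq] and g = gen_map[OF \<sigma>]
      have t: "t \<in> Hom E (tgt i) Y" using q(4) is_stageD(2)[OF stages] by simp
      show "?c b i s t \<cdot> ubot \<sigma> = ?c b j (s \<cdot> utop \<sigma>) (t \<cdot> ubot \<sigma>)"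
        using r(5)[OF k_sqr[OF b sq] \<sigma>] E.Comp_assoc[OF g(2) q(3) kD(1)[OF b]]
          E.Comp_assoc[OF g(3) t t\<^sub>0] by simp }
    fix a assume a: "a \<in> D" "(a, b) \<in> R"
    show "k b \<cdot> link (S b) a = k a" by (rule k_link[OF b a(2)])
    fix i s t assume sq: "sqr i (proj (S a)) s t"
    show "k b \<cdot> cell (S b) a i s t = ?c a i s t"
      using k_cell[OF b a(2) sq] k_link[OF b a(2)] by simp
    have li: "link (S b) a \<in> Hom E (Dom E (proj (S a))) (Dom E (proj (S b)))"
      using stage_coconeD(2)[OF is_stageD(3)[OF stages[of b]]] a by simp
    show "?c b i (link (S b) a \<cdot> s) t = ?c a i s t"
      using E.Comp_assoc[OF sqrD(3)[OF sq] li kD(1)[OF b]] k_link[OF b a(2)] by simp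
  qed
  have cY: "stage_cocone S D (Cod E h) (t\<^sub>0 \<cdot> f) (\<lambda>b. t\<^sub>0 \<cdot> proj (S b)) (\<lambda>b i s t. t\<^sub>0 \<cdot> t)"
  proof -
    show ?thesis
    proof (rule stage_coconeI)
      show "t\<^sub>0 \<cdot> f \<in> Hom E X (Cod E h)" by (rule E.Comp_Hom[OF E.Arr_Hom[OF f] t\<^sub>0])
      fix b assume b: "b \<in> D"
      note sb = is_stageD[OF stages[of b]]
      note cb = stage_coconeD[OF sb(3)]
      show "t\<^sub>0 \<cdot> proj (S b) \<in> Hom E (Dom E (proj (S b))) (Cod E h)" by (rule E.Comp_Hom[OF sb(7) t\<^sub>0])
      show "t\<^sub>0 \<cdot> proj (S b) \<cdot> seed (S b) = t\<^sub>0 \<cdot> f"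
        using E.Comp_assoc[OF cb(1) sb(7) t\<^sub>0] sb(4) by simp
      { fix i s t assume sq: "sqr i (proj (S b)) s t"
        note q = sqrD[OF sq]
        have t: "t \<in> Hom E (tgt i) Y" using q(4) sb(2) by simp
        show "t\<^sub>0 \<cdot> t \<in> Hom E (tgt i) (Cod E h)" by (rule E.Comp_Hom[OF t t\<^sub>0])
        show "t\<^sub>0 \<cdot> t \<cdot> fob u i = t\<^sub>0 \<cdot> proj (S b) \<cdot> s"
          using E.Comp_assoc[OF q(6) t t\<^sub>0] E.Comp_assoc[OF q(3) sb(7) t\<^sub>0] q(5) by simp
        fix j \<sigma> assume \<sigma>: "\<sigma> \<in> Hom I j i"
        show "t\<^sub>0 \<cdot> t \<cdot> ubot \<sigma> = t\<^sub>0 \<cdot> (t \<cdot> ubot \<sigma>)" by (rule E.Comp_assoc[OF gen_map(3)[OF \<sigma>] t t\<^sub>0]) }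
      fix a assume a: "a \<in> D" "(a, b) \<in> R"
      hence ab: "a \<in> below b" by simp
      show "t\<^sub>0 \<cdot> proj (S b) \<cdot> link (S b) a = t\<^sub>0 \<cdot> proj (S a)"
        using E.Comp_assoc[OF cb(2)[OF ab] sb(7) t\<^sub>0] sb(5)[OF ab] by simp
      fix i s t assume sq: "sqr i (proj (S a)) s t"
      show "t\<^sub>0 \<cdot> proj (S b) \<cdot> cell (S b) a i s t = t\<^sub>0 \<cdot> t"
        using E.Comp_assoc[OF cb(4)[OF ab sq] sb(7) t\<^sub>0] sb(6)[OF ab sq] by simp
    qed simp
  qed
  obtain m where m: "m \<in> Hom E (Dom E (proj st)) (Dom E h)" "mediates S D st s\<^sub>0 k ?c m"
    using is_stageD(8)[OF st cc] by blast
  have m': "m \<cdot> seed st = s\<^sub>0" "\<And>b. b \<in> D \<Longrightarrow> m \<cdot> link st b = k b"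
    "\<And>b i s t. b \<in> D \<Longrightarrow> sqr i (proj (S b)) s t \<Longrightarrow> m \<cdot> cell st b i s t = ?c b i s t"
    using m(2) by (auto simp: mediates_def)
  have hm: "h \<cdot> m = t\<^sub>0 \<cdot> proj st"
  proof (rule stage_map_eqI[OF st cY E.Comp_Hom[OF m(1) hH] _ E.Comp_Hom[OF is_stageD(7)[OF st] t\<^sub>0]])
    show "mediates S D st (t\<^sub>0 \<cdot> f) (\<lambda>b. t\<^sub>0 \<cdot> proj (S b)) (\<lambda>b i s t. t\<^sub>0 \<cdot> t) (t\<^sub>0 \<cdot> proj st)"
      unfolding mediates_def
      using E.Comp_assoc[OF c(1) is_stageD(7)[OF st] t\<^sub>0] is_stageD(4)[OF st]
        E.Comp_assoc[OF c(2) is_stageD(7)[OF st] t\<^sub>0] is_stageD(5)[OF st]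
        E.Comp_assoc[OF c(4) is_stageD(7)[OF st] t\<^sub>0] is_stageD(6)[OF st] by simp
    show "mediates S D st (t\<^sub>0 \<cdot> f) (\<lambda>b. t\<^sub>0 \<cdot> proj (S b)) (\<lambda>b i s t. t\<^sub>0 \<cdot> t) (h \<cdot> m)"
      unfolding mediates_def
      using E.Comp_assoc[OF c(1) m(1) hH] m'(1) sq E.Comp_assoc[OF c(2) m(1) hH] m'(2) kD(2)
        E.Comp_assoc[OF c(4) m(1) hH] m'(3) r(4)[OF k_sqr] by simp
  qed
  have "extends S h \<psi> s\<^sub>0 t\<^sub>0 D st m"
    unfolding extends_def using m(1) hm m' by simp
  moreover have "l = m" if l: "extends S h \<psi> s\<^sub>0 t\<^sub>0 D st l" for l
  proof (rule stage_map_eqI[OF st cc _ _ m])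
    show "l \<in> Hom E (Dom E (proj st)) (Dom E h)" using l by (simp add: extends_def)
    have ll: "l \<cdot> link st b = k b" if "b \<in> D" for b
      by (rule uniq[OF that extends_restrict[OF st l that D[OF that]]])
    show "mediates S D st s\<^sub>0 k ?c l"
      unfolding mediates_def
    proof (intro conjI ballI allI impI)
      show "l \<cdot> seed st = s\<^sub>0" using l by (simp add: extends_def)
      fix b assume b: "b \<in> D"
      show "l \<cdot> link st b = k b" by (rule ll[OF b])
      fix i s t assume "sqr i (proj (S b)) s t"
      thus "l \<cdot> cell st b i s t = ?c b i s t" using l b ll[OF b] unfolding extends_def by metis
    qed
  qed
  ultimately show ?thesis by blast
qed

lemma extends_unique: "\<exists>!k. extends S h \<psi> s\<^sub>0 t\<^sub>0 (below b) (S b) k"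
proof (induction b rule: wf_induct_rule[OF index(2)])
  case (1 b)
  show ?case
  proof (rule extends_step[OF stages])
    show "below a \<subseteq> below b" if "a \<in> below b" for a using that index(3) by (auto dest: transD)
  qed (use 1 in simp)
qed

end

definition stage_ftor :: "('l, 'l \<times> 'l, 'o, 'm) ftor" where
  "stage_ftor = \<lparr>fob = \<lambda>b. Dom E (proj (S b)),
     far = \<lambda>(a, b). if a = b then Ide E (Dom E (proj (S a))) else link (S b) a\<rparr>"

context
  fixes st :: "('l, 'i, 'm) stage"
  assumes st: "is_stage S \<Lambda> st"
begin

lemma limit_link:
  "b \<in> \<Lambda> \<Longrightarrow> link st b \<in> Hom E (Dom E (proj (S b))) (Dom E (proj st))"
  "b \<in> \<Lambda> \<Longrightarrow> link st b \<cdot> seed (S b) = seed st"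
  "b \<in> \<Lambda> \<Longrightarrow> proj st \<cdot> link st b = proj (S b)"
  using stage_coconeD[OF is_stageD(3)[OF st]] is_stageD(5)[OF st] by simp_all

lemma R_index: "(a, b) \<in> R \<Longrightarrow> a \<in> \<Lambda> \<and> b \<in> \<Lambda>"
  using index(1) by blast

lemma irrefl: "(a, a) \<notin> R"
  using wf_not_refl[OF index(2)] .

lemma stage_ftor_arr:
  assumes "a \<in> \<Lambda>" "b \<in> \<Lambda>" "a = b \<or> (a, b) \<in> R"
  shows "far stage_ftor (a, b) \<in> Hom E (Dom E (proj (S a))) (Dom E (proj (S b)))"
    "proj (S b) \<cdot> far stage_ftor (a, b) = proj (S a)"
    "far stage_ftor (a, b) \<cdot> seed (S a) = seed (S b)"
proof -
  have "\<And>b. b \<in> \<Lambda> \<Longrightarrow> is_stage S (below b) (S b)" by (rule stages)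
  note l = stage_link[OF this]
  note sa = is_stageD[OF stages[of a]]
  have ob: "Dom E (proj (S a)) \<in> Obj E" using sa(1) by simp
  have "far stage_ftor (a, b) \<in> Hom E (Dom E (proj (S a))) (Dom E (proj (S b))) \<and>
    proj (S b) \<cdot> far stage_ftor (a, b) = proj (S a) \<and> far stage_ftor (a, b) \<cdot> seed (S a) = seed (S b)"
  proof (cases "a = b")
    case True
    thus ?thesis using E.Id_Hom[OF ob] E.Comp_Id[OF sa(7)]
        E.Id_Comp[OF stage_coconeD(1)[OF sa(3)]] by (simp add: stage_ftor_def)
  next
    case False
    thus ?thesis using l[where a = a and b = b] assms by (simp add: stage_ftor_def)
  qed
  thus "far stage_ftor (a, b) \<in> Hom E (Dom E (proj (S a))) (Dom E (proj (S b)))"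
    "proj (S b) \<cdot> far stage_ftor (a, b) = proj (S a)"
    "far stage_ftor (a, b) \<cdot> seed (S a) = seed (S b)" by blast+
qed

lemma stage_ftor_functor: "is_functor chain E stage_ftor"
  unfolding is_functor_def
proof (intro conjI ballI allI)
  show "fob stage_ftor a \<in> Obj E" for a using is_stageD(1)[OF stages] by (simp add: stage_ftor_def)
  show "far stage_ftor g \<in> Hom E (fob stage_ftor a) (fob stage_ftor b)" if "g \<in> Hom chain a b" for a b g
    using stage_ftor_arr[of a b] that by (auto simp: stage_ftor_def)
  show "far stage_ftor (Ide chain a) = Ide E (fob stage_ftor a)" for a by (simp add: stage_ftor_def)
  fix a b d g k assume "g \<in> Hom chain a b" "k \<in> Hom chain b d"
  hence g: "g = (a, b)" "a \<in> \<Lambda>" "b \<in> \<Lambda>" "a = b \<or> (a, b) \<in> R"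
    and k: "k = (b, d)" "d \<in> \<Lambda>" "b = d \<or> (b, d) \<in> R" by auto
  note m = stage_ftor_arr[OF g(2-4)] and n = stage_ftor_arr[OF g(3) k(2,3)]
  have "far stage_ftor (a, d) = far stage_ftor (b, d) \<cdot> far stage_ftor (a, b)"
  proof (cases "a = b \<or> b = d")
    case True
    thus ?thesis using m(1) n(1) E.Id_Comp[OF m(1)] E.Comp_Id[OF n(1)] by (auto simp: stage_ftor_def)
  next
    case False
    hence R: "(a, b) \<in> R" "(b, d) \<in> R" using g k by auto
    hence "(a, d) \<in> R" using index(3) by (auto dest: transD)
    hence ne: "a \<noteq> d" using irrefl by blast
    have "link (S d) b \<cdot> link (S b) a = link (S d) a"
      using stage_coconeD(7)[OF is_stageD(3)[OF stages[of d]], of b a] R \<open>(a, d) \<in> R\<close> by simp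
    thus ?thesis using False ne by (simp add: stage_ftor_def)
  qed
  thus "far stage_ftor (k \<cdot>\<^bsub>chain\<^esub> g) = far stage_ftor k \<cdot> far stage_ftor g" using g k by simp
qed

lemma limit_link_comp:
  assumes "a \<in> \<Lambda>" "b \<in> \<Lambda>" "a = b \<or> (a, b) \<in> R"
  shows "link st b \<cdot> far stage_ftor (a, b) = link st a"
proof (cases "a = b")
  case True
  thus ?thesis using E.Comp_Id[OF limit_link(1)[OF assms(1)]] by (simp add: stage_ftor_def)
next
  case False
  thus ?thesis using stage_coconeD(7)[OF is_stageD(3)[OF st]] assms by (simp add: stage_ftor_def)
qed

text \<open>The universal object for all stages also carries the adjoined fillers, but these add nothing in
  the absence of a last stage: the fillers for squares into \<open>W\<^sub>b\<close> exist in every later stage, so a map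
  that is given on the stages has a prescribed value on them.\<close>

lemma limit_is_colimit: "is_colimit chain E stage_ftor (Dom E (proj st)) (link st)"
  unfolding is_colimit_def
proof (intro conjI allI impI)
  note c = stage_coconeD[OF is_stageD(3)[OF st]]
  show "is_cocone chain E stage_ftor (Dom E (proj st)) (link st)"
    unfolding is_cocone_def
  proof (intro conjI ballI allI)
    show "Dom E (proj st) \<in> Obj E" using is_stageD(1)[OF st] by simp
    show "link st b \<in> Hom E (fob stage_ftor b) (Dom E (proj st))" if "b \<in> Obj chain" for b
      using limit_link(1) that by (simp add: stage_ftor_def)
    show "link st b \<cdot> far stage_ftor g = link st a" if "g \<in> Hom chain a b" for a b g
      using limit_link_comp that by auto
  qed
  fix Z \<xi> assume "is_cocone chain E stage_ftor Z \<xi>"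
  hence \<xi>: "\<xi> b \<in> Hom E (Dom E (proj (S b))) Z" if "b \<in> \<Lambda>" for b
    using that by (simp add: is_cocone_def stage_ftor_def)
  have \<xi>_comp: "\<xi> b \<cdot> far stage_ftor (a, b) = \<xi> a" if "a \<in> \<Lambda>" "b \<in> \<Lambda>" "a = b \<or> (a, b) \<in> R" for a b
    using that \<open>is_cocone chain E stage_ftor Z \<xi>\<close> by (simp add: is_cocone_def)
  have \<xi>_link: "\<xi> b \<cdot> link (S b) a = \<xi> a" if "(a, b) \<in> R" for a b
  proof -
    have "a \<noteq> b" using irrefl that by blast
    thus ?thesis using \<xi>_comp[of a b] that R_index[OF that] by (simp add: stage_ftor_def)
  qed
  have seedH: "seed (S b) \<in> Hom E X (Dom E (proj (S b)))" for b
    by (rule stage_coconeD(1)[OF is_stageD(3)[OF stages]])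
  obtain b0 where b0: "b0 \<in> \<Lambda>" using nonempty by blast
  define x where "x = \<xi> b0 \<cdot> seed (S b0)"
  have \<xi>_seed: "\<xi> b \<cdot> seed (S b) = x" if b: "b \<in> \<Lambda>" for b
  proof -
    obtain d where d: "d \<in> \<Lambda>" "b = d \<or> (b, d) \<in> R" "b0 = d \<or> (b0, d) \<in> R"
      by (rule common_bound[OF b b0])
    have "\<xi> a \<cdot> seed (S a) = \<xi> d \<cdot> seed (S d)" if a: "a \<in> \<Lambda>" "a = d \<or> (a, d) \<in> R" for a
      using E.Comp_assoc[OF seedH stage_ftor_arr(1)[OF a(1) d(1) a(2)] \<xi>[OF d(1)]]
        \<xi>_comp[OF a(1) d(1) a(2)] stage_ftor_arr(3)[OF a(1) d(1) a(2)] by simp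
    thus ?thesis using b b0 d x_def by metis
  qed
  \<comment> \<open>The fillers at \<open>b\<close> live at every later stage, so \<open>\<xi>\<close> determines their images.\<close>
  define nx where "nx b = (SOME d. d \<in> \<Lambda> \<and> (b, d) \<in> R)" for b
  have nx: "nx b \<in> \<Lambda>" "(b, nx b) \<in> R" if "b \<in> \<Lambda>" for b
    using someI_ex[of "\<lambda>d. d \<in> \<Lambda> \<and> (b, d) \<in> R"] later[OF that] unfolding nx_def by blast+
  define cc where "cc b i s t = \<xi> (nx b) \<cdot> cell (S (nx b)) b i s t" for b i s t
  have cellH: "cell (S d) b i s t \<in> Hom E (tgt i) (Dom E (proj (S d)))"
    if "(b, d) \<in> R" "sqr i (proj (S b)) s t" for b d i s t
    using stage_coconeD(4)[OF is_stageD(3)[OF stages[of d]]] that by simp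
  have \<xi>_cell: "\<xi> d \<cdot> cell (S d) b i s t = cc b i s t" if bd: "(b, d) \<in> R" and sq: "sqr i (proj (S b)) s t"
    for b d i s t
  proof -
    have b: "b \<in> \<Lambda>" "d \<in> \<Lambda>" using R_index[OF bd] by auto
    obtain e where e: "e \<in> \<Lambda>" "d = e \<or> (d, e) \<in> R" "nx b = e \<or> (nx b, e) \<in> R"
      by (rule common_bound[OF b(2) nx(1)[OF b(1)]])
    have "\<xi> d' \<cdot> cell (S d') b i s t = \<xi> e \<cdot> cell (S e) b i s t"
      if d': "(b, d') \<in> R" "d' = e \<or> (d', e) \<in> R" for d'
    proof (cases "d' = e")
      case False
      hence de: "(d', e) \<in> R" using d' by simp
      have be: "(b, e) \<in> R" using index(3) d'(1) de by (rule transD)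
      have li: "link (S e) d' \<in> Hom E (Dom E (proj (S d'))) (Dom E (proj (S e)))"
        using stage_coconeD(2)[OF is_stageD(3)[OF stages[of e]]] de by simp
      have "link (S e) d' \<cdot> cell (S d') b i s t = cell (S e) b i s t"
        using stage_coconeD(8)[OF is_stageD(3)[OF stages[of e]], of d' b] de be d'(1) sq by simp
      thus ?thesis using E.Comp_assoc[OF cellH[OF d'(1) sq] li \<xi>[OF e(1)]] \<xi>_link[OF de] by simp
    qed simp
    thus ?thesis unfolding cc_def using bd nx(2)[OF b(1)] e by metis
  qed
  have cx: "stage_cocone S \<Lambda> Z x \<xi> cc"
  proof (rule stage_coconeI)
    show "x \<in> Hom E X Z" unfolding x_def by (rule E.Comp_Hom[OF seedH \<xi>[OF b0]])
    fix b assume b: "b \<in> \<Lambda>"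
    note d = nx[OF b]
    note sd = stage_coconeD[OF is_stageD(3)[OF stages[of "nx b"]]]
    show "\<xi> b \<in> Hom E (Dom E (proj (S b))) Z" "\<xi> b \<cdot> seed (S b) = x" using \<xi> \<xi>_seed b by auto
    have bd: "b \<in> below (nx b)" using d by simp
    { fix i s t assume sq: "sqr i (proj (S b)) s t"
      note q = sqrD[OF sq]
      show "cc b i s t \<in> Hom E (tgt i) Z" unfolding cc_def by (rule E.Comp_Hom[OF cellH[OF d(2) sq] \<xi>[OF d(1)]])
      show "cc b i s t \<cdot> fob u i = \<xi> b \<cdot> s"
        unfolding cc_def
        using E.Comp_assoc[OF q(6) cellH[OF d(2) sq] \<xi>[OF d(1)]] sd(5)[OF bd sq]
          E.Comp_assoc[OF q(3) sd(2)[OF bd] \<xi>[OF d(1)]] \<xi>_link[OF d(2)] by simp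
      fix j \<sigma> assume \<sigma>: "\<sigma> \<in> Hom I j i"
      show "cc b i s t \<cdot> ubot \<sigma> = cc b j (s \<cdot> utop \<sigma>) (t \<cdot> ubot \<sigma>)"
        unfolding cc_def
        using E.Comp_assoc[OF gen_map(3)[OF \<sigma>] cellH[OF d(2) sq] \<xi>[OF d(1)]] sd(6)[OF bd sq \<sigma>] by simp }
    fix a assume a: "a \<in> \<Lambda>" "(a, b) \<in> R"
    have ad: "(a, nx b) \<in> R" using index(3) a(2) d(2) by (rule transD)
    show "\<xi> b \<cdot> link (S b) a = \<xi> a" by (rule \<xi>_link[OF a(2)])
    fix i s t assume sq: "sqr i (proj (S a)) s t"
    show "\<xi> b \<cdot> cell (S b) a i s t = cc a i s t" by (rule \<xi>_cell[OF a(2) sq])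
    have "cc b i (link (S b) a \<cdot> s) t = \<xi> (nx b) \<cdot> cell (S (nx b)) a i s t"
      unfolding cc_def using sd(9)[OF bd _ a(2) sq] ad by simp
    also have "\<dots> = cc a i s t" by (rule \<xi>_cell[OF ad sq])
    finally show "cc b i (link (S b) a \<cdot> s) t = cc a i s t" .
  qed
  have "(\<forall>j\<in>\<Lambda>. k \<cdot> link st j = \<xi> j) \<longleftrightarrow> mediates S \<Lambda> st x \<xi> cc k" if k: "k \<in> Hom E (Dom E (proj st)) Z" for k
  proof
    assume m: "\<forall>j\<in>\<Lambda>. k \<cdot> link st j = \<xi> j"
    show "mediates S \<Lambda> st x \<xi> cc k"
      unfolding mediates_def
    proof (intro conjI ballI allI impI)
      show "k \<cdot> seed st = x"
        using E.Comp_assoc[OF seedH limit_link(1)[OF b0] k] limit_link(2)[OF b0] m b0 x_def by simp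
      fix b assume b: "b \<in> \<Lambda>"
      show "k \<cdot> link st b = \<xi> b" using m b by simp
      fix i s t assume sq: "sqr i (proj (S b)) s t"
      note d = nx[OF b]
      show "k \<cdot> cell st b i s t = cc b i s t"
        using E.Comp_assoc[OF cellH[OF d(2) sq] limit_link(1)[OF d(1)] k] m d(1)
          c(8)[OF d(1) b d(2) sq] by (simp add: cc_def)
    qed
  qed (simp add: mediates_def)
  thus "\<exists>!k. k \<in> Hom E (Dom E (proj st)) Z \<and> (\<forall>j\<in>Obj chain. k \<cdot> link st j = \<xi> j)"
    using is_stageD(8)[OF st cx] by auto
qed

text \<open>Here, and in \<open>cell_unique\<close>, compactness of the domains of the generators is used.\<close>

lemma factor_stage:
  assumes sq: "sqr i (proj st) s t"
  obtains b s' where "b \<in> \<Lambda>" "sqr i (proj (S b)) s' t" "s = link st b \<cdot> s'"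
proof -
  note q = sqrD[OF sq]
  note cm = compact[OF q(1), unfolded compact_for_def, rule_format, OF conjI[OF stage_ftor_functor limit_is_colimit]]
  obtain b s' where b: "b \<in> \<Lambda>" "s' \<in> Hom E (src i) (Dom E (proj (S b)))" "s = link st b \<cdot> s'"
    using cm[THEN conjunct1] q(3) by (auto simp: stage_ftor_def)
  note sb = is_stageD[OF stages[of b]]
  have "proj (S b) \<cdot> s' = t \<cdot> fob u i"
    using E.Comp_assoc[OF b(2) limit_link(1)[OF b(1)] q(7)] limit_link(3)[OF b(1)] q(5) b(3) by simp
  hence "sqr i (proj (S b)) s' t"
    using q(1,4) b(2) sb(1,2) is_stageD(2)[OF st] by (simp add: sqr_iff)
  thus ?thesis using that b by blast
qed

lemma cell_later:
  assumes "a \<in> \<Lambda>" "d \<in> \<Lambda>" "a = d \<or> (a, d) \<in> R" and sq: "sqr i (proj (S a)) s t"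
  shows "sqr i (proj (S d)) (far stage_ftor (a, d) \<cdot> s) t"
    "cell st d i (far stage_ftor (a, d) \<cdot> s) t = cell st a i s t"
proof -
  show "sqr i (proj (S d)) (far stage_ftor (a, d) \<cdot> s) t"
    by (rule sqr_postcomp_over[OF sq])
      (use stage_ftor_arr[OF assms(1-3)] is_stageD(1,2)[OF stages] in simp_all)
  show "cell st d i (far stage_ftor (a, d) \<cdot> s) t = cell st a i s t"
  proof (cases "a = d")
    case True
    thus ?thesis using E.Id_Comp[OF sqrD(3)[OF sq]] by (simp add: stage_ftor_def)
  next
    case False
    thus ?thesis using stage_coconeD(9)[OF is_stageD(3)[OF st] assms(2,1) _ sq] assms(3)
      by (simp add: stage_ftor_def)
  qed
qed

text \<open>Two representatives of a square into the colimit are identified at a later stage, and squares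
  keep their fillers when they move to a later stage.\<close>

lemma cell_unique:
  assumes a: "a \<in> \<Lambda>" "sqr i (proj (S a)) s t" and b: "b \<in> \<Lambda>" "sqr i (proj (S b)) s' t"
    and eq: "link st a \<cdot> s = link st b \<cdot> s'"
  shows "cell st a i s t = cell st b i s' t"
proof -
  obtain d where d: "d \<in> \<Lambda>" "a = d \<or> (a, d) \<in> R" "b = d \<or> (b, d) \<in> R"
    by (rule common_bound[OF a(1) b(1)])
  note A = cell_later[OF a(1) d(1,2) a(2)] and B = cell_later[OF b(1) d(1,3) b(2)]
  note q = sqrD[OF a(2)] and q' = sqrD[OF b(2)]
  let ?y = "far stage_ftor (a, d) \<cdot> s" and ?y' = "far stage_ftor (b, d) \<cdot> s'"
  note cm = compact[OF q(1), unfolded compact_for_def, rule_format, OF conjI[OF stage_ftor_functor limit_is_colimit]]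
  have "link st d \<cdot> ?y = link st d \<cdot> ?y'"
    using E.Comp_assoc[OF q(3) stage_ftor_arr(1)[OF a(1) d(1,2)] limit_link(1)[OF d(1)]]
      E.Comp_assoc[OF q'(3) stage_ftor_arr(1)[OF b(1) d(1,3)] limit_link(1)[OF d(1)]]
      limit_link_comp[OF a(1) d(1,2)] limit_link_comp[OF b(1) d(1,3)] eq by simp
  moreover have "?y \<in> Hom E (src i) (fob stage_ftor d)" "?y' \<in> Hom E (src i) (fob stage_ftor d)"
    using sqrD(3)[OF A(1)] sqrD(3)[OF B(1)] by (simp_all add: stage_ftor_def)
  moreover have "d \<in> Obj chain" using d by simp
  ultimately have "\<exists>k. \<exists>f\<in>Hom chain d k. far stage_ftor f \<cdot> ?y = far stage_ftor f \<cdot> ?y'"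
    using cm[THEN conjunct2] by blast
  then obtain e where e: "e \<in> \<Lambda>" "d = e \<or> (d, e) \<in> R"
    "far stage_ftor (d, e) \<cdot> ?y = far stage_ftor (d, e) \<cdot> ?y'" by auto
  show ?thesis
    using A(2) B(2) cell_later(2)[OF d(1) e(1,2) A(1)] cell_later(2)[OF d(1) e(1,2) B(1)] e(3) by simp
qed

text \<open>By \<open>cell_unique\<close> the filler does not depend on the stage through which the square is factored.\<close>

definition filler :: "'i \<Rightarrow> 'm sq \<Rightarrow> 'm" where
  "filler i q = (if i \<in> Obj I \<and> q \<in> Hom (arrow_cat E) (fob u i) (proj st)
     then SOME h. \<exists>b s. b \<in> \<Lambda> \<and> sqr i (proj (S b)) s (sq_bot q) \<and> sq_top q = link st b \<cdot> s \<and>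
            h = cell st b i s (sq_bot q)
     else undefined)"

lemma filler_cell:
  assumes b: "b \<in> \<Lambda>" and sq: "sqr i (proj (S b)) s t"
  shows "filler i (Sq (fob u i) (proj st) (link st b \<cdot> s) t) = cell st b i s t"
proof -
  let ?q = "Sq (fob u i) (proj st) (link st b \<cdot> s) t"
  have "sqr i (proj st) (link st b \<cdot> s) t"
    by (rule sqr_postcomp_over[OF sq])
      (use limit_link[OF b] is_stageD(1,2)[OF st] is_stageD(2)[OF stages] in simp_all)
  hence "i \<in> Obj I \<and> ?q \<in> Hom (arrow_cat E) (fob u i) (proj st)" by (simp add: sqr_def)
  hence "filler i ?q = (SOME h. \<exists>b' s'. b' \<in> \<Lambda> \<and> sqr i (proj (S b')) s' t \<and>
      link st b \<cdot> s = link st b' \<cdot> s' \<and> h = cell st b' i s' t)" by (simp add: filler_def)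
  also have "\<dots> = cell st b i s t"
  proof (rule some_equality)
    show "\<exists>b' s'. b' \<in> \<Lambda> \<and> sqr i (proj (S b')) s' t \<and> link st b \<cdot> s = link st b' \<cdot> s' \<and>
        cell st b i s t = cell st b' i s' t" using b sq by blast
  next
    fix h assume "\<exists>b' s'. b' \<in> \<Lambda> \<and> sqr i (proj (S b')) s' t \<and> link st b \<cdot> s = link st b' \<cdot> s' \<and>
        h = cell st b' i s' t"
    thus "h = cell st b i s t" using cell_unique[OF b sq] by auto
  qed
  finally show ?thesis .
qed

lemma right_map_limit: "right_map E I u (proj st, filler)"
  unfolding right_map_def prod.case
proof (intro conjI ballI allI impI)
  note c = stage_coconeD[OF is_stageD(3)[OF st]]
  show "proj st \<in> Arr E" by (rule is_stageD(1)[OF st])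
  show "filler i q = undefined"
    if "\<not> (i \<in> Obj I \<and> q \<in> Hom (arrow_cat E) (fob u i) (proj st))" for i q
    unfolding filler_def by (rule if_not_P[OF that])
  show "is_filler E q (filler i q)"
    if i: "i \<in> Obj I" and q: "q \<in> Hom (arrow_cat E) (fob u i) (proj st)" for i q
  proof -
    obtain s t where qe: "q = Sq (fob u i) (proj st) s t" using E.Sq_HomE[OF q] by metis
    have "sqr i (proj st) s t" using i q by (simp add: sqr_def qe)
    then obtain b s' where b: "b \<in> \<Lambda>" "sqr i (proj (S b)) s' t" "s = link st b \<cdot> s'" by (rule factor_stage)
    have "filler i q = cell st b i s' t" unfolding qe b(3) by (rule filler_cell[OF b(1,2)])
    thus ?thesis using c(4,5)[OF b(1,2)] is_stageD(6)[OF st b(1,2)] b(3) by (simp add: is_filler_def qe)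
  qed
  fix i j \<sigma> q assume \<sigma>: "\<sigma> \<in> Hom I i j" and q: "q \<in> Hom (arrow_cat E) (fob u j) (proj st)"
  obtain s t where qe: "q = Sq (fob u j) (proj st) s t" using E.Sq_HomE[OF q] by metis
  have "sqr j (proj st) s t" using gen_map(5)[OF \<sigma>] q by (simp add: sqr_def qe)
  then obtain b s' where b: "b \<in> \<Lambda>" "sqr j (proj (S b)) s' t" "s = link st b \<cdot> s'" by (rule factor_stage)
  have "filler j q = cell st b j s' t" unfolding qe b(3) by (rule filler_cell[OF b(1,2)])
  hence "filler j q \<cdot> ubot \<sigma> = cell st b i (s' \<cdot> utop \<sigma>) (t \<cdot> ubot \<sigma>)" using c(6)[OF b(1,2) \<sigma>] by simp
  also have "\<dots> = filler i (Sq (fob u i) (proj st) (link st b \<cdot> (s' \<cdot> utop \<sigma>)) (t \<cdot> ubot \<sigma>))"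
    by (rule filler_cell[OF b(1) sqr_precomp[OF b(2) \<sigma>], symmetric])
  also have "link st b \<cdot> (s' \<cdot> utop \<sigma>) = s \<cdot> utop \<sigma>"
    unfolding b(3) using E.Comp_assoc[OF gen_map(2)[OF \<sigma>] sqrD(3)[OF b(2)] limit_link(1)[OF b(1)]] by simp
  finally show "filler j q \<cdot> ubot \<sigma> = filler i (q \<cdot>\<^bsub>arrow_cat E\<^esub> far u \<sigma>)"
    using E.HomA_D(1)[OF gen_map(1)[OF \<sigma>]] by (simp add: qe)
qed

lemma limit_free:
  assumes h: "right_map E I u (h, \<psi>)" and sq: "Sq f h s\<^sub>0 t\<^sub>0 \<in> Hom (arrow_cat E) f h"
  shows "\<exists>!k. k \<cdot> seed st = s\<^sub>0 \<and> Sq (proj st) h k t\<^sub>0 \<in> Hom (arrow_cat E) (proj st) h \<and>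
    (\<forall>i\<in>Obj I. \<forall>q\<in>Hom (arrow_cat E) (fob u i) (proj st).
       k \<cdot> filler i q = \<psi> i (Sq (proj st) h k t\<^sub>0 \<cdot>\<^bsub>arrow_cat E\<^esub> q))"
proof -
  have s\<^sub>0: "s\<^sub>0 \<in> Hom E X (Dom E h)" and t\<^sub>0: "t\<^sub>0 \<in> Hom E Y (Cod E h)" and eq: "h \<cdot> s\<^sub>0 = t\<^sub>0 \<cdot> f"
    using sq by (auto simp: E.Sq_Hom_iff)
  have "\<exists>!k. extends S h \<psi> s\<^sub>0 t\<^sub>0 \<Lambda> st k"
    by (rule extends_step[OF h s\<^sub>0 t\<^sub>0 eq st below_index extends_unique[OF h s\<^sub>0 t\<^sub>0 eq]])
  moreover have "extends S h \<psi> s\<^sub>0 t\<^sub>0 \<Lambda> st k \<longleftrightarrow>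
    k \<cdot> seed st = s\<^sub>0 \<and> Sq (proj st) h k t\<^sub>0 \<in> Hom (arrow_cat E) (proj st) h \<and>
    (\<forall>i\<in>Obj I. \<forall>q\<in>Hom (arrow_cat E) (fob u i) (proj st).
       k \<cdot> filler i q = \<psi> i (Sq (proj st) h k t\<^sub>0 \<cdot>\<^bsub>arrow_cat E\<^esub> q))" (is "_ \<longleftrightarrow> ?R") for k
  proof
    assume k: "extends S h \<psi> s\<^sub>0 t\<^sub>0 \<Lambda> st k"
    have kH: "k \<in> Hom E (Dom E (proj st)) (Dom E h)" using k by (simp add: extends_def)
    show ?R
    proof (intro conjI ballI)
      show "k \<cdot> seed st = s\<^sub>0" using k by (simp add: extends_def)
      show "Sq (proj st) h k t\<^sub>0 \<in> Hom (arrow_cat E) (proj st) h"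
        using k t\<^sub>0 is_stageD(1,2)[OF st] right_mapD(1)[OF h] by (simp add: extends_def E.Sq_Hom_iff)
      fix i q assume i: "i \<in> Obj I" and q: "q \<in> Hom (arrow_cat E) (fob u i) (proj st)"
      obtain s t where qe: "q = Sq (fob u i) (proj st) s t" using E.Sq_HomE[OF q] by metis
      have "sqr i (proj st) s t" using i q by (simp add: sqr_def qe)
      then obtain b s' where b: "b \<in> \<Lambda>" "sqr i (proj (S b)) s' t" "s = link st b \<cdot> s'" by (rule factor_stage)
      have "k \<cdot> filler i q = k \<cdot> cell st b i s' t" unfolding qe b(3) using filler_cell[OF b(1,2)] by simp
      also have "\<dots> = \<psi> i (Sq (fob u i) h (k \<cdot> link st b \<cdot> s') (t\<^sub>0 \<cdot> t))"
        using k b(1,2) unfolding extends_def by blast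
      also have "k \<cdot> link st b \<cdot> s' = k \<cdot> s"
        using E.Comp_assoc[OF sqrD(3)[OF b(2)] limit_link(1)[OF b(1)] kH] b(3) by simp
      finally show "k \<cdot> filler i q = \<psi> i (Sq (proj st) h k t\<^sub>0 \<cdot>\<^bsub>arrow_cat E\<^esub> q)" by (simp add: qe)
    qed
  next
    assume R: ?R
    hence kH: "k \<in> Hom E (Dom E (proj st)) (Dom E h)" and hk: "h \<cdot> k = t\<^sub>0 \<cdot> proj st"
      by (auto simp: E.Sq_Hom_iff)
    show "extends S h \<psi> s\<^sub>0 t\<^sub>0 \<Lambda> st k"
      unfolding extends_def
    proof (intro conjI ballI allI impI)
      show "k \<cdot> seed st = s\<^sub>0" using R by blast
      fix b i s t assume b: "b \<in> \<Lambda>" and s: "sqr i (proj (S b)) s t"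
      have "sqr i (proj st) (link st b \<cdot> s) t"
        by (rule sqr_postcomp_over[OF s])
          (use limit_link[OF b] is_stageD(1,2)[OF st] is_stageD(2)[OF stages] in simp_all)
      hence "k \<cdot> filler i (Sq (fob u i) (proj st) (link st b \<cdot> s) t) =
          \<psi> i (Sq (proj st) h k t\<^sub>0 \<cdot>\<^bsub>arrow_cat E\<^esub> Sq (fob u i) (proj st) (link st b \<cdot> s) t)"
        using R unfolding sqr_def by blast
      thus "k \<cdot> cell st b i s t = \<psi> i (Sq (fob u i) h (k \<cdot> link st b \<cdot> s) (t\<^sub>0 \<cdot> t))"
        using filler_cell[OF b s] E.Comp_assoc[OF sqrD(3)[OF s] limit_link(1)[OF b] kH] by simp
    qed fact+
  qed
  ultimately show ?thesis by simp
qed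

end
end
end

text \<open>The value at \<open>f\<close> of the left adjoint of the forgetful functor from right maps to arrows. The unit \<open>l\<close>
  is the identity on codomains.\<close>

definition free_right_map ::
  "('o, 'm) cat \<Rightarrow> ('i, 'j) cat \<Rightarrow> ('i, 'j, 'm, 'm sq) ftor \<Rightarrow> 'm \<Rightarrow> 'm \<Rightarrow> 'm \<Rightarrow> ('i \<Rightarrow> 'm sq \<Rightarrow> 'm) \<Rightarrow> bool"
  where
  "free_right_map E I u f l r \<phi> \<longleftrightarrow> l \<in> Hom E (Dom E f) (Dom E r) \<and> r \<in> Hom E (Dom E r) (Cod E f) \<and>
     r \<cdot>\<^bsub>E\<^esub> l = f \<and> right_map E I u (r, \<phi>) \<and>
     (\<forall>h \<psi> s t. right_map E I u (h, \<psi>) \<and> Sq f h s t \<in> Hom (arrow_cat E) f h \<longrightarrow>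
        (\<exists>!k. k \<cdot>\<^bsub>E\<^esub> l = s \<and> Sq r h k t \<in> Hom (arrow_cat E) r h \<and>
           (\<forall>i\<in>Obj I. \<forall>q\<in>Hom (arrow_cat E) (fob u i) r.
              k \<cdot>\<^bsub>E\<^esub> \<phi> i q = \<psi> i (Sq r h k t \<cdot>\<^bsub>arrow_cat E\<^esub> q))))"

theorem (in small_universe) free_right_map_exists:
  fixes E :: "('o, 'm) cat" and I :: "('i, 'j) cat"
  assumes E: "category E" "locally_presentable \<kappa> E" and I: "small_category \<kappa> I"
    and u: "is_functor I (arrow_cat E) u" and f: "f \<in> Arr E"
  shows "\<exists>l r \<phi>. free_right_map E I u f l r \<phi>"
proof -
  interpret IM: indexed_maps E I u
    using E I u by (simp add: indexed_maps_def indexed_maps_axioms_def small_category_def)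
  have "small \<kappa> ((\<lambda>i. Dom E (fob u i)) ` Obj I)" "(\<lambda>i. Dom E (fob u i)) ` Obj I \<subseteq> Obj E"
    using I IM.gen_arr by (auto simp: small_category_def small_image)
  then obtain \<Lambda> :: "('u + 'o \<times> 'u) set set" and R and Q :: "('u + 'o \<times> 'u) set"
    where \<Lambda>: "long_chain \<kappa> \<Lambda> R Q"
      "\<And>a. a \<in> (\<lambda>i. Dom E (fob u i)) ` Obj I \<Longrightarrow> compact_for (chain_cat \<Lambda> R) E a"
    by (rule long_chain_exists[OF E]) blast
  interpret long_chain \<kappa> \<Lambda> R Q by fact
  interpret cell_chain \<kappa> \<Lambda> R Q E I u f
    by unfold_locales (use E(2) I f \<Lambda>(2) in \<open>auto simp: locally_presentable_def\<close>)
  obtain S where S: "\<And>b. is_stage S (below b) (S b)" using stage_family_exists by blast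
  then obtain st where st: "is_stage S \<Lambda> st" using stage_exists[of \<Lambda> S] by blast
  have "free_right_map E I u f (seed st) (proj st) (filler S st)"
    unfolding free_right_map_def
    using stage_coconeD(1)[OF is_stageD(3)[OF st]] is_stageD(4,7)[OF st] right_map_limit[OF S st]
      limit_free[OF S st] by simp
  thus ?thesis by blast
qed

section \<open>The factorization system given by free right maps\<close>

context indexed_maps
begin

lemma right_mapI:
  assumes "h \<in> Arr E"
    "\<And>i s t. sqr i h s t \<Longrightarrow> \<psi> i (Sq (fob u i) h s t) \<in> Hom E (tgt i) (Dom E h)"
    "\<And>i s t. sqr i h s t \<Longrightarrow> \<psi> i (Sq (fob u i) h s t) \<cdot> fob u i = s"
    "\<And>i s t. sqr i h s t \<Longrightarrow> h \<cdot> \<psi> i (Sq (fob u i) h s t) = t"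
    "\<And>i j \<sigma> s t. sqr j h s t \<Longrightarrow> \<sigma> \<in> Hom I i j \<Longrightarrow>
       \<psi> j (Sq (fob u j) h s t) \<cdot> ubot \<sigma> = \<psi> i (Sq (fob u i) h (s \<cdot> utop \<sigma>) (t \<cdot> ubot \<sigma>))"
    "\<And>i q. \<not> (i \<in> Obj I \<and> q \<in> Hom (arrow_cat E) (fob u i) h) \<Longrightarrow> \<psi> i q = undefined"
  shows "right_map E I u (h, \<psi>)"
  unfolding right_map_def prod.case
proof (intro conjI ballI allI impI)
  show "h \<in> Arr E" by fact
  show "\<psi> i q = undefined" if "\<not> (i \<in> Obj I \<and> q \<in> Hom (arrow_cat E) (fob u i) h)" for i q
    using assms(6) that by blast
  fix i q assume i: "i \<in> Obj I" and q: "q \<in> Hom (arrow_cat E) (fob u i) h"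
  obtain s t where qe: "q = Sq (fob u i) h s t" using E.Sq_HomE[OF q] by metis
  have "sqr i h s t" using i q by (simp add: sqr_def qe)
  thus "is_filler E q (\<psi> i q)" using assms(2-4) by (simp add: is_filler_def qe)
next
  fix i j \<sigma> q assume \<sigma>: "\<sigma> \<in> Hom I i j" and q: "q \<in> Hom (arrow_cat E) (fob u j) h"
  obtain s t where qe: "q = Sq (fob u j) h s t" using E.Sq_HomE[OF q] by metis
  have "sqr j h s t" using gen_map(5)[OF \<sigma>] q by (simp add: sqr_def qe)
  thus "\<psi> j q \<cdot> ubot \<sigma> = \<psi> i (q \<cdot>\<^bsub>arrow_cat E\<^esub> far u \<sigma>)"
    using assms(5)[OF _ \<sigma>] E.HomA_D(1)[OF gen_map(1)[OF \<sigma>]] by (simp add: qe)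
qed

definition rmor ::
  "'m \<Rightarrow> ('i \<Rightarrow> 'm sq \<Rightarrow> 'm) \<Rightarrow> 'm \<Rightarrow> ('i \<Rightarrow> 'm sq \<Rightarrow> 'm) \<Rightarrow> 'm \<Rightarrow> 'm \<Rightarrow> bool" where
  "rmor g \<phi> h \<psi> a b \<longleftrightarrow> Sq g h a b \<in> Hom (arrow_cat E) g h \<and>
     (\<forall>i s t. sqr i g s t \<longrightarrow> a \<cdot> \<phi> i (Sq (fob u i) g s t) = \<psi> i (Sq (fob u i) h (a \<cdot> s) (b \<cdot> t)))"

lemma rmorD:
  assumes "rmor g \<phi> h \<psi> a b"
  shows "Sq g h a b \<in> Hom (arrow_cat E) g h" "g \<in> Arr E" "h \<in> Arr E"
    "a \<in> Hom E (Dom E g) (Dom E h)" "b \<in> Hom E (Cod E g) (Cod E h)" "h \<cdot> a = b \<cdot> g"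
    "sqr i g s t \<Longrightarrow> a \<cdot> \<phi> i (Sq (fob u i) g s t) = \<psi> i (Sq (fob u i) h (a \<cdot> s) (b \<cdot> t))"
  using assms by (auto simp: rmor_def E.Sq_Hom_iff)

lemma rmorI:
  assumes "g \<in> Arr E" "h \<in> Arr E" "a \<in> Hom E (Dom E g) (Dom E h)" "b \<in> Hom E (Cod E g) (Cod E h)"
    "h \<cdot> a = b \<cdot> g"
    "\<And>i s t. sqr i g s t \<Longrightarrow> a \<cdot> \<phi> i (Sq (fob u i) g s t) = \<psi> i (Sq (fob u i) h (a \<cdot> s) (b \<cdot> t))"
  shows "rmor g \<phi> h \<psi> a b"
  using assms by (simp add: rmor_def E.Sq_Hom_iff)

lemma rmor_iff_squares:
  "rmor g \<phi> h \<psi> a b \<longleftrightarrow> Sq g h a b \<in> Hom (arrow_cat E) g h \<and>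
     (\<forall>i\<in>Obj I. \<forall>q\<in>Hom (arrow_cat E) (fob u i) g. a \<cdot> \<phi> i q = \<psi> i (Sq g h a b \<cdot>\<^bsub>arrow_cat E\<^esub> q))"
proof -
  have "(\<forall>i s t. sqr i g s t \<longrightarrow> a \<cdot> \<phi> i (Sq (fob u i) g s t) = \<psi> i (Sq (fob u i) h (a \<cdot> s) (b \<cdot> t))) \<longleftrightarrow>
      (\<forall>i\<in>Obj I. \<forall>q\<in>Hom (arrow_cat E) (fob u i) g. a \<cdot> \<phi> i q = \<psi> i (Sq g h a b \<cdot>\<^bsub>arrow_cat E\<^esub> q))"
    (is "?l \<longleftrightarrow> ?r")
  proof
    assume l: ?l
    show ?r
    proof (intro ballI)
      fix i q assume i: "i \<in> Obj I" and q: "q \<in> Hom (arrow_cat E) (fob u i) g"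
      obtain s t where qe: "q = Sq (fob u i) g s t" using E.Sq_HomE[OF q] by metis
      have "sqr i g s t" using i q by (simp add: sqr_def qe)
      thus "a \<cdot> \<phi> i q = \<psi> i (Sq g h a b \<cdot>\<^bsub>arrow_cat E\<^esub> q)" using l by (simp add: qe)
    qed
  next
    assume r: ?r
    show ?l
    proof (intro allI impI)
      fix i s t assume "sqr i g s t"
      hence "a \<cdot> \<phi> i (Sq (fob u i) g s t) = \<psi> i (Sq g h a b \<cdot>\<^bsub>arrow_cat E\<^esub> Sq (fob u i) g s t)"
        using r unfolding sqr_def by blast
      thus "a \<cdot> \<phi> i (Sq (fob u i) g s t) = \<psi> i (Sq (fob u i) h (a \<cdot> s) (b \<cdot> t))" by simp
    qed
  qed
  thus ?thesis by (simp add: rmor_def)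
qed

lemma rmor_sqr:
  assumes "rmor g \<phi> h \<psi> a b" "sqr i g s t"
  shows "sqr i h (a \<cdot> s) (b \<cdot> t)"
  by (rule sqr_postcomp[OF assms(2)]) (use rmorD[OF assms(1)] in auto)

lemma rmor_comp:
  assumes g: "right_map E I u (g, \<phi>)" and a: "rmor g \<phi> h \<psi> a b" and c: "rmor h \<psi> k \<chi> a' b'"
  shows "rmor g \<phi> k \<chi> (a' \<cdot> a) (b' \<cdot> b)"
proof (rule rmorI)
  note A = rmorD[OF a] and C = rmorD[OF c]
  show "g \<in> Arr E" "k \<in> Arr E" by fact+
  show "a' \<cdot> a \<in> Hom E (Dom E g) (Dom E k)" "b' \<cdot> b \<in> Hom E (Cod E g) (Cod E k)"
    using E.Comp_Hom A(4,5) C(4,5) by blast+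
  show "k \<cdot> (a' \<cdot> a) = b' \<cdot> b \<cdot> g" using E.pasting[OF A(1) C(1)] by simp
  fix i s t assume sq: "sqr i g s t"
  note q = sqrD[OF sq]
  have "a' \<cdot> a \<cdot> \<phi> i (Sq (fob u i) g s t) = a' \<cdot> \<psi> i (Sq (fob u i) h (a \<cdot> s) (b \<cdot> t))"
    using E.Comp_assoc[OF right_mapD(2)[OF g sq] A(4) C(4)] A(7)[OF sq] by simp
  also have "\<dots> = \<chi> i (Sq (fob u i) k (a' \<cdot> (a \<cdot> s)) (b' \<cdot> (b \<cdot> t)))" by (rule C(7)[OF rmor_sqr[OF a sq]])
  finally show "a' \<cdot> a \<cdot> \<phi> i (Sq (fob u i) g s t) = \<chi> i (Sq (fob u i) k (a' \<cdot> a \<cdot> s) (b' \<cdot> b \<cdot> t))"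
    using E.Comp_assoc[OF q(3) A(4) C(4)] E.Comp_assoc[OF q(4) A(5) C(5)] by simp
qed

lemma rmor_comp':
  assumes "right_map E I u (g, \<phi>)" "rmor g \<phi> h \<psi> a b" "rmor h \<psi> k \<chi> a' b'" "b' \<cdot> b = d"
  shows "rmor g \<phi> k \<chi> (a' \<cdot> a) d"
  using rmor_comp[OF assms(1-3)] assms(4) by simp

lemma rmor_id:
  assumes g: "right_map E I u (g, \<phi>)"
  shows "rmor g \<phi> g \<phi> (Ide E (Dom E g)) (Ide E (Cod E g))"
proof (rule rmorI)
  have gA: "g \<in> Arr E" by (rule right_mapD(1)[OF g])
  show "g \<in> Arr E" "g \<in> Arr E" by fact+
  show "Ide E (Dom E g) \<in> Hom E (Dom E g) (Dom E g)" "Ide E (Cod E g) \<in> Hom E (Cod E g) (Cod E g)"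
    using gA by (simp_all add: E.Id_Hom)
  show "g \<cdot> Ide E (Dom E g) = Ide E (Cod E g) \<cdot> g" using gA by simp
  fix i s t assume sq: "sqr i g s t"
  show "Ide E (Dom E g) \<cdot> \<phi> i (Sq (fob u i) g s t) =
      \<phi> i (Sq (fob u i) g (Ide E (Dom E g) \<cdot> s) (Ide E (Cod E g) \<cdot> t))"
    using E.Id_Comp[OF right_mapD(2)[OF g sq]] E.Id_Comp[OF sqrD(3)[OF sq]] E.Id_Comp[OF sqrD(4)[OF sq]]
    by simp
qed

subsection \<open>Composition of right maps\<close>

text \<open>A composite of right maps lifts first against the second map and then against the first.
  This vertical composition is what the comultiplication is extracted from.\<close>

definition vcomp ::
  "'m \<Rightarrow> ('i \<Rightarrow> 'm sq \<Rightarrow> 'm) \<Rightarrow> 'm \<Rightarrow> ('i \<Rightarrow> 'm sq \<Rightarrow> 'm) \<Rightarrow> 'i \<Rightarrow> 'm sq \<Rightarrow> 'm" where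
  "vcomp g \<phi> h \<psi> i q = (if i \<in> Obj I \<and> q \<in> Hom (arrow_cat E) (fob u i) (h \<cdot> g)
     then \<phi> i (Sq (fob u i) g (sq_top q) (\<psi> i (Sq (fob u i) h (g \<cdot> sq_top q) (sq_bot q))))
     else undefined)"

lemma vcomp_eq:
  assumes "sqr i (h \<cdot> g) s t"
  shows "vcomp g \<phi> h \<psi> i (Sq (fob u i) (h \<cdot> g) s t) =
    \<phi> i (Sq (fob u i) g s (\<psi> i (Sq (fob u i) h (g \<cdot> s) t)))"
  using assms by (simp add: vcomp_def sqr_def)

context
  fixes g \<phi> h \<psi>
  assumes g: "right_map E I u (g, \<phi>)" and h: "right_map E I u (h, \<psi>)" and gh: "Cod E g = Dom E h"
begin

lemma comp_Hom: "h \<cdot> g \<in> Arr E" "Dom E (h \<cdot> g) = Dom E g" "Cod E (h \<cdot> g) = Cod E h"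
  "g \<in> Hom E (Dom E g) (Dom E h)" "h \<in> Hom E (Dom E h) (Cod E h)"
  using right_mapD(1)[OF g] right_mapD(1)[OF h] gh by (simp_all add: E.HomI)

lemma vcomp_sqr:
  assumes sq: "sqr i (h \<cdot> g) s t"
  shows "sqr i h (g \<cdot> s) t" "sqr i g s (\<psi> i (Sq (fob u i) h (g \<cdot> s) t))"
proof -
  note q = sqrD[OF sq]
  have s: "s \<in> Hom E (src i) (Dom E g)" and t: "t \<in> Hom E (tgt i) (Cod E h)" using q comp_Hom by auto
  have "h \<cdot> (g \<cdot> s) = t \<cdot> fob u i" using E.Comp_assoc[OF s comp_Hom(4,5)] q(5) by simp
  thus 1: "sqr i h (g \<cdot> s) t"
    using q(1) right_mapD(1)[OF h] E.Comp_Hom[OF s comp_Hom(4)] t by (simp add: sqr_iff)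
  show "sqr i g s (\<psi> i (Sq (fob u i) h (g \<cdot> s) t))"
    using q(1) right_mapD(1)[OF g] s right_mapD(2,3)[OF h 1] gh by (simp add: sqr_iff)
qed

lemma right_map_vcomp: "right_map E I u (h \<cdot> g, vcomp g \<phi> h \<psi>)"
proof (rule right_mapI)
  show "h \<cdot> g \<in> Arr E" by (rule comp_Hom)
  show "vcomp g \<phi> h \<psi> i q = undefined"
    if "\<not> (i \<in> Obj I \<and> q \<in> Hom (arrow_cat E) (fob u i) (h \<cdot> g))" for i q
    unfolding vcomp_def by (rule if_not_P[OF that])
  fix i s t assume sq: "sqr i (h \<cdot> g) s t"
  note v = vcomp_sqr[OF sq]
  note F = right_mapD(2-4)[OF g v(2)]
  note G = right_mapD(2-4)[OF h v(1)]
  show "vcomp g \<phi> h \<psi> i (Sq (fob u i) (h \<cdot> g) s t) \<in> Hom E (tgt i) (Dom E (h \<cdot> g))"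
    "vcomp g \<phi> h \<psi> i (Sq (fob u i) (h \<cdot> g) s t) \<cdot> fob u i = s"
    using F comp_Hom by (simp_all add: vcomp_eq[OF sq])
  show "h \<cdot> g \<cdot> vcomp g \<phi> h \<psi> i (Sq (fob u i) (h \<cdot> g) s t) = t"
    using E.Comp_assoc[OF F(1) comp_Hom(4,5)] F(3) G(3) by (simp add: vcomp_eq[OF sq])
next
  fix i j \<sigma> s t assume sq: "sqr j (h \<cdot> g) s t" and \<sigma>: "\<sigma> \<in> Hom I i j"
  note v = vcomp_sqr[OF sq]
  have s: "s \<in> Hom E (src j) (Dom E g)" using sqrD(3)[OF sq] comp_Hom by simp
  show "vcomp g \<phi> h \<psi> j (Sq (fob u j) (h \<cdot> g) s t) \<cdot> ubot \<sigma> =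
      vcomp g \<phi> h \<psi> i (Sq (fob u i) (h \<cdot> g) (s \<cdot> utop \<sigma>) (t \<cdot> ubot \<sigma>))"
    unfolding vcomp_eq[OF sq] vcomp_eq[OF sqr_precomp[OF sq \<sigma>]]
    using right_mapD(5)[OF g v(2) \<sigma>] right_mapD(5)[OF h v(1) \<sigma>]
      E.Comp_assoc[OF gen_map(2)[OF \<sigma>] s comp_Hom(4)] by simp
qed

text \<open>The following two lemmas give the squares behind the two counit laws of the comonad: a composite
  right map projects to its second factor, by the first map or by a morphism of right maps between
  its two factors.\<close>

lemma rmor_vcomp_second: "rmor (h \<cdot> g) (vcomp g \<phi> h \<psi>) h \<psi> g (Ide E (Cod E h))"
proof (rule rmorI)
  show "h \<cdot> g \<in> Arr E" "h \<in> Arr E" using comp_Hom right_mapD(1)[OF h] by auto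
  show "g \<in> Hom E (Dom E (h \<cdot> g)) (Dom E h)" using comp_Hom by simp
  show "Ide E (Cod E h) \<in> Hom E (Cod E (h \<cdot> g)) (Cod E h)"
    using comp_Hom right_mapD(1)[OF h] by (simp add: E.Id_Hom)
  show "h \<cdot> g = Ide E (Cod E h) \<cdot> (h \<cdot> g)" using comp_Hom by simp
  fix i s t assume sq: "sqr i (h \<cdot> g) s t"
  note v = vcomp_sqr[OF sq]
  show "g \<cdot> vcomp g \<phi> h \<psi> i (Sq (fob u i) (h \<cdot> g) s t) =
      \<psi> i (Sq (fob u i) h (g \<cdot> s) (Ide E (Cod E h) \<cdot> t))"
    using right_mapD(4)[OF g v(2)] E.Id_Comp[OF sqrD(4)[OF v(1)]] by (simp add: vcomp_eq[OF sq])
qed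

lemma rmor_vcomp_first:
  assumes a: "rmor g \<phi> h \<psi> a h"
  shows "rmor (h \<cdot> g) (vcomp g \<phi> h \<psi>) h \<psi> a (Ide E (Cod E h))"
proof (rule rmorI)
  note A = rmorD[OF a]
  show "h \<cdot> g \<in> Arr E" "h \<in> Arr E" using comp_Hom right_mapD(1)[OF h] by auto
  show "a \<in> Hom E (Dom E (h \<cdot> g)) (Dom E h)" using comp_Hom A by simp
  show "Ide E (Cod E h) \<in> Hom E (Cod E (h \<cdot> g)) (Cod E h)"
    using comp_Hom right_mapD(1)[OF h] by (simp add: E.Id_Hom)
  show "h \<cdot> a = Ide E (Cod E h) \<cdot> (h \<cdot> g)" using comp_Hom A(6) by simp
  fix i s t assume sq: "sqr i (h \<cdot> g) s t"
  note v = vcomp_sqr[OF sq]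
  show "a \<cdot> vcomp g \<phi> h \<psi> i (Sq (fob u i) (h \<cdot> g) s t) =
      \<psi> i (Sq (fob u i) h (a \<cdot> s) (Ide E (Cod E h) \<cdot> t))"
    using A(7)[OF v(2)] right_mapD(4)[OF h v(1)] E.Id_Comp[OF sqrD(4)[OF v(1)]]
    by (simp add: vcomp_eq[OF sq])
qed

lemma rmor_vcomp:
  assumes g': "right_map E I u (g', \<phi>')" and h': "right_map E I u (h', \<psi>')" and gh': "Cod E g' = Dom E h'"
    and a: "rmor g \<phi> g' \<phi>' a b" and c: "rmor h \<psi> h' \<psi>' b d"
  shows "rmor (h \<cdot> g) (vcomp g \<phi> h \<psi>) (h' \<cdot> g') (vcomp g' \<phi>' h' \<psi>') a d"
proof -
  note A = rmorD[OF a] and C = rmorD[OF c]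
  have G': "g' \<in> Hom E (Dom E g') (Dom E h')" "h' \<in> Hom E (Dom E h') (Cod E h')"
    "h' \<cdot> g' \<in> Arr E" "Dom E (h' \<cdot> g') = Dom E g'" "Cod E (h' \<cdot> g') = Cod E h'"
    using A(3) C(3) gh' by (simp_all add: E.HomI)
  have aH: "a \<in> Hom E (Dom E (h \<cdot> g)) (Dom E (h' \<cdot> g'))" using A(4) comp_Hom G' by simp
  have dH: "d \<in> Hom E (Cod E (h \<cdot> g)) (Cod E (h' \<cdot> g'))" using C(5) comp_Hom G' by simp
  have bH: "b \<in> Hom E (Dom E h) (Dom E h')" using C(4) .
  have "h' \<cdot> g' \<cdot> a = h' \<cdot> (b \<cdot> g)" using E.Comp_assoc[OF A(4) G'(1,2)] A(6) by simp
  also have "\<dots> = d \<cdot> h \<cdot> g" using E.Comp_assoc[OF comp_Hom(4) bH G'(2)] C(6) by simp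
  also have "\<dots> = d \<cdot> (h \<cdot> g)" by (rule E.Comp_assoc[OF comp_Hom(4,5) C(5)])
  finally have eq: "h' \<cdot> g' \<cdot> a = d \<cdot> (h \<cdot> g)" .
  show ?thesis
  proof (rule rmorI[OF comp_Hom(1) G'(3) aH dH eq])
    fix i s t assume sq: "sqr i (h \<cdot> g) s t"
    note v = vcomp_sqr[OF sq]
    have sq': "sqr i (h' \<cdot> g') (a \<cdot> s) (d \<cdot> t)"
      by (rule sqr_postcomp[OF sq aH G'(3) dH eq])
    have s: "s \<in> Hom E (src i) (Dom E g)" using sqrD(3)[OF sq] comp_Hom by simp
    have "b \<cdot> (g \<cdot> s) = g' \<cdot> (a \<cdot> s)"
      using E.Comp_assoc[OF s comp_Hom(4) bH] E.Comp_assoc[OF s A(4) G'(1)] A(6) by simp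
    thus "a \<cdot> vcomp g \<phi> h \<psi> i (Sq (fob u i) (h \<cdot> g) s t) =
        vcomp g' \<phi>' h' \<psi>' i (Sq (fob u i) (h' \<cdot> g') (a \<cdot> s) (d \<cdot> t))"
      using A(7)[OF v(2)] C(7)[OF v(1)] by (simp add: vcomp_eq[OF sq] vcomp_eq[OF sq'])
  qed
qed

lemma vcomp_assoc:
  assumes k: "right_map E I u (k, \<chi>)" and hk: "Cod E h = Dom E k"
  shows "vcomp g \<phi> (k \<cdot> h) (vcomp h \<psi> k \<chi>) = vcomp (h \<cdot> g) (vcomp g \<phi> h \<psi>) k \<chi>"
    "k \<cdot> (h \<cdot> g) = k \<cdot> h \<cdot> g"
proof -
  have kH: "k \<in> Hom E (Cod E h) (Cod E k)" using right_mapD(1)[OF k] hk by (simp add: E.HomI)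
  show eq: "k \<cdot> (h \<cdot> g) = k \<cdot> h \<cdot> g" using E.Comp_assoc[OF comp_Hom(4,5) kH] by simp
  show "vcomp g \<phi> (k \<cdot> h) (vcomp h \<psi> k \<chi>) = vcomp (h \<cdot> g) (vcomp g \<phi> h \<psi>) k \<chi>"
  proof (intro ext)
    fix i q
    show "vcomp g \<phi> (k \<cdot> h) (vcomp h \<psi> k \<chi>) i q = vcomp (h \<cdot> g) (vcomp g \<phi> h \<psi>) k \<chi> i q"
    proof (cases "i \<in> Obj I \<and> q \<in> Hom (arrow_cat E) (fob u i) (k \<cdot> (h \<cdot> g))")
      case False
      hence "(i \<in> Obj I \<and> q \<in> Hom (arrow_cat E) (fob u i) (k \<cdot> (h \<cdot> g))) = False"
        "(i \<in> Obj I \<and> q \<in> Hom (arrow_cat E) (fob u i) (k \<cdot> h \<cdot> g)) = False"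
        by (simp_all only: eq)
      thus ?thesis by (simp only: vcomp_def[of g] vcomp_def[of "h \<cdot> g"] if_False)
    next
      case True
      then obtain s t where qe: "q = Sq (fob u i) (k \<cdot> (h \<cdot> g)) s t" using E.Sq_HomE by metis
      have sq: "sqr i (k \<cdot> (h \<cdot> g)) s t" using True by (simp add: sqr_def qe)
      note q = sqrD[OF sq]
      have kA: "k \<in> Arr E" by (rule right_mapD(1)[OF k])
      have kh: "k \<cdot> h \<in> Hom E (Dom E h) (Cod E k)" by (rule E.Comp_Hom[OF comp_Hom(5) kH])
      have khg: "Dom E (k \<cdot> (h \<cdot> g)) = Dom E g" "Cod E (k \<cdot> (h \<cdot> g)) = Cod E k"
        using kA comp_Hom hk by simp_all
      have s: "s \<in> Hom E (src i) (Dom E g)" and t: "t \<in> Hom E (tgt i) (Cod E k)" using q khg by auto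
      have hgs: "h \<cdot> (g \<cdot> s) = h \<cdot> g \<cdot> s" using E.Comp_assoc[OF s comp_Hom(4,5)] by simp
      have "k \<cdot> h \<cdot> (g \<cdot> s) = t \<cdot> fob u i"
        using E.Comp_assoc[OF s comp_Hom(4) kh] q(5) eq by simp
      hence sq1: "sqr i (k \<cdot> h) (g \<cdot> s) t"
        using q(1) kh t E.Comp_Hom[OF s comp_Hom(4)] E.HomD[OF kh] by (simp add: sqr_iff)
      have "k \<cdot> (h \<cdot> g \<cdot> s) = t \<cdot> fob u i"
        using E.Comp_assoc[OF s _ kH, of "h \<cdot> g"] q(5) comp_Hom by (simp add: E.HomI)
      hence sq2: "sqr i k (h \<cdot> g \<cdot> s) t"
        using q(1) kA t hk E.Comp_Hom[OF s, of "h \<cdot> g"] comp_Hom by (simp add: sqr_iff E.HomI)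
      have sq3: "sqr i (h \<cdot> g) s (\<chi> i (Sq (fob u i) k (h \<cdot> g \<cdot> s) t))"
        using q(1) comp_Hom s hk right_mapD(2,3)[OF k sq2] by (simp add: sqr_iff)
      have "vcomp g \<phi> (k \<cdot> h) (vcomp h \<psi> k \<chi>) i q =
          \<phi> i (Sq (fob u i) g s (\<psi> i (Sq (fob u i) h (g \<cdot> s) (\<chi> i (Sq (fob u i) k (h \<cdot> (g \<cdot> s)) t)))))"
        using vcomp_eq[of i "k \<cdot> h" g s t] sq vcomp_eq[OF sq1] by (simp add: qe eq)
      also have "\<dots> = vcomp (h \<cdot> g) (vcomp g \<phi> h \<psi>) k \<chi> i q"
        using vcomp_eq[OF sq] vcomp_eq[OF sq3] by (simp add: qe hgs)
      finally show ?thesis .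
    qed
  qed
qed

end

end

locale free_right_maps = indexed_maps E I u
  for E :: "('o, 'm) cat" (structure) and I :: "('i, 'j) cat" and u :: "('i, 'j, 'm, 'm sq) ftor" +
  fixes lf rf :: "'m \<Rightarrow> 'm" and \<phi> :: "'m \<Rightarrow> 'i \<Rightarrow> 'm sq \<Rightarrow> 'm"
  assumes free: "f \<in> Arr E \<Longrightarrow> free_right_map E I u f (lf f) (rf f) (\<phi> f)"
begin

abbreviation "D f \<equiv> Dom E (rf f)"

lemma free_Hom:
  assumes "f \<in> Arr E"
  shows "lf f \<in> Hom E (Dom E f) (D f)" "rf f \<in> Hom E (D f) (Cod E f)" "rf f \<cdot> lf f = f"
    "right_map E I u (rf f, \<phi> f)"
    "lf f \<in> Arr E" "Dom E (lf f) = Dom E f" "Cod E (lf f) = D f" "rf f \<in> Arr E" "Cod E (rf f) = Cod E f"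
    "D f \<in> Obj E"
  using free[OF assms] by (auto simp: free_right_map_def dest: E.HomD)

lemma free_univ:
  assumes h: "right_map E I u (h, \<psi>)" and sq: "Sq f h s t \<in> Hom (arrow_cat E) f h"
  shows "\<exists>!k. k \<cdot> lf f = s \<and> rmor (rf f) (\<phi> f) h \<psi> k t"
  unfolding rmor_iff_squares
  using free[OF E.HomA_D(3)[OF sq]] h sq unfolding free_right_map_def by blast

definition ext :: "'m \<Rightarrow> 'm \<Rightarrow> ('i \<Rightarrow> 'm sq \<Rightarrow> 'm) \<Rightarrow> 'm \<Rightarrow> 'm \<Rightarrow> 'm" where
  "ext f h \<psi> s t = (THE k. k \<cdot> lf f = s \<and> rmor (rf f) (\<phi> f) h \<psi> k t)"

lemma ext:
  assumes "right_map E I u (h, \<psi>)" "Sq f h s t \<in> Hom (arrow_cat E) f h"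
  shows "ext f h \<psi> s t \<cdot> lf f = s" "rmor (rf f) (\<phi> f) h \<psi> (ext f h \<psi> s t) t"
  using theI'[OF free_univ[OF assms]] by (simp_all add: ext_def)

text \<open>The uniqueness half of freeness, which proves all the laws below: two morphisms of right maps out
  of a free one agree if they agree on the generating map \<open>lf f\<close>.\<close>

lemma rmor_eqI:
  assumes f: "f \<in> Arr E" and h: "right_map E I u (h, \<psi>)"
    and k: "rmor (rf f) (\<phi> f) h \<psi> k t" "rmor (rf f) (\<phi> f) h \<psi> k' t" and eq: "k \<cdot> lf f = k' \<cdot> lf f"
  shows "k = k'"
proof -
  note F = free_Hom[OF f] and K = rmorD[OF k(1)]
  have kH: "k \<cdot> lf f \<in> Hom E (Dom E f) (Dom E h)" by (rule E.Comp_Hom[OF F(1) K(4)])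
  have hH: "h \<in> Hom E (Dom E h) (Cod E h)" using K(3) by (simp add: E.HomI)
  have tH: "t \<in> Hom E (Cod E f) (Cod E h)" using K(5) F(9) by simp
  have "h \<cdot> (k \<cdot> lf f) = t \<cdot> f"
    using E.Comp_assoc[OF F(1) K(4) hH] E.Comp_assoc[OF F(1,2) tH] K(6) F(3) by simp
  hence "Sq f h (k \<cdot> lf f) t \<in> Hom (arrow_cat E) f h"
    using f K(3) kH tH by (simp add: E.Sq_Hom_iff)
  thus ?thesis using free_univ[OF h] k eq by metis
qed

lemma ext_eqI:
  assumes "right_map E I u (h, \<psi>)" "Sq f h s t \<in> Hom (arrow_cat E) f h"
    "k \<cdot> lf f = s" "rmor (rf f) (\<phi> f) h \<psi> k t"
  shows "k = ext f h \<psi> s t"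
  using free_univ[OF assms(1,2)] ext[OF assms(1,2)] assms(3,4) by blast

lemma unit_sq:
  assumes "f \<in> Arr E"
  shows "Sq f (rf f) (lf f) (Ide E (Cod E f)) \<in> Hom (arrow_cat E) f (rf f)"
  using free_Hom[OF assms] assms by (simp add: E.Sq_Hom_iff E.Id_Hom)

subsection \<open>The monad\<close>

text \<open>The action of the factorization on squares.\<close>

definition K :: "'m sq \<Rightarrow> 'm" where
  "K q = ext (sq_dom q) (rf (sq_cod q)) (\<phi> (sq_cod q)) (lf (sq_cod q) \<cdot> sq_top q) (sq_bot q)"

lemma K:
  assumes q: "q \<in> Hom (arrow_cat E) f g"
  shows "K q \<cdot> lf f = lf g \<cdot> sq_top q" "rmor (rf f) (\<phi> f) (rf g) (\<phi> g) (K q) (sq_bot q)"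
    "K q \<in> Hom E (D f) (D g)"
proof -
  note Q = E.HomA_D[OF q]
  note G = free_Hom[OF Q(4)]
  have t: "sq_top q \<in> Hom E (Dom E f) (Dom E g)" using Q by (simp add: E.HomI)
  have b: "sq_bot q \<in> Hom E (Cod E f) (Cod E (rf g))" using Q G by (simp add: E.HomI)
  have "rf g \<cdot> (lf g \<cdot> sq_top q) = sq_bot q \<cdot> f"
    using E.Comp_assoc[OF t G(1,2)] G(3) Q(11) by simp
  hence "Sq f (rf g) (lf g \<cdot> sq_top q) (sq_bot q) \<in> Hom (arrow_cat E) f (rf g)"
    using Q(3) G(8) b E.Comp_Hom[OF t G(1)] by (simp add: E.Sq_Hom_iff)
  from ext[OF G(4) this]
  show "K q \<cdot> lf f = lf g \<cdot> sq_top q" and r: "rmor (rf f) (\<phi> f) (rf g) (\<phi> g) (K q) (sq_bot q)"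
    using Q(1,2) by (simp_all add: K_def)
  show "K q \<in> Hom E (D f) (D g)" using rmorD(4)[OF r] .
qed

lemma K_eqI:
  assumes q: "q \<in> Hom (arrow_cat E) f g" and k: "k \<cdot> lf f = lf g \<cdot> sq_top q"
    "rmor (rf f) (\<phi> f) (rf g) (\<phi> g) k (sq_bot q)"
  shows "K q = k"
  by (rule rmor_eqI[OF E.HomA_D(3)[OF q] free_Hom(4)[OF E.HomA_D(4)[OF q]] K(2)[OF q] k(2)])
    (simp add: K(1)[OF q] k(1))

lemma K_Ide:
  assumes f: "f \<in> Arr E"
  shows "K (Ide (arrow_cat E) f) = Ide E (D f)"
proof (rule K_eqI)
  note F = free_Hom[OF f]
  show "Ide (arrow_cat E) f \<in> Hom (arrow_cat E) f f"
    using category.Id_Hom[OF E.arrow_category, of f] f by simp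
  show "Ide E (D f) \<cdot> lf f = lf f \<cdot> sq_top (Ide (arrow_cat E) f)" using F by simp
  show "rmor (rf f) (\<phi> f) (rf f) (\<phi> f) (Ide E (D f)) (sq_bot (Ide (arrow_cat E) f))"
    using rmor_id[OF F(4)] F(9) by simp
qed

lemma K_comp:
  assumes q: "q \<in> Hom (arrow_cat E) f g" and r: "r \<in> Hom (arrow_cat E) g h"
  shows "K (r \<cdot>\<^bsub>arrow_cat E\<^esub> q) = K r \<cdot> K q"
proof (rule K_eqI)
  note Q = E.HomA_D[OF q] and R = E.HomA_D[OF r]
  note F = free_Hom[OF Q(3)] and G = free_Hom[OF Q(4)] and H = free_Hom[OF R(4)]
  show "r \<cdot>\<^bsub>arrow_cat E\<^esub> q \<in> Hom (arrow_cat E) f h" by (rule category.Comp_Hom[OF E.arrow_category q r])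
  have t: "sq_top q \<in> Hom E (Dom E f) (Dom E g)" "sq_top r \<in> Hom E (Dom E g) (Dom E h)"
    using Q R by (simp_all add: E.HomI)
  have "K r \<cdot> K q \<cdot> lf f = K r \<cdot> (lf g \<cdot> sq_top q)"
    using E.Comp_assoc[OF F(1) K(3)[OF q] K(3)[OF r]] K(1)[OF q] by simp
  also have "\<dots> = lf h \<cdot> sq_top r \<cdot> sq_top q"
    using E.Comp_assoc[OF t(1) G(1) K(3)[OF r]] K(1)[OF r] by simp
  also have "\<dots> = lf h \<cdot> (sq_top r \<cdot> sq_top q)" by (rule E.Comp_assoc[OF t H(1)])
  finally show "K r \<cdot> K q \<cdot> lf f = lf h \<cdot> sq_top (r \<cdot>\<^bsub>arrow_cat E\<^esub> q)" by simp
  show "rmor (rf f) (\<phi> f) (rf h) (\<phi> h) (K r \<cdot> K q) (sq_bot (r \<cdot>\<^bsub>arrow_cat E\<^esub> q))"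
    using rmor_comp[OF F(4) K(2)[OF q] K(2)[OF r]] by simp
qed

definition R_sq :: "'m sq \<Rightarrow> 'm sq" where
  "R_sq q = Sq (rf (sq_dom q)) (rf (sq_cod q)) (K q) (sq_bot q)"

lemma R_sq:
  assumes q: "q \<in> Hom (arrow_cat E) f g"
  shows "R_sq q \<in> Hom (arrow_cat E) (rf f) (rf g)" "sq_top (R_sq q) = K q" "sq_bot (R_sq q) = sq_bot q"
    "sq_dom (R_sq q) = rf f" "sq_cod (R_sq q) = rf g"
  using rmorD(1)[OF K(2)[OF q]] E.HomA_D[OF q] by (simp_all add: R_sq_def)

text \<open>The multiplication extends the identity of \<open>rf f\<close>, which is already a right map.\<close>

definition m :: "'m \<Rightarrow> 'm" where
  "m f = ext (rf f) (rf f) (\<phi> f) (Ide E (D f)) (Ide E (Cod E f))"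

lemma m:
  assumes f: "f \<in> Arr E"
  shows "m f \<cdot> lf (rf f) = Ide E (D f)"
    "rmor (rf (rf f)) (\<phi> (rf f)) (rf f) (\<phi> f) (m f) (Ide E (Cod E f))"
    "m f \<in> Hom E (D (rf f)) (D f)"
proof -
  note F = free_Hom[OF f]
  have "Sq (rf f) (rf f) (Ide E (D f)) (Ide E (Cod E f)) \<in> Hom (arrow_cat E) (rf f) (rf f)"
    using F f by (simp add: E.Sq_Hom_iff E.Id_Hom)
  from ext[OF F(4) this] show "m f \<cdot> lf (rf f) = Ide E (D f)"
    and r: "rmor (rf (rf f)) (\<phi> (rf f)) (rf f) (\<phi> f) (m f) (Ide E (Cod E f))"
    by (simp_all add: m_def)
  show "m f \<in> Hom E (D (rf f)) (D f)" using rmorD(4)[OF r] .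
qed

lemma m_natural:
  assumes q: "q \<in> Hom (arrow_cat E) f g"
  shows "m g \<cdot> K (R_sq q) = K q \<cdot> m f"
proof -
  note Q = E.HomA_D[OF q]
  note F = free_Hom[OF Q(3)] and G = free_Hom[OF Q(4)] and R = R_sq[OF q]
  note F2 = free_Hom[OF F(8)] and G2 = free_Hom[OF G(8)]
  show ?thesis
  proof (rule rmor_eqI[OF F(8) G(4)])
    show "rmor (rf (rf f)) (\<phi> (rf f)) (rf g) (\<phi> g) (m g \<cdot> K (R_sq q)) (sq_bot q)"
      by (rule rmor_comp'[OF F2(4) K(2)[OF R(1)] m(2)[OF Q(4)]]) (use Q R in simp)
    show "rmor (rf (rf f)) (\<phi> (rf f)) (rf g) (\<phi> g) (K q \<cdot> m f) (sq_bot q)"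
      by (rule rmor_comp'[OF F2(4) m(2)[OF Q(3)] K(2)[OF q]]) (use Q in simp)
    have "m g \<cdot> K (R_sq q) \<cdot> lf (rf f) = m g \<cdot> (lf (rf g) \<cdot> K q)"
      using E.Comp_assoc[OF F2(1) K(3)[OF R(1)] m(3)[OF Q(4)]] K(1)[OF R(1)] R(2) by simp
    also have "\<dots> = K q"
      using E.Comp_assoc[OF K(3)[OF q] G2(1) m(3)[OF Q(4)]] m(1)[OF Q(4)] E.Id_Comp[OF K(3)[OF q]] by simp
    also have "\<dots> = K q \<cdot> m f \<cdot> lf (rf f)"
      using E.Comp_assoc[OF F2(1) m(3)[OF Q(3)] K(3)[OF q]] m(1)[OF Q(3)] E.Comp_Id[OF K(3)[OF q]] by simp
    finally show "m g \<cdot> K (R_sq q) \<cdot> lf (rf f) = K q \<cdot> m f \<cdot> lf (rf f)" .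
  qed
qed

abbreviation "\<eta> f \<equiv> Sq f (rf f) (lf f) (Ide E (Cod E f))"
abbreviation "\<mu> f \<equiv> Sq (rf (rf f)) (rf f) (m f) (Ide E (Cod E f))"

lemma mult_sq: "f \<in> Arr E \<Longrightarrow> \<mu> f \<in> Hom (arrow_cat E) (rf (rf f)) (rf f)"
  using rmorD(1)[OF m(2)] .

lemma m_unit:
  assumes f: "f \<in> Arr E"
  shows "m f \<cdot> K (\<eta> f) = Ide E (D f)"
proof -
  note F = free_Hom[OF f]
  note F2 = free_Hom[OF F(8)] and U = unit_sq[OF f]
  show ?thesis
  proof (rule rmor_eqI[OF f F(4)])
    show "rmor (rf f) (\<phi> f) (rf f) (\<phi> f) (m f \<cdot> K (\<eta> f)) (Ide E (Cod E f))"
      by (rule rmor_comp'[OF F(4) K(2)[OF U] m(2)[OF f]]) (use f in simp)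
    show "rmor (rf f) (\<phi> f) (rf f) (\<phi> f) (Ide E (D f)) (Ide E (Cod E f))"
      using rmor_id[OF F(4)] F(9) by simp
    have "m f \<cdot> K (\<eta> f) \<cdot> lf f = m f \<cdot> (lf (rf f) \<cdot> lf f)"
      using E.Comp_assoc[OF F(1) K(3)[OF U] m(3)[OF f]] K(1)[OF U] by simp
    also have "\<dots> = Ide E (D f) \<cdot> lf f"
      using E.Comp_assoc[OF F(1) F2(1) m(3)[OF f]] m(1)[OF f] by simp
    finally show "m f \<cdot> K (\<eta> f) \<cdot> lf f = Ide E (D f) \<cdot> lf f" .
  qed
qed

lemma m_assoc:
  assumes f: "f \<in> Arr E"
  shows "m f \<cdot> m (rf f) = m f \<cdot> K (\<mu> f)"
proof -
  note F = free_Hom[OF f]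
  note F2 = free_Hom[OF F(8)] and M = mult_sq[OF f]
  note F3 = free_Hom[OF F2(8)]
  show ?thesis
  proof (rule rmor_eqI[OF F2(8) F(4)])
    show "rmor (rf (rf (rf f))) (\<phi> (rf (rf f))) (rf f) (\<phi> f) (m f \<cdot> m (rf f)) (Ide E (Cod E f))"
      by (rule rmor_comp'[OF F3(4) m(2)[OF F(8)] m(2)[OF f]]) (use f F in simp)
    show "rmor (rf (rf (rf f))) (\<phi> (rf (rf f))) (rf f) (\<phi> f) (m f \<cdot> K (\<mu> f)) (Ide E (Cod E f))"
      by (rule rmor_comp'[OF F3(4) K(2)[OF M] m(2)[OF f]]) (use f in simp)
    have "m f \<cdot> m (rf f) \<cdot> lf (rf (rf f)) = m f"
      using E.Comp_assoc[OF F3(1) m(3)[OF F(8)] m(3)[OF f]] m(1)[OF F(8)] E.Comp_Id[OF m(3)[OF f]] by simp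
    also have "\<dots> = m f \<cdot> (lf (rf f) \<cdot> m f)"
      using E.Comp_assoc[OF m(3)[OF f] F2(1) m(3)[OF f]] m(1)[OF f] E.Id_Comp[OF m(3)[OF f]] by simp
    also have "\<dots> = m f \<cdot> K (\<mu> f) \<cdot> lf (rf (rf f))"
      using E.Comp_assoc[OF F3(1) K(3)[OF M] m(3)[OF f]] K(1)[OF M] by simp
    finally show "m f \<cdot> m (rf f) \<cdot> lf (rf (rf f)) = m f \<cdot> K (\<mu> f) \<cdot> lf (rf (rf f))" .
  qed
qed

subsection \<open>The comonad\<close>

abbreviation "comp_map f \<equiv> rf f \<cdot> rf (lf f)"
abbreviation "comp_fill f \<equiv> vcomp (rf (lf f)) (\<phi> (lf f)) (rf f) (\<phi> f)"

lemma comp_right_map: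
  assumes f: "f \<in> Arr E"
  shows "right_map E I u (comp_map f, comp_fill f)" "Cod E (rf (lf f)) = D f"
    "comp_map f \<in> Hom E (D (lf f)) (Cod E f)" "Dom E (comp_map f) = D (lf f)" "Cod E (comp_map f) = Cod E f"
proof -
  note F = free_Hom[OF f]
  note L = free_Hom[OF F(5)]
  show c: "Cod E (rf (lf f)) = D f" using L(9) F(7) by simp
  show "right_map E I u (comp_map f, comp_fill f)" by (rule right_map_vcomp[OF L(4) F(4) c])
  show "comp_map f \<in> Hom E (D (lf f)) (Cod E f)" using E.Comp_Hom[OF L(2), of "rf f" "Cod E f"] F(2,7) by simp
  thus "Dom E (comp_map f) = D (lf f)" "Cod E (comp_map f) = Cod E f" using E.HomD by auto
qed

text \<open>The comultiplication: the factorization \<open>f = rf f \<cdot> rf (lf f) \<cdot> lf (lf f)\<close> has a composite of right maps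
  as its right part, so freeness of \<open>rf f\<close> compares it with the factorization of \<open>f\<close>.\<close>

definition \<sigma> :: "'m \<Rightarrow> 'm" where
  "\<sigma> f = ext f (comp_map f) (comp_fill f) (lf (lf f)) (Ide E (Cod E f))"

lemma \<sigma>:
  assumes f: "f \<in> Arr E"
  shows "\<sigma> f \<cdot> lf f = lf (lf f)"
    "rmor (rf f) (\<phi> f) (comp_map f) (comp_fill f) (\<sigma> f) (Ide E (Cod E f))"
    "\<sigma> f \<in> Hom E (D f) (D (lf f))"
proof -
  note F = free_Hom[OF f]
  note L = free_Hom[OF F(5)] and C = comp_right_map[OF f]
  have rl: "rf (lf f) \<in> Hom E (D (lf f)) (D f)" and ll: "lf (lf f) \<in> Hom E (Dom E f) (D (lf f))"
    using L F by simp_all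
  have "comp_map f \<cdot> lf (lf f) = f"
    using E.Comp_assoc[OF ll rl F(2)] L(3) F(3) by simp
  hence "Sq f (comp_map f) (lf (lf f)) (Ide E (Cod E f)) \<in> Hom (arrow_cat E) f (comp_map f)"
    using f ll C right_mapD(1)[OF C(1)] by (simp add: E.Sq_Hom_iff E.Id_Hom)
  from ext[OF C(1) this] show "\<sigma> f \<cdot> lf f = lf (lf f)"
    and r: "rmor (rf f) (\<phi> f) (comp_map f) (comp_fill f) (\<sigma> f) (Ide E (Cod E f))"
    by (simp_all add: \<sigma>_def)
  show "\<sigma> f \<in> Hom E (D f) (D (lf f))" using rmorD(4)[OF r] C(4) by simp
qed

definition L_sq :: "'m sq \<Rightarrow> 'm sq" where
  "L_sq q = Sq (lf (sq_dom q)) (lf (sq_cod q)) (sq_top q) (K q)"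

lemma L_sq:
  assumes q: "q \<in> Hom (arrow_cat E) f g"
  shows "L_sq q \<in> Hom (arrow_cat E) (lf f) (lf g)" "sq_top (L_sq q) = sq_top q" "sq_bot (L_sq q) = K q"
    "sq_dom (L_sq q) = lf f" "sq_cod (L_sq q) = lf g"
proof -
  note Q = E.HomA_D[OF q]
  note F = free_Hom[OF Q(3)] and G = free_Hom[OF Q(4)]
  show "L_sq q \<in> Hom (arrow_cat E) (lf f) (lf g)"
    using Q F G K[OF q] by (simp add: L_sq_def E.Sq_Hom_iff E.HomI)
  show "sq_top (L_sq q) = sq_top q" "sq_bot (L_sq q) = K q"
    "sq_dom (L_sq q) = lf f" "sq_cod (L_sq q) = lf g" using Q by (simp_all add: L_sq_def)
qed

abbreviation "\<epsilon> f \<equiv> Sq (lf f) f (Ide E (Dom E f)) (rf f)"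
abbreviation "\<Delta> f \<equiv> Sq (lf f) (lf (lf f)) (Ide E (Dom E f)) (\<sigma> f)"

lemma counit_sq: "f \<in> Arr E \<Longrightarrow> \<epsilon> f \<in> Hom (arrow_cat E) (lf f) f"
  using free_Hom[of f] by (simp add: E.Sq_Hom_iff E.Id_Hom)

lemma comult_sq:
  assumes f: "f \<in> Arr E"
  shows "\<Delta> f \<in> Hom (arrow_cat E) (lf f) (lf (lf f))"
  using free_Hom[OF f] free_Hom[OF free_Hom(5)[OF f]] \<sigma>[OF f] f by (simp add: E.Sq_Hom_iff E.Id_Hom)

text \<open>Functoriality of the comparison: the image of a square under \<open>L\<close> and then \<open>R\<close>, pasted with its
  image under \<open>R\<close>, is a morphism between the composite right maps.\<close>

lemma R_comp_sq:
  assumes q: "q \<in> Hom (arrow_cat E) f g"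
  shows "rmor (comp_map f) (comp_fill f) (comp_map g) (comp_fill g) (K (L_sq q)) (sq_bot q)"
proof -
  note Q = E.HomA_D[OF q]
  note F = free_Hom[OF Q(3)] and G = free_Hom[OF Q(4)] and L = L_sq[OF q]
  note F2 = free_Hom[OF F(5)] and G2 = free_Hom[OF G(5)]
  have "rmor (rf (lf f)) (\<phi> (lf f)) (rf (lf g)) (\<phi> (lf g)) (K (L_sq q)) (K q)"
    using K(2)[OF L(1)] L(3) by simp
  thus ?thesis
    by (rule rmor_vcomp[OF F2(4) F(4) comp_right_map(2)[OF Q(3)] G2(4) G(4) comp_right_map(2)[OF Q(4)] _ K(2)[OF q]])
qed

lemma \<sigma>_natural:
  assumes q: "q \<in> Hom (arrow_cat E) f g"
  shows "K (L_sq q) \<cdot> \<sigma> f = \<sigma> g \<cdot> K q"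
proof -
  note Q = E.HomA_D[OF q]
  note F = free_Hom[OF Q(3)] and G = free_Hom[OF Q(4)] and L = L_sq[OF q]
  note F2 = free_Hom[OF F(5)] and G2 = free_Hom[OF G(5)]
  have t: "sq_top q \<in> Hom E (Dom E f) (Dom E g)" using Q by (simp add: E.HomI)
  show ?thesis
  proof (rule rmor_eqI[OF Q(3) comp_right_map(1)[OF Q(4)]])
    show "rmor (rf f) (\<phi> f) (comp_map g) (comp_fill g) (K (L_sq q) \<cdot> \<sigma> f) (sq_bot q)"
      by (rule rmor_comp'[OF F(4) \<sigma>(2)[OF Q(3)] R_comp_sq[OF q]]) (use Q in simp)
    show "rmor (rf f) (\<phi> f) (comp_map g) (comp_fill g) (\<sigma> g \<cdot> K q) (sq_bot q)"
      by (rule rmor_comp'[OF F(4) K(2)[OF q] \<sigma>(2)[OF Q(4)]]) (use Q in simp)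
    have "K (L_sq q) \<cdot> \<sigma> f \<cdot> lf f = lf (lf g) \<cdot> sq_top q"
      using E.Comp_assoc[OF F(1) \<sigma>(3)[OF Q(3)] K(3)[OF L(1)]] \<sigma>(1)[OF Q(3)] K(1)[OF L(1)] L(2) by simp
    also have "\<dots> = \<sigma> g \<cdot> K q \<cdot> lf f"
      using E.Comp_assoc[OF F(1) K(3)[OF q] \<sigma>(3)[OF Q(4)]] K(1)[OF q]
        E.Comp_assoc[OF t G(1) \<sigma>(3)[OF Q(4)]] \<sigma>(1)[OF Q(4)] by simp
    finally show "K (L_sq q) \<cdot> \<sigma> f \<cdot> lf f = \<sigma> g \<cdot> K q \<cdot> lf f" .
  qed
qed

lemma \<sigma>_counit:
  assumes f: "f \<in> Arr E"
  shows "rf (lf f) \<cdot> \<sigma> f = Ide E (D f)" "K (\<epsilon> f) \<cdot> \<sigma> f = Ide E (D f)"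
proof -
  note F = free_Hom[OF f]
  note L = free_Hom[OF F(5)] and C = comp_right_map[OF f] and e = counit_sq[OF f]
  have rl: "rf (lf f) \<in> Hom E (D (lf f)) (D f)" using L F by simp
  have i: "rmor (rf f) (\<phi> f) (rf f) (\<phi> f) (Ide E (D f)) (Ide E (Cod E f))"
    using rmor_id[OF F(4)] F(9) by simp
  show "rf (lf f) \<cdot> \<sigma> f = Ide E (D f)"
  proof (rule rmor_eqI[OF f F(4) _ i])
    show "rmor (rf f) (\<phi> f) (rf f) (\<phi> f) (rf (lf f) \<cdot> \<sigma> f) (Ide E (Cod E f))"
      by (rule rmor_comp'[OF F(4) \<sigma>(2)[OF f] rmor_vcomp_second[OF L(4) F(4) C(2)]]) (use f F in simp)
    have "rf (lf f) \<cdot> \<sigma> f \<cdot> lf f = lf f"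
      using E.Comp_assoc[OF F(1) \<sigma>(3)[OF f] rl] \<sigma>(1)[OF f] L(3) by simp
    thus "rf (lf f) \<cdot> \<sigma> f \<cdot> lf f = Ide E (D f) \<cdot> lf f" using F by simp
  qed
  show "K (\<epsilon> f) \<cdot> \<sigma> f = Ide E (D f)"
  proof (rule rmor_eqI[OF f F(4) _ i])
    have "rmor (rf (lf f)) (\<phi> (lf f)) (rf f) (\<phi> f) (K (\<epsilon> f)) (rf f)" using K(2)[OF e] by simp
    from rmor_vcomp_first[OF L(4) F(4) C(2) this]
    show "rmor (rf f) (\<phi> f) (rf f) (\<phi> f) (K (\<epsilon> f) \<cdot> \<sigma> f) (Ide E (Cod E f))"
      by (rule rmor_comp'[OF F(4) \<sigma>(2)[OF f]]) (use f F in simp)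
    have "K (\<epsilon> f) \<cdot> \<sigma> f \<cdot> lf f = lf f"
      using E.Comp_assoc[OF F(1) \<sigma>(3)[OF f] K(3)[OF e]] \<sigma>(1)[OF f] K(1)[OF e] F by simp
    thus "K (\<epsilon> f) \<cdot> \<sigma> f \<cdot> lf f = Ide E (D f) \<cdot> lf f" using F by simp
  qed
qed

text \<open>Both sides are morphisms of right maps from \<open>rf f\<close> to the threefold composite
  \<open>rf f \<cdot> rf (lf f) \<cdot> rf (lf (lf f))\<close>, for which the two ways of bracketing give the same fillers.\<close>

lemma \<sigma>_coassoc:
  assumes f: "f \<in> Arr E"
  shows "\<sigma> (lf f) \<cdot> \<sigma> f = K (\<Delta> f) \<cdot> \<sigma> f"
proof -
  note F = free_Hom[OF f]
  note L = free_Hom[OF F(5)] and C = comp_right_map[OF f] and d = comult_sq[OF f]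
  note LL = free_Hom[OF L(5)] and CL = comp_right_map[OF F(5)]
  let ?h = "comp_map f \<cdot> rf (lf (lf f))"
  let ?c = "vcomp (rf (lf (lf f))) (\<phi> (lf (lf f))) (comp_map f) (comp_fill f)"
  have c2: "Cod E (rf (lf (lf f))) = Dom E (comp_map f)" using LL(9) L(7) C(4) by simp
  have rm: "right_map E I u (?h, ?c)" by (rule right_map_vcomp[OF LL(4) C(1) c2])
  have assoc: "vcomp (comp_map (lf f)) (comp_fill (lf f)) (rf f) (\<phi> f) = ?c" "rf f \<cdot> comp_map (lf f) = ?h"
    using vcomp_assoc[OF LL(4) L(4) CL(2) F(4) C(2)] by simp_all
  have ccl: "Cod E (comp_map (lf f)) = Dom E (rf f)" using CL(5) F(7) by simp
  show ?thesis
  proof (rule rmor_eqI[OF f rm])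
    have s: "rmor (rf (lf f)) (\<phi> (lf f)) (comp_map (lf f)) (comp_fill (lf f)) (\<sigma> (lf f)) (Ide E (D f))"
      using \<sigma>(2)[OF F(5)] F(7) by simp
    have i: "rmor (rf f) (\<phi> f) (rf f) (\<phi> f) (Ide E (D f)) (Ide E (Cod E f))"
      using rmor_id[OF F(4)] F(9) by simp
    have "rmor (comp_map f) (comp_fill f) ?h ?c (\<sigma> (lf f)) (Ide E (Cod E f))"
      using rmor_vcomp[OF L(4) F(4) C(2) CL(1) F(4) ccl s i] unfolding assoc .
    thus "rmor (rf f) (\<phi> f) ?h ?c (\<sigma> (lf f) \<cdot> \<sigma> f) (Ide E (Cod E f))"
      by (rule rmor_comp'[OF F(4) \<sigma>(2)[OF f]]) (use f in simp)
    have "rmor (rf (lf f)) (\<phi> (lf f)) (rf (lf (lf f))) (\<phi> (lf (lf f))) (K (\<Delta> f)) (\<sigma> f)"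
      using K(2)[OF d] by simp
    from rmor_vcomp[OF L(4) F(4) C(2) LL(4) C(1) c2 this \<sigma>(2)[OF f]]
    show "rmor (rf f) (\<phi> f) ?h ?c (K (\<Delta> f) \<cdot> \<sigma> f) (Ide E (Cod E f))"
      by (rule rmor_comp'[OF F(4) \<sigma>(2)[OF f]]) (use f in simp)
    have s1: "\<sigma> (lf f) \<in> Hom E (D (lf f)) (D (lf (lf f)))" by (rule \<sigma>(3)[OF F(5)])
    have "\<sigma> (lf f) \<cdot> \<sigma> f \<cdot> lf f = lf (lf (lf f))"
      using E.Comp_assoc[OF F(1) \<sigma>(3)[OF f] s1] \<sigma>(1)[OF f] \<sigma>(1)[OF F(5)] by simp
    also have "\<dots> = K (\<Delta> f) \<cdot> \<sigma> f \<cdot> lf f"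
      using E.Comp_assoc[OF F(1) \<sigma>(3)[OF f] K(3)[OF d]] \<sigma>(1)[OF f] K(1)[OF d] LL L F by simp
    finally show "\<sigma> (lf f) \<cdot> \<sigma> f \<cdot> lf f = K (\<Delta> f) \<cdot> \<sigma> f \<cdot> lf f" .
  qed
qed

subsection \<open>The distributive law\<close>

abbreviation "\<Theta> f \<equiv> Sq (lf (rf f)) (rf (lf f)) (\<sigma> f) (m f)"

lemma dist_sq:
  assumes f: "f \<in> Arr E"
  shows "\<Theta> f \<in> Hom (arrow_cat E) (lf (rf f)) (rf (lf f))"
proof -
  note F = free_Hom[OF f]
  note L = free_Hom[OF F(5)] and R = free_Hom[OF F(8)]
  show ?thesis
    using F L R \<sigma>[OF f] m[OF f] \<sigma>_counit(1)[OF f] by (simp add: E.Sq_Hom_iff)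
qed

text \<open>Both sides are morphisms of right maps out of the free right map on \<open>rf f\<close>, into the composite
  right map, because each ingredient is one; hence they agree.\<close>

lemma \<sigma>_m:
  assumes f: "f \<in> Arr E"
  shows "\<sigma> f \<cdot> m f = m (lf f) \<cdot> K (\<Theta> f) \<cdot> \<sigma> (rf f)"
proof -
  note F = free_Hom[OF f]
  note L = free_Hom[OF F(5)] and R = free_Hom[OF F(8)] and C = comp_right_map[OF f] and t = dist_sq[OF f]
  note LR = free_Hom[OF R(5)] and RL = free_Hom[OF L(8)] and CR = comp_right_map[OF F(8)]
  have K3: "K (\<Theta> f) \<in> Hom E (D (lf (rf f))) (D (rf (lf f)))" by (rule K(3)[OF t])
  have mK: "m (lf f) \<cdot> K (\<Theta> f) \<in> Hom E (D (lf (rf f))) (D (lf f))"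
    by (rule E.Comp_Hom[OF K3 m(3)[OF F(5)]])
  show ?thesis
  proof (rule rmor_eqI[OF F(8) C(1)])
    show "rmor (rf (rf f)) (\<phi> (rf f)) (comp_map f) (comp_fill f) (\<sigma> f \<cdot> m f) (Ide E (Cod E f))"
      by (rule rmor_comp'[OF R(4) m(2)[OF f] \<sigma>(2)[OF f]]) (use f in simp)
    have k: "rmor (rf (lf (rf f))) (\<phi> (lf (rf f))) (rf (rf (lf f))) (\<phi> (rf (lf f))) (K (\<Theta> f)) (m f)"
      using K(2)[OF t] by simp
    have "rmor (rf (lf (rf f))) (\<phi> (lf (rf f))) (rf (lf f)) (\<phi> (lf f)) (m (lf f) \<cdot> K (\<Theta> f)) (m f)"
      by (rule rmor_comp'[OF LR(4) k m(2)[OF F(5)]]) (use E.Id_Comp[OF m(3)[OF f]] F(7) in simp)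
    from rmor_vcomp[OF LR(4) R(4) CR(2) L(4) F(4) C(2) this m(2)[OF f]]
    show "rmor (rf (rf f)) (\<phi> (rf f)) (comp_map f) (comp_fill f)
        (m (lf f) \<cdot> K (\<Theta> f) \<cdot> \<sigma> (rf f)) (Ide E (Cod E f))"
      by (rule rmor_comp'[OF R(4) \<sigma>(2)[OF F(8)]]) (use f F in simp)
    have s: "\<sigma> f \<in> Hom E (D f) (D (lf f))" by (rule \<sigma>(3)[OF f])
    have "m (lf f) \<cdot> K (\<Theta> f) \<cdot> \<sigma> (rf f) \<cdot> lf (rf f) = m (lf f) \<cdot> K (\<Theta> f) \<cdot> lf (lf (rf f))"
      using E.Comp_assoc[OF R(1) \<sigma>(3)[OF F(8)] mK] \<sigma>(1)[OF F(8)] by simp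
    also have "\<dots> = m (lf f) \<cdot> (lf (rf (lf f)) \<cdot> \<sigma> f)"
      using E.Comp_assoc[OF LR(1) K3 m(3)[OF F(5)]] K(1)[OF t] R(6) by simp
    also have "\<dots> = \<sigma> f"
      using E.Comp_assoc[OF s RL(1) m(3)[OF F(5)]] m(1)[OF F(5)] E.Id_Comp[OF s] by simp
    also have "\<dots> = \<sigma> f \<cdot> m f \<cdot> lf (rf f)"
      using E.Comp_assoc[OF R(1) m(3)[OF f] s] m(1)[OF f] E.Comp_Id[OF s] by simp
    finally show "\<sigma> f \<cdot> m f \<cdot> lf (rf f) = m (lf f) \<cdot> K (\<Theta> f) \<cdot> \<sigma> (rf f) \<cdot> lf (rf f)" by simp
  qed
qed

definition W :: "('o, 'm) awfs_data" where
  "W = \<lparr>mid = \<lparr>fob = D, far = K\<rparr>, lft = lf, rgt = rf, comul = \<Delta>, mul = \<mu>\<rparr>"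

lemma W_simps [simp]:
  "fob (mid W) = D" "far (mid W) = K" "lft W = lf" "rgt W = rf" "comul W = \<Delta>" "mul W = \<mu>"
  "fob (L_ftor W) = lf" "far (L_ftor W) = L_sq" "fob (R_ftor W) = rf" "far (R_ftor W) = R_sq"
  "L_counit E W = \<epsilon>" "R_unit E W = \<eta>" "canonical_dist W = \<Theta>"
  by (auto simp: W_def L_ftor_def R_ftor_def L_sq_def R_sq_def L_counit_def R_unit_def canonical_dist_def)

lemma W_factorization: "functorial_factorization E W"
  unfolding functorial_factorization_def
proof (intro conjI ballI)
  show "is_functor (arrow_cat E) E (mid W)"
    unfolding is_functor_def using free_Hom(10) K(3) K_Ide K_comp by (simp del: E.arrow_cat_simps(4,5))
  show "nat_trans (arrow_cat E) E (dom_ftor E) (mid W) (lft W)"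
    using free_Hom(1) K(1) by (auto simp: nat_trans_def dom_ftor_def)
  show "nat_trans (arrow_cat E) E (mid W) (cod_ftor E) (rgt W)"
    using free_Hom(2) rmorD(6)[OF K(2)] by (auto simp: nat_trans_def cod_ftor_def)
  show "rgt W f \<cdot> lft W f = f" if "f \<in> Arr E" for f using free_Hom(3)[OF that] by simp
qed

lemma W_comonad: "comonad (arrow_cat E) (L_ftor W) (L_counit E W) (comul W)"
  unfolding comonad_def
proof (intro conjI ballI)
  show "is_functor (arrow_cat E) (arrow_cat E) (L_ftor W)"
    unfolding is_functor_def
  proof (intro conjI ballI allI)
    fix f assume f: "f \<in> Obj (arrow_cat E)"
    show "fob (L_ftor W) f \<in> Obj (arrow_cat E)" using free_Hom(5) f by simp
    have "f \<in> Arr E" using f by simp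
    thus "far (L_ftor W) (Ide (arrow_cat E) f) = Ide (arrow_cat E) (fob (L_ftor W) f)"
      using free_Hom[of f] K_Ide[of f] by (simp add: L_sq_def)
  next
    fix f g q assume "q \<in> Hom (arrow_cat E) f g"
    thus "far (L_ftor W) q \<in> Hom (arrow_cat E) (fob (L_ftor W) f) (fob (L_ftor W) g)"
      using L_sq(1) by simp
  next
    fix f g h q r assume q: "q \<in> Hom (arrow_cat E) f g" and r: "r \<in> Hom (arrow_cat E) g h"
    show "far (L_ftor W) (r \<cdot>\<^bsub>arrow_cat E\<^esub> q) = far (L_ftor W) r \<cdot>\<^bsub>arrow_cat E\<^esub> far (L_ftor W) q"
      using K_comp[OF q r] E.HomA_D(1,2)[OF q] E.HomA_D(1,2)[OF r] by (simp add: L_sq_def)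
  qed
  show "nat_trans (arrow_cat E) (arrow_cat E) (L_ftor W) id_ftor (L_counit E W)"
    unfolding nat_trans_def
  proof (intro conjI ballI allI)
    show "L_counit E W f \<in> Hom (arrow_cat E) (fob (L_ftor W) f) (fob id_ftor f)"
      if "f \<in> Obj (arrow_cat E)" for f using counit_sq[of f] that by simp
    fix f g q assume q: "q \<in> Hom (arrow_cat E) f g"
    show "L_counit E W g \<cdot>\<^bsub>arrow_cat E\<^esub> far (L_ftor W) q = far id_ftor q \<cdot>\<^bsub>arrow_cat E\<^esub> L_counit E W f"
      using rmorD(6)[OF K(2)[OF q]] E.HomA_D[OF q] by (simp add: L_sq_def)
  qed
  show "nat_trans (arrow_cat E) (arrow_cat E) (L_ftor W) (L_ftor W \<circ>\<^sub>F L_ftor W) (comul W)"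
    unfolding nat_trans_def
  proof (intro conjI ballI allI)
    show "comul W f \<in> Hom (arrow_cat E) (fob (L_ftor W) f) (fob (L_ftor W \<circ>\<^sub>F L_ftor W) f)"
      if "f \<in> Obj (arrow_cat E)" for f using comult_sq[of f] that by simp
    fix f g q assume q: "q \<in> Hom (arrow_cat E) f g"
    show "comul W g \<cdot>\<^bsub>arrow_cat E\<^esub> far (L_ftor W) q =
        far (L_ftor W \<circ>\<^sub>F L_ftor W) q \<cdot>\<^bsub>arrow_cat E\<^esub> comul W f"
      using \<sigma>_natural[OF q] E.HomA_D[OF q] L_sq[OF q] L_sq[OF L_sq(1)[OF q]] by simp
  qed
  fix f assume "f \<in> Obj (arrow_cat E)"
  hence f: "f \<in> Arr E" by simp
  note F = free_Hom[OF f]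
  note L = free_Hom[OF F(5)]
  show "L_counit E W (fob (L_ftor W) f) \<cdot>\<^bsub>arrow_cat E\<^esub> comul W f = Ide (arrow_cat E) (fob (L_ftor W) f)"
    using \<sigma>_counit(1)[OF f] F f by simp
  show "far (L_ftor W) (L_counit E W f) \<cdot>\<^bsub>arrow_cat E\<^esub> comul W f = Ide (arrow_cat E) (fob (L_ftor W) f)"
    using \<sigma>_counit(2)[OF f] F f by (simp add: L_sq_def)
  show "comul W (fob (L_ftor W) f) \<cdot>\<^bsub>arrow_cat E\<^esub> comul W f =
      far (L_ftor W) (comul W f) \<cdot>\<^bsub>arrow_cat E\<^esub> comul W f"
    using \<sigma>_coassoc[OF f] F f by (simp add: L_sq_def)
qed

lemma W_monad: "monad (arrow_cat E) (R_ftor W) (R_unit E W) (mul W)"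
  unfolding monad_def
proof (intro conjI ballI)
  show "is_functor (arrow_cat E) (arrow_cat E) (R_ftor W)"
    unfolding is_functor_def
  proof (intro conjI ballI allI)
    fix f assume f: "f \<in> Obj (arrow_cat E)"
    show "fob (R_ftor W) f \<in> Obj (arrow_cat E)" using free_Hom(8) f by simp
    have "f \<in> Arr E" using f by simp
    thus "far (R_ftor W) (Ide (arrow_cat E) f) = Ide (arrow_cat E) (fob (R_ftor W) f)"
      using free_Hom[of f] K_Ide[of f] by (simp add: R_sq_def)
  next
    fix f g q assume "q \<in> Hom (arrow_cat E) f g"
    thus "far (R_ftor W) q \<in> Hom (arrow_cat E) (fob (R_ftor W) f) (fob (R_ftor W) g)"
      using R_sq(1) by simp
  next
    fix f g h q r assume q: "q \<in> Hom (arrow_cat E) f g" and r: "r \<in> Hom (arrow_cat E) g h"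
    show "far (R_ftor W) (r \<cdot>\<^bsub>arrow_cat E\<^esub> q) = far (R_ftor W) r \<cdot>\<^bsub>arrow_cat E\<^esub> far (R_ftor W) q"
      using K_comp[OF q r] E.HomA_D(1,2)[OF q] E.HomA_D(1,2)[OF r] by (simp add: R_sq_def)
  qed
  show "nat_trans (arrow_cat E) (arrow_cat E) id_ftor (R_ftor W) (R_unit E W)"
    unfolding nat_trans_def
  proof (intro conjI ballI allI)
    show "R_unit E W f \<in> Hom (arrow_cat E) (fob id_ftor f) (fob (R_ftor W) f)"
      if "f \<in> Obj (arrow_cat E)" for f using unit_sq[of f] that by simp
    fix f g q assume q: "q \<in> Hom (arrow_cat E) f g"
    show "R_unit E W g \<cdot>\<^bsub>arrow_cat E\<^esub> far id_ftor q = far (R_ftor W) q \<cdot>\<^bsub>arrow_cat E\<^esub> R_unit E W f"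
      using K(1)[OF q] E.HomA_D[OF q] by (simp add: R_sq_def)
  qed
  show "nat_trans (arrow_cat E) (arrow_cat E) (R_ftor W \<circ>\<^sub>F R_ftor W) (R_ftor W) (mul W)"
    unfolding nat_trans_def
  proof (intro conjI ballI allI)
    show "mul W f \<in> Hom (arrow_cat E) (fob (R_ftor W \<circ>\<^sub>F R_ftor W) f) (fob (R_ftor W) f)"
      if "f \<in> Obj (arrow_cat E)" for f using mult_sq[of f] that by simp
    fix f g q assume q: "q \<in> Hom (arrow_cat E) f g"
    show "mul W g \<cdot>\<^bsub>arrow_cat E\<^esub> far (R_ftor W \<circ>\<^sub>F R_ftor W) q =
        far (R_ftor W) q \<cdot>\<^bsub>arrow_cat E\<^esub> mul W f"
      using m_natural[OF q] E.HomA_D[OF q] R_sq[OF q] R_sq[OF R_sq(1)[OF q]] by simp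
  qed
  fix f assume "f \<in> Obj (arrow_cat E)"
  hence f: "f \<in> Arr E" by simp
  note F = free_Hom[OF f]
  note R = free_Hom[OF F(8)]
  show "mul W f \<cdot>\<^bsub>arrow_cat E\<^esub> R_unit E W (fob (R_ftor W) f) = Ide (arrow_cat E) (fob (R_ftor W) f)"
    using m(1)[OF f] F f by simp
  show "mul W f \<cdot>\<^bsub>arrow_cat E\<^esub> far (R_ftor W) (R_unit E W f) = Ide (arrow_cat E) (fob (R_ftor W) f)"
    using m_unit[OF f] F f by (simp add: R_sq_def)
  show "mul W f \<cdot>\<^bsub>arrow_cat E\<^esub> mul W (fob (R_ftor W) f) =
      mul W f \<cdot>\<^bsub>arrow_cat E\<^esub> far (R_ftor W) (mul W f)"
    using m_assoc[OF f] F f by (simp add: R_sq_def)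
qed

lemma W_distributive:
  "distributive_law (arrow_cat E) (L_ftor W) (L_counit E W) (comul W)
     (R_ftor W) (R_unit E W) (mul W) (canonical_dist W)"
  unfolding distributive_law_def
proof (intro conjI ballI)
  show "nat_trans (arrow_cat E) (arrow_cat E) (L_ftor W \<circ>\<^sub>F R_ftor W) (R_ftor W \<circ>\<^sub>F L_ftor W) (canonical_dist W)"
    unfolding nat_trans_def
  proof (intro conjI ballI allI)
    show "canonical_dist W f \<in> Hom (arrow_cat E) (fob (L_ftor W \<circ>\<^sub>F R_ftor W) f) (fob (R_ftor W \<circ>\<^sub>F L_ftor W) f)"
      if "f \<in> Obj (arrow_cat E)" for f using dist_sq[of f] that by simp
    fix f g q assume q: "q \<in> Hom (arrow_cat E) f g"
    show "canonical_dist W g \<cdot>\<^bsub>arrow_cat E\<^esub> far (L_ftor W \<circ>\<^sub>F R_ftor W) q =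
        far (R_ftor W \<circ>\<^sub>F L_ftor W) q \<cdot>\<^bsub>arrow_cat E\<^esub> canonical_dist W f"
      using m_natural[OF q] \<sigma>_natural[OF q] E.HomA_D[OF q] R_sq[OF q] L_sq[OF q]
      by (simp add: L_sq_def[of "R_sq q"] R_sq_def[of "L_sq q"])
  qed
  fix f assume "f \<in> Obj (arrow_cat E)"
  hence f: "f \<in> Arr E" by simp
  note F = free_Hom[OF f]
  note R = free_Hom[OF F(8)] and L = free_Hom[OF F(5)]
  show "canonical_dist W f \<cdot>\<^bsub>arrow_cat E\<^esub> far (L_ftor W) (R_unit E W f) = R_unit E W (fob (L_ftor W) f)"
    using \<sigma>(1)[OF f] m_unit[OF f] F f by (simp add: L_sq_def)
  show "far (R_ftor W) (L_counit E W f) \<cdot>\<^bsub>arrow_cat E\<^esub> canonical_dist W f = L_counit E W (fob (R_ftor W) f)"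
    using \<sigma>_counit(2)[OF f] rmorD(6)[OF m(2)[OF f]] F R f by (simp add: R_sq_def)
  have mH: "m f \<in> Arr E" "Dom E (m f) = D (rf f)" "Cod E (m f) = D f"
    and \<sigma>H: "\<sigma> f \<in> Arr E" "Dom E (\<sigma> f) = D f" "Cod E (\<sigma> f) = D (lf f)"
    using E.HomD[OF m(3)[OF f]] E.HomD[OF \<sigma>(3)[OF f]] by auto
  have mR: "m (rf f) \<in> Arr E" "Dom E (m (rf f)) = D (rf (rf f))" "Cod E (m (rf f)) = D (rf f)"
    and \<sigma>L: "\<sigma> (lf f) \<in> Arr E" "Dom E (\<sigma> (lf f)) = D (lf f)" "Cod E (\<sigma> (lf f)) = D (lf (lf f))"
    using E.HomD[OF m(3)[OF F(8)]] E.HomD[OF \<sigma>(3)[OF F(5)]] by auto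
  show "canonical_dist W f \<cdot>\<^bsub>arrow_cat E\<^esub> far (L_ftor W) (mul W f) =
      mul W (fob (L_ftor W) f) \<cdot>\<^bsub>arrow_cat E\<^esub> far (R_ftor W) (canonical_dist W f)
        \<cdot>\<^bsub>arrow_cat E\<^esub> canonical_dist W (fob (R_ftor W) f)"
    using \<sigma>_m[OF f] m_assoc[OF f] F f mH mR by (simp add: L_sq_def R_sq_def)
  show "far (R_ftor W) (comul W f) \<cdot>\<^bsub>arrow_cat E\<^esub> canonical_dist W f =
      canonical_dist W (fob (L_ftor W) f) \<cdot>\<^bsub>arrow_cat E\<^esub> far (L_ftor W) (canonical_dist W f)
        \<cdot>\<^bsub>arrow_cat E\<^esub> comul W (fob (R_ftor W) f)"
    using \<sigma>_m[OF f] \<sigma>_coassoc[OF f] F R f \<sigma>H \<sigma>L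
      E.Comp_Id[OF E.Comp_Hom[OF \<sigma>(3)[OF f] K(3)[OF comult_sq[OF f]]]] by (simp add: L_sq_def R_sq_def)
qed

theorem W_awfs: "is_awfs E W"
  unfolding is_awfs_def using W_factorization W_comonad W_monad W_distributive by blast

end

section \<open>Algebras and coalgebras\<close>

lemma str_cat_Hom_iff:
  "F \<in> Hom (str_cat C S P) X Y \<longleftrightarrow> (\<exists>m. F = (X, Y, m) \<and> X \<in> S \<and> Y \<in> S \<and> m \<in> Hom C (fst X) (fst Y) \<and> P X Y m)"
  by (auto simp: str_cat_def Hom_def)

lemma iso_over_str_catI:
  assumes F: "\<And>X. X \<in> S \<Longrightarrow> F X \<in> S' \<and> fst (F X) = fst X \<and> G (F X) = X"
    and G: "\<And>Y. Y \<in> S' \<Longrightarrow> G Y \<in> S \<and> fst (G Y) = fst Y \<and> F (G Y) = Y"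
    and P: "\<And>X Y m. X \<in> S \<Longrightarrow> Y \<in> S \<Longrightarrow> m \<in> Hom C (fst X) (fst Y) \<Longrightarrow> P X Y m \<longleftrightarrow> P' (F X) (F Y) m"
  shows "iso_over (str_cat C S P) forget (str_cat C S' P') forget"
  unfolding iso_over_def
proof (intro exI conjI)
  let ?F = "\<lparr>fob = F, far = \<lambda>(X, Y, m). (F X, F Y, m)\<rparr>"
  let ?G = "\<lparr>fob = G, far = \<lambda>(X, Y, m). (G X, G Y, m)\<rparr>"
  have P': "P (G X) (G Y) m \<longleftrightarrow> P' X Y m" if "X \<in> S'" "Y \<in> S'" "m \<in> Hom C (fst X) (fst Y)" for X Y m
    using P[of "G X" "G Y" m] G that by simp
  show "is_functor (str_cat C S P) (str_cat C S' P') ?F"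
    unfolding is_functor_def
  proof (intro conjI ballI allI)
    fix f X Y assume "f \<in> Hom (str_cat C S P) X Y"
    then obtain m where "f = (X, Y, m)" "X \<in> S" "Y \<in> S" "m \<in> Hom C (fst X) (fst Y)" "P X Y m"
      unfolding str_cat_Hom_iff by blast
    thus "far ?F f \<in> Hom (str_cat C S' P') (fob ?F X) (fob ?F Y)"
      using F[of X] F[of Y] P[of X Y m] by (simp add: str_cat_Hom_iff)
  qed (use F in \<open>auto simp: str_cat_Hom_iff\<close>, auto simp: str_cat_def F)
  show "is_functor (str_cat C S' P') (str_cat C S P) ?G"
    unfolding is_functor_def
  proof (intro conjI ballI allI)
    fix f X Y assume "f \<in> Hom (str_cat C S' P') X Y"
    then obtain m where "f = (X, Y, m)" "X \<in> S'" "Y \<in> S'" "m \<in> Hom C (fst X) (fst Y)" "P' X Y m"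
      unfolding str_cat_Hom_iff by blast
    thus "far ?G f \<in> Hom (str_cat C S P) (fob ?G X) (fob ?G Y)"
      using G[of X] G[of Y] P'[of X Y m] by (simp add: str_cat_Hom_iff)
  qed (use G in \<open>auto simp: str_cat_Hom_iff\<close>, auto simp: str_cat_def G)
  show "ftor_eq (str_cat C S P) (?G \<circ>\<^sub>F ?F) id_ftor" "ftor_eq (str_cat C S' P') (?F \<circ>\<^sub>F ?G) id_ftor"
    "ftor_eq (str_cat C S P) (forget \<circ>\<^sub>F ?F) forget"
    using F G by (auto simp: ftor_eq_def str_cat_def forget_def)
qed

lemma iso_over_sym:
  assumes "iso_over C U D V"
  shows "iso_over D V C U"
proof -
  obtain F G where F: "is_functor C D F" "is_functor D C G" "ftor_eq C (G \<circ>\<^sub>F F) id_ftor"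
    "ftor_eq D (F \<circ>\<^sub>F G) id_ftor" "ftor_eq C (V \<circ>\<^sub>F F) U"
    using assms unfolding iso_over_def by blast
  have "fob U (fob G b) = fob V b" if "b \<in> Obj D" for b
    using F(4,5) that functorD(1)[OF F(2) that] unfolding ftor_eq_def by (metis comp_ftor_simps(1,3))
  moreover have "far U (far G f) = far V f" if "f \<in> Arr D" for f
  proof -
    have "f \<in> Hom D (Dom D f) (Cod D f)" using that by (simp add: Hom_def)
    hence "far G f \<in> Arr C" using functorD(2)[OF F(2)] by (auto simp: Hom_def)
    thus ?thesis using F(4,5) that unfolding ftor_eq_def by (metis comp_ftor_simps(2,4))
  qed
  ultimately have "ftor_eq D (U \<circ>\<^sub>F G) V" by (simp add: ftor_eq_def)
  thus ?thesis using F unfolding iso_over_def by blast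
qed

lemma iso_over_trans:
  assumes "iso_over C U D V" "iso_over D V B T"
  shows "iso_over C U B T"
proof -
  obtain F G where F: "is_functor C D F" "is_functor D C G" "ftor_eq C (G \<circ>\<^sub>F F) id_ftor"
    "ftor_eq D (F \<circ>\<^sub>F G) id_ftor" "ftor_eq C (V \<circ>\<^sub>F F) U"
    using assms(1) unfolding iso_over_def by blast
  obtain F' G' where F': "is_functor D B F'" "is_functor B D G'" "ftor_eq D (G' \<circ>\<^sub>F F') id_ftor"
    "ftor_eq B (F' \<circ>\<^sub>F G') id_ftor" "ftor_eq D (T \<circ>\<^sub>F F') V"
    using assms(2) unfolding iso_over_def by blast
  have arr: "far H f \<in> Arr Q" if "is_functor P Q H" "f \<in> Arr P" for P Q H f
  proof -
    have "f \<in> Hom P (Dom P f) (Cod P f)" using that(2) by (simp add: Hom_def)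
    thus ?thesis using functorD(2)[OF that(1)] by (auto simp: Hom_def)
  qed
  have "ftor_eq C (G \<circ>\<^sub>F G' \<circ>\<^sub>F (F' \<circ>\<^sub>F F)) id_ftor"
    using F(3) F'(3) functorD(1)[OF F(1)] arr[OF F(1)] by (simp add: ftor_eq_def)
  moreover have "ftor_eq B (F' \<circ>\<^sub>F F \<circ>\<^sub>F (G \<circ>\<^sub>F G')) id_ftor"
    using F(4) F'(4) functorD(1)[OF F'(2)] arr[OF F'(2)] by (simp add: ftor_eq_def)
  moreover have "ftor_eq C (T \<circ>\<^sub>F (F' \<circ>\<^sub>F F)) U"
    using F(5) F'(5) functorD(1)[OF F(1)] arr[OF F(1)] by (simp add: ftor_eq_def)
  ultimately show ?thesis
    unfolding iso_over_def using is_functor_comp[OF F(1) F'(1)] is_functor_comp[OF F'(2) F(2)] by blast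
qed

context free_right_maps
begin

lemma right_maps_morphism:
  "Sq g h a b \<in> Hom (arrow_cat E) g h \<Longrightarrow>
    (\<forall>i\<in>Obj I. \<forall>q\<in>Hom (arrow_cat E) (fob u i) g.
       sq_top (Sq g h a b) \<cdot> \<psi> i q = \<chi> i (Sq g h a b \<cdot>\<^bsub>arrow_cat E\<^esub> q)) \<longleftrightarrow> rmor g \<psi> h \<chi> a b"
  by (simp add: rmor_iff_squares del: E.arrow_cat_simps)

subsection \<open>Algebras are right maps\<close>

text \<open>The algebra structure of a right map is the extension of the identity to the free one; an algebra lifts
  a square by lifting its composite with the unit.\<close>

definition alg_of :: "'m \<Rightarrow> ('i \<Rightarrow> 'm sq \<Rightarrow> 'm) \<Rightarrow> 'm" where
  "alg_of f \<psi> = ext f f \<psi> (Ide E (Dom E f)) (Ide E (Cod E f))"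

definition fill_of :: "'m \<Rightarrow> 'm \<Rightarrow> 'i \<Rightarrow> 'm sq \<Rightarrow> 'm" where
  "fill_of f a i q = (if i \<in> Obj I \<and> q \<in> Hom (arrow_cat E) (fob u i) f
     then a \<cdot> \<phi> f i (Sq (fob u i) (rf f) (lf f \<cdot> sq_top q) (sq_bot q)) else undefined)"

lemma alg_of:
  assumes "right_map E I u (f, \<psi>)"
  shows "alg_of f \<psi> \<cdot> lf f = Ide E (Dom E f)" "rmor (rf f) (\<phi> f) f \<psi> (alg_of f \<psi>) (Ide E (Cod E f))"
proof -
  have f: "f \<in> Arr E" by (rule right_mapD(1)[OF assms])
  have "Sq f f (Ide E (Dom E f)) (Ide E (Cod E f)) \<in> Hom (arrow_cat E) f f"
    using f by (simp add: E.Sq_Hom_iff E.Id_Hom)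
  from ext[OF assms this] show "alg_of f \<psi> \<cdot> lf f = Ide E (Dom E f)"
    "rmor (rf f) (\<phi> f) f \<psi> (alg_of f \<psi>) (Ide E (Cod E f))" by (simp_all add: alg_of_def)
qed

definition is_alg :: "'m \<Rightarrow> 'm \<Rightarrow> bool" where
  "is_alg f a \<longleftrightarrow> f \<in> Arr E \<and> a \<in> Hom E (D f) (Dom E f) \<and> f \<cdot> a = rf f \<and> a \<cdot> lf f = Ide E (Dom E f) \<and>
     a \<cdot> m f = a \<cdot> K (Sq (rf f) f a (Ide E (Cod E f)))"

lemma alg_sq:
  assumes "is_alg f a"
  shows "Sq (rf f) f a (Ide E (Cod E f)) \<in> Hom (arrow_cat E) (rf f) f"
  using assms free_Hom[of f] by (simp add: is_alg_def E.Sq_Hom_iff E.Id_Hom)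

lemma R_Map_obj_iff:
  "(f, \<alpha>) \<in> Obj (R_Map E W) \<longleftrightarrow> (\<exists>a. \<alpha> = Sq (rf f) f a (Ide E (Cod E f)) \<and> is_alg f a)"
proof
  assume "(f, \<alpha>) \<in> Obj (R_Map E W)"
  hence f: "f \<in> Arr E" and \<alpha>: "\<alpha> \<in> Hom (arrow_cat E) (rf f) f"
    and un: "\<alpha> \<cdot>\<^bsub>arrow_cat E\<^esub> \<eta> f = Ide (arrow_cat E) f"
    and as: "\<alpha> \<cdot>\<^bsub>arrow_cat E\<^esub> \<mu> f = \<alpha> \<cdot>\<^bsub>arrow_cat E\<^esub> R_sq \<alpha>"
    by (auto simp: R_Map_def monad_alg_def str_cat_def simp del: E.arrow_cat_simps(4,5))
  obtain a b where ab: "\<alpha> = Sq (rf f) f a b" "a \<in> Hom E (D f) (Dom E f)" "b \<in> Hom E (Cod E (rf f)) (Cod E f)"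
    "f \<cdot> a = b \<cdot> rf f" using E.Sq_HomE[OF \<alpha>] by metis
  note F = free_Hom[OF f]
  have b: "b = Ide E (Cod E f)" using un ab F E.HomD[OF ab(3)] by simp
  have "a \<cdot> lf f = Ide E (Dom E f)" using un ab by simp
  moreover have "a \<cdot> m f = a \<cdot> K \<alpha>" using as R_sq[OF \<alpha>] by (simp add: ab(1))
  moreover have "f \<cdot> a = rf f" using ab(4) b F by simp
  ultimately show "\<exists>a. \<alpha> = Sq (rf f) f a (Ide E (Cod E f)) \<and> is_alg f a"
    using ab b f unfolding is_alg_def by blast
next
  assume "\<exists>a. \<alpha> = Sq (rf f) f a (Ide E (Cod E f)) \<and> is_alg f a"
  then obtain a where a: "\<alpha> = Sq (rf f) f a (Ide E (Cod E f))" "is_alg f a" by blast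
  hence f: "f \<in> Arr E" by (simp add: is_alg_def)
  note s = alg_sq[OF a(2)]
  have "\<alpha> \<cdot>\<^bsub>arrow_cat E\<^esub> \<eta> f = Ide (arrow_cat E) f" using a f by (simp add: is_alg_def)
  moreover have "\<alpha> \<cdot>\<^bsub>arrow_cat E\<^esub> \<mu> f = \<alpha> \<cdot>\<^bsub>arrow_cat E\<^esub> R_sq \<alpha>"
    using a f R_sq[OF s] by (simp add: is_alg_def)
  ultimately show "(f, \<alpha>) \<in> Obj (R_Map E W)"
    using s a f by (simp add: R_Map_def monad_alg_def str_cat_def del: E.arrow_cat_simps(4,5))
qed

lemma is_alg_of:
  assumes \<psi>: "right_map E I u (f, \<psi>)"
  shows "is_alg f (alg_of f \<psi>)"
proof -
  have f: "f \<in> Arr E" by (rule right_mapD(1)[OF \<psi>])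
  note F = free_Hom[OF f]
  note R = free_Hom[OF F(8)]
  let ?a = "alg_of f \<psi>"
  note a = alg_of[OF \<psi>]
  note A = rmorD[OF a(2)]
  have fa: "f \<cdot> ?a = rf f" using A(6) F by simp
  have s: "Sq (rf f) f ?a (Ide E (Cod E f)) \<in> Hom (arrow_cat E) (rf f) f" (is "?s \<in> _") by (rule A(1))
  have "?a \<cdot> m f = ?a \<cdot> K ?s"
  proof (rule rmor_eqI[OF F(8) \<psi>])
    show "rmor (rf (rf f)) (\<phi> (rf f)) f \<psi> (?a \<cdot> m f) (Ide E (Cod E f))"
      by (rule rmor_comp'[OF R(4) m(2)[OF f] a(2)]) (use f in simp)
    show "rmor (rf (rf f)) (\<phi> (rf f)) f \<psi> (?a \<cdot> K ?s) (Ide E (Cod E f))"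
      by (rule rmor_comp'[OF R(4) K(2)[OF s] a(2)]) (use f in simp)
    have "?a \<cdot> m f \<cdot> lf (rf f) = ?a"
      using E.Comp_assoc[OF R(1) m(3)[OF f] A(4)] m(1)[OF f] E.Comp_Id[OF A(4)] by simp
    also have "\<dots> = ?a \<cdot> (lf f \<cdot> ?a)" using E.Comp_assoc[OF A(4) F(1) A(4)] a(1) E.Id_Comp[OF A(4)] by simp
    also have "\<dots> = ?a \<cdot> K ?s \<cdot> lf (rf f)"
      using E.Comp_assoc[OF R(1) K(3)[OF s] A(4)] K(1)[OF s] by simp
    finally show "?a \<cdot> m f \<cdot> lf (rf f) = ?a \<cdot> K ?s \<cdot> lf (rf f)" .
  qed
  thus ?thesis using f A(4) fa a(1) by (simp add: is_alg_def)
qed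

lemma fill_of_eq:
  assumes "sqr i f s t"
  shows "fill_of f a i (Sq (fob u i) f s t) = a \<cdot> \<phi> f i (Sq (fob u i) (rf f) (lf f \<cdot> s) t)"
  using assms by (simp add: fill_of_def sqr_def)

lemma unit_sqr:
  assumes "sqr i f s t"
  shows "sqr i (rf f) (lf f \<cdot> s) t"
  by (rule sqr_postcomp_over[OF assms]) (use free_Hom[OF sqrD(2)[OF assms]] in simp_all)

text \<open>The laws of an algebra enter separately: the unit law makes the induced fillers fill, and the
  associative law makes the structure map \<open>a\<close> preserve fillers.\<close>

lemma right_map_of_alg:
  assumes a: "is_alg f a"
  shows "right_map E I u (f, fill_of f a)" "rmor (rf f) (\<phi> f) f (fill_of f a) a (Ide E (Cod E f))"
proof -
  have f: "f \<in> Arr E" and aH: "a \<in> Hom E (D f) (Dom E f)" and fa: "f \<cdot> a = rf f"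
    and al: "a \<cdot> lf f = Ide E (Dom E f)" and am: "a \<cdot> m f = a \<cdot> K (Sq (rf f) f a (Ide E (Cod E f)))"
    using a by (auto simp: is_alg_def)
  note F = free_Hom[OF f] and s = alg_sq[OF a]
  note R = free_Hom[OF F(8)] and fH = E.Arr_Hom[OF f]
  note r = right_mapD[OF F(4)]
  show "right_map E I u (f, fill_of f a)"
  proof (rule right_mapI[OF f])
    show "fill_of f a i q = undefined" if "\<not> (i \<in> Obj I \<and> q \<in> Hom (arrow_cat E) (fob u i) f)" for i q
      unfolding fill_of_def by (rule if_not_P[OF that])
    fix i s t assume sq: "sqr i f s t"
    note q = sqrD[OF sq] and v = unit_sqr[OF sq]
    note rv = r(2-4)[OF v]
    show "fill_of f a i (Sq (fob u i) f s t) \<in> Hom E (tgt i) (Dom E f)"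
      unfolding fill_of_eq[OF sq] by (rule E.Comp_Hom[OF rv(1) aH])
    show "fill_of f a i (Sq (fob u i) f s t) \<cdot> fob u i = s"
      using E.Comp_assoc[OF q(6) rv(1) aH] rv(2) E.Comp_assoc[OF q(3) F(1) aH] al E.Id_Comp[OF q(3)]
      by (simp add: fill_of_eq[OF sq])
    show "f \<cdot> fill_of f a i (Sq (fob u i) f s t) = t"
      using E.Comp_assoc[OF rv(1) aH fH] rv(3) fa by (simp add: fill_of_eq[OF sq])
  next
    fix i j \<tau> s t assume sq: "sqr j f s t" and \<tau>: "\<tau> \<in> Hom I i j"
    note q = sqrD[OF sq] and v = unit_sqr[OF sq]
    show "fill_of f a j (Sq (fob u j) f s t) \<cdot> ubot \<tau> = fill_of f a i (Sq (fob u i) f (s \<cdot> utop \<tau>) (t \<cdot> ubot \<tau>))"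
      unfolding fill_of_eq[OF sq] fill_of_eq[OF sqr_precomp[OF sq \<tau>]]
      using E.Comp_assoc[OF gen_map(3)[OF \<tau>] r(2)[OF v] aH] r(5)[OF v \<tau>]
        E.Comp_assoc[OF gen_map(2)[OF \<tau>] q(3) F(1)] by simp
  qed
  show "rmor (rf f) (\<phi> f) f (fill_of f a) a (Ide E (Cod E f))"
  proof (rule rmorI)
    show "rf f \<in> Arr E" "f \<in> Arr E" "a \<in> Hom E (D f) (Dom E f)" by fact+
    show "Ide E (Cod E f) \<in> Hom E (Cod E (rf f)) (Cod E f)" using F f by (simp add: E.Id_Hom)
    show "f \<cdot> a = Ide E (Cod E f) \<cdot> rf f" using fa F by simp
    fix i x t assume sq: "sqr i (rf f) x t"
    note q = sqrD[OF sq] and v = unit_sqr[OF sq]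
    let ?S = "Sq (rf f) f a (Ide E (Cod E f))"
    have t: "Ide E (Cod E f) \<cdot> t = t" using q(4) F E.Id_Comp by simp
    have fsq: "sqr i f (a \<cdot> x) t"
      by (rule sqr_postcomp_over[OF sq aH f]) (use F fa in simp_all)
    have ws: "\<phi> (rf f) i (Sq (fob u i) (rf (rf f)) (lf (rf f) \<cdot> x) t) \<in> Hom E (tgt i) (D (rf f))"
      (is "?w \<in> _") by (rule right_mapD(2)[OF R(4) v])
    have "a \<cdot> \<phi> f i (Sq (fob u i) (rf f) x t) = a \<cdot> (m f \<cdot> ?w)"
    proof -
      have "m f \<cdot> (lf (rf f) \<cdot> x) = x"
        using E.Comp_assoc[OF q(3) R(1) m(3)[OF f]] m(1)[OF f] E.Id_Comp[OF q(3)] by simp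
      thus ?thesis using rmorD(7)[OF m(2)[OF f] v] t by simp
    qed
    also have "\<dots> = a \<cdot> m f \<cdot> ?w" using E.Comp_assoc[OF ws m(3)[OF f] aH] by simp
    also have "\<dots> = a \<cdot> (K ?S \<cdot> ?w)" unfolding am by (rule E.Comp_assoc[OF ws K(3)[OF s] aH])
    also have "K ?S \<cdot> ?w = \<phi> f i (Sq (fob u i) (rf f) (lf f \<cdot> (a \<cdot> x)) t)"
    proof -
      have "K ?S \<cdot> (lf (rf f) \<cdot> x) = lf f \<cdot> (a \<cdot> x)"
        using E.Comp_assoc[OF q(3) R(1) K(3)[OF s]] K(1)[OF s] E.Comp_assoc[OF q(3) aH F(1)] by simp
      thus ?thesis using rmorD(7)[OF K(2)[OF s] v] t by simp
    qed
    finally show "a \<cdot> \<phi> f i (Sq (fob u i) (rf f) x t) =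
        fill_of f a i (Sq (fob u i) f (a \<cdot> x) (Ide E (Cod E f) \<cdot> t))"
      using t by (simp add: fill_of_eq[OF fsq])
  qed
qed

lemma alg_of_fill_of:
  assumes a: "is_alg f a"
  shows "alg_of f (fill_of f a) = a"
proof (rule rmor_eqI)
  note r = right_map_of_alg[OF a]
  show "f \<in> Arr E" using a by (simp add: is_alg_def)
  show "right_map E I u (f, fill_of f a)" by (rule r(1))
  show "rmor (rf f) (\<phi> f) f (fill_of f a) (alg_of f (fill_of f a)) (Ide E (Cod E f))" by (rule alg_of(2)[OF r(1)])
  show "rmor (rf f) (\<phi> f) f (fill_of f a) a (Ide E (Cod E f))" by (rule r(2))
  show "alg_of f (fill_of f a) \<cdot> lf f = a \<cdot> lf f" using alg_of(1)[OF r(1)] a by (simp add: is_alg_def)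
qed

lemma fill_of_alg_of:
  assumes \<psi>: "right_map E I u (f, \<psi>)"
  shows "fill_of f (alg_of f \<psi>) = \<psi>"
proof (intro HOL.ext)
  fix i q
  note a = alg_of[OF \<psi>]
  show "fill_of f (alg_of f \<psi>) i q = \<psi> i q"
  proof (cases "i \<in> Obj I \<and> q \<in> Hom (arrow_cat E) (fob u i) f")
    case False
    thus ?thesis using right_mapD(6)[OF \<psi> False] unfolding fill_of_def by (simp only: if_False)
  next
    case True
    then obtain s t where qe: "q = Sq (fob u i) f s t" using E.Sq_HomE by metis
    have sq: "sqr i f s t" using True by (simp add: sqr_def qe)
    note Q = sqrD[OF sq] and F = free_Hom[OF sqrD(2)[OF sq]]
    have "alg_of f \<psi> \<cdot> (lf f \<cdot> s) = s"
      using E.Comp_assoc[OF Q(3) F(1) rmorD(4)[OF a(2)]] a(1) E.Id_Comp[OF Q(3)] by simp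
    thus ?thesis using rmorD(7)[OF a(2) unit_sqr[OF sq]] E.Id_Comp[OF Q(4)]
      by (simp add: qe fill_of_eq[OF sq])
  qed
qed

text \<open>Morphisms of right maps are morphisms of algebras, because fillers and structure maps determine
  each other.\<close>

lemma rmor_iff_alg:
  assumes \<psi>: "right_map E I u (f, \<psi>)" and \<chi>: "right_map E I u (g, \<chi>)"
    and q: "q \<in> Hom (arrow_cat E) f g"
  shows "rmor f \<psi> g \<chi> (sq_top q) (sq_bot q) \<longleftrightarrow> sq_top q \<cdot> alg_of f \<psi> = alg_of g \<chi> \<cdot> K q"
proof
  note Q = E.HomA_D[OF q]
  note F = free_Hom[OF Q(3)] and G = free_Hom[OF Q(4)]
  note a = alg_of[OF \<psi>] and b = alg_of[OF \<chi>]
  note A = rmorD[OF a(2)] and B = rmorD[OF b(2)]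
  have x: "sq_top q \<in> Hom E (Dom E f) (Dom E g)" and y: "sq_bot q \<in> Hom E (Cod E f) (Cod E g)"
    using Q by (simp_all add: E.HomI)
  {
    assume r: "rmor f \<psi> g \<chi> (sq_top q) (sq_bot q)"
    show "sq_top q \<cdot> alg_of f \<psi> = alg_of g \<chi> \<cdot> K q"
    proof (rule rmor_eqI[OF Q(3) \<chi>])
      show "rmor (rf f) (\<phi> f) g \<chi> (sq_top q \<cdot> alg_of f \<psi>) (sq_bot q)"
        by (rule rmor_comp'[OF F(4) a(2) r]) (use Q in simp)
      show "rmor (rf f) (\<phi> f) g \<chi> (alg_of g \<chi> \<cdot> K q) (sq_bot q)"
        by (rule rmor_comp'[OF F(4) K(2)[OF q] b(2)]) (use Q in simp)
      have "sq_top q \<cdot> alg_of f \<psi> \<cdot> lf f = sq_top q"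
        using E.Comp_assoc[OF F(1) A(4) x] a(1) E.Comp_Id[OF x] by simp
      also have "\<dots> = alg_of g \<chi> \<cdot> K q \<cdot> lf f"
        using E.Comp_assoc[OF F(1) K(3)[OF q] B(4)] K(1)[OF q] E.Comp_assoc[OF x G(1) B(4)] b(1)
          E.Id_Comp[OF x] by simp
      finally show "sq_top q \<cdot> alg_of f \<psi> \<cdot> lf f = alg_of g \<chi> \<cdot> K q \<cdot> lf f" .
    qed
  }
  assume e: "sq_top q \<cdot> alg_of f \<psi> = alg_of g \<chi> \<cdot> K q"
  show "rmor f \<psi> g \<chi> (sq_top q) (sq_bot q)"
  proof (rule rmorI[OF Q(3,4) x y Q(11)])
    fix i s t assume sq: "sqr i f s t"
    note q' = sqrD[OF sq] and v = unit_sqr[OF sq]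
    have w: "\<phi> f i (Sq (fob u i) (rf f) (lf f \<cdot> s) t) \<in> Hom E (tgt i) (D f)" (is "?w \<in> _")
      by (rule right_mapD(2)[OF F(4) v])
    have gsq: "sqr i g (sq_top q \<cdot> s) (sq_bot q \<cdot> t)" by (rule sqr_postcomp[OF sq x Q(4) y Q(11)])
    have "\<psi> i (Sq (fob u i) f s t) = alg_of f \<psi> \<cdot> ?w"
      using fill_of_eq[OF sq, of "alg_of f \<psi>"] fill_of_alg_of[OF \<psi>] by simp
    hence "sq_top q \<cdot> \<psi> i (Sq (fob u i) f s t) = alg_of g \<chi> \<cdot> (K q \<cdot> ?w)"
      using E.Comp_assoc[OF w A(4) x] e E.Comp_assoc[OF w K(3)[OF q] B(4)] by simp
    also have "K q \<cdot> ?w = \<phi> g i (Sq (fob u i) (rf g) (K q \<cdot> (lf f \<cdot> s)) (sq_bot q \<cdot> t))"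
      by (rule rmorD(7)[OF K(2)[OF q] v])
    also have "K q \<cdot> (lf f \<cdot> s) = lf g \<cdot> (sq_top q \<cdot> s)"
      using E.Comp_assoc[OF q'(3) F(1) K(3)[OF q]] K(1)[OF q] E.Comp_assoc[OF q'(3) x G(1)] by simp
    also have "alg_of g \<chi> \<cdot> \<phi> g i (Sq (fob u i) (rf g) (lf g \<cdot> (sq_top q \<cdot> s)) (sq_bot q \<cdot> t)) =
        \<chi> i (Sq (fob u i) g (sq_top q \<cdot> s) (sq_bot q \<cdot> t))"
      using fill_of_eq[OF gsq, of "alg_of g \<chi>"] fill_of_alg_of[OF \<chi>] by simp
    finally show "sq_top q \<cdot> \<psi> i (Sq (fob u i) f s t) = \<chi> i (Sq (fob u i) g (sq_top q \<cdot> s) (sq_bot q \<cdot> t))" .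
  qed
qed

theorem right_maps_iso_R_Map: "iso_over (right_maps E I u) forget (R_Map E W) forget"
proof -
  let ?F = "\<lambda>(f, \<psi>). (f, Sq (rf f) f (alg_of f \<psi>) (Ide E (Cod E f)))"
  let ?G = "\<lambda>(f, \<alpha>). (f, fill_of f (sq_top \<alpha>))"
  have RM: "R_Map E W = str_cat (arrow_cat E) (Obj (R_Map E W))
      (\<lambda>(a, \<alpha>) (b, \<beta>) m. m \<cdot>\<^bsub>arrow_cat E\<^esub> \<alpha> = \<beta> \<cdot>\<^bsub>arrow_cat E\<^esub> far (R_ftor W) m)"
    by (simp add: R_Map_def monad_alg_def str_cat_def)
  show ?thesis
    unfolding right_maps_def
  proof (subst RM, rule iso_over_str_catI[where F = ?F and G = ?G])
    fix X assume "X \<in> {X. right_map E I u X}"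
    then obtain f \<psi> where X: "X = (f, \<psi>)" "right_map E I u (f, \<psi>)" by (cases X) auto
    show "?F X \<in> Obj (R_Map E W) \<and> fst (?F X) = fst X \<and> ?G (?F X) = X"
      using is_alg_of[OF X(2)] fill_of_alg_of[OF X(2)] by (simp add: X(1) R_Map_obj_iff)
  next
    fix Y assume Y: "Y \<in> Obj (R_Map E W)"
    obtain f \<alpha> where fa: "Y = (f, \<alpha>)" by (cases Y)
    then obtain a where a: "\<alpha> = Sq (rf f) f a (Ide E (Cod E f))" "is_alg f a" using Y R_Map_obj_iff by blast
    show "?G Y \<in> {X. right_map E I u X} \<and> fst (?G Y) = fst Y \<and> ?F (?G Y) = Y"
      using right_map_of_alg(1)[OF a(2)] alg_of_fill_of[OF a(2)] by (simp add: fa a(1))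
  next
    fix X Y q assume "X \<in> {X. right_map E I u X}" "Y \<in> {X. right_map E I u X}"
      and q: "q \<in> Hom (arrow_cat E) (fst X) (fst Y)"
    then obtain f \<psi> g \<chi> where X: "X = (f, \<psi>)" "right_map E I u (f, \<psi>)" and Y: "Y = (g, \<chi>)" "right_map E I u (g, \<chi>)"
      by (cases X, cases Y) auto
    have q: "q \<in> Hom (arrow_cat E) f g" using q X Y by simp
    note Q = E.HomA_D[OF q]
    have qe: "q = Sq f g (sq_top q) (sq_bot q)" using Q by (cases q) simp
    have "(\<forall>i\<in>Obj I. \<forall>p\<in>Hom (arrow_cat E) (fob u i) f.
        sq_top q \<cdot> \<psi> i p = \<chi> i (q \<cdot>\<^bsub>arrow_cat E\<^esub> p)) \<longleftrightarrow> rmor f \<psi> g \<chi> (sq_top q) (sq_bot q)"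
      using right_maps_morphism[of f g "sq_top q" "sq_bot q" \<psi> \<chi>] q qe by metis
    also have "\<dots> \<longleftrightarrow> sq_top q \<cdot> alg_of f \<psi> = alg_of g \<chi> \<cdot> K q" by (rule rmor_iff_alg[OF X(2) Y(2) q])
    also have "\<dots> \<longleftrightarrow> q \<cdot>\<^bsub>arrow_cat E\<^esub> Sq (rf f) f (alg_of f \<psi>) (Ide E (Cod E f)) =
        Sq (rf g) g (alg_of g \<chi>) (Ide E (Cod E g)) \<cdot>\<^bsub>arrow_cat E\<^esub> R_sq q"
      using Q R_sq[OF q] by simp
    finally show "(case X of (f, \<phi>) \<Rightarrow> \<lambda>(g, \<psi>) m. \<forall>i \<in> Obj I. \<forall>q \<in> Hom (arrow_cat E) (fob u i) f.
        sq_top m \<cdot> \<phi> i q = \<psi> i (m \<cdot>\<^bsub>arrow_cat E\<^esub> q)) Y q \<longleftrightarrow>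
      (case ?F X of (a, \<alpha>) \<Rightarrow> \<lambda>(b, \<beta>) m. m \<cdot>\<^bsub>arrow_cat E\<^esub> \<alpha> = \<beta> \<cdot>\<^bsub>arrow_cat E\<^esub> far (R_ftor W) m) (?F Y) q"
      unfolding X(1) Y(1) prod.case W_simps .
  qed
qed

subsection \<open>Coalgebras are left maps\<close>

text \<open>The coalgebra structure of a left map is its lift against the free right map \<open>rf f\<close>; conversely a
  coalgebra lifts a square by extending it to \<open>rf f\<close>.\<close>

lemma right_maps_Hom_iff:
  "F \<in> Hom (right_maps E I u) (g, \<psi>) (h, \<chi>) \<longleftrightarrow> (\<exists>a b. F = ((g, \<psi>), (h, \<chi>), Sq g h a b) \<and>
     right_map E I u (g, \<psi>) \<and> right_map E I u (h, \<chi>) \<and> rmor g \<psi> h \<chi> a b)"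
proof
  assume "F \<in> Hom (right_maps E I u) (g, \<psi>) (h, \<chi>)"
  then obtain p where p: "F = ((g, \<psi>), (h, \<chi>), p)" "right_map E I u (g, \<psi>)" "right_map E I u (h, \<chi>)"
    "p \<in> Hom (arrow_cat E) g h"
    "\<forall>i\<in>Obj I. \<forall>q\<in>Hom (arrow_cat E) (fob u i) g. sq_top p \<cdot> \<psi> i q = \<chi> i (p \<cdot>\<^bsub>arrow_cat E\<^esub> q)"
    unfolding right_maps_def str_cat_Hom_iff by auto
  obtain a b where ab: "p = Sq g h a b" using E.Sq_HomE[OF p(4)] by metis
  have "rmor g \<psi> h \<chi> a b" using right_maps_morphism p(4,5) unfolding ab by blast
  thus "\<exists>a b. F = ((g, \<psi>), (h, \<chi>), Sq g h a b) \<and>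
     right_map E I u (g, \<psi>) \<and> right_map E I u (h, \<chi>) \<and> rmor g \<psi> h \<chi> a b" using p ab by blast
next
  assume "\<exists>a b. F = ((g, \<psi>), (h, \<chi>), Sq g h a b) \<and>
     right_map E I u (g, \<psi>) \<and> right_map E I u (h, \<chi>) \<and> rmor g \<psi> h \<chi> a b"
  then obtain a b where F: "F = ((g, \<psi>), (h, \<chi>), Sq g h a b)"
     "right_map E I u (g, \<psi>)" "right_map E I u (h, \<chi>)" "rmor g \<psi> h \<chi> a b" by blast
  have "\<forall>i\<in>Obj I. \<forall>q\<in>Hom (arrow_cat E) (fob u i) g.
      sq_top (Sq g h a b) \<cdot> \<psi> i q = \<chi> i (Sq g h a b \<cdot>\<^bsub>arrow_cat E\<^esub> q)"
    using right_maps_morphism[OF rmorD(1)[OF F(4)]] F(4) by blast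
  thus "F \<in> Hom (right_maps E I u) (g, \<psi>) (h, \<chi>)"
    using F rmorD(1)[OF F(4)] unfolding right_maps_def str_cat_Hom_iff
    by (simp del: E.arrow_cat_simps)
qed

lemma right_maps_Obj [simp]: "Obj (right_maps E I u) = {X. right_map E I u X}"
  by (simp add: right_maps_def str_cat_def)

lemma forget_simps [simp]: "fob forget X = fst X" "far forget (X, Y, q) = q"
  by (simp_all add: forget_def)

lemma ext_comp:
  assumes g: "right_map E I u (g, \<psi>)" and h: "right_map E I u (h, \<chi>)" and r: "rmor g \<psi> h \<chi> a b"
    and q: "Sq f g s t \<in> Hom (arrow_cat E) f g"
  shows "a \<cdot> ext f g \<psi> s t = ext f h \<chi> (a \<cdot> s) (b \<cdot> t)"
proof (rule ext_eqI[OF h])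
  note e = ext[OF g q] and R = rmorD[OF r] and F = free_Hom[OF E.HomA_D(3)[OF q]]
  show "Sq f h (a \<cdot> s) (b \<cdot> t) \<in> Hom (arrow_cat E) f h"
    using category.Comp_Hom[OF E.arrow_category q R(1)] by simp
  show "a \<cdot> ext f g \<psi> s t \<cdot> lf f = a \<cdot> s" using E.Comp_assoc[OF F(1) rmorD(4)[OF e(2)] R(4)] e(1) by simp
  show "rmor (rf f) (\<phi> f) h \<chi> (a \<cdot> ext f g \<psi> s t) (b \<cdot> t)" by (rule rmor_comp[OF F(4) e(2) r])
qed

lemma ext_K:
  assumes h: "right_map E I u (h, \<psi>)" and p: "p \<in> Hom (arrow_cat E) f g"
    and q: "Sq g h s t \<in> Hom (arrow_cat E) g h"
  shows "ext g h \<psi> s t \<cdot> K p = ext f h \<psi> (s \<cdot> sq_top p) (t \<cdot> sq_bot p)"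
proof (rule ext_eqI[OF h])
  note e = ext[OF h q] and P = E.HomA_D[OF p]
  note F = free_Hom[OF P(3)] and G = free_Hom[OF P(4)]
  have x: "sq_top p \<in> Hom E (Dom E f) (Dom E g)" using P by (simp add: E.HomI)
  show "Sq f h (s \<cdot> sq_top p) (t \<cdot> sq_bot p) \<in> Hom (arrow_cat E) f h"
    using category.Comp_Hom[OF E.arrow_category p q] P by simp
  show "ext g h \<psi> s t \<cdot> K p \<cdot> lf f = s \<cdot> sq_top p"
    using E.Comp_assoc[OF F(1) K(3)[OF p] rmorD(4)[OF e(2)]] K(1)[OF p]
      E.Comp_assoc[OF x G(1) rmorD(4)[OF e(2)]] e(1) by simp
  show "rmor (rf f) (\<phi> f) h \<psi> (ext g h \<psi> s t \<cdot> K p) (t \<cdot> sq_bot p)" by (rule rmor_comp[OF F(4) K(2)[OF p] e(2)])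
qed

lemma ext_unit:
  assumes f: "f \<in> Arr E"
  shows "ext f (rf f) (\<phi> f) (lf f) (Ide E (Cod E f)) = Ide E (D f)"
proof -
  note F = free_Hom[OF f]
  have "rmor (rf f) (\<phi> f) (rf f) (\<phi> f) (Ide E (D f)) (Ide E (Cod E f))"
    using rmor_id[OF F(4)] F(9) by simp
  thus ?thesis using ext_eqI[OF F(4) unit_sq[OF f], of "Ide E (D f)"] F by simp
qed

definition is_coalg :: "'m \<Rightarrow> 'm \<Rightarrow> bool" where
  "is_coalg f y \<longleftrightarrow> f \<in> Arr E \<and> y \<in> Hom E (Cod E f) (D f) \<and> y \<cdot> f = lf f \<and> rf f \<cdot> y = Ide E (Cod E f)"

lemma L_map_obj_iff:
  "(f, \<alpha>) \<in> Obj (L_map E W) \<longleftrightarrow> (\<exists>y. \<alpha> = Sq f (lf f) (Ide E (Dom E f)) y \<and> is_coalg f y)"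
proof
  assume "(f, \<alpha>) \<in> Obj (L_map E W)"
  hence f: "f \<in> Arr E" and \<alpha>: "\<alpha> \<in> Hom (arrow_cat E) f (lf f)"
    and co: "\<epsilon> f \<cdot>\<^bsub>arrow_cat E\<^esub> \<alpha> = Ide (arrow_cat E) f"
    by (auto simp: L_map_def copointed_coalg_def str_cat_def simp del: E.arrow_cat_simps(4,5))
  note F = free_Hom[OF f]
  obtain x y where xy: "\<alpha> = Sq f (lf f) x y" "x \<in> Hom E (Dom E f) (Dom E (lf f))"
    "y \<in> Hom E (Cod E f) (Cod E (lf f))" "lf f \<cdot> x = y \<cdot> f" using E.Sq_HomE[OF \<alpha>] by metis
  have x: "x = Ide E (Dom E f)" using co xy F E.HomD[OF xy(2)] by simp
  have "rf f \<cdot> y = Ide E (Cod E f)" using co xy by simp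
  thus "\<exists>y. \<alpha> = Sq f (lf f) (Ide E (Dom E f)) y \<and> is_coalg f y"
    using xy x f F by (intro exI[of _ y]) (simp add: is_coalg_def)
next
  assume "\<exists>y. \<alpha> = Sq f (lf f) (Ide E (Dom E f)) y \<and> is_coalg f y"
  then obtain y where y: "\<alpha> = Sq f (lf f) (Ide E (Dom E f)) y" "is_coalg f y" by blast
  hence f: "f \<in> Arr E" by (simp add: is_coalg_def)
  note F = free_Hom[OF f]
  have "\<alpha> \<in> Hom (arrow_cat E) f (lf f)" using y f F by (simp add: is_coalg_def E.Sq_Hom_iff E.Id_Hom)
  moreover have "\<epsilon> f \<cdot>\<^bsub>arrow_cat E\<^esub> \<alpha> = Ide (arrow_cat E) f" using y f by (simp add: is_coalg_def)
  ultimately show "(f, \<alpha>) \<in> Obj (L_map E W)"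
    using f by (simp add: L_map_def copointed_coalg_def str_cat_def del: E.arrow_cat_simps(4,5))
qed

definition coalg_of :: "'m \<Rightarrow> ('m \<times> ('i \<Rightarrow> 'm sq \<Rightarrow> 'm) \<Rightarrow> 'm sq \<Rightarrow> 'm) \<Rightarrow> 'm" where
  "coalg_of f \<chi> = \<chi> (rf f, \<phi> f) (\<eta> f)"

definition lift_of :: "'m \<Rightarrow> 'm \<Rightarrow> 'm \<times> ('i \<Rightarrow> 'm sq \<Rightarrow> 'm) \<Rightarrow> 'm sq \<Rightarrow> 'm" where
  "lift_of f y X q = (if X \<in> Obj (right_maps E I u) \<and> q \<in> Hom (arrow_cat E) f (fst X)
     then ext f (fst X) (snd X) (sq_top q) (sq_bot q) \<cdot> y else undefined)"

lemma left_mapD: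
  assumes "left_map E (right_maps E I u) forget (f, \<chi>)"
  shows "f \<in> Arr E"
    "\<And>g \<psi> q. right_map E I u (g, \<psi>) \<Longrightarrow> q \<in> Hom (arrow_cat E) f g \<Longrightarrow> is_filler E q (\<chi> (g, \<psi>) q)"
    "\<And>g \<psi> h \<psi>' a b q. right_map E I u (g, \<psi>) \<Longrightarrow> right_map E I u (h, \<psi>') \<Longrightarrow> rmor g \<psi> h \<psi>' a b \<Longrightarrow>
      q \<in> Hom (arrow_cat E) f g \<Longrightarrow> a \<cdot> \<chi> (g, \<psi>) q = \<chi> (h, \<psi>') (Sq g h a b \<cdot>\<^bsub>arrow_cat E\<^esub> q)"
    "\<And>X q. \<not> (X \<in> Obj (right_maps E I u) \<and> q \<in> Hom (arrow_cat E) f (fst X)) \<Longrightarrow> \<chi> X q = undefined"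
proof -
  note L = assms[unfolded left_map_def prod.case forget_simps(1)]
  show "f \<in> Arr E" by (rule L[THEN conjunct1])
  show "is_filler E q (\<chi> (g, \<psi>) q)"
    if "right_map E I u (g, \<psi>)" "q \<in> Hom (arrow_cat E) f g" for g \<psi> q
    using L[THEN conjunct2, THEN conjunct1, rule_format, of "(g, \<psi>)" q] that by simp
  show "\<chi> X q = undefined"
    if "\<not> (X \<in> Obj (right_maps E I u) \<and> q \<in> Hom (arrow_cat E) f (fst X))" for X q
    by (rule L[THEN conjunct2, THEN conjunct2, THEN conjunct2, rule_format, OF that])
  fix g \<psi> h \<psi>' a b q
  assume r: "right_map E I u (g, \<psi>)" "right_map E I u (h, \<psi>')" "rmor g \<psi> h \<psi>' a b"
    and q: "q \<in> Hom (arrow_cat E) f g"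
  have "((g, \<psi>), (h, \<psi>'), Sq g h a b) \<in> Hom (right_maps E I u) (g, \<psi>) (h, \<psi>')"
    using r by (simp add: right_maps_Hom_iff)
  moreover have "q \<in> Hom (arrow_cat E) f (fst (g, \<psi>))" using q by simp
  ultimately have "sq_top (far forget ((g, \<psi>), (h, \<psi>'), Sq g h a b)) \<cdot> \<chi> (g, \<psi>) q =
      \<chi> (h, \<psi>') (far forget ((g, \<psi>), (h, \<psi>'), Sq g h a b) \<cdot>\<^bsub>arrow_cat E\<^esub> q)"
    by (rule L[THEN conjunct2, THEN conjunct2, THEN conjunct1, rule_format])
  thus "a \<cdot> \<chi> (g, \<psi>) q = \<chi> (h, \<psi>') (Sq g h a b \<cdot>\<^bsub>arrow_cat E\<^esub> q)" by simp
qed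

lemma is_coalg_of:
  assumes "left_map E (right_maps E I u) forget (f, \<chi>)"
  shows "is_coalg f (coalg_of f \<chi>)"
proof -
  note l = left_mapD[OF assms]
  note F = free_Hom[OF l(1)]
  show ?thesis using l(2)[OF F(4) unit_sq[OF l(1)]] l(1)
    by (simp add: is_coalg_def coalg_of_def is_filler_def)
qed

lemma lift_of_eq:
  assumes "right_map E I u (g, \<psi>)" "Sq f g s t \<in> Hom (arrow_cat E) f g"
  shows "lift_of f y (g, \<psi>) (Sq f g s t) = ext f g \<psi> s t \<cdot> y"
  using assms by (simp add: lift_of_def)

lemma left_map_of_coalg:
  assumes y: "is_coalg f y"
  shows "left_map E (right_maps E I u) forget (f, lift_of f y)"
  unfolding left_map_def prod.case forget_simps(1)
proof (intro conjI ballI allI impI)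
  have f: "f \<in> Arr E" and yH: "y \<in> Hom E (Cod E f) (D f)" and yf: "y \<cdot> f = lf f"
    and ry: "rf f \<cdot> y = Ide E (Cod E f)" using y by (auto simp: is_coalg_def)
  note F = free_Hom[OF f]
  show "f \<in> Arr E" by fact
  show "lift_of f y X q = undefined"
    if "\<not> (X \<in> Obj (right_maps E I u) \<and> q \<in> Hom (arrow_cat E) f (fst X))" for X q
    unfolding lift_of_def by (rule if_not_P[OF that])
  { fix X q assume "X \<in> Obj (right_maps E I u)" and "q \<in> Hom (arrow_cat E) f (fst X)"
    then obtain g \<psi> where X: "X = (g, \<psi>)" "right_map E I u (g, \<psi>)" and q: "q \<in> Hom (arrow_cat E) f g"
      by (cases X) auto
    obtain s t where qe: "q = Sq f g s t" "g \<in> Arr E" "t \<in> Hom E (Cod E f) (Cod E g)"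
      using E.Sq_HomE[OF q] by metis
    note e = ext[OF X(2) q[unfolded qe(1)]]
    note R = rmorD[OF e(2)]
    have t: "t \<in> Hom E (Cod E (rf f)) (Cod E g)" using qe(3) F by simp
    have "ext f g \<psi> s t \<cdot> y \<cdot> f = s" using E.Comp_assoc[OF E.Arr_Hom[OF f] yH R(4)] yf e(1) by simp
    moreover have "g \<cdot> (ext f g \<psi> s t \<cdot> y) = t"
      using E.Comp_assoc[OF yH R(4) E.Arr_Hom[OF qe(2)]] R(6) E.Comp_assoc[OF yH F(2) qe(3)] ry
        E.Comp_Id[OF qe(3)] by simp
    ultimately show "is_filler E q (lift_of f y X q)"
      using lift_of_eq[OF X(2) q[unfolded qe(1)], of y] E.Comp_Hom[OF yH R(4)] by (simp add: is_filler_def qe X(1)) }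
  fix X Y p q assume p: "p \<in> Hom (right_maps E I u) X Y" and q: "q \<in> Hom (arrow_cat E) f (fst X)"
  obtain g \<psi> h \<chi> where XY: "X = (g, \<psi>)" "Y = (h, \<chi>)" by (cases X, cases Y)
  obtain a b where p': "p = ((g, \<psi>), (h, \<chi>), Sq g h a b)"
     "right_map E I u (g, \<psi>)" "right_map E I u (h, \<chi>)" "rmor g \<psi> h \<chi> a b"
    using p unfolding XY right_maps_Hom_iff by blast
  have q: "q \<in> Hom (arrow_cat E) f g" using q XY by simp
  obtain s t where qe: "q = Sq f g s t" using E.Sq_HomE[OF q] by metis
  note q = q[unfolded qe] and R = rmorD[OF p'(4)]
  have q2: "Sq f h (a \<cdot> s) (b \<cdot> t) \<in> Hom (arrow_cat E) f h"
    using category.Comp_Hom[OF E.arrow_category q R(1)] by simp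
  have "a \<cdot> (ext f g \<psi> s t \<cdot> y) = ext f h \<chi> (a \<cdot> s) (b \<cdot> t) \<cdot> y"
    using E.Comp_assoc[OF yH rmorD(4)[OF ext(2)[OF p'(2) q]] R(4)] ext_comp[OF p'(2-4) q] by simp
  thus "sq_top (far forget p) \<cdot> lift_of f y X q = lift_of f y Y (far forget p \<cdot>\<^bsub>arrow_cat E\<^esub> q)"
    using lift_of_eq[OF p'(2) q, of y] lift_of_eq[OF p'(3) q2, of y] by (simp add: XY p'(1) qe)
qed

text \<open>Every square from \<open>f\<close> to a right map is its unit square followed by a morphism of right maps, so a
  natural choice of lifts is determined by the lift of the unit square.\<close>

lemma lift_of_coalg_of:
  assumes "left_map E (right_maps E I u) forget (f, \<chi>)"
  shows "lift_of f (coalg_of f \<chi>) = \<chi>"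
proof (intro HOL.ext)
  fix X q
  note l = left_mapD[OF assms]
  note F = free_Hom[OF l(1)]
  show "lift_of f (coalg_of f \<chi>) X q = \<chi> X q"
  proof (cases "X \<in> Obj (right_maps E I u) \<and> q \<in> Hom (arrow_cat E) f (fst X)")
    case False
    thus ?thesis using l(4)[OF False] unfolding lift_of_def by (simp only: if_False)
  next
    case True
    then obtain g \<psi> where X: "X = (g, \<psi>)" "right_map E I u (g, \<psi>)" and q: "q \<in> Hom (arrow_cat E) f g"
      by (cases X) auto
    obtain s t where qe: "q = Sq f g s t" "t \<in> Hom E (Cod E f) (Cod E g)" using E.Sq_HomE[OF q] by metis
    note q = q[unfolded qe(1)]
    note e = ext[OF X(2) q]
    have "ext f g \<psi> s t \<cdot> \<chi> (rf f, \<phi> f) (\<eta> f) = \<chi> (g, \<psi>) (Sq (rf f) g (ext f g \<psi> s t) t \<cdot>\<^bsub>arrow_cat E\<^esub> \<eta> f)"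
      by (rule l(3)[OF F(4) X(2) e(2) unit_sq[OF l(1)]])
    also have "Sq (rf f) g (ext f g \<psi> s t) t \<cdot>\<^bsub>arrow_cat E\<^esub> \<eta> f = q"
      using e(1) E.Comp_Id[OF qe(2)] by (simp add: qe(1))
    finally show ?thesis using lift_of_eq[OF X(2) q] by (simp add: X(1) qe(1) coalg_of_def)
  qed
qed

lemma coalg_of_lift_of:
  assumes y: "is_coalg f y"
  shows "coalg_of f (lift_of f y) = y"
proof -
  have f: "f \<in> Arr E" and yH: "y \<in> Hom E (Cod E f) (D f)" using y by (auto simp: is_coalg_def)
  note F = free_Hom[OF f]
  show ?thesis
    using lift_of_eq[OF F(4) unit_sq[OF f], of y] ext_unit[OF f] E.Id_Comp[OF yH] by (simp add: coalg_of_def)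
qed

lemma lift_of_morphism:
  assumes y: "is_coalg f y" and y': "is_coalg g y'" and p: "p \<in> Hom (arrow_cat E) f g"
  shows "(\<forall>X\<in>Obj (right_maps E I u). \<forall>q\<in>Hom (arrow_cat E) g (fst X).
      lift_of f y X (q \<cdot>\<^bsub>arrow_cat E\<^esub> p) = lift_of g y' X q \<cdot> sq_bot p) \<longleftrightarrow> y' \<cdot> sq_bot p = K p \<cdot> y"
    (is "?l \<longleftrightarrow> ?r")
proof
  have f: "f \<in> Arr E" and yH: "y \<in> Hom E (Cod E f) (D f)" using y by (auto simp: is_coalg_def)
  have g: "g \<in> Arr E" and yH': "y' \<in> Hom E (Cod E g) (D g)" using y' by (auto simp: is_coalg_def)
  note F = free_Hom[OF f] and G = free_Hom[OF g] and P = E.HomA_D[OF p]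
  have z: "sq_bot p \<in> Hom E (Cod E f) (Cod E g)" using P by (simp add: E.HomI)
  have key: "lift_of f y (h, \<psi>) (Sq g h s t \<cdot>\<^bsub>arrow_cat E\<^esub> p) = ext g h \<psi> s t \<cdot> (K p \<cdot> y)"
    "lift_of g y' (h, \<psi>) (Sq g h s t) \<cdot> sq_bot p = ext g h \<psi> s t \<cdot> (y' \<cdot> sq_bot p)"
    if h: "right_map E I u (h, \<psi>)" and q: "Sq g h s t \<in> Hom (arrow_cat E) g h" for h \<psi> s t
  proof -
    note e = rmorD(4)[OF ext(2)[OF h q]]
    have q2: "Sq f h (s \<cdot> sq_top p) (t \<cdot> sq_bot p) \<in> Hom (arrow_cat E) f h"
      using category.Comp_Hom[OF E.arrow_category p q] P by simp
    show "lift_of f y (h, \<psi>) (Sq g h s t \<cdot>\<^bsub>arrow_cat E\<^esub> p) = ext g h \<psi> s t \<cdot> (K p \<cdot> y)"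
      using lift_of_eq[OF h q2, of y] ext_K[OF h p q] E.Comp_assoc[OF yH K(3)[OF p] e] P by simp
    show "lift_of g y' (h, \<psi>) (Sq g h s t) \<cdot> sq_bot p = ext g h \<psi> s t \<cdot> (y' \<cdot> sq_bot p)"
      using lift_of_eq[OF h q, of y'] E.Comp_assoc[OF z yH' e] by simp
  qed
  {
    assume l: ?l
    have G_obj: "(rf g, \<phi> g) \<in> Obj (right_maps E I u)" "\<eta> g \<in> Hom (arrow_cat E) g (fst (rf g, \<phi> g))"
      using G(4) unit_sq[OF g] by simp_all
    have "lift_of f y (rf g, \<phi> g) (\<eta> g \<cdot>\<^bsub>arrow_cat E\<^esub> p) = lift_of g y' (rf g, \<phi> g) (\<eta> g) \<cdot> sq_bot p"
      using l G_obj by blast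
    hence "Ide E (D g) \<cdot> (K p \<cdot> y) = Ide E (D g) \<cdot> (y' \<cdot> sq_bot p)"
      unfolding key[OF G(4) unit_sq[OF g]] ext_unit[OF g] .
    thus ?r using E.Id_Comp[OF E.Comp_Hom[OF yH K(3)[OF p]]] E.Id_Comp[OF E.Comp_Hom[OF z yH']] by simp
  }
  assume r: ?r
  show ?l
  proof (intro ballI)
    fix X q assume "X \<in> Obj (right_maps E I u)" and "q \<in> Hom (arrow_cat E) g (fst X)"
    then obtain h \<psi> where X: "X = (h, \<psi>)" "right_map E I u (h, \<psi>)" and q: "q \<in> Hom (arrow_cat E) g h"
      by (cases X) auto
    obtain s t where qe: "q = Sq g h s t" using E.Sq_HomE[OF q] by metis
    show "lift_of f y X (q \<cdot>\<^bsub>arrow_cat E\<^esub> p) = lift_of g y' X q \<cdot> sq_bot p"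
      unfolding X(1) qe key[OF X(2) q[unfolded qe]] r ..
  qed
qed

theorem left_maps_iso_L_map: "iso_over (left_maps E (right_maps E I u) forget) forget (L_map E W) forget"
proof -
  let ?F = "\<lambda>(f, \<chi>). (f, Sq f (lf f) (Ide E (Dom E f)) (coalg_of f \<chi>))"
  let ?G = "\<lambda>(f, \<alpha>). (f, lift_of f (sq_bot \<alpha>))"
  have LM: "L_map E W = str_cat (arrow_cat E) (Obj (L_map E W))
      (\<lambda>(a, \<alpha>) (b, \<beta>) m. \<beta> \<cdot>\<^bsub>arrow_cat E\<^esub> m = far (L_ftor W) m \<cdot>\<^bsub>arrow_cat E\<^esub> \<alpha>)"
    by (simp add: L_map_def copointed_coalg_def str_cat_def)
  show ?thesis
    unfolding left_maps_def forget_simps(1)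
  proof (subst LM, rule iso_over_str_catI[where F = ?F and G = ?G])
    fix X assume "X \<in> {X. left_map E (right_maps E I u) forget X}"
    then obtain f \<chi> where X: "X = (f, \<chi>)" "left_map E (right_maps E I u) forget (f, \<chi>)" by (cases X) auto
    show "?F X \<in> Obj (L_map E W) \<and> fst (?F X) = fst X \<and> ?G (?F X) = X"
      using is_coalg_of[OF X(2)] lift_of_coalg_of[OF X(2)] by (simp add: X(1) L_map_obj_iff)
  next
    fix Y assume Y: "Y \<in> Obj (L_map E W)"
    obtain f \<alpha> where fa: "Y = (f, \<alpha>)" by (cases Y)
    then obtain y where y: "\<alpha> = Sq f (lf f) (Ide E (Dom E f)) y" "is_coalg f y" using Y L_map_obj_iff by blast
    show "?G Y \<in> {X. left_map E (right_maps E I u) forget X} \<and> fst (?G Y) = fst Y \<and> ?F (?G Y) = Y"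
      using left_map_of_coalg[OF y(2)] coalg_of_lift_of[OF y(2)] by (simp add: fa y(1))
  next
    fix X Y q assume "X \<in> {X. left_map E (right_maps E I u) forget X}"
      "Y \<in> {X. left_map E (right_maps E I u) forget X}" and q: "q \<in> Hom (arrow_cat E) (fst X) (fst Y)"
    then obtain f \<psi> g \<chi> where X: "X = (f, \<psi>)" "left_map E (right_maps E I u) forget (f, \<psi>)"
      and Y: "Y = (g, \<chi>)" "left_map E (right_maps E I u) forget (g, \<chi>)"
      by (cases X, cases Y) auto
    have q: "q \<in> Hom (arrow_cat E) f g" using q X Y by simp
    note Q = E.HomA_D[OF q]
    have "(\<forall>i\<in>Obj (right_maps E I u). \<forall>p\<in>Hom (arrow_cat E) g (fst i).
        \<psi> i (p \<cdot>\<^bsub>arrow_cat E\<^esub> q) = \<chi> i p \<cdot> sq_bot q) \<longleftrightarrow> coalg_of g \<chi> \<cdot> sq_bot q = K q \<cdot> coalg_of f \<psi>"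
      using lift_of_morphism[OF is_coalg_of[OF X(2)] is_coalg_of[OF Y(2)] q]
      unfolding lift_of_coalg_of[OF X(2)] lift_of_coalg_of[OF Y(2)] .
    also have "\<dots> \<longleftrightarrow> Sq g (lf g) (Ide E (Dom E g)) (coalg_of g \<chi>) \<cdot>\<^bsub>arrow_cat E\<^esub> q =
        L_sq q \<cdot>\<^bsub>arrow_cat E\<^esub> Sq f (lf f) (Ide E (Dom E f)) (coalg_of f \<psi>)"
      using Q L_sq[OF q] by simp
    finally show "(case X of (f, \<phi>) \<Rightarrow> \<lambda>(g, \<psi>) m. \<forall>i \<in> Obj (right_maps E I u).
        \<forall>q \<in> Hom (arrow_cat E) g (fst i).
        \<phi> i (q \<cdot>\<^bsub>arrow_cat E\<^esub> m) = \<psi> i q \<cdot> sq_bot m) Y q \<longleftrightarrow>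
      (case ?F X of (a, \<alpha>) \<Rightarrow> \<lambda>(b, \<beta>) m. \<beta> \<cdot>\<^bsub>arrow_cat E\<^esub> m = far (L_ftor W) m \<cdot>\<^bsub>arrow_cat E\<^esub> \<alpha>) (?F Y) q"
      unfolding X(1) Y(1) prod.case W_simps .
  qed
qed

end

section \<open>Leibniz products are functorial\<close>

locale pushout_category = category E for E :: "('o, 'm) cat" (structure) +
  assumes pushouts: "f \<in> Arr E \<Longrightarrow> g \<in> Arr E \<Longrightarrow> Dom E f = Dom E g \<Longrightarrow> \<exists>j k. is_pushout E f g j k"
begin

context
  fixes f g
  assumes fg: "f \<in> Arr E" "g \<in> Arr E" "Dom E f = Dom E g"
begin

lemma po_is_pushout: "is_pushout E f g (fst (po E f g)) (snd (po E f g))"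
proof -
  have "\<exists>p. case p of (j, k) \<Rightarrow> is_pushout E f g j k" using pushouts[OF fg] by auto
  hence "case po E f g of (j, k) \<Rightarrow> is_pushout E f g j k"
    unfolding po_def by (rule someI_ex)
  thus ?thesis by (simp add: case_prod_beta)
qed

abbreviation (input) "P \<equiv> Cod E (fst (po E f g))"

lemma po_legs:
  "fst (po E f g) \<in> Hom E (Cod E f) P" "snd (po E f g) \<in> Hom E (Cod E g) P"
  "fst (po E f g) \<cdot> f = snd (po E f g) \<cdot> g"
  using po_is_pushout unfolding is_pushout_def by (auto simp: Hom_def)

lemma po_univ:
  assumes "a \<in> Hom E (Cod E f) x" "b \<in> Hom E (Cod E g) x" "a \<cdot> f = b \<cdot> g"
  shows "\<exists>!k. k \<in> Hom E P x \<and> k \<cdot> fst (po E f g) = a \<and> k \<cdot> snd (po E f g) = b"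
proof -
  obtain p where p: "fst (po E f g) \<in> Hom E (Cod E f) p"
    "\<forall>x \<in> Obj E. \<forall>a \<in> Hom E (Cod E f) x. \<forall>b \<in> Hom E (Cod E g) x.
           a \<cdot> f = b \<cdot> g \<longrightarrow> (\<exists>!k. k \<in> Hom E p x \<and> k \<cdot> fst (po E f g) = a \<and> k \<cdot> snd (po E f g) = b)"
    using po_is_pushout unfolding is_pushout_def by blast
  have "p = P" using p(1) by (simp add: Hom_def)
  thus ?thesis using p(2) assms HomD(5)[OF assms(1)] by blast
qed

lemma po_copair:
  assumes "a \<in> Hom E (Cod E f) x" "b \<in> Hom E (Cod E g) x" "a \<cdot> f = b \<cdot> g"
  shows "po_copair E f g a b \<in> Hom E P x" "po_copair E f g a b \<cdot> fst (po E f g) = a"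
    "po_copair E f g a b \<cdot> snd (po E f g) = b"
proof -
  have "Cod E a = x" using assms(1) by (simp add: Hom_def)
  thus "po_copair E f g a b \<in> Hom E P x" "po_copair E f g a b \<cdot> fst (po E f g) = a"
    "po_copair E f g a b \<cdot> snd (po E f g) = b"
    using theI'[OF po_univ[OF assms]] by (simp_all add: po_copair_def case_prod_beta)
qed

lemma po_eqI:
  assumes "k \<in> Hom E P x" "k' \<in> Hom E P x"
    "k \<cdot> fst (po E f g) = k' \<cdot> fst (po E f g)" "k \<cdot> snd (po E f g) = k' \<cdot> snd (po E f g)"
  shows "k = k'"
proof -
  have fH: "f \<in> Hom E (Dom E f) (Cod E f)" "g \<in> Hom E (Dom E f) (Cod E g)" using fg by (simp_all add: HomI)
  have "k \<cdot> fst (po E f g) \<cdot> f = k \<cdot> snd (po E f g) \<cdot> g"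
    using Comp_assoc[OF fH(1) po_legs(1) assms(1)] Comp_assoc[OF fH(2) po_legs(2) assms(1)] po_legs(3) by simp
  from po_univ[OF Comp_Hom[OF po_legs(1) assms(1)] Comp_Hom[OF po_legs(2) assms(1)] this]
  show ?thesis using assms by (metis (no_types))
qed

end

lemma leibniz_functor:
  assumes T: "is_functor E E T" and d: "nat_trans E E id_ftor T d"
  shows "is_functor (arrow_cat E) (arrow_cat E) (leibniz E T d)"
proof -
  have dH: "d a \<in> Hom E a (fob T a)" if "a \<in> Obj E" for a
    using d that by (simp add: nat_trans_def)
  have dn: "d b \<cdot> s = far T s \<cdot> d a" if "s \<in> Hom E a b" for s a b
    using d that by (simp add: nat_trans_def)
  let ?j = "\<lambda>i. fst (po E (d (Dom E i)) i)" and ?k = "\<lambda>i. snd (po E (d (Dom E i)) i)"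
  let ?P = "\<lambda>i. Cod E (?j i)" and ?l = "leibniz_obj E T d"
  have span: "d (Dom E i) \<in> Arr E" "i \<in> Arr E" "Dom E (d (Dom E i)) = Dom E i"
    "Cod E (d (Dom E i)) = fob T (Dom E i)" if "i \<in> Arr E" for i
    using that HomD[OF dH[of "Dom E i"]] by simp_all
  have legs: "?j i \<in> Hom E (fob T (Dom E i)) (?P i)" "?k i \<in> Hom E (Cod E i) (?P i)"
    "?j i \<cdot> d (Dom E i) = ?k i \<cdot> i" if "i \<in> Arr E" for i
    using po_legs[OF span(1-3)[OF that]] span(4)[OF that] by simp_all
  have l: "?l i \<in> Hom E (?P i) (fob T (Cod E i))" "?l i \<cdot> ?j i = far T i" "?l i \<cdot> ?k i = d (Cod E i)"
    if i: "i \<in> Arr E" for i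
  proof -
    have "far T i \<in> Hom E (Cod E (d (Dom E i))) (fob T (Cod E i))"
      using functorD(2)[OF T Arr_Hom[OF i]] span(4)[OF i] by simp
    from po_copair[OF span(1-3)[OF i] this dH dn[OF Arr_Hom[OF i], symmetric]]
    show "?l i \<in> Hom E (?P i) (fob T (Cod E i))" "?l i \<cdot> ?j i = far T i" "?l i \<cdot> ?k i = d (Cod E i)"
      using i by (simp_all add: leibniz_obj_def)
  qed
  define c where "c q = po_copair E (d (Dom E (sq_dom q))) (sq_dom q)
      (?j (sq_cod q) \<cdot> far T (sq_top q)) (?k (sq_cod q) \<cdot> sq_bot q)" for q
  have far_l: "far (leibniz E T d) q = Sq (?l (sq_dom q)) (?l (sq_cod q)) (c q) (far T (sq_bot q))" for q
    by (simp add: leibniz_def c_def case_prod_beta split: sq.split)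
  have fob_l: "fob (leibniz E T d) = ?l" by (simp add: leibniz_def)
  have c: "c q \<in> Hom E (?P f) (?P g)" "c q \<cdot> ?j f = ?j g \<cdot> far T (sq_top q)" "c q \<cdot> ?k f = ?k g \<cdot> sq_bot q"
    if q: "q \<in> Hom (arrow_cat E) f g" for q f g
  proof -
    note Q = HomA_D[OF q]
    have s: "sq_top q \<in> Hom E (Dom E f) (Dom E g)" and t: "sq_bot q \<in> Hom E (Cod E f) (Cod E g)"
      using Q by (simp_all add: HomI)
    note Ts = functorD(2)[OF T s]
    have a: "?j g \<cdot> far T (sq_top q) \<in> Hom E (Cod E (d (Dom E f))) (?P g)"
      using Comp_Hom[OF Ts legs(1)[OF Q(4)]] span(4)[OF Q(3)] by simp
    have b: "?k g \<cdot> sq_bot q \<in> Hom E (Cod E f) (?P g)" by (rule Comp_Hom[OF t legs(2)[OF Q(4)]])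
    have df: "d (Dom E f) \<in> Hom E (Dom E f) (fob T (Dom E f))" and dg: "d (Dom E g) \<in> Hom E (Dom E g) (fob T (Dom E g))"
      using Q by (simp_all add: dH)
    have "?j g \<cdot> far T (sq_top q) \<cdot> d (Dom E f) = ?j g \<cdot> (d (Dom E g) \<cdot> sq_top q)"
      using Comp_assoc[OF df Ts legs(1)[OF Q(4)]] dn[OF s] by simp
    also have "\<dots> = ?k g \<cdot> (g \<cdot> sq_top q)"
      using Comp_assoc[OF s dg legs(1)[OF Q(4)]] legs(3)[OF Q(4)]
        Comp_assoc[OF s Arr_Hom[OF Q(4)] legs(2)[OF Q(4)]] by simp
    also have "\<dots> = ?k g \<cdot> sq_bot q \<cdot> f"
      unfolding Q(11) using Comp_assoc[OF Arr_Hom[OF Q(3)] t legs(2)[OF Q(4)]] by simp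
    finally have e: "?j g \<cdot> far T (sq_top q) \<cdot> d (Dom E f) = ?k g \<cdot> sq_bot q \<cdot> f" .
    from po_copair[OF span(1-3)[OF Q(3)] a b e] show "c q \<in> Hom E (?P f) (?P g)"
      "c q \<cdot> ?j f = ?j g \<cdot> far T (sq_top q)" "c q \<cdot> ?k f = ?k g \<cdot> sq_bot q"
      using Q by (simp_all add: c_def)
  qed
  show ?thesis
    unfolding is_functor_def
  proof (intro conjI ballI allI)
    fix f assume "f \<in> Obj (arrow_cat E)"
    hence f: "f \<in> Arr E" by simp
    show "fob (leibniz E T d) f \<in> Obj (arrow_cat E)" using HomD(1)[OF l(1)[OF f]] by (simp add: fob_l)
    have i: "Ide (arrow_cat E) f \<in> Hom (arrow_cat E) f f"
      using category.Id_Hom[OF arrow_category, of f] f by simp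
    have P: "?P f \<in> Obj E" using HomD(5)[OF legs(1)[OF f]] .
    have "c (Ide (arrow_cat E) f) = Ide E (?P f)"
    proof (rule po_eqI[OF span(1-3)[OF f] c(1)[OF i] Id_Hom[OF P]])
      show "c (Ide (arrow_cat E) f) \<cdot> ?j f = Ide E (?P f) \<cdot> ?j f"
        using c(2)[OF i] functorD(3)[OF T, of "Dom E f"] f Comp_Id[OF legs(1)[OF f]] Id_Comp[OF legs(1)[OF f]] by simp
      show "c (Ide (arrow_cat E) f) \<cdot> ?k f = Ide E (?P f) \<cdot> ?k f"
        using c(3)[OF i] Comp_Id[OF legs(2)[OF f]] Id_Comp[OF legs(2)[OF f]] by simp
    qed
    moreover have "far T (Ide E (Cod E f)) = Ide E (fob T (Cod E f))" using functorD(3)[OF T] f by simp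
    ultimately show "far (leibniz E T d) (Ide (arrow_cat E) f) = Ide (arrow_cat E) (fob (leibniz E T d) f)"
      using HomD[OF l(1)[OF f]] by (simp add: far_l fob_l)
  next
    fix f g q assume q: "q \<in> Hom (arrow_cat E) f g"
    note Q = HomA_D[OF q]
    have s: "sq_top q \<in> Hom E (Dom E f) (Dom E g)" and t: "sq_bot q \<in> Hom E (Cod E f) (Cod E g)"
      using Q by (simp_all add: HomI)
    note Ts = functorD(2)[OF T s] and Tt = functorD(2)[OF T t] and lf = l[OF Q(3)] and lg = l[OF Q(4)]
    have "?l g \<cdot> c q = far T (sq_bot q) \<cdot> ?l f"
    proof (rule po_eqI[OF span(1-3)[OF Q(3)] Comp_Hom[OF c(1)[OF q] lg(1)] Comp_Hom[OF lf(1) Tt]])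
      have "?l g \<cdot> c q \<cdot> ?j f = far T g \<cdot> far T (sq_top q)"
        using Comp_assoc[OF legs(1)[OF Q(3)] c(1)[OF q] lg(1)] c(2)[OF q]
          Comp_assoc[OF Ts legs(1)[OF Q(4)] lg(1)] lg(2) by simp
      also have "\<dots> = far T (sq_bot q) \<cdot> far T f"
        using functorD(4)[OF T s Arr_Hom[OF Q(4)]] functorD(4)[OF T Arr_Hom[OF Q(3)] t] Q(11) by simp
      also have "\<dots> = far T (sq_bot q) \<cdot> ?l f \<cdot> ?j f"
        using Comp_assoc[OF legs(1)[OF Q(3)] lf(1) Tt] lf(2) by simp
      finally show "?l g \<cdot> c q \<cdot> ?j f = far T (sq_bot q) \<cdot> ?l f \<cdot> ?j f" .
      have "?l g \<cdot> c q \<cdot> ?k f = d (Cod E g) \<cdot> sq_bot q"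
        using Comp_assoc[OF legs(2)[OF Q(3)] c(1)[OF q] lg(1)] c(3)[OF q]
          Comp_assoc[OF t legs(2)[OF Q(4)] lg(1)] lg(3) by simp
      also have "\<dots> = far T (sq_bot q) \<cdot> ?l f \<cdot> ?k f"
        using dn[OF t] Comp_assoc[OF legs(2)[OF Q(3)] lf(1) Tt] lf(3) by simp
      finally show "?l g \<cdot> c q \<cdot> ?k f = far T (sq_bot q) \<cdot> ?l f \<cdot> ?k f" .
    qed
    thus "far (leibniz E T d) q \<in> Hom (arrow_cat E) (fob (leibniz E T d) f) (fob (leibniz E T d) g)"
      using HomD[OF lf(1)] HomD[OF lg(1)] c(1)[OF q] Tt Q by (simp add: far_l fob_l Sq_Hom_iff)
  next
    fix f g h q r assume q: "q \<in> Hom (arrow_cat E) f g" and r: "r \<in> Hom (arrow_cat E) g h"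
    note Q = HomA_D[OF q] and R = HomA_D[OF r]
    have s: "sq_top q \<in> Hom E (Dom E f) (Dom E g)" "sq_top r \<in> Hom E (Dom E g) (Dom E h)"
      and t: "sq_bot q \<in> Hom E (Cod E f) (Cod E g)" "sq_bot r \<in> Hom E (Cod E g) (Cod E h)"
      using Q R by (simp_all add: HomI)
    have rq: "r \<cdot>\<^bsub>arrow_cat E\<^esub> q \<in> Hom (arrow_cat E) f h"
      by (rule category.Comp_Hom[OF arrow_category q r])
    note Ts = functorD(2)[OF T s(1)] functorD(2)[OF T s(2)]
    have "c (r \<cdot>\<^bsub>arrow_cat E\<^esub> q) = c r \<cdot> c q"
    proof (rule po_eqI[OF span(1-3)[OF Q(3)] c(1)[OF rq] Comp_Hom[OF c(1)[OF q] c(1)[OF r]]])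
      show "c (r \<cdot>\<^bsub>arrow_cat E\<^esub> q) \<cdot> ?j f = c r \<cdot> c q \<cdot> ?j f"
        using c(2)[OF rq] functorD(4)[OF T s] Comp_assoc[OF Ts legs(1)[OF R(4)]]
          Comp_assoc[OF legs(1)[OF Q(3)] c(1)[OF q] c(1)[OF r]] c(2)[OF q]
          Comp_assoc[OF Ts(1) legs(1)[OF Q(4)] c(1)[OF r]] c(2)[OF r] by simp
      show "c (r \<cdot>\<^bsub>arrow_cat E\<^esub> q) \<cdot> ?k f = c r \<cdot> c q \<cdot> ?k f"
        using c(3)[OF rq] Comp_assoc[OF t legs(2)[OF R(4)]]
          Comp_assoc[OF legs(2)[OF Q(3)] c(1)[OF q] c(1)[OF r]] c(3)[OF q]
          Comp_assoc[OF t(1) legs(2)[OF Q(4)] c(1)[OF r]] c(3)[OF r] by simp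
    qed
    thus "far (leibniz E T d) (r \<cdot>\<^bsub>arrow_cat E\<^esub> q) =
        far (leibniz E T d) r \<cdot>\<^bsub>arrow_cat E\<^esub> far (leibniz E T d) q"
      using functorD(4)[OF T t] Q R by (simp add: far_l)
  qed
qed

end

lemma (in small_universe) cocomplete_pushouts:
  assumes C: "category E" "cocomplete \<kappa> E" "locally_small \<kappa> E"
  shows "pushout_category E"
proof -
  interpret category E by fact
  show ?thesis
  proof unfold_locales
    fix f g assume f: "f \<in> Arr E" and g: "g \<in> Arr E" and fg: "Dom E f = Dom E g"
    let ?ob = "\<lambda>b. if b then Cod E f else Cod E g" and ?R = "{(True, f, False, g)}"
    have "\<exists>Z z. glue_cocone E UNIV ?ob ?R Z z \<and> (\<forall>Z' z'. glue_cocone E UNIV ?ob ?R Z' z' \<longrightarrow>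
           (\<exists>!k. k \<in> Hom E Z Z' \<and> (\<forall>n\<in>UNIV. k \<cdot>\<^bsub>E\<^esub> z n = z' n)))"
      by (rule glue_colimit[OF C, where T = "{Dom E f}"])
        (use f g fg in \<open>auto simp: small_finite Hom_def\<close>)
    then obtain Z z where Z: "glue_cocone E UNIV ?ob ?R Z z"
      and univ: "\<And>Z' z'. glue_cocone E UNIV ?ob ?R Z' z' \<Longrightarrow> \<exists>!k. k \<in> Hom E Z Z' \<and> (\<forall>n. k \<cdot>\<^bsub>E\<^esub> z n = z' n)"
      by auto
    have all: "(\<forall>n::bool. A n) \<longleftrightarrow> A True \<and> A False" for A by (metis (full_types))
    have iff: "glue_cocone E UNIV ?ob ?R Z' z' \<longleftrightarrow> Z' \<in> Obj E \<and> z' True \<in> Hom E (Cod E f) Z' \<and>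
        z' False \<in> Hom E (Cod E g) Z' \<and> z' True \<cdot>\<^bsub>E\<^esub> f = z' False \<cdot>\<^bsub>E\<^esub> g" for Z' z'
      by (auto simp: glue_cocone_def all)
    have "is_pushout E f g (z True) (z False)"
      unfolding is_pushout_def
    proof (intro bexI[of _ Z] conjI ballI impI)
      fix x a b assume "x \<in> Obj E" "a \<in> Hom E (Cod E f) x" "b \<in> Hom E (Cod E g) x" "a \<cdot>\<^bsub>E\<^esub> f = b \<cdot>\<^bsub>E\<^esub> g"
      hence "glue_cocone E UNIV ?ob ?R x (\<lambda>n. if n then a else b)" unfolding iff by simp
      from univ[OF this] show "\<exists>!k. k \<in> Hom E Z x \<and> k \<cdot>\<^bsub>E\<^esub> z True = a \<and> k \<cdot>\<^bsub>E\<^esub> z False = b"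
        by (simp add: all)
    qed (use Z in \<open>simp_all only: iff\<close>)
    thus "\<exists>j k. is_pushout E f g j k" by blast
  qed
qed

section \<open>Index categories\<close>

lemma coprod_cat_Hom:
  "f \<in> Hom (coprod_cat C D) x y \<longleftrightarrow>
     (\<exists>g a b. f = Inl g \<and> x = Inl a \<and> y = Inl b \<and> g \<in> Hom C a b) \<or>
     (\<exists>g a b. f = Inr g \<and> x = Inr a \<and> y = Inr b \<and> g \<in> Hom D a b)"
  by (auto simp: coprod_cat_def Hom_def)

lemma coprod_category:
  assumes "category C" "category D"
  shows "category (coprod_cat C D)"
proof -
  interpret C: category C by fact
  interpret D: category D by fact
  show ?thesis
  proof
    fix f assume "f \<in> Arr (coprod_cat C D)"
    thus "Dom (coprod_cat C D) f \<in> Obj (coprod_cat C D)" "Cod (coprod_cat C D) f \<in> Obj (coprod_cat C D)"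
      by (auto simp: coprod_cat_def)
  next
    fix a assume "a \<in> Obj (coprod_cat C D)"
    thus "Ide (coprod_cat C D) a \<in> Hom (coprod_cat C D) a a"
      unfolding coprod_cat_Hom by (auto simp: coprod_cat_def C.Id_Hom D.Id_Hom)
  next
    fix f g a b c assume "f \<in> Hom (coprod_cat C D) a b" "g \<in> Hom (coprod_cat C D) b c"
    thus "g \<cdot>\<^bsub>coprod_cat C D\<^esub> f \<in> Hom (coprod_cat C D) a c"
      unfolding coprod_cat_Hom using C.Comp_Hom D.Comp_Hom by (auto simp: coprod_cat_def)
  next
    fix f a b assume "f \<in> Hom (coprod_cat C D) a b"
    thus "f \<cdot>\<^bsub>coprod_cat C D\<^esub> Ide (coprod_cat C D) a = f" "Ide (coprod_cat C D) b \<cdot>\<^bsub>coprod_cat C D\<^esub> f = f"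
      unfolding coprod_cat_Hom using C.Comp_Id D.Comp_Id C.Id_Comp D.Id_Comp by (auto simp: coprod_cat_def)
  next
    fix f g h a b c d assume "f \<in> Hom (coprod_cat C D) a b" "g \<in> Hom (coprod_cat C D) b c"
      "h \<in> Hom (coprod_cat C D) c d"
    thus "h \<cdot>\<^bsub>coprod_cat C D\<^esub> g \<cdot>\<^bsub>coprod_cat C D\<^esub> f = h \<cdot>\<^bsub>coprod_cat C D\<^esub> (g \<cdot>\<^bsub>coprod_cat C D\<^esub> f)"
      unfolding coprod_cat_Hom using C.Comp_assoc D.Comp_assoc by (auto simp: coprod_cat_def)
  qed
qed

lemma copair_functor:
  assumes "is_functor C B F" "is_functor D B G"
  shows "is_functor (coprod_cat C D) B (copair_ftor F G)"
  unfolding is_functor_def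
proof (intro conjI ballI allI)
  fix a assume a: "a \<in> Obj (coprod_cat C D)"
  show "fob (copair_ftor F G) a \<in> Obj B"
    using a functorD(1)[OF assms(1)] functorD(1)[OF assms(2)] by (auto simp: coprod_cat_def copair_ftor_def)
  show "far (copair_ftor F G) (Ide (coprod_cat C D) a) = Ide B (fob (copair_ftor F G) a)"
    using a functorD(3)[OF assms(1)] functorD(3)[OF assms(2)] by (auto simp: coprod_cat_def copair_ftor_def)
next
  fix f a b assume "f \<in> Hom (coprod_cat C D) a b"
  thus "far (copair_ftor F G) f \<in> Hom B (fob (copair_ftor F G) a) (fob (copair_ftor F G) b)"
    unfolding coprod_cat_Hom using functorD(2)[OF assms(1)] functorD(2)[OF assms(2)]
    by (auto simp: copair_ftor_def)
next
  fix f g a b c assume "f \<in> Hom (coprod_cat C D) a b" "g \<in> Hom (coprod_cat C D) b c"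
  thus "far (copair_ftor F G) (g \<cdot>\<^bsub>coprod_cat C D\<^esub> f) = far (copair_ftor F G) g \<cdot>\<^bsub>B\<^esub> far (copair_ftor F G) f"
    unfolding coprod_cat_Hom using functorD(4)[OF assms(1)] functorD(4)[OF assms(2)]
    by (auto simp: copair_ftor_def coprod_cat_def)
qed

lemma right_map_reindex:
  assumes iso: "cat_iso J J' P Q" and f: "right_map E J v (f, \<psi>)"
  shows "right_map E J' (v \<circ>\<^sub>F Q) (f, \<lambda>i. if i \<in> Obj J' then \<psi> (fob Q i) else (\<lambda>_. undefined))"
  unfolding right_map_def prod.case comp_ftor_simps
proof (intro conjI ballI allI impI)
  note i = cat_isoD[OF iso]
  interpret J': category J' by (fact i)
  note F = f[unfolded right_map_def prod.case]
  show "f \<in> Arr E" by (rule F[THEN conjunct1])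
  show "is_filler E q ((if i \<in> Obj J' then \<psi> (fob Q i) else (\<lambda>_. undefined)) q)"
    if "i \<in> Obj J'" "q \<in> Hom (arrow_cat E) (fob v (fob Q i)) f" for i q
    using F[THEN conjunct2, THEN conjunct1, rule_format, OF functorD(1)[OF i(4) that(1)] that(2)] that(1) by simp
  show "(if j \<in> Obj J' then \<psi> (fob Q j) else (\<lambda>_. undefined)) q \<cdot>\<^bsub>E\<^esub> sq_bot (far v (far Q \<sigma>)) =
      (if k \<in> Obj J' then \<psi> (fob Q k) else (\<lambda>_. undefined)) (q \<cdot>\<^bsub>arrow_cat E\<^esub> far v (far Q \<sigma>))"
    if "\<sigma> \<in> Hom J' k j" "q \<in> Hom (arrow_cat E) (fob v (fob Q j)) f" for j k \<sigma> q
    using F[THEN conjunct2, THEN conjunct2, THEN conjunct1, rule_format, OF functorD(2)[OF i(4) that(1)] that(2)]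
      J'.HomD[OF that(1)] by simp
  show "(if i \<in> Obj J' then \<psi> (fob Q i) else (\<lambda>_. undefined)) q = undefined"
    if "\<not> (i \<in> Obj J' \<and> q \<in> Hom (arrow_cat E) (fob v (fob Q i)) f)" for i q
    using F[THEN conjunct2, THEN conjunct2, THEN conjunct2, rule_format, of "fob Q i" q] that by auto
qed

text \<open>An awfs is cofibrantly generated by a category on the type \<open>'u\<close>, so the generating category is
  replaced by a copy.\<close>

lemma right_maps_reindex:
  fixes E :: "('o, 'm) cat" and J :: "('i, 'j) cat"
  assumes iso: "cat_iso J J' P Q"
  shows "iso_over (right_maps E J v) forget (right_maps E J' (v \<circ>\<^sub>F Q)) forget"
  unfolding right_maps_def
proof (rule iso_over_str_catI[where
    F = "\<lambda>(f, \<psi>). (f, \<lambda>i. if i \<in> Obj J' then \<psi> (fob Q i) else (\<lambda>_. undefined))" and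
    G = "\<lambda>(f, \<psi>). (f, \<lambda>i. if i \<in> Obj J then \<psi> (fob P i) else (\<lambda>_. undefined))"])
  note i = cat_isoD[OF iso]
  interpret J: category J by (fact i)
  have undef: "\<psi> k = (\<lambda>_. undefined)" if "right_map E K w (f, \<psi>)" "k \<notin> Obj K" for K w f \<psi> k
    using that by (auto simp: right_map_def)
  have v: "right_map E J (v \<circ>\<^sub>F Q \<circ>\<^sub>F P) = right_map E J v"
    unfolding right_map_def using i(5,6) J.HomD by (auto simp: fun_eq_iff cong: conj_cong)
  {
    fix X assume "X \<in> {X. right_map E J v X}"
    then obtain f \<psi> where X: "X = (f, \<psi>)" "right_map E J v (f, \<psi>)" by (cases X) auto
    have "(\<lambda>i. if i \<in> Obj J then (if fob P i \<in> Obj J' then \<psi> (fob Q (fob P i)) else (\<lambda>_. undefined))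
        else (\<lambda>_. undefined)) = \<psi>"
      using i(5) functorD(1)[OF i(3)] undef[OF X(2)] by (auto simp: fun_eq_iff)
    thus "(case X of (f, \<psi>) \<Rightarrow> (f, \<lambda>i. if i \<in> Obj J' then \<psi> (fob Q i) else (\<lambda>_. undefined)))
          \<in> {X. right_map E J' (v \<circ>\<^sub>F Q) X} \<and>
        fst (case X of (f, \<psi>) \<Rightarrow> (f, \<lambda>i. if i \<in> Obj J' then \<psi> (fob Q i) else (\<lambda>_. undefined))) = fst X \<and>
        (case case X of (f, \<psi>) \<Rightarrow> (f, \<lambda>i. if i \<in> Obj J' then \<psi> (fob Q i) else (\<lambda>_. undefined)) of
          (f, \<psi>) \<Rightarrow> (f, \<lambda>i. if i \<in> Obj J then \<psi> (fob P i) else (\<lambda>_. undefined))) = X"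
      using right_map_reindex[OF iso X(2)] by (simp add: X(1))
  }
  {
    fix X assume "X \<in> {X. right_map E J' (v \<circ>\<^sub>F Q) X}"
    then obtain f \<psi> where X: "X = (f, \<psi>)" "right_map E J' (v \<circ>\<^sub>F Q) (f, \<psi>)" by (cases X) auto
    have "(\<lambda>i. if i \<in> Obj J' then (if fob Q i \<in> Obj J then \<psi> (fob P (fob Q i)) else (\<lambda>_. undefined))
        else (\<lambda>_. undefined)) = \<psi>"
      using i(7) functorD(1)[OF i(4)] undef[OF X(2)] by (auto simp: fun_eq_iff)
    thus "(case X of (f, \<psi>) \<Rightarrow> (f, \<lambda>i. if i \<in> Obj J then \<psi> (fob P i) else (\<lambda>_. undefined)))
          \<in> {X. right_map E J v X} \<and>
        fst (case X of (f, \<psi>) \<Rightarrow> (f, \<lambda>i. if i \<in> Obj J then \<psi> (fob P i) else (\<lambda>_. undefined))) = fst X \<and>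
        (case case X of (f, \<psi>) \<Rightarrow> (f, \<lambda>i. if i \<in> Obj J then \<psi> (fob P i) else (\<lambda>_. undefined)) of
          (f, \<psi>) \<Rightarrow> (f, \<lambda>i. if i \<in> Obj J' then \<psi> (fob Q i) else (\<lambda>_. undefined))) = X"
      using right_map_reindex[OF cat_iso_sym[OF iso] X(2)] unfolding v by (simp add: X(1))
  }
  fix X Y :: "'m \<times> ('i \<Rightarrow> 'm sq \<Rightarrow> 'm)" and m :: "'m sq"
  obtain f \<psi> g \<chi> where XY: "X = (f, \<psi>)" "Y = (g, \<chi>)" by (cases X, cases Y)
  let ?p = "\<lambda>j. \<forall>q\<in>Hom (arrow_cat E) (fob v j) f. sq_top m \<cdot>\<^bsub>E\<^esub> \<psi> j q = \<chi> j (m \<cdot>\<^bsub>arrow_cat E\<^esub> q)"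
  have "(\<forall>j\<in>Obj J. ?p j) \<longleftrightarrow> (\<forall>j\<in>Obj J'. ?p (fob Q j))"
    using i(5) functorD(1)[OF i(3)] functorD(1)[OF i(4)] by metis
  thus "(case X of (f, \<phi>) \<Rightarrow> \<lambda>(g, \<psi>) m. \<forall>i\<in>Obj J. \<forall>q\<in>Hom (arrow_cat E) (fob v i) f.
        sq_top m \<cdot>\<^bsub>E\<^esub> \<phi> i q = \<psi> i (m \<cdot>\<^bsub>arrow_cat E\<^esub> q)) Y m \<longleftrightarrow>
    (case case X of (f, \<psi>) \<Rightarrow> (f, \<lambda>i. if i \<in> Obj J' then \<psi> (fob Q i) else (\<lambda>_. undefined)) of
      (f, \<phi>) \<Rightarrow> \<lambda>(g, \<psi>) m. \<forall>i\<in>Obj J'. \<forall>q\<in>Hom (arrow_cat E) (fob (v \<circ>\<^sub>F Q) i) f.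
        sq_top m \<cdot>\<^bsub>E\<^esub> \<phi> i q = \<psi> i (m \<cdot>\<^bsub>arrow_cat E\<^esub> q))
      (case Y of (f, \<psi>) \<Rightarrow> (f, \<lambda>i. if i \<in> Obj J' then \<psi> (fob Q i) else (\<lambda>_. undefined))) m"
    by (simp add: XY)
qed

section \<open>The small object argument\<close>

text \<open>That \<open>W\<close> is cofibrantly generated follows from the last conjunct once \<open>J\<close> is replaced by an
  isomorphic category whose objects and arrows are elements of \<open>'u\<close>.\<close>

theorem (in small_universe) algebraic_small_object_argument:
  fixes E :: "('o, 'm) cat" and J :: "('i, 'j) cat"
  assumes E: "category E" "locally_presentable \<kappa> E" and J: "small_category \<kappa> J"
    and v: "is_functor J (arrow_cat E) v"
  shows "\<exists>W. is_awfs E W \<and> cofibrantly_generated \<kappa> E W \<and>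
    iso_over (left_maps E (right_maps E J v) forget) forget (L_map E W) forget \<and>
    iso_over (right_maps E J v) forget (R_Map E W) forget"
proof -
  have "\<forall>f\<in>Arr E. \<exists>l r \<phi>. free_right_map E J v f l r \<phi>"
    using free_right_map_exists[OF E J v] by blast
  then obtain lf where "\<forall>f\<in>Arr E. \<exists>r \<phi>. free_right_map E J v f (lf f) r \<phi>" by (rule bchoice[THEN exE])
  then obtain rf where "\<forall>f\<in>Arr E. \<exists>\<phi>. free_right_map E J v f (lf f) (rf f) \<phi>" by (rule bchoice[THEN exE])
  then obtain \<phi> where \<phi>: "\<forall>f\<in>Arr E. free_right_map E J v f (lf f) (rf f) (\<phi> f)" by (rule bchoice[THEN exE])
  interpret free_right_maps E J v lf rf \<phi>
    using E J v \<phi> by (simp add: free_right_maps_def free_right_maps_axioms_def indexed_maps_def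
        indexed_maps_axioms_def small_category_def)
  obtain J' :: "('u, 'u) cat" and P Q where J': "small_category \<kappa> J'" "cat_iso J J' P Q"
    using small_category_copy[OF J] .
  have "iso_over (R_Map E W) forget (right_maps E J' (v \<circ>\<^sub>F Q)) forget"
    by (rule iso_over_trans[OF iso_over_sym[OF right_maps_iso_R_Map] right_maps_reindex[OF J'(2)]])
  moreover have "is_functor J' (arrow_cat E) (v \<circ>\<^sub>F Q)" by (rule is_functor_comp[OF cat_isoD(4)[OF J'(2)] v])
  ultimately have "cofibrantly_generated \<kappa> E W"
    using J'(1) unfolding cofibrantly_generated_def cofibrantly_generated_by_def algebraically_free_def by blast
  thus ?thesis using W_awfs left_maps_iso_L_map right_maps_iso_R_Map by blast
qed

theorem theorem6p5:
  fixes \<kappa> :: "'u rel"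
    and E :: "('o, 'm) cat"
    and T :: "('o, 'm, 'o, 'm) ftor"
    and \<delta> c :: "nat \<Rightarrow> 'o \<Rightarrow> 'm"
    and \<epsilon> :: "'o \<Rightarrow> 'm"
    and W :: "('o, 'm) awfs_data"
    and I :: "('i, 'j) cat"
    and u :: "('i, 'j, 'm, 'm sq) ftor"
  assumes "universe \<kappa>"
    and "category E"
    and "locally_presentable \<kappa> E"
    and "locally_cartesian_closed E"
    and "functorial_cylinder E T \<delta>"
    and "contraction E T \<delta> \<epsilon>"
    and "connections E T \<delta> \<epsilon> c"
    and "has_right_adjoint E E T"
    and "is_awfs E W"
    and "suitable \<kappa> E T \<delta> W"
    and "cofibrantly_generated_by \<kappa> E W I u"
  shows "\<exists>W'. is_awfs E W' \<and> cofibrantly_generated \<kappa> E W' \<and>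
           iso_over (TrivCof E T \<delta> I u) forget (L_map E W') forget \<and>
           iso_over (Fib E T \<delta> I u) forget (R_Map E W') forget"
proof -
  interpret small_universe \<kappa> by unfold_locales fact
  have I: "small_category \<kappa> I" "is_functor I (arrow_cat E) u"
    using assms(11) by (simp_all add: cofibrantly_generated_by_def)
  interpret pushout_category E
    by (rule cocomplete_pushouts) (use assms(2,3) in \<open>simp_all add: locally_presentable_def\<close>)
  have T: "is_functor E E T" "nat_trans E E id_ftor T (\<delta> 0)" "nat_trans E E id_ftor T (\<delta> 1)"
    using assms(5) by (simp_all add: functorial_cylinder_def)
  have "is_functor (coprod_cat I I) (arrow_cat E) (u_tensor E T \<delta> u)"
    unfolding u_tensor_def
    by (intro copair_functor is_functor_comp[OF I(2)] leibniz_functor T)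
  moreover have "small_category \<kappa> (coprod_cat I I)"
  proof -
    have "category (coprod_cat I I)" using I(1) by (intro coprod_category) (simp_all add: small_category_def)
    thus ?thesis using I(1) by (simp add: small_category_def) (simp add: coprod_cat_def small_Plus)
  qed
  ultimately show ?thesis
    using algebraic_small_object_argument[OF assms(2,3)] unfolding TrivCof_def Fib_def by blast
qed

end
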